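(* For any finite set $X$ let $\widetilde{\mathbb{D}}_X$ be the $\mathbf{k}$-vector space with basis the ordered pairs $(\mathcal{T},\mathcal{T}')$, where $\mathcal{T}$ is a topology on $X$ and $\mathcal{T}'$ is a $\mathcal{T}$-admissible topology on $X$ (written $\mathcal{T}'\preccurlyeq_{\mathrm{ad}}\mathcal{T}$). Equip the species $\widetilde{\mathbb{D}}$ with the product $$\widetilde{\mathbb{D}}_{X_1}\otimes\widetilde{\mathbb{D}}_{X_2}\to\widetilde{\mathbb{D}}_{X_1\sqcup X_2},\qquad (\mathcal{T}_1,\mathcal{T}_1')(\mathcal{T}_2,\mathcal{T}_2')=(\mathcal{T}_1\mathcal{T}_2,\,\mathcal{T}_1'\mathcal{T}_2'),$$ whose unit $\mathbf{1}$ is the pair of topologies on the empty set, with the coproduct $$\Gamma:\widetilde{\mathbb{D}}_X\to\widetilde{\mathbb{D}}_X\otimes\widetilde{\mathbb{D}}_X,\qquad \Gamma(\mathcal{T},\mathcal{T}')=\sum_{\mathcal{T}''\preccurlyeq_{\mathrm{ad}}\mathcal{T}'}(\mathcal{T},\mathcal{T}'')\otimes(\mathcal{T}/\mathcal{T}'',\,\mathcal{T}'/\mathcal{T}''),$$ with the counit $\epsilon(\mathcal{T},\mathcal{T}')=\epsilon(\mathcal{T}')$, and with the grading $d(\mathcal{T},\mathcal{T}')=d(\mathcal{T}')$. Then $\widetilde{\mathbb{D}}$ is a commutative graded bimonoid, and $\widetilde{\mathcal{D}}=\overline{\mathcal{K}}(\widetilde{\mathbb{D}})$, with the induced operations, is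 a graded bialgebra.
   Context: $\mathbf{k}$ is a field. A topology on a finite set $X$ is identified with its family $\mathcal{T}$ of open subsets. It corresponds bijectively to a quasi-order: $x\le_{\mathcal{T}}y$ iff every open subset containing $x$ contains $y$ (open subsets are the upper ideals). Put $x\sim_{\mathcal{T}}y$ iff $x\le_{\mathcal{T}}y$ and $y\le_{\mathcal{T}}x$. For $Y\subset X$, $\mathcal{T}_{|Y}=\{Z\cap Y:Z\in\mathcal{T}\}$. For topologies $\mathcal{T}_i$ on $X_i$ ($i=1,2$), $\mathcal{T}_1\mathcal{T}_2$ is the disjoint union topology on $X_1\sqcup X_2$. For topologies on the same set $X$, $\mathcal{T}'$ is finer than $\mathcal{T}$, written $\mathcal{T}'\prec\mathcal{T}$, if every $\mathcal{T}$-open set is $\mathcal{T}'$-open (equivalently $x\le_{\mathcal{T}'}y\Rightarrow x\le_{\mathcal{T}}y$; equality is allowed). If $\mathcal{T}'\prec\mathcal{T}$, the quotient $\mathcal{T}/\mathcal{T}'$ is the topology on $X$ whose quasi-order is the transitive closure of the relation: $x\le_{\mathcal{T}}y$ or $y\le_{\mathcal{T}'}x$. The topology $\mathcal{T}'$ is $\mathcal{T}$-admissible, written $\mathcal{T}'\preccurlyeq_{\mathrm{ad}}\mathcal{T}$, if: (i) $\mathcal{T}'\prec\mathcal{T}$; (ii) $\mathcal{T}'_{|Y}=\mathcal{T}_{|Y}$ for every $Y\subset X$ connected for $\mathcal{T}'$; (iii) for all $x,y\in X$, $x\sim_{\mathcal{T}/\mathcal{T}'}y\iff x\sim_{\mathcal{T}'/\mathcal{T}'}y$.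 For a topology $\mathcal{T}$, $d(\mathcal{T})$ is the number of equivalence classes of $\sim_{\mathcal{T}}$ minus the number of connected components of $\mathcal{T}$; $\epsilon(\mathcal{T})=1$ if $d(\mathcal{T})=0$ and $\epsilon(\mathcal{T})=0$ otherwise. A linear species is a contravariant functor from finite sets with bijections to $\mathbf{k}$-vector spaces; here bijections act by relabelling. The bosonic Fock functor is $\overline{\mathcal{K}}(\mathbb{E})=\bigoplus_{n\ge0}\mathbb{E}_{\{1,\dots,n\}}/S_n$ (coinvariants); operations on species induce operations on these spaces. "Bimonoid" (for an internal coproduct) means: the product is associative and unital, each $(\widetilde{\mathbb{D}}_X,\Gamma,\epsilon)$ is a coassociative counital coalgebra, and $\Gamma$ and $\epsilon$ are multiplicative, $\Gamma(ab)=\Gamma(a)\Gamma(b)$ with $(a_1\otimes a_2)(b_1\otimes b_2)=a_1b_1\otimes a_2b_2$, and compatible with the unit. Graded means that product and coproduct preserve the degree $d$ (total degree on tensor products). *)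

theory Defs
  imports "HOL-Analysis.Abstract_Topology_2" "HOL-Algebra.Module" "HOL-Algebra.AbelCoset"
begin

section \<open>Vector spaces, quotients and tensor products\<close>

text \<open>
  A vector space over a field \<open>K\<close> is a \<^typ>\<open>('k, 'v) module\<close> record \<open>V\<close> with
  \<open>Module.module K V\<close>. The record also has the fields \<open>mult\<close> and \<open>one\<close>; they are
  left undefined for plain vector spaces and carry the product and the unit of an algebra.
\<close>

definition base_vs :: "('k, 'm) ring_scheme \<Rightarrow> ('k, 'k) module" where
  "base_vs K = \<lparr>carrier = carrier K, mult = mult K, one = one K, zero = zero K, add = add K,
     smult = mult K\<rparr>"

definition linear_maps ::
  "('k, 'm) ring_scheme \<Rightarrow> ('k, 'v) module \<Rightarrow> ('k, 'w) module \<Rightarrow> ('v \<Rightarrow> 'w) set" where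
  "linear_maps K V W = {f \<in> carrier V \<rightarrow> carrier W.
     (\<forall>x\<in>carrier V. \<forall>y\<in>carrier V. f (x \<oplus>\<^bsub>V\<^esub> y) = f x \<oplus>\<^bsub>W\<^esub> f y) \<and>
     (\<forall>c\<in>carrier K. \<forall>x\<in>carrier V. f (c \<odot>\<^bsub>V\<^esub> x) = c \<odot>\<^bsub>W\<^esub> f x)}"

definition bilinear_map ::
  "('k, 'm) ring_scheme \<Rightarrow> ('k, 'v) module \<Rightarrow> ('k, 'w) module \<Rightarrow> ('k, 'u) module
    \<Rightarrow> ('v \<Rightarrow> 'w \<Rightarrow> 'u) \<Rightarrow> bool" where
  "bilinear_map K V W U \<beta> \<longleftrightarrow>
     (\<forall>x\<in>carrier V. \<beta> x \<in> linear_maps K W U) \<and>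
     (\<forall>y\<in>carrier W. (\<lambda>x. \<beta> x y) \<in> linear_maps K V U)"

definition lin_span :: "('k, 'm) ring_scheme \<Rightarrow> ('k, 'v) module \<Rightarrow> 'v set \<Rightarrow> 'v set" where
  "lin_span K V S = \<Inter>{N. submodule N K V \<and> S \<subseteq> N}"

definition quot_vs :: "('k, 'v) module \<Rightarrow> 'v set \<Rightarrow> ('k, 'v set) module" where
  "quot_vs V N = \<lparr>carrier = a_rcosets\<^bsub>V\<^esub> N, mult = undefined, one = undefined,
     zero = N, add = set_add V, smult = (\<lambda>c A. \<Union>a\<in>A. N +>\<^bsub>V\<^esub> (c \<odot>\<^bsub>V\<^esub> a))\<rparr>"

text \<open>The space with basis \<open>B\<close>: finitely supported functions from \<open>B\<close> to \<open>K\<close>, extended by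
  zero outside \<open>B\<close>.\<close>

definition free_vs :: "('k, 'm) ring_scheme \<Rightarrow> 'b set \<Rightarrow> ('k, 'b \<Rightarrow> 'k) module" where
  "free_vs K B = \<lparr>
     carrier = {f. range f \<subseteq> carrier K \<and> {b. f b \<noteq> \<zero>\<^bsub>K\<^esub>} \<subseteq> B \<and> finite {b. f b \<noteq> \<zero>\<^bsub>K\<^esub>}},
     mult = undefined, one = undefined,
     zero = (\<lambda>_. \<zero>\<^bsub>K\<^esub>), add = (\<lambda>f g b. f b \<oplus>\<^bsub>K\<^esub> g b), smult = (\<lambda>c f b. c \<otimes>\<^bsub>K\<^esub> f b)\<rparr>"

definition basis_vec :: "('k, 'm) ring_scheme \<Rightarrow> 'b \<Rightarrow> 'b \<Rightarrow> 'k" where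
  "basis_vec K b = (\<lambda>c. if c = b then \<one>\<^bsub>K\<^esub> else \<zero>\<^bsub>K\<^esub>)"

text \<open>The linear map into \<open>U\<close> with the prescribed values \<open>\<phi>\<close> on basis vectors.\<close>

definition lin_ext ::
  "('k, 'm) ring_scheme \<Rightarrow> ('k, 'u) module \<Rightarrow> ('b \<Rightarrow> 'u) \<Rightarrow> ('b \<Rightarrow> 'k) \<Rightarrow> 'u" where
  "lin_ext K U \<phi> f = (\<Oplus>\<^bsub>U\<^esub>b\<in>{b. f b \<noteq> \<zero>\<^bsub>K\<^esub>}. f b \<odot>\<^bsub>U\<^esub> \<phi> b)"

text \<open>The tensor product is the free space on pairs modulo the bilinearity relations.\<close>

definition bilin_rels ::
  "('k, 'm) ring_scheme \<Rightarrow> ('k, 'v) module \<Rightarrow> ('k, 'w) module \<Rightarrow> ('v \<times> 'w \<Rightarrow> 'k) set" where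
  "bilin_rels K V W =
    (let F = free_vs K (carrier V \<times> carrier W); \<delta> = (\<lambda>v w. basis_vec K (v, w)) in
     {\<delta> (v \<oplus>\<^bsub>V\<^esub> v') w \<ominus>\<^bsub>F\<^esub> (\<delta> v w \<oplus>\<^bsub>F\<^esub> \<delta> v' w) | v v' w.
        v \<in> carrier V \<and> v' \<in> carrier V \<and> w \<in> carrier W} \<union>
     {\<delta> v (w \<oplus>\<^bsub>W\<^esub> w') \<ominus>\<^bsub>F\<^esub> (\<delta> v w \<oplus>\<^bsub>F\<^esub> \<delta> v w') | v w w'.
        v \<in> carrier V \<and> w \<in> carrier W \<and> w' \<in> carrier W} \<union>
     {\<delta> (c \<odot>\<^bsub>V\<^esub> v) w \<ominus>\<^bsub>F\<^esub> (c \<odot>\<^bsub>F\<^esub> \<delta> v w) | c v w.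
        c \<in> carrier K \<and> v \<in> carrier V \<and> w \<in> carrier W} \<union>
     {\<delta> v (c \<odot>\<^bsub>W\<^esub> w) \<ominus>\<^bsub>F\<^esub> (c \<odot>\<^bsub>F\<^esub> \<delta> v w) | c v w.
        c \<in> carrier K \<and> v \<in> carrier V \<and> w \<in> carrier W})"

definition bilin_sub ::
  "('k, 'm) ring_scheme \<Rightarrow> ('k, 'v) module \<Rightarrow> ('k, 'w) module \<Rightarrow> ('v \<times> 'w \<Rightarrow> 'k) set" where
  "bilin_sub K V W = lin_span K (free_vs K (carrier V \<times> carrier W)) (bilin_rels K V W)"

definition tensor ::
  "('k, 'm) ring_scheme \<Rightarrow> ('k, 'v) module \<Rightarrow> ('k, 'w) module
    \<Rightarrow> ('k, ('v \<times> 'w \<Rightarrow> 'k) set) module" where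
  "tensor K V W = quot_vs (free_vs K (carrier V \<times> carrier W)) (bilin_sub K V W)"

text \<open>The pure tensor of \<open>v\<close> and \<open>w\<close>.\<close>

definition tens ::
  "('k, 'm) ring_scheme \<Rightarrow> ('k, 'v) module \<Rightarrow> ('k, 'w) module \<Rightarrow> 'v \<Rightarrow> 'w
    \<Rightarrow> ('v \<times> 'w \<Rightarrow> 'k) set" where
  "tens K V W v w =
     bilin_sub K V W +>\<^bsub>free_vs K (carrier V \<times> carrier W)\<^esub> basis_vec K (v, w)"

text \<open>The linear map on the tensor product of \<open>V\<close> and \<open>W\<close> induced by a bilinear map \<open>\<beta>\<close> into \<open>U\<close>;
  like all maps on quotients below, it is evaluated on the representatives of a coset.\<close>

definition tensor_lift ::
  "('k, 'm) ring_scheme \<Rightarrow> ('k, 'u) module \<Rightarrow> ('v \<Rightarrow> 'w \<Rightarrow> 'u)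
    \<Rightarrow> ('v \<times> 'w \<Rightarrow> 'k) set \<Rightarrow> 'u" where
  "tensor_lift K U \<beta> A = the_elem (lin_ext K U (\<lambda>(v, w). \<beta> v w) ` A)"

text \<open>The map induced by \<open>f\<close> and \<open>g\<close> into the tensor product of \<open>V'\<close> and \<open>W'\<close>.\<close>

definition tensor_map ::
  "('k, 'm) ring_scheme \<Rightarrow> ('k, 'v2) module \<Rightarrow> ('k, 'w2) module
    \<Rightarrow> ('v1 \<Rightarrow> 'v2) \<Rightarrow> ('w1 \<Rightarrow> 'w2) \<Rightarrow> ('v1 \<times> 'w1 \<Rightarrow> 'k) set \<Rightarrow> ('v2 \<times> 'w2 \<Rightarrow> 'k) set" where
  "tensor_map K V' W' f g =
     tensor_lift K (tensor K V' W') (\<lambda>v w. tens K V' W' (f v) (g w))"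

text \<open>The associativity isomorphism, mapping (v tensor w) tensor u to v tensor (w tensor u).\<close>

definition tensor_assoc ::
  "('k, 'm) ring_scheme \<Rightarrow> ('k, 'v) module \<Rightarrow> ('k, 'w) module \<Rightarrow> ('k, 'u) module
    \<Rightarrow> (('v \<times> 'w \<Rightarrow> 'k) set \<times> 'u \<Rightarrow> 'k) set \<Rightarrow> ('v \<times> ('w \<times> 'u \<Rightarrow> 'k) set \<Rightarrow> 'k) set" where
  "tensor_assoc K V W U =
    (let T = tensor K V (tensor K W U) in
     tensor_lift K T
       (\<lambda>t u. tensor_lift K T (\<lambda>v w. tens K V (tensor K W U) v (tens K W U w u)) t))"

text \<open>The componentwise product
  \<open>(a\<^sub>1 \<otimes> a\<^sub>2)(b\<^sub>1 \<otimes> b\<^sub>2) = a\<^sub>1b\<^sub>1 \<otimes> a\<^sub>2b\<^sub>2\<close>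
  induced by a product \<open>\<mu>\<close> with values in \<open>U\<close>.\<close>

definition tensor_mult ::
  "('k, 'm) ring_scheme \<Rightarrow> ('k, 'u) module \<Rightarrow> ('v \<Rightarrow> 'w \<Rightarrow> 'u)
    \<Rightarrow> ('v \<times> 'v \<Rightarrow> 'k) set \<Rightarrow> ('w \<times> 'w \<Rightarrow> 'k) set \<Rightarrow> ('u \<times> 'u \<Rightarrow> 'k) set" where
  "tensor_mult K U \<mu> s t =
    tensor_lift K (tensor K U U)
      (\<lambda>a1 a2. tensor_lift K (tensor K U U)
        (\<lambda>b1 b2. tens K U U (\<mu> a1 b1) (\<mu> a2 b2)) t) s"


section \<open>Coalgebras, gradings and bialgebras\<close>

definition coalgebra ::
  "('k, 'm) ring_scheme \<Rightarrow> ('k, 'v) module \<Rightarrow> ('v \<Rightarrow> ('v \<times> 'v \<Rightarrow> 'k) set) \<Rightarrow> ('v \<Rightarrow> 'k) \<Rightarrow> bool"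
  where
  "coalgebra K C \<Delta> \<epsilon> \<longleftrightarrow>
     Module.module K C \<and>
     \<Delta> \<in> linear_maps K C (tensor K C C) \<and>
     \<epsilon> \<in> linear_maps K C (base_vs K) \<and>
     (\<forall>c\<in>carrier C.
        tensor_assoc K C C C (tensor_map K (tensor K C C) C \<Delta> (\<lambda>x. x) (\<Delta> c)) =
        tensor_map K C (tensor K C C) (\<lambda>x. x) \<Delta> (\<Delta> c)) \<and>
     (\<forall>c\<in>carrier C. tensor_lift K C (\<lambda>x y. \<epsilon> x \<odot>\<^bsub>C\<^esub> y) (\<Delta> c) = c) \<and>
     (\<forall>c\<in>carrier C. tensor_lift K C (\<lambda>x y. \<epsilon> y \<odot>\<^bsub>C\<^esub> x) (\<Delta> c) = c)"

definition direct_sum_decomposition ::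
  "('k, 'm) ring_scheme \<Rightarrow> ('k, 'v) module \<Rightarrow> (nat \<Rightarrow> 'v set) \<Rightarrow> bool" where
  "direct_sum_decomposition K V G \<longleftrightarrow>
     (\<forall>n. submodule (G n) K V) \<and>
     (\<forall>v\<in>carrier V. \<exists>!h. (\<forall>n. h n \<in> G n) \<and> finite {n. h n \<noteq> \<zero>\<^bsub>V\<^esub>} \<and>
        v = (\<Oplus>\<^bsub>V\<^esub>n\<in>{n. h n \<noteq> \<zero>\<^bsub>V\<^esub>}. h n))"

text \<open>The part of total degree \<open>n\<close> of the tensor square of a graded space.\<close>

definition tensor_degree ::
  "('k, 'm) ring_scheme \<Rightarrow> ('k, 'v) module \<Rightarrow> (nat \<Rightarrow> 'v set) \<Rightarrow> nat \<Rightarrow> ('v \<times> 'v \<Rightarrow> 'k) set set"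
  where
  "tensor_degree K V G n = lin_span K (tensor K V V)
     {tens K V V a b | a b i j. i + j = n \<and> a \<in> G i \<and> b \<in> G j}"

definition graded_coalgebra ::
  "('k, 'm) ring_scheme \<Rightarrow> ('k, 'v) module \<Rightarrow> ('v \<Rightarrow> ('v \<times> 'v \<Rightarrow> 'k) set) \<Rightarrow> ('v \<Rightarrow> 'k)
    \<Rightarrow> (nat \<Rightarrow> 'v set) \<Rightarrow> bool" where
  "graded_coalgebra K C \<Delta> \<epsilon> G \<longleftrightarrow>
     coalgebra K C \<Delta> \<epsilon> \<and>
     direct_sum_decomposition K C G \<and>
     (\<forall>n. \<Delta> ` G n \<subseteq> tensor_degree K C G n) \<and>
     (\<forall>n. n \<noteq> 0 \<longrightarrow> \<epsilon> ` G n \<subseteq> {\<zero>\<^bsub>K\<^esub>})"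

text \<open>The product and unit of the algebra \<open>H\<close> are the fields \<open>mult\<close> and \<open>one\<close>. The library
  locale \<open>algebra\<close> does not apply, since it requires a commutative product.\<close>

definition graded_bialgebra ::
  "('k, 'm) ring_scheme \<Rightarrow> ('k, 'v) module \<Rightarrow> ('v \<Rightarrow> ('v \<times> 'v \<Rightarrow> 'k) set) \<Rightarrow> ('v \<Rightarrow> 'k)
    \<Rightarrow> (nat \<Rightarrow> 'v set) \<Rightarrow> bool" where
  "graded_bialgebra K H \<Delta> \<epsilon> G \<longleftrightarrow>
     ring H \<and> bilinear_map K H H H (mult H) \<and>
     graded_coalgebra K H \<Delta> \<epsilon> G \<and>
     (\<forall>a\<in>carrier H. \<forall>b\<in>carrier H.
        \<Delta> (a \<otimes>\<^bsub>H\<^esub> b) = tensor_mult K H (mult H) (\<Delta> a) (\<Delta> b) \<and>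
        \<epsilon> (a \<otimes>\<^bsub>H\<^esub> b) = \<epsilon> a \<otimes>\<^bsub>K\<^esub> \<epsilon> b) \<and>
     \<Delta> \<one>\<^bsub>H\<^esub> = tens K H H \<one>\<^bsub>H\<^esub> \<one>\<^bsub>H\<^esub> \<and>
     \<epsilon> \<one>\<^bsub>H\<^esub> = \<one>\<^bsub>K\<^esub> \<and>
     \<one>\<^bsub>H\<^esub> \<in> G 0 \<and>
     (\<forall>i j. \<forall>a\<in>G i. \<forall>b\<in>G j. a \<otimes>\<^bsub>H\<^esub> b \<in> G (i + j))"


section \<open>Species and bimonoids\<close>

text \<open>
  Finite sets are the finite subsets of a type \<open>'a\<close>, and disjoint unions are unions of
  disjoint subsets. For a bijection \<open>f\<close> from \<open>X\<close> to \<open>Y\<close>, \<open>relab_sp X f\<close> is the contravariant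
  action, from the space attached to \<open>Y\<close> to that attached to \<open>X\<close>; \<open>Y\<close> is determined as the
  image of \<open>X\<close>. The field \<open>deg_sp X n\<close> is the homogeneous part of degree \<open>n\<close>.
\<close>

record ('k, 'a, 'v) species_data =
  sp_space :: "'a set \<Rightarrow> ('k, 'v) module"
  relab_sp :: "'a set \<Rightarrow> ('a \<Rightarrow> 'a) \<Rightarrow> 'v \<Rightarrow> 'v"
  prod_sp :: "'a set \<Rightarrow> 'a set \<Rightarrow> 'v \<Rightarrow> 'v \<Rightarrow> 'v"
  unit_sp :: "'v"
  coprod_sp :: "'a set \<Rightarrow> 'v \<Rightarrow> ('v \<times> 'v \<Rightarrow> 'k) set"
  counit_sp :: "'a set \<Rightarrow> 'v \<Rightarrow> 'k"
  deg_sp :: "'a set \<Rightarrow> nat \<Rightarrow> 'v set"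

definition linear_species ::
  "('k, 'm) ring_scheme \<Rightarrow> ('k, 'a, 'v) species_data \<Rightarrow> bool" where
  "linear_species K E \<longleftrightarrow>
     (\<forall>X. finite X \<longrightarrow> Module.module K (sp_space E X)) \<and>
     (\<forall>X Y f. finite X \<and> bij_betw f X Y \<longrightarrow>
        relab_sp E X f \<in> linear_maps K (sp_space E Y) (sp_space E X)) \<and>
     (\<forall>X Y f g. finite X \<and> bij_betw f X Y \<and> (\<forall>x\<in>X. f x = g x) \<longrightarrow>
        (\<forall>v\<in>carrier (sp_space E Y). relab_sp E X f v = relab_sp E X g v)) \<and>
     (\<forall>X. finite X \<longrightarrow> (\<forall>v\<in>carrier (sp_space E X). relab_sp E X (\<lambda>x. x) v = v)) \<and>
     (\<forall>X Y Z f g. finite X \<and> bij_betw f X Y \<and> bij_betw g Y Z \<longrightarrow>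
        (\<forall>v\<in>carrier (sp_space E Z). relab_sp E X (g \<circ> f) v = relab_sp E X f (relab_sp E Y g v)))"

definition species_monoid ::
  "('k, 'm) ring_scheme \<Rightarrow> ('k, 'a, 'v) species_data \<Rightarrow> bool" where
  "species_monoid K E \<longleftrightarrow>
     linear_species K E \<and>
     (\<forall>X Y. finite X \<and> finite Y \<and> X \<inter> Y = {} \<longrightarrow>
        bilinear_map K (sp_space E X) (sp_space E Y) (sp_space E (X \<union> Y)) (prod_sp E X Y)) \<and>
     (\<forall>X Y Z f. finite X \<and> finite Y \<and> X \<inter> Y = {} \<and> bij_betw f (X \<union> Y) Z \<longrightarrow>
        (\<forall>a\<in>carrier (sp_space E (f ` X)). \<forall>b\<in>carrier (sp_space E (f ` Y)).
           relab_sp E (X \<union> Y) f (prod_sp E (f ` X) (f ` Y) a b) =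
           prod_sp E X Y (relab_sp E X f a) (relab_sp E Y f b))) \<and>
     (\<forall>X Y Z. finite X \<and> finite Y \<and> finite Z \<and> X \<inter> Y = {} \<and> X \<inter> Z = {} \<and> Y \<inter> Z = {} \<longrightarrow>
        (\<forall>a\<in>carrier (sp_space E X). \<forall>b\<in>carrier (sp_space E Y). \<forall>c\<in>carrier (sp_space E Z).
           prod_sp E (X \<union> Y) Z (prod_sp E X Y a b) c =
           prod_sp E X (Y \<union> Z) a (prod_sp E Y Z b c))) \<and>
     unit_sp E \<in> carrier (sp_space E {}) \<and>
     (\<forall>X. finite X \<longrightarrow> (\<forall>a\<in>carrier (sp_space E X).
        prod_sp E {} X (unit_sp E) a = a \<and> prod_sp E X {} a (unit_sp E) = a))"

definition commutative_species ::
  "('k, 'a, 'v) species_data \<Rightarrow> bool" where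
  "commutative_species E \<longleftrightarrow>
     (\<forall>X Y. finite X \<and> finite Y \<and> X \<inter> Y = {} \<longrightarrow>
        (\<forall>a\<in>carrier (sp_space E X). \<forall>b\<in>carrier (sp_space E Y).
           prod_sp E X Y a b = prod_sp E Y X b a))"

definition species_bimonoid ::
  "('k, 'm) ring_scheme \<Rightarrow> ('k, 'a, 'v) species_data \<Rightarrow> bool" where
  "species_bimonoid K E \<longleftrightarrow>
     species_monoid K E \<and>
     (\<forall>X. finite X \<longrightarrow> coalgebra K (sp_space E X) (coprod_sp E X) (counit_sp E X)) \<and>
     (\<forall>X Y f. finite X \<and> bij_betw f X Y \<longrightarrow>
        (\<forall>v\<in>carrier (sp_space E Y).
           coprod_sp E X (relab_sp E X f v) =
             tensor_map K (sp_space E X) (sp_space E X) (relab_sp E X f) (relab_sp E X f) (coprod_sp E Y v) \<and>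
           counit_sp E X (relab_sp E X f v) = counit_sp E Y v)) \<and>
     (\<forall>X Y. finite X \<and> finite Y \<and> X \<inter> Y = {} \<longrightarrow>
        (\<forall>a\<in>carrier (sp_space E X). \<forall>b\<in>carrier (sp_space E Y).
           coprod_sp E (X \<union> Y) (prod_sp E X Y a b) =
             tensor_mult K (sp_space E (X \<union> Y)) (prod_sp E X Y) (coprod_sp E X a) (coprod_sp E Y b) \<and>
           counit_sp E (X \<union> Y) (prod_sp E X Y a b) = counit_sp E X a \<otimes>\<^bsub>K\<^esub> counit_sp E Y b)) \<and>
     coprod_sp E {} (unit_sp E) = tens K (sp_space E {}) (sp_space E {}) (unit_sp E) (unit_sp E) \<and>
     counit_sp E {} (unit_sp E) = \<one>\<^bsub>K\<^esub>"

definition graded_species_bimonoid ::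
  "('k, 'm) ring_scheme \<Rightarrow> ('k, 'a, 'v) species_data \<Rightarrow> bool" where
  "graded_species_bimonoid K E \<longleftrightarrow>
     species_bimonoid K E \<and>
     (\<forall>X. finite X \<longrightarrow>
        graded_coalgebra K (sp_space E X) (coprod_sp E X) (counit_sp E X) (deg_sp E X)) \<and>
     (\<forall>X Y f n. finite X \<and> bij_betw f X Y \<longrightarrow> relab_sp E X f ` deg_sp E Y n \<subseteq> deg_sp E X n) \<and>
     (\<forall>X Y i j. finite X \<and> finite Y \<and> X \<inter> Y = {} \<longrightarrow>
        (\<forall>a\<in>deg_sp E X i. \<forall>b\<in>deg_sp E Y j. prod_sp E X Y a b \<in> deg_sp E (X \<union> Y) (i + j))) \<and>
     unit_sp E \<in> deg_sp E {} 0"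


section \<open>The bosonic Fock functor\<close>

definition coinv_sub ::
  "('k, 'm) ring_scheme \<Rightarrow> ('k, nat, 'v) species_data \<Rightarrow> nat \<Rightarrow> 'v set" where
  "coinv_sub K E n = lin_span K (sp_space E {1..n})
     {v \<ominus>\<^bsub>sp_space E {1..n}\<^esub> relab_sp E {1..n} \<sigma> v | v \<sigma>.
        v \<in> carrier (sp_space E {1..n}) \<and> bij_betw \<sigma> {1..n} {1..n}}"

definition coinv ::
  "('k, 'm) ring_scheme \<Rightarrow> ('k, nat, 'v) species_data \<Rightarrow> nat \<Rightarrow> ('k, 'v set) module" where
  "coinv K E n = quot_vs (sp_space E {1..n}) (coinv_sub K E n)"

definition coinv_class ::
  "('k, 'm) ring_scheme \<Rightarrow> ('k, nat, 'v) species_data \<Rightarrow> nat \<Rightarrow> 'v \<Rightarrow> 'v set" where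
  "coinv_class K E n v = coinv_sub K E n +>\<^bsub>sp_space E {1..n}\<^esub> v"

text \<open>The second factor is transported from \<open>{1..n}\<close> to \<open>{m+1..m+n}\<close> before multiplying.\<close>

definition coinv_prod ::
  "('k, 'm) ring_scheme \<Rightarrow> ('k, nat, 'v) species_data \<Rightarrow> nat \<Rightarrow> nat
    \<Rightarrow> 'v set \<Rightarrow> 'v set \<Rightarrow> 'v set" where
  "coinv_prod K E m n A B = the_elem
     {coinv_class K E (m + n)
        (prod_sp E {1..m} {m+1..m+n} a (relab_sp E {m+1..m+n} (\<lambda>i. i - m) b)) | a b.
        a \<in> A \<and> b \<in> B}"

text \<open>\<open>fock K E\<close> is the direct sum of the spaces of coinvariants, with its induced product.\<close>

definition fock ::
  "('k, 'm) ring_scheme \<Rightarrow> ('k, nat, 'v) species_data \<Rightarrow> ('k, nat \<Rightarrow> 'v set) module" where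
  "fock K E = \<lparr>
     carrier = {h. (\<forall>n. h n \<in> carrier (coinv K E n)) \<and> finite {n. h n \<noteq> \<zero>\<^bsub>coinv K E n\<^esub>}},
     mult = (\<lambda>h h' N. \<Oplus>\<^bsub>coinv K E N\<^esub>m\<in>{..N}. coinv_prod K E m (N - m) (h m) (h' (N - m))),
     one = (\<lambda>n. if n = 0 then coinv_class K E 0 (unit_sp E) else \<zero>\<^bsub>coinv K E n\<^esub>),
     zero = (\<lambda>n. \<zero>\<^bsub>coinv K E n\<^esub>),
     add = (\<lambda>h h' n. h n \<oplus>\<^bsub>coinv K E n\<^esub> h' n),
     smult = (\<lambda>c h n. c \<odot>\<^bsub>coinv K E n\<^esub> h n)\<rparr>"

definition fock_class ::
  "('k, 'm) ring_scheme \<Rightarrow> ('k, nat, 'v) species_data \<Rightarrow> nat \<Rightarrow> 'v \<Rightarrow> nat \<Rightarrow> 'v set" where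
  "fock_class K E n v = (\<lambda>m. if m = n then coinv_class K E n v else \<zero>\<^bsub>coinv K E m\<^esub>)"

definition fock_coprod ::
  "('k, 'm) ring_scheme \<Rightarrow> ('k, nat, 'v) species_data \<Rightarrow> (nat \<Rightarrow> 'v set)
    \<Rightarrow> ((nat \<Rightarrow> 'v set) \<times> (nat \<Rightarrow> 'v set) \<Rightarrow> 'k) set" where
  "fock_coprod K E h =
     (\<Oplus>\<^bsub>tensor K (fock K E) (fock K E)\<^esub>n\<in>{n. h n \<noteq> \<zero>\<^bsub>coinv K E n\<^esub>}.
        the_elem ((\<lambda>v. tensor_map K (fock K E) (fock K E) (fock_class K E n) (fock_class K E n)
          (coprod_sp E {1..n} v)) ` h n))"

definition fock_counit ::
  "('k, 'm) ring_scheme \<Rightarrow> ('k, nat, 'v) species_data \<Rightarrow> (nat \<Rightarrow> 'v set) \<Rightarrow> 'k" where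
  "fock_counit K E h =
     (\<Oplus>\<^bsub>K\<^esub>n\<in>{n. h n \<noteq> \<zero>\<^bsub>coinv K E n\<^esub>}. the_elem (counit_sp E {1..n} ` h n))"

definition fock_deg ::
  "('k, 'm) ring_scheme \<Rightarrow> ('k, nat, 'v) species_data \<Rightarrow> nat \<Rightarrow> (nat \<Rightarrow> 'v set) set" where
  "fock_deg K E d =
     {h \<in> carrier (fock K E). \<forall>n. \<exists>v\<in>deg_sp E {1..n} d. h n = coinv_class K E n v}"


section \<open>Finite topologies\<close>

text \<open>A topology on \<open>X\<close> is a \<^typ>\<open>'a topology\<close> with \<^const>\<open>topspace\<close> equal to \<open>X\<close>.\<close>

definition top_le :: "'a topology \<Rightarrow> 'a \<Rightarrow> 'a \<Rightarrow> bool" where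
  "top_le T x y \<longleftrightarrow> x \<in> topspace T \<and> y \<in> topspace T \<and>
     (\<forall>U. openin T U \<and> x \<in> U \<longrightarrow> y \<in> U)"

definition top_sim :: "'a topology \<Rightarrow> 'a \<Rightarrow> 'a \<Rightarrow> bool" where
  "top_sim T x y \<longleftrightarrow> top_le T x y \<and> top_le T y x"

text \<open>The topology of a quasi-order \<open>R\<close> on \<open>X\<close>: its open sets are the upper ideals.\<close>

definition upset_topology :: "'a set \<Rightarrow> ('a \<times> 'a) set \<Rightarrow> 'a topology" where
  "upset_topology X R =
     topology (\<lambda>U. U \<subseteq> X \<and> (\<forall>x\<in>U. \<forall>y\<in>X. (x, y) \<in> R \<longrightarrow> y \<in> U))"

lemma openin_upset_topology:
  "openin (upset_topology X R) U \<longleftrightarrow>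
     U \<subseteq> X \<and> (\<forall>x\<in>U. \<forall>y\<in>X. (x, y) \<in> R \<longrightarrow> y \<in> U)"
proof -
  have "istopology (\<lambda>U. U \<subseteq> X \<and> (\<forall>x\<in>U. \<forall>y\<in>X. (x, y) \<in> R \<longrightarrow> y \<in> U))"
    unfolding istopology_def
  proof (intro conjI allI impI)
    fix \<U> :: "'a set set" assume *: "\<forall>U\<in>\<U>. U \<subseteq> X \<and> (\<forall>x\<in>U. \<forall>y\<in>X. (x, y) \<in> R \<longrightarrow> y \<in> U)"
    then show "\<Union>\<U> \<subseteq> X" by blast
    show "\<forall>x\<in>\<Union>\<U>. \<forall>y\<in>X. (x, y) \<in> R \<longrightarrow> y \<in> \<Union>\<U>"
    proof (intro ballI impI)
      fix x y assume "x \<in> \<Union>\<U>" "y \<in> X" "(x, y) \<in> R"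
      then show "y \<in> \<Union>\<U>" using * by (meson UnionE UnionI)
    qed
  qed auto
  then show ?thesis by (simp add: upset_topology_def)
qed

lemma topspace_upset_topology [simp]: "topspace (upset_topology X R) = X"
  unfolding topspace_def by (auto simp: openin_upset_topology)

lemma top_le_upset_topology:
  assumes "R \<subseteq> X \<times> X" "refl_on X R" "trans R"
  shows "top_le (upset_topology X R) x y \<longleftrightarrow> (x, y) \<in> R"
proof
  assume *: "top_le (upset_topology X R) x y"
  then have "x \<in> X" by (simp add: top_le_def)
  have "openin (upset_topology X R) {z \<in> X. (x, z) \<in> R}"
    using assms(3) by (auto simp: openin_upset_topology dest: transD)
  moreover have "x \<in> {z \<in> X. (x, z) \<in> R}"
    using \<open>x \<in> X\<close> assms(2) by (auto simp: refl_on_def)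
  ultimately show "(x, y) \<in> R" using * unfolding top_le_def by blast
next
  assume "(x, y) \<in> R"
  then show "top_le (upset_topology X R) x y"
    using assms(1) by (auto simp: top_le_def openin_upset_topology)
qed

definition top_union :: "'a topology \<Rightarrow> 'a topology \<Rightarrow> 'a topology" where
  "top_union T1 T2 = topology (\<lambda>U. U \<subseteq> topspace T1 \<union> topspace T2 \<and>
     openin T1 (U \<inter> topspace T1) \<and> openin T2 (U \<inter> topspace T2))"

lemma openin_top_union:
  "openin (top_union T1 T2) U \<longleftrightarrow> U \<subseteq> topspace T1 \<union> topspace T2 \<and>
     openin T1 (U \<inter> topspace T1) \<and> openin T2 (U \<inter> topspace T2)"
proof -
  let ?P = "\<lambda>U. U \<subseteq> topspace T1 \<union> topspace T2 \<and>
     openin T1 (U \<inter> topspace T1) \<and> openin T2 (U \<inter> topspace T2)"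
  have un: "openin T (\<Union>\<U> \<inter> topspace T)"
    if "\<forall>U\<in>\<U>. openin T (U \<inter> topspace T)" for T :: "'a topology" and \<U>
  proof -
    have "openin T (\<Union>((\<lambda>U. U \<inter> topspace T) ` \<U>))"
      using that by (intro openin_Union) auto
    moreover have "\<Union>((\<lambda>U. U \<inter> topspace T) ` \<U>) = \<Union>\<U> \<inter> topspace T" by blast
    ultimately show ?thesis by simp
  qed
  have int: "openin T (A \<inter> B \<inter> topspace T)"
    if "openin T (A \<inter> topspace T)" "openin T (B \<inter> topspace T)" for T :: "'a topology" and A B
  proof -
    have "(A \<inter> topspace T) \<inter> (B \<inter> topspace T) = A \<inter> B \<inter> topspace T" by blast
    then show ?thesis using openin_Int[OF that] by simp
  qed
  have "istopology ?P"
    unfolding istopology_def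
  proof (intro conjI allI impI)
    fix A B assume "?P A" "?P B"
    then show "A \<inter> B \<subseteq> topspace T1 \<union> topspace T2"
      "openin T1 (A \<inter> B \<inter> topspace T1)" "openin T2 (A \<inter> B \<inter> topspace T2)"
      by (blast, blast intro: int, blast intro: int)
  next
    fix \<U> assume *: "\<forall>U\<in>\<U>. ?P U"
    then show "\<Union>\<U> \<subseteq> topspace T1 \<union> topspace T2" by (intro Union_least) simp
    show "openin T1 (\<Union>\<U> \<inter> topspace T1)" "openin T2 (\<Union>\<U> \<inter> topspace T2)"
      using * by (simp_all add: un)
  qed
  then show ?thesis by (simp add: top_union_def)
qed

definition finer :: "'a topology \<Rightarrow> 'a topology \<Rightarrow> bool" where
  "finer T' T \<longleftrightarrow> topspace T' = topspace T \<and> (\<forall>U. openin T U \<longrightarrow> openin T' U)"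

definition top_quot :: "'a topology \<Rightarrow> 'a topology \<Rightarrow> 'a topology" where
  "top_quot T T' = upset_topology (topspace T) ({(x, y). top_le T x y \<or> top_le T' y x}\<^sup>+)"

lemma top_le_top_quot:
  assumes "topspace T' = topspace T"
  shows "top_le (top_quot T T') x y \<longleftrightarrow> (x, y) \<in> {(x, y). top_le T x y \<or> top_le T' y x}\<^sup>+"
  unfolding top_quot_def
proof (rule top_le_upset_topology)
  show "{(x, y). top_le T x y \<or> top_le T' y x}\<^sup>+ \<subseteq> topspace T \<times> topspace T"
    using assms by (intro trancl_subset_Sigma) (auto simp: top_le_def)
  show "refl_on (topspace T) ({(x, y). top_le T x y \<or> top_le T' y x}\<^sup>+)"
    by (intro refl_onI r_into_trancl) (simp add: top_le_def)
qed simp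

definition admissible :: "'a topology \<Rightarrow> 'a topology \<Rightarrow> bool" where
  "admissible T' T \<longleftrightarrow>
     finer T' T \<and>
     (\<forall>Y. connectedin T' Y \<longrightarrow> subtopology T' Y = subtopology T Y) \<and>
     (\<forall>x\<in>topspace T. \<forall>y\<in>topspace T. top_sim (top_quot T T') x y \<longleftrightarrow> top_sim (top_quot T' T') x y)"

text \<open>The subtraction does not truncate on finite spaces: each component is a union of
  \<^const>\<open>top_sim\<close>-classes.\<close>

definition top_degree :: "'a topology \<Rightarrow> nat" where
  "top_degree T = card (topspace T // {(x, y). top_sim T x y}) - card (connected_components_of T)"


section \<open>The species of pairs of topologies\<close>

definition adm_pairs :: "'a set \<Rightarrow> ('a topology \<times> 'a topology) set" where
  "adm_pairs X = {(T, T'). topspace T = X \<and> admissible T' T}"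

text \<open>For the relabelling along \<open>f\<close> from \<open>X\<close> to \<open>Y\<close>, the open sets are the
  preimages of open sets.\<close>

definition Dtilde ::
  "('k, 'm) ring_scheme \<Rightarrow> ('k, 'a, 'a topology \<times> 'a topology \<Rightarrow> 'k) species_data" where
  "Dtilde K =
    (let D = (\<lambda>X. free_vs K (adm_pairs X)) in
    \<lparr>sp_space = D,
     relab_sp = (\<lambda>X f. lin_ext K (D X)
       (\<lambda>(T, T'). basis_vec K (pullback_topology X f T, pullback_topology X f T'))),
     prod_sp = (\<lambda>X1 X2 a b.
       lin_ext K (D (X1 \<union> X2)) (\<lambda>(T1, T1').
         lin_ext K (D (X1 \<union> X2)) (\<lambda>(T2, T2').
           basis_vec K (top_union T1 T2, top_union T1' T2')) b) a),
     unit_sp = basis_vec K (discrete_topology {}, discrete_topology {}),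
     coprod_sp = (\<lambda>X. lin_ext K (tensor K (D X) (D X)) (\<lambda>(T, T').
       \<Oplus>\<^bsub>tensor K (D X) (D X)\<^esub>T''\<in>{T''. admissible T'' T'}.
         tens K (D X) (D X) (basis_vec K (T, T''))
           (basis_vec K (top_quot T T'', top_quot T' T'')))),
     counit_sp = (\<lambda>X. lin_ext K (base_vs K) (\<lambda>(T, T').
       if top_degree T' = 0 then \<one>\<^bsub>K\<^esub> else \<zero>\<^bsub>K\<^esub>)),
     deg_sp = (\<lambda>X n. lin_span K (D X)
       {basis_vec K (T, T') | T T'. (T, T') \<in> adm_pairs X \<and> top_degree T' = n})\<rparr>)"

end

theory Submission
  imports Defs
begin

text \<open>
  A topology on a finite set is a quasi-order, and in these terms \<open>S\<close> is \<open>R\<close>-admissible iff \<open>S \<subseteq> R\<close>,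
  \<open>R\<close> and \<open>S\<close> agree inside the connected components of \<open>S\<close>, and no cycle made of steps of \<open>R\<close> and
  reversed steps of \<open>S\<close> leaves a component of \<open>S\<close>. The last condition confines the steps of a path
  whose end points are equivalent to a single component, whence admissibility is transitive and
  compatible with quotients. For \<open>A\<close> admissible for \<open>C\<close>, the map \<open>B \<mapsto> B/A\<close> is a bijection from the
  \<open>B\<close> between \<open>A\<close> and \<open>C\<close> onto the topologies admissible for \<open>C/A\<close>, with \<open>(C/A)/(B/A) = C/B\<close>;
  this is coassociativity on the basis. The counit picks out the two extreme admissible topologies:
  \<open>T\<close> itself, and the partition of \<open>T\<close> into its classes.

  The passage to coinvariants works for every graded bimonoid: the Fock space is spanned by the
  classes of elements of the species, on which every axiom of a graded bialgebra reduces to the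
  corresponding axiom of the species.
\<close>

section \<open>Admissible quasi-orders\<close>

text \<open>A quotient quasi-order is a transitive closure, so a pair in \<open>C/A\<close> says
  nothing about the points through which it passes. The third condition restores control only when
  the path closes up to a cycle; the arguments on quotients are therefore arranged so that a return
  path is available in a suitable larger quotient. The field is arbitrary, so coinvariants cannot be
  treated by averaging over permutations: each operation has to be shown invariant and then pushed
  to the quotient. For the grading this means that the degree projections commute with relabelling
  and descend; the descended projections then show that the images of the homogeneous parts still
  form a direct sum. Tensor products are quotients of free spaces on all pairs of vectors, and maps
  on quotients are evaluated on representatives. The value of such a map is accessible only after
  its well-definedness is known; from then on identities are tested on pure tensors.\<close>

definition quasi_order :: "'a set \<Rightarrow> ('a \<times> 'a) set \<Rightarrow> bool" where
  "quasi_order X R \<longleftrightarrow> R \<subseteq> X \<times> X \<and> refl_on X R \<and> trans R"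

text \<open>For a finite topology the classes of this relation are the connected components. The
  closure is only transitive: reflexivity on \<open>X\<close> comes from the quasi-order itself, so
  no pair outside \<open>X\<close> is added.\<close>

definition equiv_closure :: "('a \<times> 'a) set \<Rightarrow> ('a \<times> 'a) set" where
  "equiv_closure R = (R \<union> R\<inverse>)\<^sup>+"

text \<open>The quasi-order of a quotient of topologies. For \<open>S = R\<close> it is the
  component relation \<open>equiv_closure R\<close>, so condition (iii) of admissibility compares
  cycles of a quotient with components.\<close>

definition rel_quot :: "('a \<times> 'a) set \<Rightarrow> ('a \<times> 'a) set \<Rightarrow> ('a \<times> 'a) set" where
  "rel_quot R S = (R \<union> S\<inverse>)\<^sup>+"

definition rel_sim :: "('a \<times> 'a) set \<Rightarrow> ('a \<times> 'a) set" where
  "rel_sim R = R \<inter> R\<inverse>"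

text \<open>Condition (ii), about all connected subsets, is expressed by pairs inside a component of
  \<open>S\<close>. Condition (iii) is expressed by one inclusion, from which
  \<open>rel_adm_sim_quot\<close> obtains the equality. Agreement with the topological notion is
  \<open>admissible_rel_adm\<close>.\<close>

definition rel_adm :: "'a set \<Rightarrow> ('a \<times> 'a) set \<Rightarrow> ('a \<times> 'a) set \<Rightarrow> bool" where
  "rel_adm X S R \<longleftrightarrow> quasi_order X S \<and> quasi_order X R \<and> S \<subseteq> R \<and> R \<inter> equiv_closure S \<subseteq> S \<and> rel_sim (rel_quot R S) \<subseteq> equiv_closure S"

section \<open>Closures and quotients of relations\<close>

lemma trancl_least: "R \<subseteq> S \<Longrightarrow> trans S \<Longrightarrow> R\<^sup>+ \<subseteq> S"
  using trancl_mono_subset[of R S] by (simp add: trancl_id)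

lemma equiv_closure_sym: "sym (equiv_closure R)"
  unfolding equiv_closure_def by (intro sym_trancl sym_Un_converse)

lemma equiv_closure_symD: "(x, y) \<in> equiv_closure R \<Longrightarrow> (y, x) \<in> equiv_closure R"
  using equiv_closure_sym by (rule symD)

lemma equiv_closure_trans: "trans (equiv_closure R)" by (simp add: equiv_closure_def)
lemma rel_quot_trans: "trans (rel_quot R S)" by (simp add: rel_quot_def)
lemma sub_equiv_closure: "R \<subseteq> equiv_closure R" by (auto simp: equiv_closure_def)
lemma sub_rel_quot: "R \<subseteq> rel_quot R S" "S\<inverse> \<subseteq> rel_quot R S" by (auto simp: rel_quot_def)
lemma rel_quot_least: "R \<subseteq> P \<Longrightarrow> S\<inverse> \<subseteq> P \<Longrightarrow> trans P \<Longrightarrow> rel_quot R S \<subseteq> P"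
  unfolding rel_quot_def by (intro trancl_least) auto
lemma equiv_closure_least: "R \<subseteq> P \<Longrightarrow> sym P \<Longrightarrow> trans P \<Longrightarrow> equiv_closure R \<subseteq> P"
  unfolding equiv_closure_def by (intro trancl_least) (auto dest: symD)
lemma equiv_closure_mono: "R \<subseteq> S \<Longrightarrow> equiv_closure R \<subseteq> equiv_closure S"
  by (intro equiv_closure_least order.trans[OF _ sub_equiv_closure] equiv_closure_sym equiv_closure_trans)
lemma rel_quot_mono: "R \<subseteq> R' \<Longrightarrow> S \<subseteq> S' \<Longrightarrow> rel_quot R S \<subseteq> rel_quot R' S'"
  unfolding rel_quot_def by (intro trancl_mono_subset) auto
lemma rel_quot_self: "rel_quot R R = equiv_closure R" by (simp add: rel_quot_def equiv_closure_def)
lemma rel_sim_mono: "R \<subseteq> S \<Longrightarrow> rel_sim R \<subseteq> rel_sim S" by (auto simp: rel_sim_def)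
lemma rel_sim_trans: "trans R \<Longrightarrow> trans (rel_sim R)"
  unfolding rel_sim_def trans_def by blast
lemma rel_sim_sym: "sym (rel_sim R)" by (auto simp: rel_sim_def sym_def)

lemma quasi_order_equiv_closure: "quasi_order X R \<Longrightarrow> quasi_order X (equiv_closure R)"
  unfolding quasi_order_def
proof (intro conjI equiv_closure_trans)
  assume *: "R \<subseteq> X \<times> X \<and> refl_on X R \<and> trans R"
  show "equiv_closure R \<subseteq> X \<times> X" unfolding equiv_closure_def using * by (intro trancl_subset_Sigma) auto
  show "refl_on X (equiv_closure R)" using * sub_equiv_closure[of R] by (auto simp: refl_on_def)
qed

lemma quasi_order_rel_quot: "quasi_order X R \<Longrightarrow> quasi_order X S \<Longrightarrow> quasi_order X (rel_quot R S)"
  unfolding quasi_order_def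
proof (intro conjI rel_quot_trans)
  assume *: "R \<subseteq> X \<times> X \<and> refl_on X R \<and> trans R" "S \<subseteq> X \<times> X \<and> refl_on X S \<and> trans S"
  show "rel_quot R S \<subseteq> X \<times> X" unfolding rel_quot_def using * by (intro trancl_subset_Sigma) auto
  show "refl_on X (rel_quot R S)" using * sub_rel_quot(1)[of R S] by (auto simp: refl_on_def)
qed

lemma rel_admD:
  assumes "rel_adm X S R"
  shows "quasi_order X S" "quasi_order X R" "S \<subseteq> R" "\<And>x y. (x, y) \<in> R \<Longrightarrow> (x, y) \<in> equiv_closure S \<Longrightarrow> (x, y) \<in> S"
    "\<And>x y. (x, y) \<in> rel_quot R S \<Longrightarrow> (y, x) \<in> rel_quot R S \<Longrightarrow> (x, y) \<in> equiv_closure S"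
  using assms unfolding rel_adm_def rel_sim_def by blast+

lemma rel_admI:
  assumes "quasi_order X S" "quasi_order X R" "S \<subseteq> R" "\<And>x y. (x, y) \<in> R \<Longrightarrow> (x, y) \<in> equiv_closure S \<Longrightarrow> (x, y) \<in> S"
    "\<And>x y. (x, y) \<in> rel_quot R S \<Longrightarrow> (y, x) \<in> rel_quot R S \<Longrightarrow> (x, y) \<in> equiv_closure S"
  shows "rel_adm X S R"
  using assms unfolding rel_adm_def rel_sim_def by auto

lemma rel_quot_symD: "S \<subseteq> R \<Longrightarrow> (x, y) \<in> equiv_closure S \<Longrightarrow> (x, y) \<in> rel_quot R S"
  using rel_quot_mono[of S R S S] by (auto simp: rel_quot_self)

lemma rel_adm_sim_quot: "rel_adm X S R \<Longrightarrow> rel_sim (rel_quot R S) = equiv_closure S"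
proof (intro subset_antisym subrelI)
  assume *: "rel_adm X S R"
  fix x y
  { assume "(x, y) \<in> rel_sim (rel_quot R S)"
    then show "(x, y) \<in> equiv_closure S" using * by (auto simp: rel_adm_def) }
  { assume xy: "(x, y) \<in> equiv_closure S"
    show "(x, y) \<in> rel_sim (rel_quot R S)"
      using rel_quot_symD[OF rel_admD(3)[OF *] xy] rel_quot_symD[OF rel_admD(3)[OF *] equiv_closure_symD[OF xy]]
      by (simp add: rel_sim_def) }
qed

text \<open>The quotient adds only reversals of steps of \<open>R\<close>, and components ignore the
  direction of steps.\<close>

lemma equiv_closure_rel_quot: assumes "S \<subseteq> R" shows "equiv_closure (rel_quot R S) = equiv_closure R"
proof
  show "equiv_closure (rel_quot R S) \<subseteq> equiv_closure R"
  proof (intro equiv_closure_least rel_quot_least equiv_closure_sym equiv_closure_trans sub_equiv_closure)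
    show "S\<inverse> \<subseteq> equiv_closure R" using assms by (auto simp: equiv_closure_def)
  qed
  show "equiv_closure R \<subseteq> equiv_closure (rel_quot R S)" by (intro equiv_closure_mono sub_rel_quot)
qed

text \<open>The inverse of \<open>B/A\<close> is generated by \<open>A\<close> and the reversed
  steps of \<open>B\<close>. Steps of \<open>A\<close> already belong to \<open>C\<close>, and
  reversed steps of \<open>A\<close> are reversed steps of \<open>B\<close>, so only the reversed
  steps of \<open>B\<close> matter.\<close>

lemma rel_quot_rel_quot:
  assumes "A \<subseteq> B" "B \<subseteq> C"
  shows "rel_quot (rel_quot C A) (rel_quot B A) = rel_quot C B"
proof
  have "A \<union> B\<inverse> \<subseteq> rel_quot C B" using assms sub_rel_quot(1)[of C B] sub_rel_quot(2)[of B C] by (meson Un_least order.trans)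
  moreover have "A\<inverse> \<subseteq> rel_quot C B" using assms(1) sub_rel_quot(2)[of B C] by (meson converse_mono order.trans)
  moreover have "(rel_quot B A)\<inverse> = (A \<union> B\<inverse>)\<^sup>+"
    by (simp add: rel_quot_def trancl_converse[symmetric] converse_Un Un_commute)
  ultimately show "rel_quot (rel_quot C A) (rel_quot B A) \<subseteq> rel_quot C B"
    by (intro rel_quot_least rel_quot_trans) (simp_all add: trancl_least rel_quot_trans sub_rel_quot)
  show "rel_quot C B \<subseteq> rel_quot (rel_quot C A) (rel_quot B A)"
    by (intro rel_quot_mono sub_rel_quot)
qed

section \<open>Paths in quotients and the behaviour of admissibility along chains\<close>

text \<open>The reversed steps of \<open>A\<close> are common to both quotients, so a path can be
  moved from \<open>C/A\<close> to \<open>B/A\<close> by checking its steps in \<open>C\<close>. The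
  hypothesis keeps both ends of the path in view, because a step is under control only if it can be
  closed up to a cycle.\<close>

lemma rel_quot_path:
  assumes "(x, y) \<in> rel_quot C A"
    and "\<And>z z'. (x, z) \<in> (C \<union> A\<inverse>)\<^sup>* \<Longrightarrow> (z, z') \<in> C \<Longrightarrow> (z', y) \<in> (C \<union> A\<inverse>)\<^sup>* \<Longrightarrow> (z, z') \<in> B"
  shows "(x, y) \<in> rel_quot B A"
proof -
  \<comment> \<open>That \<open>w\<close> still reaches \<open>y\<close> is part of the induction
    statement: the hypothesis on steps requires the remainder of the path as well as its
    beginning.\<close>
  have "(w, y) \<in> (C \<union> A\<inverse>)\<^sup>* \<longrightarrow> (x, w) \<in> (B \<union> A\<inverse>)\<^sup>+" if "(x, w) \<in> (C \<union> A\<inverse>)\<^sup>+" for w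
    using that
  proof (induction rule: trancl_induct)
    case (base z)
    then show ?case using assms(2)[of x z] by auto
  next
    case (step z w)
    show ?case
    proof
      assume w: "(w, y) \<in> (C \<union> A\<inverse>)\<^sup>*"
      then have "(x, z) \<in> (B \<union> A\<inverse>)\<^sup>+" using step by (meson converse_rtrancl_into_rtrancl)
      moreover have "(z, w) \<in> B \<union> A\<inverse>"
        using step assms(2)[OF trancl_into_rtrancl[OF step(1)] _ w] by auto
      ultimately show "(x, w) \<in> (B \<union> A\<inverse>)\<^sup>+" by (rule trancl_into_trancl)
    qed
  qed
  then show ?thesis using assms(1) by (auto simp: rel_quot_def)
qed

lemma rtrancl_rel_quot: "(x, z) \<in> (C \<union> A\<inverse>)\<^sup>* \<Longrightarrow> x = z \<or> (x, z) \<in> rel_quot C A"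
  by (auto simp: rel_quot_def rtrancl_eq_or_trancl)

text \<open>With a return from \<open>y\<close> to \<open>x\<close> in \<open>P\<close>, a step on a
  path from \<open>x\<close> to \<open>y\<close> lies on a cycle of \<open>P\<close>, so it holds in
  \<open>P\<close> in both directions. In the uses, \<open>P\<close> is a quotient and
  \<open>E\<close> is the component relation that condition (iii) attaches to its cycles.\<close>

lemma cycle_step:
  assumes "(x, z) \<in> (C \<union> A\<inverse>)\<^sup>*" "(z, z') \<in> C" "(z', y) \<in> (C \<union> A\<inverse>)\<^sup>*" "(y, x) \<in> P"
    "rel_quot C A \<subseteq> P" "trans P" "\<And>u v. (u, v) \<in> P \<Longrightarrow> (v, u) \<in> P \<Longrightarrow> (u, v) \<in> E"
  shows "(z, z') \<in> E"
proof -
  have "(z', z) \<in> P"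
    using rtrancl_rel_quot[OF assms(1)] rtrancl_rel_quot[OF assms(3)] assms(4-6)
    by (meson subsetD transD)
  moreover have "(z, z') \<in> P" using assms(2,5) sub_rel_quot(1)[of C A] by blast
  ultimately show ?thesis using assms(7) by blast
qed

text \<open>A cycle of \<open>C/A\<close> is also a cycle of \<open>C/B\<close>, so it stays in one
  component of \<open>B\<close>, where \<open>C\<close> and \<open>B\<close> agree. Hence it is a
  cycle of \<open>B/A\<close>, and admissibility of \<open>A\<close> in \<open>B\<close>
  applies.\<close>

lemma rel_adm_trans:
  assumes AB: "rel_adm X A B" and BC: "rel_adm X B C"
  shows "rel_adm X A C"
proof (rule rel_admI)
  show "quasi_order X A" "quasi_order X C" "A \<subseteq> C" using rel_admD[OF AB] rel_admD[OF BC] by auto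
  have sub: "rel_quot C A \<subseteq> rel_quot C B" using rel_admD[OF AB] by (intro rel_quot_mono) auto
  show "(x, y) \<in> A" if "(x, y) \<in> C" "(x, y) \<in> equiv_closure A" for x y
    using that equiv_closure_mono[OF rel_admD(3)[OF AB]] rel_admD(4)[OF AB] rel_admD(4)[OF BC] by blast
  have *: "(x, y) \<in> rel_quot B A" if "(x, y) \<in> rel_quot C A" "(y, x) \<in> rel_quot C A" for x y
    by (rule rel_quot_path[OF that(1)])
      (meson cycle_step[OF _ _ _ _ sub rel_quot_trans rel_admD(5)[OF BC]] rel_admD(4)[OF BC] subsetD[OF sub that(2)])
  show "(x, y) \<in> equiv_closure A" if "(x, y) \<in> rel_quot C A" "(y, x) \<in> rel_quot C A" for x y
    using * that rel_admD(5)[OF AB] by blast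
qed

text \<open>\<open>B/A\<close> has the components of \<open>B\<close>, and the quotient of the two
  quotients is \<open>C/B\<close>, so condition (iii) is the one for \<open>B\<close> in
  \<open>C\<close>. For condition (ii), two points in one component of \<open>B\<close> are joined
  both ways in \<open>C/B\<close>; this return path turns a path of \<open>C/A\<close> into one of
  \<open>B/A\<close>.\<close>

lemma rel_adm_rel_quot:
  assumes AB: "rel_adm X A B" and BC: "rel_adm X B C"
  shows "rel_adm X (rel_quot B A) (rel_quot C A)"
proof (rule rel_admI)
  show "quasi_order X (rel_quot B A)" "quasi_order X (rel_quot C A)" "rel_quot B A \<subseteq> rel_quot C A"
    using rel_admD(1,2)[OF AB] rel_admD(2,3)[OF BC] by (simp_all add: quasi_order_rel_quot rel_quot_mono)
  have sub: "rel_quot C A \<subseteq> rel_quot C B" using rel_admD[OF AB] by (intro rel_quot_mono) auto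
  have ce: "equiv_closure (rel_quot B A) = equiv_closure B" using rel_admD(3)[OF AB] by (rule equiv_closure_rel_quot)
  show "(x, y) \<in> rel_quot B A" if xy: "(x, y) \<in> rel_quot C A" "(x, y) \<in> equiv_closure (rel_quot B A)" for x y
  proof -
    have "(y, x) \<in> rel_quot C B" using xy(2) rel_quot_symD[OF rel_admD(3)[OF BC]] equiv_closure_symD unfolding ce by metis
    then show ?thesis
      by (intro rel_quot_path[OF xy(1)])
       (meson cycle_step[OF _ _ _ _ sub rel_quot_trans rel_admD(5)[OF BC]] rel_admD(4)[OF BC])
  qed
  show "(x, y) \<in> equiv_closure (rel_quot B A)"
    if "(x, y) \<in> rel_quot (rel_quot C A) (rel_quot B A)" "(y, x) \<in> rel_quot (rel_quot C A) (rel_quot B A)" for x y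
    using that rel_admD(5)[OF BC] unfolding ce rel_quot_rel_quot[OF rel_admD(3)[OF AB] rel_admD(3)[OF BC]] by blast
qed

lemma quasi_order_Int: "quasi_order X R \<Longrightarrow> quasi_order X S \<Longrightarrow> quasi_order X (R \<inter> S)"
  unfolding quasi_order_def refl_on_def by (auto intro: trans_Int)

text \<open>The inverse of the map \<open>B \<mapsto> B/A\<close>: keep those steps of \<open>C\<close> that stay in a component of \<open>U\<close>.\<close>

lemma rel_adm_lift:
  assumes AC: "rel_adm X A C" and U: "rel_adm X U (rel_quot C A)"
  defines "B \<equiv> C \<inter> equiv_closure U"
  shows "rel_adm X A B" "rel_adm X B C" "rel_quot B A = U"
proof -
  let ?P = "rel_quot (rel_quot C A) U"
  have Us: "U \<subseteq> rel_quot C A" by (rule rel_admD(3)[OF U])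
  have PP: "rel_quot C A \<subseteq> ?P" by (rule sub_rel_quot)
  have simU: "(x, y) \<in> equiv_closure U" if "(x, y) \<in> rel_quot C A" "(y, x) \<in> rel_quot C A" for x y
    using that PP rel_admD(5)[OF U] by blast
  \<comment> \<open>Steps of \<open>A\<close> are reversible in \<open>C/A\<close>, and cycles of
    \<open>C/A\<close> are cycles of \<open>(C/A)/U\<close>, which condition (iii) for
    \<open>U\<close> confines to components of \<open>U\<close>.\<close>
  have AceU: "A \<subseteq> equiv_closure U"
  proof (rule subrelI)
    fix x y assume "(x, y) \<in> A"
    then have "(x, y) \<in> rel_quot C A" "(y, x) \<in> rel_quot C A"
      using sub_rel_quot(1)[of C A] sub_rel_quot(2)[of A C] rel_admD(3)[OF AC] by auto
    then show "(x, y) \<in> equiv_closure U" by (rule simU)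
  qed
  have qB: "quasi_order X B" unfolding B_def using rel_admD[OF AC] rel_admD[OF U] by (intro quasi_order_Int quasi_order_equiv_closure) auto
  have AsB: "A \<subseteq> B" using AceU rel_admD(3)[OF AC] by (auto simp: B_def)
  \<comment> \<open>Inside its components \<open>U\<close> agrees with \<open>C/A\<close>, which
    contains \<open>C\<close>.\<close>
  have BsU: "B \<subseteq> U" using rel_admD(4)[OF U] sub_rel_quot(1)[of C A] by (auto simp: B_def)
  show QB: "rel_quot B A = U"
  proof
    have "A\<inverse> \<subseteq> U" using AceU sub_rel_quot(2)[of A C] rel_admD(4)[OF U] equiv_closure_symD[of _ _ U] by blast
    then show "rel_quot B A \<subseteq> U" using BsU rel_admD(1)[OF U] by (intro rel_quot_least) (auto simp: quasi_order_def)
    show "U \<subseteq> rel_quot B A"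
    proof clarify
      fix x y assume xy: "(x, y) \<in> U"
      \<comment> \<open>A step of \<open>U\<close> may be reversed in \<open>(C/A)/U\<close>. This
        reversal closes every path of \<open>C/A\<close> from \<open>x\<close> to \<open>y\<close>,
        so the steps of \<open>C\<close> on it stay in components of \<open>U\<close> and belong to
        \<open>B\<close>.\<close>
      then have yx: "(y, x) \<in> ?P" using sub_rel_quot(2)[of U] by auto
      show "(x, y) \<in> rel_quot B A"
        by (rule rel_quot_path[OF subsetD[OF Us xy]])
          (auto simp: B_def intro: cycle_step[OF _ _ _ yx PP rel_quot_trans rel_admD(5)[OF U]])
    qed
  qed
  have ce: "equiv_closure B = equiv_closure U" using equiv_closure_rel_quot[OF AsB] by (simp add: QB)
  show "rel_adm X A B"
  proof (rule rel_admI)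
    have "rel_quot B A \<subseteq> rel_quot C A" by (rule rel_quot_mono) (auto simp: B_def)
    then show "(x, y) \<in> equiv_closure A" if "(x, y) \<in> rel_quot B A" "(y, x) \<in> rel_quot B A" for x y
      using that rel_admD(5)[OF AC] by blast
  qed (use rel_admD[OF AC] qB AsB in \<open>auto simp: B_def\<close>)
  show "rel_adm X B C"
  proof (rule rel_admI)
    have "rel_quot C B \<subseteq> ?P" using BsU by (intro rel_quot_mono sub_rel_quot)
    then show "(x, y) \<in> equiv_closure B" if "(x, y) \<in> rel_quot C B" "(y, x) \<in> rel_quot C B" for x y
      using that rel_admD(5)[OF U] unfolding ce by blast
    show "(x, y) \<in> B" if "(x, y) \<in> C" "(x, y) \<in> equiv_closure B" for x y
      using that unfolding ce by (simp add: B_def)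
  qed (use rel_admD[OF AC] qB in \<open>auto simp: B_def\<close>)
qed

text \<open>Injectivity of \<open>B \<mapsto> B/A\<close>: the quotient has the same components as
  \<open>B\<close>, and \<open>B\<close> consists of the steps of \<open>C\<close> inside
  them.\<close>

lemma rel_adm_determined:
  assumes AB: "rel_adm X A B" and BC: "rel_adm X B C"
  shows "B = C \<inter> equiv_closure (rel_quot B A)"
  using rel_admD(3,4)[OF BC] sub_equiv_closure[of B] unfolding equiv_closure_rel_quot[OF rel_admD(3)[OF AB]] by auto

section \<open>Classes, and the two extreme admissible quasi-orders\<close>

text \<open>Points equivalent in \<open>B\<close> are equivalent in \<open>B/A\<close>, hence lie in
  one component of \<open>A\<close>, where \<open>A\<close> and \<open>B\<close> agree.\<close>

lemma rel_adm_rel_sim: assumes "rel_adm X A B" shows "rel_sim A = rel_sim B"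
proof
  show "rel_sim A \<subseteq> rel_sim B" using rel_admD(3)[OF assms] by (rule rel_sim_mono)
  show "rel_sim B \<subseteq> rel_sim A"
    using rel_admD(4,5)[OF assms] sub_rel_quot(1)[of B A] unfolding rel_sim_def by blast
qed

lemma rel_adm_refl: "quasi_order X R \<Longrightarrow> rel_adm X R R"
  by (rule rel_admI) (auto simp: rel_quot_self)

lemma equiv_closure_rel_sim: "trans R \<Longrightarrow> equiv_closure (rel_sim R) = rel_sim R"
  by (meson equiv_closure_least order.refl rel_sim_sym rel_sim_trans sub_equiv_closure subset_antisym)

text \<open>Steps between equivalent points are already reversible. The classes are taken from a
  second relation \<open>S\<close> because the counit law divides \<open>T\<close> by the partition
  of \<open>T'\<close> into classes.\<close>

lemma rel_quot_rel_sim: "trans R \<Longrightarrow> rel_sim R = rel_sim S \<Longrightarrow> rel_quot R (rel_sim S) = R"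
  using sub_rel_quot(1)[of R] by (intro subset_antisym rel_quot_least) (auto simp: rel_sim_def)

text \<open>The components of \<open>rel_sim R\<close> are its classes, and dividing
  \<open>R\<close> by it changes nothing, so conditions (ii) and (iii) both compare
  \<open>rel_sim R\<close> with itself.\<close>

lemma rel_adm_rel_sim_self: assumes "quasi_order X R" shows "rel_adm X (rel_sim R) R"
proof (rule rel_admI)
  have t: "trans R" using assms by (simp add: quasi_order_def)
  show "quasi_order X (rel_sim R)"
    using assms rel_sim_trans[OF t] by (auto simp: quasi_order_def rel_sim_def refl_on_def)
  show "(x, y) \<in> equiv_closure (rel_sim R)" if "(x, y) \<in> rel_quot R (rel_sim R)" "(y, x) \<in> rel_quot R (rel_sim R)" for x y
    using that rel_quot_rel_sim[OF t, of R] by (simp add: equiv_closure_rel_sim[OF t]) (simp add: rel_sim_def)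
  show "(x, y) \<in> rel_sim R" if "(x, y) \<in> R" "(x, y) \<in> equiv_closure (rel_sim R)" for x y
    using that by (simp add: equiv_closure_rel_sim[OF t])
qed (use assms in \<open>auto simp: rel_sim_def\<close>)

text \<open>If the components of \<open>A\<close> are its classes, \<open>A\<close> equals its own
  class relation, and \<open>A\<close> has the classes of \<open>B\<close>. This selects the
  surviving term when the counit is applied to the left factor.\<close>

lemma rel_adm_discrete: assumes "rel_adm X A B" "equiv_closure A = rel_sim A" shows "A = rel_sim B"
  using rel_adm_rel_sim[OF assms(1)] assms(2) sub_equiv_closure[of A] by (auto simp: rel_sim_def)

text \<open>\<open>B/A\<close> has the components of \<open>B\<close>, while its classes are the
  components of \<open>A\<close>. If these coincide, all of \<open>B\<close> lies inside the
  components of \<open>A\<close>, where it agrees with \<open>A\<close>. This selects the surviving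
  term when the counit is applied to the right factor.\<close>

lemma rel_adm_full: assumes "rel_adm X A B" "equiv_closure (rel_quot B A) = rel_sim (rel_quot B A)" shows "A = B"
  using rel_adm_sim_quot[OF assms(1)] assms(2) rel_admD(3,4)[OF assms(1)] sub_equiv_closure[of B]
  unfolding equiv_closure_rel_quot[OF rel_admD(3)[OF assms(1)]] by auto

section \<open>Disjoint unions of quasi-orders\<close>

text \<open>No path passes between the disjoint sets, so the union of the two closures is already
  transitive.\<close>

lemma trancl_Un_disjoint:
  assumes "R \<subseteq> X \<times> X" "S \<subseteq> Y \<times> Y" "X \<inter> Y = {}"
  shows "(R \<union> S)\<^sup>+ = R\<^sup>+ \<union> S\<^sup>+"
proof
  have R: "R\<^sup>+ \<subseteq> X \<times> X" "S\<^sup>+ \<subseteq> Y \<times> Y" using assms by (auto dest!: trancl_subset_Sigma)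
  have "trans (R\<^sup>+ \<union> S\<^sup>+)"
  proof (rule transI)
    fix x y z assume "(x, y) \<in> R\<^sup>+ \<union> S\<^sup>+" "(y, z) \<in> R\<^sup>+ \<union> S\<^sup>+"
    then show "(x, z) \<in> R\<^sup>+ \<union> S\<^sup>+" using R assms(3) by (blast intro: trancl_trans)
  qed
  then show "(R \<union> S)\<^sup>+ \<subseteq> R\<^sup>+ \<union> S\<^sup>+" by (intro trancl_least) auto
  show "R\<^sup>+ \<union> S\<^sup>+ \<subseteq> (R \<union> S)\<^sup>+" by (simp add: trancl_mono_subset)
qed

lemma equiv_closure_Un: "R \<subseteq> X \<times> X \<Longrightarrow> S \<subseteq> Y \<times> Y \<Longrightarrow> X \<inter> Y = {} \<Longrightarrow> equiv_closure (R \<union> S) = equiv_closure R \<union> equiv_closure S"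
  unfolding equiv_closure_def converse_Un
  by (subst trancl_Un_disjoint[of _ X _ Y, symmetric]) (auto simp: ac_simps)

lemma rel_quot_Un: "R \<subseteq> X \<times> X \<Longrightarrow> R' \<subseteq> X \<times> X \<Longrightarrow> S \<subseteq> Y \<times> Y \<Longrightarrow> S' \<subseteq> Y \<times> Y \<Longrightarrow> X \<inter> Y = {} \<Longrightarrow>
  rel_quot (R \<union> S) (R' \<union> S') = rel_quot R R' \<union> rel_quot S S'"
  unfolding rel_quot_def converse_Un
  by (subst trancl_Un_disjoint[of _ X _ Y, symmetric]) (auto simp: ac_simps)

lemma quasi_orderD: "quasi_order X R \<Longrightarrow> R \<subseteq> X \<times> X" by (simp add: quasi_order_def)

lemma quasi_order_Un: "quasi_order X R \<Longrightarrow> quasi_order Y S \<Longrightarrow> X \<inter> Y = {} \<Longrightarrow> quasi_order (X \<union> Y) (R \<union> S)"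
proof -
  assume *: "quasi_order X R" "quasi_order Y S" "X \<inter> Y = {}"
  then have "R = R\<^sup>+" "S = S\<^sup>+" by (simp_all add: quasi_order_def trancl_id)
  with trancl_Un_disjoint[OF quasi_orderD[OF *(1)] quasi_orderD[OF *(2)] *(3)] have "trans (R \<union> S)"
    by (metis trans_trancl)
  with * show ?thesis unfolding quasi_order_def refl_on_def by auto
qed

lemma rel_adm_Un:
  assumes A: "rel_adm X A1 B1" "rel_adm Y A2 B2" and XY: "X \<inter> Y = {}"
  shows "rel_adm (X \<union> Y) (A1 \<union> A2) (B1 \<union> B2)"
proof (rule rel_admI)
  note q = rel_admD(1)[OF A(1)] rel_admD(2)[OF A(1)] rel_admD(1)[OF A(2)] rel_admD(2)[OF A(2)]
  note s = quasi_orderD[OF q(1)] quasi_orderD[OF q(2)] quasi_orderD[OF q(3)] quasi_orderD[OF q(4)]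
  show "quasi_order (X \<union> Y) (A1 \<union> A2)" "quasi_order (X \<union> Y) (B1 \<union> B2)" using q XY by (auto intro: quasi_order_Un)
  show "A1 \<union> A2 \<subseteq> B1 \<union> B2" using rel_admD(3)[OF A(1)] rel_admD(3)[OF A(2)] by auto
  have c: "equiv_closure (A1 \<union> A2) = equiv_closure A1 \<union> equiv_closure A2" by (rule equiv_closure_Un[OF s(1,3) XY])
  have r: "rel_quot (B1 \<union> B2) (A1 \<union> A2) = rel_quot B1 A1 \<union> rel_quot B2 A2" by (rule rel_quot_Un[OF s(2,1,4,3) XY])
  have cs: "equiv_closure A1 \<subseteq> X \<times> X" "equiv_closure A2 \<subseteq> Y \<times> Y" "rel_quot B1 A1 \<subseteq> X \<times> X" "rel_quot B2 A2 \<subseteq> Y \<times> Y"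
    using q by (simp_all add: quasi_orderD quasi_order_equiv_closure quasi_order_rel_quot)
  show "(x, y) \<in> A1 \<union> A2" if "(x, y) \<in> B1 \<union> B2" "(x, y) \<in> equiv_closure (A1 \<union> A2)" for x y
    using that rel_admD(4)[OF A(1)] rel_admD(4)[OF A(2)] cs s XY unfolding c by blast
  show "(x, y) \<in> equiv_closure (A1 \<union> A2)" if "(x, y) \<in> rel_quot (B1 \<union> B2) (A1 \<union> A2)" "(y, x) \<in> rel_quot (B1 \<union> B2) (A1 \<union> A2)" for x y
    using that rel_admD(5)[OF A(1)] rel_admD(5)[OF A(2)] cs s XY unfolding c r by blast
qed

text \<open>Being contained in \<open>B1 \<union> B2\<close>, the relation \<open>A\<close> has no
  pair across the two sets, and its closures split accordingly. With \<open>rel_adm_Un\<close> this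
  identifies admissible quasi-orders on a disjoint union with pairs of admissible ones.\<close>

lemma rel_adm_UnD:
  assumes A: "rel_adm (X \<union> Y) A (B1 \<union> B2)" and B: "quasi_order X B1" "quasi_order Y B2" and XY: "X \<inter> Y = {}"
  shows "A = A \<inter> X \<times> X \<union> A \<inter> Y \<times> Y" "rel_adm X (A \<inter> X \<times> X) B1" "rel_adm Y (A \<inter> Y \<times> Y) B2"
proof -
  \<comment> \<open>Stated for arbitrary data, so that the claim about \<open>Y\<close> is the same
    claim with the two parts exchanged.\<close>
  have *: "A = A \<inter> X \<times> X \<union> A \<inter> Y \<times> Y \<and> rel_adm X (A \<inter> X \<times> X) B1"
    if A: "rel_adm (X \<union> Y) A (B1 \<union> B2)" and B: "quasi_order X B1" "quasi_order Y B2" and XY: "X \<inter> Y = {}" for X Y B1 B2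
  proof -
    let ?A1 = "A \<inter> X \<times> X" and ?A2 = "A \<inter> Y \<times> Y"
    have AA: "A = ?A1 \<union> ?A2" using rel_admD(3)[OF A] quasi_orderD[OF B(1)] quasi_orderD[OF B(2)] by auto
    have c: "equiv_closure A = equiv_closure ?A1 \<union> equiv_closure ?A2"
      using equiv_closure_Un[of ?A1 X ?A2 Y] XY AA by simp
    have r: "rel_quot (B1 \<union> B2) A = rel_quot B1 ?A1 \<union> rel_quot B2 ?A2"
      using rel_quot_Un[of B1 X ?A1 B2 Y ?A2] XY AA quasi_orderD[OF B(1)] quasi_orderD[OF B(2)] by simp
    have q: "quasi_order X ?A1" "quasi_order Y ?A2" using rel_admD(1)[OF A] unfolding quasi_order_def refl_on_def trans_def by blast+
    have cs: "equiv_closure ?A1 \<subseteq> X \<times> X" "equiv_closure ?A2 \<subseteq> Y \<times> Y" "rel_quot B1 ?A1 \<subseteq> X \<times> X" "rel_quot B2 ?A2 \<subseteq> Y \<times> Y"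
      using q B by (simp_all add: quasi_orderD quasi_order_equiv_closure quasi_order_rel_quot)
    have "rel_adm X ?A1 B1"
    proof (rule rel_admI)
      show "?A1 \<subseteq> B1" using rel_admD(3)[OF A] quasi_orderD[OF B(2)] XY by blast
      show "(x, y) \<in> ?A1" if "(x, y) \<in> B1" "(x, y) \<in> equiv_closure ?A1" for x y
        using that rel_admD(4)[OF A, of x y] cs unfolding c by blast
      show "(x, y) \<in> equiv_closure ?A1" if "(x, y) \<in> rel_quot B1 ?A1" "(y, x) \<in> rel_quot B1 ?A1" for x y
        using that rel_admD(5)[OF A, of x y] cs XY unfolding c r by blast
    qed (use q B in auto)
    with AA show ?thesis by blast
  qed
  from *[OF A B XY] show "A = A \<inter> X \<times> X \<union> A \<inter> Y \<times> Y" "rel_adm X (A \<inter> X \<times> X) B1" by auto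
  from *[of Y X B2 B1] A B XY show "rel_adm Y (A \<inter> Y \<times> Y) B2" by (auto simp: ac_simps)
qed

section \<open>Pullback of quasi-orders along bijections\<close>

definition rel_pull :: "'a set \<Rightarrow> ('a \<Rightarrow> 'b) \<Rightarrow> ('b \<times> 'b) set \<Rightarrow> ('a \<times> 'a) set" where
  "rel_pull X f R = {(x, y). x \<in> X \<and> y \<in> X \<and> (f x, f y) \<in> R}"

text \<open>A path in \<open>Y\<close> is lifted point by point: surjectivity of \<open>f\<close>
  supplies a preimage for each intermediate point.\<close>

lemma rel_pull_trancl:
  assumes f: "bij_betw f X Y" and R: "R \<subseteq> Y \<times> Y"
  shows "rel_pull X f (R\<^sup>+) = (rel_pull X f R)\<^sup>+"
proof
  have img: "f ` X = Y" and inj: "inj_on f X" using f by (auto simp: bij_betw_def)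
  have "(x, x') \<in> (rel_pull X f R)\<^sup>+" if "(f x, y) \<in> R\<^sup>+" "x \<in> X" "x' \<in> X" "f x' = y" for x x' y
    using that
  proof (induction arbitrary: x' rule: trancl_induct)
    case (base y)
    then show ?case by (auto simp: rel_pull_def)
  next
    case (step y z)
    then obtain u where u: "u \<in> X" "f u = y" using R img by blast
    then have "(u, x') \<in> rel_pull X f R" using step by (auto simp: rel_pull_def)
    then show ?case using step.IH[OF step.prems(1) u] by simp
  qed
  then show "rel_pull X f (R\<^sup>+) \<subseteq> (rel_pull X f R)\<^sup>+" by (auto simp: rel_pull_def)
  have "trans (rel_pull X f (R\<^sup>+))" by (auto simp: rel_pull_def trans_def intro: trancl_trans)
  then show "(rel_pull X f R)\<^sup>+ \<subseteq> rel_pull X f (R\<^sup>+)" by (intro trancl_least) (auto simp: rel_pull_def)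
qed

lemma rel_pull_rel_quot:
  assumes f: "bij_betw f X Y" and R: "R \<subseteq> Y \<times> Y" "S \<subseteq> Y \<times> Y"
  shows "rel_pull X f (rel_quot R S) = rel_quot (rel_pull X f R) (rel_pull X f S)"
proof -
  have "rel_pull X f (R \<union> S\<inverse>) = rel_pull X f R \<union> (rel_pull X f S)\<inverse>" by (auto simp: rel_pull_def)
  then show ?thesis unfolding rel_quot_def using rel_pull_trancl[OF f, of "R \<union> S\<inverse>"] R by auto
qed

lemma rel_pull_equiv_closure:
  assumes f: "bij_betw f X Y" and R: "R \<subseteq> Y \<times> Y"
  shows "rel_pull X f (equiv_closure R) = equiv_closure (rel_pull X f R)"
  using rel_pull_rel_quot[OF f R R] by (simp add: rel_quot_self)

lemma quasi_order_rel_pull: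
  assumes f: "bij_betw f X Y" and R: "quasi_order Y R"
  shows "quasi_order X (rel_pull X f R)"
  using assms unfolding quasi_order_def rel_pull_def refl_on_def trans_def bij_betw_def by blast

lemma rel_adm_rel_pull:
  assumes f: "bij_betw f X Y" and A: "rel_adm Y A B"
  shows "rel_adm X (rel_pull X f A) (rel_pull X f B)"
proof (rule rel_admI)
  note s = quasi_orderD[OF rel_admD(1)[OF A]] quasi_orderD[OF rel_admD(2)[OF A]]
  show "quasi_order X (rel_pull X f A)" "quasi_order X (rel_pull X f B)" using quasi_order_rel_pull[OF f] rel_admD[OF A] by auto
  show "rel_pull X f A \<subseteq> rel_pull X f B" using rel_admD(3)[OF A] by (auto simp: rel_pull_def)
  show "(x, y) \<in> rel_pull X f A" if "(x, y) \<in> rel_pull X f B" "(x, y) \<in> equiv_closure (rel_pull X f A)" for x y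
    using that rel_admD(4)[OF A] unfolding rel_pull_equiv_closure[OF f s(1), symmetric] by (auto simp: rel_pull_def)
  show "(x, y) \<in> equiv_closure (rel_pull X f A)"
    if "(x, y) \<in> rel_quot (rel_pull X f B) (rel_pull X f A)" "(y, x) \<in> rel_quot (rel_pull X f B) (rel_pull X f A)" for x y
    using that rel_admD(5)[OF A] unfolding rel_pull_equiv_closure[OF f s(1), symmetric] rel_pull_rel_quot[OF f s(2,1), symmetric]
    by (auto simp: rel_pull_def)
qed

section \<open>The degree of a quasi-order\<close>

definition rel_degree :: "'a set \<Rightarrow> ('a \<times> 'a) set \<Rightarrow> nat" where
  "rel_degree X R = card (X // rel_sim R) - card (X // equiv_closure R)"

lemma equiv_rel_sim: "quasi_order X R \<Longrightarrow> equiv X (rel_sim R)"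
  using rel_sim_trans[of R] rel_sim_sym[of R] by (intro equivI) (auto simp: quasi_order_def rel_sim_def refl_on_def)

lemma equiv_equiv_closure: "quasi_order X R \<Longrightarrow> equiv X (equiv_closure R)"
  using quasi_order_equiv_closure[of X R] equiv_closure_sym[of R] by (intro equivI) (auto simp: quasi_order_def)

lemma rel_sim_sub_equiv_closure: "rel_sim R \<subseteq> equiv_closure R"
  using sub_equiv_closure[of R] by (auto simp: rel_sim_def)

lemma finite_quot: "finite X \<Longrightarrow> finite (X // R)"
  by (simp add: quotient_def)

text \<open>The classes refine the components, so the subtraction in \<open>rel_degree\<close> does
  not truncate.\<close>

lemma rel_degree_le: "finite X \<Longrightarrow> quasi_order X R \<Longrightarrow> card (X // equiv_closure R) \<le> card (X // rel_sim R)"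
  by (intro finite_refines_card_le finite_quot rel_sim_sub_equiv_closure equiv_rel_sim equiv_equiv_closure)

text \<open>Sending a class of \<open>E\<close> to the class of \<open>F\<close> that contains it is
  onto. Between finite sets of equal size it is also injective, so \<open>F\<close> merges no two
  classes of \<open>E\<close>.\<close>

lemma quot_card_eqD:
  assumes X: "finite X" and E: "equiv X E" "equiv X F" "E \<subseteq> F" and c: "card (X // F) = card (X // E)"
  shows "F \<subseteq> E"
proof (rule subrelI)
  fix x y assume xy: "(x, y) \<in> F"
  have inj: "inj_on (\<lambda>C. F `` C) (X // E)"
    using refines_equiv_image_eq[OF E(3,1,2)] c
    by (intro eq_card_imp_inj_on finite_quot X) simp
  have "F `` (E `` {x}) = F `` (E `` {y})"
    using refines_equiv_class_eq2[OF E(3,1,2)] equiv_class_eq[OF E(2) xy] by simp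
  moreover have xX: "x \<in> X" "y \<in> X" using xy E(2) by (auto simp: equiv_def)
  ultimately have "E `` {x} = E `` {y}" by (rule inj_onD[OF inj _ quotientI quotientI])
  then show "(x, y) \<in> E" using E(1) xX by (simp add: eq_equiv_class)
qed

lemma rel_degree_zero:
  assumes "finite X" "quasi_order X R"
  shows "rel_degree X R = 0 \<longleftrightarrow> equiv_closure R = rel_sim R"
proof
  assume "rel_degree X R = 0"
  then have "card (X // equiv_closure R) = card (X // rel_sim R)" using rel_degree_le[OF assms] by (simp add: rel_degree_def)
  from quot_card_eqD[OF assms(1) equiv_rel_sim[OF assms(2)] equiv_equiv_closure[OF assms(2)] rel_sim_sub_equiv_closure this]
  show "equiv_closure R = rel_sim R" using rel_sim_sub_equiv_closure by blast
qed (simp add: rel_degree_def)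

text \<open>The sum telescopes: \<open>A\<close> has the classes of \<open>B\<close>, the classes of
  \<open>B/A\<close> are the components of \<open>A\<close>, and \<open>B/A\<close> has the
  components of \<open>B\<close>.\<close>

lemma rel_degree_add:
  assumes "finite X" "rel_adm X A B"
  shows "rel_degree X A + rel_degree X (rel_quot B A) = rel_degree X B"
  using rel_degree_le[OF assms(1) rel_admD(1)[OF assms(2)]] rel_degree_le[OF assms(1) quasi_order_rel_quot[OF rel_admD(2,1)[OF assms(2)]]]
  unfolding rel_degree_def by (simp add: rel_adm_sim_quot[OF assms(2)] equiv_closure_rel_quot[OF rel_admD(3)[OF assms(2)]] rel_adm_rel_sim[OF assms(2)])

lemma card_quot_Un:
  assumes "finite X" "finite Y" "X \<inter> Y = {}" "equiv X R" "equiv Y S"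
  shows "card ((X \<union> Y) // (R \<union> S)) = card (X // R) + card (Y // S)"
proof -
  have R: "R \<subseteq> X \<times> X" "S \<subseteq> Y \<times> Y" using assms by (auto simp: equiv_def)
  have "(R \<union> S) `` {x} = R `` {x}" if "x \<in> X" for x using that R assms(3) by auto
  moreover have "(R \<union> S) `` {x} = S `` {x}" if "x \<in> Y" for x using that R assms(3) by auto
  ultimately have "(X \<union> Y) // (R \<union> S) = X // R \<union> Y // S"
    by (simp add: quotient_def)
  moreover have "X // R \<inter> Y // S = {}"
  proof -
    have "c \<noteq> {}" "c \<subseteq> X" if "c \<in> X // R" for c
      using in_quotient_imp_non_empty[OF assms(4) that] in_quotient_imp_subset[OF assms(4) that] .
    moreover have "c \<subseteq> Y" if "c \<in> Y // S" for c using in_quotient_imp_subset[OF assms(5) that] .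
    ultimately show ?thesis using assms(3) by blast
  qed
  ultimately show ?thesis using assms by (simp add: card_Un_disjoint finite_quot)
qed

lemma rel_degree_Un:
  assumes "finite X" "finite Y" "X \<inter> Y = {}" "quasi_order X R" "quasi_order Y S"
  shows "rel_degree (X \<union> Y) (R \<union> S) = rel_degree X R + rel_degree Y S"
proof -
  have q: "R \<subseteq> X \<times> X" "S \<subseteq> Y \<times> Y" using assms by (auto simp: quasi_orderD)
  have s: "rel_sim (R \<union> S) = rel_sim R \<union> rel_sim S" using q assms(3) unfolding rel_sim_def by blast
  show ?thesis
    unfolding rel_degree_def equiv_closure_Un[OF q assms(3)] s
      card_quot_Un[OF assms(1-3) equiv_rel_sim[OF assms(4)] equiv_rel_sim[OF assms(5)]]
      card_quot_Un[OF assms(1-3) equiv_equiv_closure[OF assms(4)] equiv_equiv_closure[OF assms(5)]]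
    using rel_degree_le[OF assms(1,4)] rel_degree_le[OF assms(2,5)] by simp
qed

lemma card_quot_rel_pull:
  assumes f: "bij_betw f X Y" and E: "E \<subseteq> Y \<times> Y"
  shows "card (X // rel_pull X f E) = card (Y // E)"
proof -
  have img: "f ` X = Y" and inj: "inj_on f X" using f by (auto simp: bij_betw_def)
  have 1: "f ` (rel_pull X f E `` {x}) = E `` {f x}" if "x \<in> X" for x
    using that img E by (auto simp: rel_pull_def image_iff)
  have "(image f) ` (X // rel_pull X f E) = (\<lambda>x. f ` (rel_pull X f E `` {x})) ` X"
    unfolding quotient_def by blast
  also have "\<dots> = (\<lambda>x. E `` {f x}) ` X" by (intro image_cong refl 1)
  also have "\<dots> = Y // E" unfolding quotient_def img[symmetric] by blast
  finally have "(image f) ` (X // rel_pull X f E) = Y // E" .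
  moreover have "inj_on (image f) (X // rel_pull X f E)"
    by (rule inj_on_subset[OF inj_on_image_Pow[OF inj]]) (auto simp: quotient_def rel_pull_def)
  ultimately show ?thesis using card_image by metis
qed

lemma rel_degree_rel_pull:
  assumes f: "bij_betw f X Y" and R: "quasi_order Y R"
  shows "rel_degree X (rel_pull X f R) = rel_degree Y R"
proof -
  have "rel_sim (rel_pull X f R) = rel_pull X f (rel_sim R)" by (auto simp: rel_pull_def rel_sim_def)
  moreover have "rel_sim R \<subseteq> Y \<times> Y" "equiv_closure R \<subseteq> Y \<times> Y" using R quasi_orderD[OF quasi_order_equiv_closure[OF R]] by (auto simp: quasi_order_def rel_sim_def)
  ultimately show ?thesis unfolding rel_degree_def
    using card_quot_rel_pull[OF f] rel_pull_equiv_closure[OF f quasi_orderD[OF R]] by metis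
qed

section \<open>Finite topologies as quasi-orders\<close>

definition top_rel :: "'a topology \<Rightarrow> ('a \<times> 'a) set" where
  "top_rel T = {(x, y). top_le T x y}"

lemma quasi_order_top_rel: "quasi_order (topspace T) (top_rel T)"
  unfolding quasi_order_def top_rel_def refl_on_def trans_def top_le_def by auto

lemma top_rel_upset: "quasi_order X R \<Longrightarrow> top_rel (upset_topology X R) = R"
  by (auto simp: top_rel_def quasi_order_def top_le_upset_topology)

text \<open>Finiteness makes the intersection \<open>N x\<close> of all open neighbourhoods of a
  point open, and every upper ideal is the union of the \<open>N x\<close> of its points.\<close>

lemma openin_top_rel:
  assumes "finite (topspace T)"
  shows "openin T U \<longleftrightarrow> U \<subseteq> topspace T \<and> (\<forall>x\<in>U. \<forall>y. (x, y) \<in> top_rel T \<longrightarrow> y \<in> U)" (is "_ \<longleftrightarrow> ?R")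
proof
  assume "openin T U"
  then show ?R using openin_subset[of T U] by (auto simp: top_rel_def top_le_def)
next
  assume R: ?R
  define N where "N x = \<Inter>{V. openin T V \<and> x \<in> V}" for x
  have "openin T (N x)" "x \<in> N x" "N x \<subseteq> U" if "x \<in> U" for x
  proof -
    have x: "x \<in> topspace T" using that R by auto
    have "finite {V. openin T V \<and> x \<in> V}"
      by (rule finite_subset[of _ "Pow (topspace T)"]) (use assms openin_subset in auto)
    then show "openin T (N x)" unfolding N_def using x by (intro openin_Inter) auto
    show "x \<in> N x" by (auto simp: N_def)
    show "N x \<subseteq> U"
    proof
      fix y assume y: "y \<in> N x"
      then have "y \<in> topspace T" using x by (auto simp: N_def)
      then have "(x, y) \<in> top_rel T" using y x by (auto simp: top_rel_def top_le_def N_def)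
      then show "y \<in> U" using R that by blast
    qed
  qed
  then have "U = \<Union>(N ` U)" "openin T (\<Union>(N ` U))" by (blast, blast intro: openin_Union)
  then show "openin T U" by simp
qed

text \<open>The quasi-order determines the open sets of a finite space, so identities between finite
  topologies can be proved as identities between relations.\<close>

lemma top_eqI: "finite (topspace T) \<Longrightarrow> topspace T = topspace T' \<Longrightarrow> top_rel T = top_rel T' \<Longrightarrow> T = T'"
  unfolding topology_eq by (simp add: openin_top_rel)

lemma finer_top_rel:
  assumes "finite (topspace T)"
  shows "finer T' T \<longleftrightarrow> topspace T' = topspace T \<and> top_rel T' \<subseteq> top_rel T"
proof
  assume "finer T' T"
  then show "topspace T' = topspace T \<and> top_rel T' \<subseteq> top_rel T"
    by (auto simp: finer_def top_rel_def top_le_def)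
next
  assume "topspace T' = topspace T \<and> top_rel T' \<subseteq> top_rel T"
  then show "finer T' T" using assms by (auto simp: finer_def openin_top_rel subset_iff)
qed

lemma topspace_top_union [simp]: "topspace (top_union T1 T2) = topspace T1 \<union> topspace T2"
proof -
  have "openin (top_union T1 T2) (topspace T1 \<union> topspace T2)"
    by (simp add: openin_top_union Int_absorb1)
  then show ?thesis using openin_subset openin_top_union by (metis openin_topspace subset_antisym)
qed

text \<open>Open sets of either summand stay open in the union. Hence the summands themselves
  exclude pairs across the two parts, and inside one part the same test sets are available as
  before.\<close>

lemma top_rel_top_union:
  assumes "topspace T1 \<inter> topspace T2 = {}"
  shows "top_rel (top_union T1 T2) = top_rel T1 \<union> top_rel T2"
proof -
  have o1: "openin (top_union T1 T2) U" if "openin T1 U" for U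
  proof -
    have "U \<inter> topspace T1 = U" "U \<inter> topspace T2 = {}" using openin_subset[OF that] assms by auto
    then show ?thesis using that openin_subset[OF that] by (auto simp: openin_top_union)
  qed
  have o2: "openin (top_union T1 T2) U" if "openin T2 U" for U
  proof -
    have "U \<inter> topspace T2 = U" "U \<inter> topspace T1 = {}" using openin_subset[OF that] assms by auto
    then show ?thesis using that openin_subset[OF that] by (auto simp: openin_top_union)
  qed
  show ?thesis
  proof (intro subset_antisym subrelI)
    fix x y assume "(x, y) \<in> top_rel (top_union T1 T2)"
    then have xy: "x \<in> topspace T1 \<union> topspace T2" "\<And>U. openin (top_union T1 T2) U \<Longrightarrow> x \<in> U \<Longrightarrow> y \<in> U"
      by (auto simp: top_rel_def top_le_def)
    show "(x, y) \<in> top_rel T1 \<union> top_rel T2"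
    proof (cases "x \<in> topspace T1")
      case True
      then have "y \<in> topspace T1" using xy(2)[OF o1[OF openin_topspace]] by simp
      then show ?thesis using True xy(2)[OF o1] by (auto simp: top_rel_def top_le_def)
    next
      case False
      then have "x \<in> topspace T2" using xy by auto
      moreover then have "y \<in> topspace T2" using xy(2)[OF o2[OF openin_topspace]] by simp
      ultimately show ?thesis using xy(2)[OF o2] by (auto simp: top_rel_def top_le_def)
    qed
  next
    fix x y assume "(x, y) \<in> top_rel T1 \<union> top_rel T2"
    then show "(x, y) \<in> top_rel (top_union T1 T2)" by (auto simp: top_rel_def top_le_def openin_top_union)
  qed
qed

lemma topspace_pull: "f ` X \<subseteq> topspace T \<Longrightarrow> topspace (pullback_topology X f T) = X"
  by (auto simp: topspace_pullback_topology)

lemma top_rel_pull: "f ` X \<subseteq> topspace T \<Longrightarrow> top_rel (pullback_topology X f T) = rel_pull X f (top_rel T)"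
  by (auto simp: top_rel_def rel_pull_def top_le_def topspace_pullback_topology openin_pullback_topology)

lemma topspace_top_quot [simp]: "topspace (top_quot T T') = topspace T"
  by (simp add: top_quot_def)

lemma top_rel_top_quot: "topspace T' = topspace T \<Longrightarrow> top_rel (top_quot T T') = rel_quot (top_rel T) (top_rel T')"
proof -
  assume *: "topspace T' = topspace T"
  have "top_rel T \<union> (top_rel T')\<inverse> = {(x, y). top_le T x y \<or> top_le T' y x}" by (auto simp: top_rel_def)
  then show ?thesis by (auto simp: top_rel_def[of "top_quot T T'"] rel_quot_def top_le_top_quot[OF *])
qed

text \<open>The upper ideal of \<open>x\<close> is open in \<open>T\<close>, so its trace on
  \<open>Y\<close> is an open test set in the subspace; this gives the inclusion from left to
  right.\<close>

lemma top_rel_subtopology: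
  assumes "finite (topspace T)" "Y \<subseteq> topspace T"
  shows "top_rel (subtopology T Y) = top_rel T \<inter> Y \<times> Y"
proof (intro subset_antisym subrelI)
  fix x y assume xy: "(x, y) \<in> top_rel (subtopology T Y)"
  then have Y: "x \<in> Y" "y \<in> Y" by (auto simp: top_rel_def top_le_def)
  have "openin T {z. (x, z) \<in> top_rel T}"
    using quasi_order_top_rel[of T] by (auto simp: openin_top_rel[OF assms(1)] quasi_order_def dest: transD)
  then have "openin (subtopology T Y) ({z. (x, z) \<in> top_rel T} \<inter> Y)" by (auto simp: openin_subtopology)
  moreover have "(x, x) \<in> top_rel T" using Y assms(2) quasi_order_top_rel[of T] by (auto simp: quasi_order_def refl_on_def)
  ultimately have "y \<in> {z. (x, z) \<in> top_rel T} \<inter> Y" using xy Y by (auto simp: top_rel_def top_le_def)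
  then show "(x, y) \<in> top_rel T \<inter> Y \<times> Y" using Y by auto
next
  fix x y assume "(x, y) \<in> top_rel T \<inter> Y \<times> Y"
  then show "(x, y) \<in> top_rel (subtopology T Y)" using assms by (auto simp: top_rel_def top_le_def openin_subtopology)
qed

section \<open>Connected components and the translation of admissibility\<close>

text \<open>The class of \<open>x\<close> and its complement are both closed under steps of the
  quasi-order, hence both open. If \<open>y\<close> were outside the class, they would separate
  \<open>Y\<close>.\<close>

lemma connectedin_equiv_closure:
  assumes fin: "finite (topspace T)" and Y: "connectedin T Y" "x \<in> Y" "y \<in> Y"
  shows "(x, y) \<in> equiv_closure (top_rel T)"
proof (rule ccontr)
  let ?A = "equiv_closure (top_rel T) `` {x}"
  let ?B = "topspace T - ?A"
  assume n: "(x, y) \<notin> equiv_closure (top_rel T)"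
  have sub: "Y \<subseteq> topspace T" using Y by (simp add: connectedin)
  have q: "quasi_order (topspace T) (equiv_closure (top_rel T))" by (rule quasi_order_equiv_closure[OF quasi_order_top_rel])
  have step: "(x, z) \<in> equiv_closure (top_rel T) \<longleftrightarrow> (x, w) \<in> equiv_closure (top_rel T)" if "(z, w) \<in> top_rel T" for z w
    using that sub_equiv_closure[of "top_rel T"] equiv_closure_symD[of _ _ "top_rel T"] transD[OF equiv_closure_trans[of "top_rel T"]] by blast
  have "openin T ?A" using step quasi_orderD[OF q] by (auto simp: openin_top_rel[OF fin])
  moreover have "openin T ?B" using step quasi_orderD[OF quasi_order_top_rel[of T]] by (auto simp: openin_top_rel[OF fin])
  moreover have "x \<in> ?A" using q Y sub by (auto simp: quasi_order_def refl_on_def)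
  moreover have "y \<in> ?B" using n Y sub by auto
  ultimately show False using Y sub unfolding connectedin by blast
qed

text \<open>Along a zigzag path inside the class, membership in \<open>E1\<close> persists: a
  forward step stays in the upper ideal \<open>E1\<close>, and a backward step into
  \<open>E2\<close> would put its starting point in both \<open>E1\<close> and \<open>E2\<close>,
  because \<open>E2\<close> is an upper ideal too.\<close>

lemma connectedin_class:
  assumes "x \<in> topspace T"
  shows "connectedin T (equiv_closure (top_rel T) `` {x})"
  unfolding connectedin
proof (intro conjI notI)
  let ?R = "top_rel T"
  let ?C = "equiv_closure ?R `` {x}"
  show "?C \<subseteq> topspace T" using quasi_orderD[OF quasi_order_equiv_closure[OF quasi_order_top_rel[of T]]] by auto
  assume "\<exists>E1 E2. openin T E1 \<and> openin T E2 \<and> ?C \<subseteq> E1 \<union> E2 \<and> E1 \<inter> E2 \<inter> ?C = {} \<and> E1 \<inter> ?C \<noteq> {} \<and> E2 \<inter> ?C \<noteq> {}"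
  then obtain E1 E2 where E: "openin T E1" "openin T E2" "?C \<subseteq> E1 \<union> E2" "E1 \<inter> E2 \<inter> ?C = {}"
    and ab: "\<exists>a. a \<in> E1 \<inter> ?C" "\<exists>b. b \<in> E2 \<inter> ?C" by blast
  from ab obtain a b where ab: "a \<in> E1" "a \<in> ?C" "b \<in> E2" "b \<in> ?C" by blast
  have op: "w' \<in> U" if "openin T U" "(w, w') \<in> ?R" "w \<in> U" for U w w'
    using that by (auto simp: top_rel_def top_le_def)
  have "(a, b) \<in> equiv_closure ?R" using ab equiv_closure_symD[of x a ?R] transD[OF equiv_closure_trans[of ?R]] by blast
  then have "(a, b) \<in> (?R \<union> ?R\<inverse>)\<^sup>+" by (simp add: equiv_closure_def)
  then have "b \<in> E1"
  proof (induction rule: trancl_induct)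
    case (base y)
    then have "(a, y) \<in> equiv_closure ?R" by (auto simp: equiv_closure_def)
    then have "y \<in> ?C" using ab(2) transD[OF equiv_closure_trans[of ?R], of x a y] by simp
    then show ?case using base op[OF E(1)] op[OF E(2)] ab E(3,4) by blast
  next
    case (step y z)
    have "(a, y) \<in> equiv_closure ?R" "(a, z) \<in> equiv_closure ?R"
      using step(1) trancl_into_trancl[OF step(1,2)] by (simp_all add: equiv_closure_def)
    then have yz: "y \<in> ?C" "z \<in> ?C"
      using ab(2) transD[OF equiv_closure_trans[of ?R], of x a] by simp_all
    then show ?case using step op[OF E(1)] op[OF E(2)] ab E(3,4) by blast
  qed
  then show False using ab E(4) by blast
qed

lemma components_top_rel:
  assumes "finite (topspace T)"
  shows "connected_components_of T = topspace T // equiv_closure (top_rel T)"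
proof -
  have "connected_component_of_set T x = equiv_closure (top_rel T) `` {x}" if "x \<in> topspace T" for x
  proof -
    have "x \<in> equiv_closure (top_rel T) `` {x}" using that quasi_order_equiv_closure[OF quasi_order_top_rel[of T]] by (auto simp: quasi_order_def refl_on_def)
    then have "connected_component_of T x y" if "y \<in> equiv_closure (top_rel T) `` {x}" for y
      unfolding connected_component_of_def using that connectedin_class[OF \<open>x \<in> topspace T\<close>] by blast
    moreover have "(x, y) \<in> equiv_closure (top_rel T)" if "connected_component_of T x y" for y
      using that connectedin_equiv_closure[OF assms] unfolding connected_component_of_def by blast
    ultimately show ?thesis by blast
  qed
  then show ?thesis by (auto simp: connected_components_of_def quotient_def)
qed

lemma top_degree_rel_degree: "finite (topspace T) \<Longrightarrow> top_degree T = rel_degree (topspace T) (top_rel T)"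
proof -
  have "{(x, y). top_sim T x y} = rel_sim (top_rel T)" by (auto simp: top_sim_def rel_sim_def top_rel_def)
  then show "finite (topspace T) \<Longrightarrow> ?thesis" by (simp add: top_degree_def rel_degree_def components_top_rel)
qed

lemma top_sim_quot: "topspace T' = topspace T \<Longrightarrow> top_sim (top_quot T T') x y \<longleftrightarrow> (x, y) \<in> rel_sim (rel_quot (top_rel T) (top_rel T'))"
  using top_rel_top_quot[of T' T] by (auto simp: top_sim_def rel_sim_def top_rel_def)

text \<open>Each side implies equal underlying sets and
  \<open>top_rel T' \<subseteq> top_rel T\<close>. Under this assumption the two remaining
  conditions are translated separately.\<close>

lemma admissible_rel_adm:
  assumes fin: "finite (topspace T)"
  shows "admissible T' T \<longleftrightarrow> topspace T' = topspace T \<and> rel_adm (topspace T) (top_rel T') (top_rel T)"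
proof (cases "topspace T' = topspace T \<and> top_rel T' \<subseteq> top_rel T")
  case False
  then show ?thesis using finer_top_rel[OF fin] rel_admD(3) unfolding admissible_def by blast
next
  case True
  let ?X = "topspace T"
  let ?R = "top_rel T" and ?S = "top_rel T'"
  have fin': "finite (topspace T')" using True fin by simp
  have q: "quasi_order ?X ?S" "quasi_order ?X ?R" using quasi_order_top_rel[of T] quasi_order_top_rel[of T'] True by auto
  \<comment> \<open>The classes of \<open>equiv_closure ?S\<close> are connected, so condition (ii)
    may be tested on them; conversely every connected set lies inside a single class.\<close>
  have ii: "(\<forall>Y. connectedin T' Y \<longrightarrow> subtopology T' Y = subtopology T Y) \<longleftrightarrow> ?R \<inter> equiv_closure ?S \<subseteq> ?S" (is "?A \<longleftrightarrow> ?B")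
  proof
    assume A: ?A
    show ?B
    proof (rule subrelI)
      fix x y assume xy: "(x, y) \<in> ?R \<inter> equiv_closure ?S"
      then have x: "x \<in> topspace T'" "y \<in> topspace T'" using quasi_orderD[OF q(2)] True by auto
      let ?Y = "equiv_closure ?S `` {x}"
      have Y: "connectedin T' ?Y" by (rule connectedin_class[OF x(1)])
      then have Ys: "?Y \<subseteq> topspace T'" "?Y \<subseteq> topspace T" using True by (auto simp: connectedin)
      from A Y have "subtopology T' ?Y = subtopology T ?Y" by blast
      then have "?R \<inter> ?Y \<times> ?Y = ?S \<inter> ?Y \<times> ?Y"
        using top_rel_subtopology[OF fin Ys(2)] top_rel_subtopology[OF fin' Ys(1)] by simp
      moreover have "x \<in> ?Y" "y \<in> ?Y" using xy x quasi_order_equiv_closure[OF q(1)] True by (auto simp: quasi_order_def refl_on_def)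
      ultimately show "(x, y) \<in> ?S" using xy by blast
    qed
  next
    assume B: ?B
    show ?A
    proof (intro allI impI)
      fix Y assume Y: "connectedin T' Y"
      then have Ys: "Y \<subseteq> topspace T'" "Y \<subseteq> topspace T" using True by (auto simp: connectedin)
      have "?S \<inter> Y \<times> Y = ?R \<inter> Y \<times> Y" using B True connectedin_equiv_closure[OF fin' Y] by blast
      then have "top_rel (subtopology T' Y) = top_rel (subtopology T Y)"
        using top_rel_subtopology[OF fin Ys(2)] top_rel_subtopology[OF fin' Ys(1)] by simp
      then show "subtopology T' Y = subtopology T Y"
        using fin' True by (intro top_eqI) auto
    qed
  qed
  have sims: "rel_sim (rel_quot ?S ?S) = equiv_closure ?S"
    using equiv_closure_symD[of _ _ ?S] by (auto simp: rel_quot_self rel_sim_def)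
  \<comment> \<open>Of the two relations in condition (iii), the components of \<open>T'\<close> are
    always contained in the cycles of the quotient, so their agreement amounts to the other
    inclusion.\<close>
  have aux: "(\<forall>x\<in>?X. \<forall>y\<in>?X. ((x, y) \<in> A) = ((x, y) \<in> C)) \<longleftrightarrow> A \<subseteq> C" if "A \<subseteq> ?X \<times> ?X" "C \<subseteq> A" for A C
    using that by auto
  have "rel_sim (rel_quot ?R ?S) \<subseteq> ?X \<times> ?X"
    using quasi_orderD[OF quasi_order_rel_quot[OF q(2,1)]] by (auto simp: rel_sim_def)
  moreover have "equiv_closure ?S \<subseteq> rel_sim (rel_quot ?R ?S)"
    using rel_quot_symD[of ?S ?R] True equiv_closure_symD[of _ _ ?S] unfolding rel_sim_def by auto
  ultimately have iii: "(\<forall>x\<in>?X. \<forall>y\<in>?X. top_sim (top_quot T T') x y \<longleftrightarrow> top_sim (top_quot T' T') x y) \<longleftrightarrow>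
      rel_sim (rel_quot ?R ?S) \<subseteq> equiv_closure ?S"
    unfolding top_sim_quot[OF conjunct1[OF True]] top_sim_quot[OF refl] sims by (rule aux)
  show ?thesis
    unfolding admissible_def finer_top_rel[OF fin] ii iii rel_adm_def using True q by simp
qed

section \<open>Admissible topologies, their quotients and the extreme cases\<close>

lemma adm_topspace: "admissible A B \<Longrightarrow> topspace A = topspace B"
  by (simp add: admissible_def finer_def)

lemma adm_fin: "finite (topspace B) \<Longrightarrow> admissible A B \<Longrightarrow> finite (topspace A)"
  by (simp add: adm_topspace)

lemma adm_rel_adm: "finite (topspace B) \<Longrightarrow> admissible A B \<Longrightarrow> rel_adm (topspace B) (top_rel A) (top_rel B)"
  by (simp add: admissible_rel_adm)

lemma admI: "finite (topspace B) \<Longrightarrow> topspace A = topspace B \<Longrightarrow> rel_adm (topspace B) (top_rel A) (top_rel B) \<Longrightarrow> admissible A B"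
  by (simp add: admissible_rel_adm)

text \<open>A topology on a finite set is determined by a subset of the square of that set.
  Finiteness matters for the coproduct because \<open>finsum\<close> over an infinite index set is
  zero by convention.\<close>

lemma finite_adm: assumes "finite (topspace T)" shows "finite {A. admissible A T}"
proof (rule inj_on_finite)
  show "inj_on top_rel {A. admissible A T}"
    using assms by (intro inj_onI top_eqI) (auto simp: adm_topspace)
  show "top_rel ` {A. admissible A T} \<subseteq> Pow (topspace T \<times> topspace T)"
    using quasi_orderD[OF quasi_order_top_rel] adm_topspace by fastforce
qed (use assms in simp)

lemma adm_refl: "finite (topspace T) \<Longrightarrow> admissible T T"
  by (simp add: admissible_rel_adm rel_adm_refl quasi_order_top_rel)

lemma adm_trans: "finite (topspace C) \<Longrightarrow> admissible A B \<Longrightarrow> admissible B C \<Longrightarrow> admissible A C"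
  using adm_rel_adm[of B A] adm_rel_adm[of C B] adm_fin[of C B] adm_topspace[of A B] adm_topspace[of B C]
  by (intro admI) (auto intro: rel_adm_trans)

lemma adm_quot: "finite (topspace C) \<Longrightarrow> admissible A B \<Longrightarrow> admissible B C \<Longrightarrow> admissible (top_quot B A) (top_quot C A)"
  using adm_rel_adm[of B A] adm_rel_adm[of C B] adm_fin[of C B] adm_topspace[of A B] adm_topspace[of B C]
  by (intro admI) (auto intro: rel_adm_rel_quot simp: top_rel_top_quot)

lemma quot_quot:
  assumes "finite (topspace C)" "admissible A B" "admissible B C"
  shows "top_quot (top_quot C A) (top_quot B A) = top_quot C B"
proof (rule top_eqI)
  note r = adm_rel_adm[OF adm_fin[OF assms(1,3)] assms(2)] adm_rel_adm[OF assms(1,3)]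
  show "top_rel (top_quot (top_quot C A) (top_quot B A)) = top_rel (top_quot C B)"
    using rel_quot_rel_quot[OF rel_admD(3)[OF r(1)] rel_admD(3)[OF r(2)]] adm_topspace[OF assms(2)] adm_topspace[OF assms(3)]
    by (simp add: top_rel_top_quot)
qed (use assms in auto)

text \<open>The two iterated coproducts run over the same chains in different orders: one chooses
  \<open>B\<close> and then \<open>A\<close> admissible for \<open>B\<close>, the other chooses
  \<open>A\<close> and then a topology admissible for the quotient. The bijection reorders the pair
  accordingly. Injectivity comes from \<open>rel_adm_determined\<close>, surjectivity from
  \<open>rel_adm_lift\<close>.\<close>

lemma adm_quot_bij:
  assumes C: "finite (topspace C)"
  shows "bij_betw (\<lambda>(B, A). (A, top_quot B A)) (SIGMA B:{B. admissible B C}. {A. admissible A B})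
    (SIGMA A:{A. admissible A C}. {U. admissible U (top_quot C A)})"
  unfolding bij_betw_def
proof
  let ?X = "topspace C"
  show "inj_on (\<lambda>(B, A). (A, top_quot B A)) (SIGMA B:{B. admissible B C}. {A. admissible A B})"
  proof (rule inj_onI; clarsimp)
    fix A B B' assume *: "admissible B C" "admissible A B" "admissible B' C" "admissible A B'"
      "top_quot B A = top_quot B' A"
    have t: "topspace B = ?X" "topspace B' = ?X" "topspace A = ?X" using * adm_topspace by metis+
    have "top_rel B = top_rel C \<inter> equiv_closure (top_rel (top_quot B A))" if "admissible B C" "admissible A B" for B
    proof -
      have t: "topspace B = ?X" "topspace A = ?X" using that adm_topspace by metis+
      show ?thesis using adm_rel_adm[OF C that(1)] adm_rel_adm[OF adm_fin[OF C that(1)] that(2)] rel_adm_determined t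
        by (metis top_rel_top_quot)
    qed
    then have "top_rel B = top_rel B'" using * by metis
    then show "B = B'" using t C by (intro top_eqI) auto
  qed
  show "(\<lambda>(B, A). (A, top_quot B A)) ` (SIGMA B:{B. admissible B C}. {A. admissible A B}) =
    (SIGMA A:{A. admissible A C}. {U. admissible U (top_quot C A)})"
  proof (intro subset_antisym subsetI)
    fix p assume "p \<in> (\<lambda>(B, A). (A, top_quot B A)) ` (SIGMA B:{B. admissible B C}. {A. admissible A B})"
    then show "p \<in> (SIGMA A:{A. admissible A C}. {U. admissible U (top_quot C A)})"
      using adm_trans[OF C] adm_quot[OF C] by auto
  next
    fix p assume "p \<in> (SIGMA A:{A. admissible A C}. {U. admissible U (top_quot C A)})"
    then obtain A U where p: "p = (A, U)" "admissible A C" "admissible U (top_quot C A)" by auto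
    have t: "topspace A = ?X" "topspace U = ?X" using p adm_topspace by fastforce+
    have rA: "rel_adm ?X (top_rel A) (top_rel C)" using adm_rel_adm[OF C p(2)] .
    have "rel_adm ?X (top_rel U) (top_rel (top_quot C A))" using adm_rel_adm[OF _ p(3)] C by simp
    then have rU: "rel_adm ?X (top_rel U) (rel_quot (top_rel C) (top_rel A))" using t by (simp add: top_rel_top_quot)
    \<comment> \<open>The relation is a quasi-order by \<open>rel_adm_lift\<close>; only therefore
      does its upper-ideal topology have this relation as its \<open>top_rel\<close>.\<close>
    define B where "B = upset_topology ?X (top_rel C \<inter> equiv_closure (top_rel U))"
    have tB: "topspace B = ?X" by (simp add: B_def)
    note l = rel_adm_lift[OF rA rU]
    have B: "top_rel B = top_rel C \<inter> equiv_closure (top_rel U)" unfolding B_def by (rule top_rel_upset[OF rel_admD(1)[OF l(2)]])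
    have "admissible B C" "admissible A B" using C tB t l(1,2) B by (auto intro!: admI)
    moreover have "top_quot B A = U" using l(3) B t tB C by (intro top_eqI) (auto simp: top_rel_top_quot)
    ultimately show "p \<in> (\<lambda>(B, A). (A, top_quot B A)) ` (SIGMA B:{B. admissible B C}. {A. admissible A B})"
      unfolding p(1) by (intro rev_image_eqI[of "(B, A)"]) auto
  qed
qed

text \<open>The partition of the space into the classes of \<open>T\<close>: its components are
  those classes. It is the discrete topology only if \<open>T\<close> separates points, that is if
  its quasi-order is antisymmetric.\<close>

definition discrete_adm :: "'a topology \<Rightarrow> 'a topology" where
  "discrete_adm T = upset_topology (topspace T) (rel_sim (top_rel T))"

lemma top_rel_disc: "top_rel (discrete_adm T) = rel_sim (top_rel T)"
  unfolding discrete_adm_def by (rule top_rel_upset[OF rel_admD(1)[OF rel_adm_rel_sim_self[OF quasi_order_top_rel]]])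

lemma topspace_disc [simp]: "topspace (discrete_adm T) = topspace T"
  by (simp add: discrete_adm_def)

lemma adm_disc: "finite (topspace T) \<Longrightarrow> admissible (discrete_adm T) T"
  by (intro admI) (auto simp: top_rel_disc rel_adm_rel_sim_self quasi_order_top_rel)

lemma degree_zero: "finite (topspace T) \<Longrightarrow> top_degree T = 0 \<longleftrightarrow> equiv_closure (top_rel T) = rel_sim (top_rel T)"
  by (simp add: top_degree_rel_degree rel_degree_zero quasi_order_top_rel)

lemma rel_sim_rel_sim: "rel_sim (rel_sim R) = rel_sim R" by (auto simp: rel_sim_def)

lemma quasi_order_trans: "quasi_order X R \<Longrightarrow> trans R" by (simp add: quasi_order_def)

lemma degree_disc: "finite (topspace T) \<Longrightarrow> top_degree (discrete_adm T) = 0"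
  by (simp add: degree_zero top_rel_disc equiv_closure_rel_sim[OF quasi_order_trans[OF quasi_order_top_rel]] rel_sim_rel_sim)

lemma degree_zero_disc: "finite (topspace T) \<Longrightarrow> admissible A T \<Longrightarrow> top_degree A = 0 \<Longrightarrow> A = discrete_adm T"
  using adm_rel_adm[of T A] rel_adm_discrete[of "topspace T" "top_rel A" "top_rel T"] adm_topspace[of A T]
  by (intro top_eqI) (auto simp: top_rel_disc degree_zero)

text \<open>\<open>T\<close> and \<open>S\<close> have the same classes because \<open>T\<close> is
  admissible for \<open>S\<close>, so the partition of \<open>T\<close> reverses only steps that are
  reversible in \<open>S\<close>. The case \<open>S = T\<close> is also used.\<close>

lemma quot_disc: "finite (topspace S) \<Longrightarrow> admissible T S \<Longrightarrow> top_quot S (discrete_adm T) = S"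
  using adm_rel_adm[of S T] adm_topspace[of T S] rel_adm_rel_sim[of "topspace S" "top_rel T" "top_rel S"]
    rel_quot_rel_sim[OF quasi_order_trans[OF quasi_order_top_rel[of S]], of "top_rel T"]
  by (intro top_eqI) (auto simp: top_rel_top_quot top_rel_disc)

lemma degree_quot:
  assumes "finite (topspace T)" "admissible A T"
  shows "top_degree A + top_degree (top_quot T A) = top_degree T"
  using rel_degree_add[OF assms(1) adm_rel_adm[OF assms]] assms adm_topspace[OF assms(2)]
  by (simp add: top_degree_rel_degree top_rel_top_quot)

lemma degree_quot_self: "finite (topspace T) \<Longrightarrow> top_degree (top_quot T T) = 0"
  using degree_quot[OF _ adm_refl, of T] by simp

lemma degree_quot_zero: "finite (topspace T) \<Longrightarrow> admissible A T \<Longrightarrow> top_degree (top_quot T A) = 0 \<Longrightarrow> A = T"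
  using adm_rel_adm[of T A] rel_adm_full[of "topspace T" "top_rel A" "top_rel T"] adm_topspace[of A T]
  by (intro top_eqI) (auto simp: degree_zero top_rel_top_quot)

section \<open>Admissible topologies on disjoint unions\<close>

lemma adm_union:
  assumes "finite (topspace T1)" "finite (topspace T2)" "topspace T1 \<inter> topspace T2 = {}" "admissible A1 T1" "admissible A2 T2"
  shows "admissible (top_union A1 A2) (top_union T1 T2)"
  using rel_adm_Un[OF adm_rel_adm[OF assms(1,4)] adm_rel_adm[OF assms(2,5)] assms(3)] assms(1-3)
    adm_topspace[OF assms(4)] adm_topspace[OF assms(5)]
  by (intro admI) (auto simp: top_rel_top_union)

text \<open>Together with the injectivity in \<open>top_union_inj\<close>, this turns the sum in the
  coproduct of a product into a sum over pairs, on which multiplicativity is visible.\<close>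

lemma adm_union_image:
  assumes fin: "finite (topspace T1)" "finite (topspace T2)" and dis: "topspace T1 \<inter> topspace T2 = {}"
  shows "{A. admissible A (top_union T1 T2)} = (\<lambda>(A1, A2). top_union A1 A2) ` ({A. admissible A T1} \<times> {A. admissible A T2})"
proof (intro subset_antisym subsetI)
  fix A assume "A \<in> {A. admissible A (top_union T1 T2)}"
  then have A: "admissible A (top_union T1 T2)" by simp
  let ?X = "topspace T1" and ?Y = "topspace T2"
  have "rel_adm (?X \<union> ?Y) (top_rel A) (top_rel T1 \<union> top_rel T2)"
    using adm_rel_adm[OF _ A] fin by (simp add: top_rel_top_union[OF dis])
  note r = rel_adm_UnD[OF this quasi_order_top_rel quasi_order_top_rel dis]
  define A1 where "A1 = upset_topology ?X (top_rel A \<inter> ?X \<times> ?X)"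
  define A2 where "A2 = upset_topology ?Y (top_rel A \<inter> ?Y \<times> ?Y)"
  have t: "topspace A1 = ?X" "topspace A2 = ?Y" by (simp_all add: A1_def A2_def)
  have r1: "top_rel A1 = top_rel A \<inter> ?X \<times> ?X" unfolding A1_def by (rule top_rel_upset[OF rel_admD(1)[OF r(2)]])
  have r2: "top_rel A2 = top_rel A \<inter> ?Y \<times> ?Y" unfolding A2_def by (rule top_rel_upset[OF rel_admD(1)[OF r(3)]])
  have "admissible A1 T1" "admissible A2 T2" using r(2,3) r1 r2 t fin by (auto intro!: admI)
  moreover have "A = top_union A1 A2"
    using adm_topspace[OF A] fin t dis r(1) r1 r2 by (intro top_eqI) (simp_all add: top_rel_top_union)
  ultimately show "A \<in> (\<lambda>(A1, A2). top_union A1 A2) ` ({A. admissible A T1} \<times> {A. admissible A T2})" by auto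
next
  fix A assume "A \<in> (\<lambda>(A1, A2). top_union A1 A2) ` ({A. admissible A T1} \<times> {A. admissible A T2})"
  then show "A \<in> {A. admissible A (top_union T1 T2)}" using adm_union[OF assms] by auto
qed

lemma top_union_inj:
  assumes fin: "finite X" "finite Y" and dis: "X \<inter> Y = {}"
  shows "inj_on (\<lambda>(A1, A2). top_union A1 A2) ({A. topspace A = X} \<times> {A. topspace A = Y})"
proof (rule inj_onI)
  fix p q assume "p \<in> {A. topspace A = X} \<times> {A. topspace A = Y}" "q \<in> {A. topspace A = X} \<times> {A. topspace A = Y}"
    and pq: "(\<lambda>(A1, A2). top_union A1 A2) p = (\<lambda>(A1, A2). top_union A1 A2) q"
  then obtain A1 A2 B1 B2 where p: "p = (A1, A2)" "q = (B1, B2)" and *: "topspace A1 = X" "topspace A2 = Y"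
    "topspace B1 = X" "topspace B2 = Y" by auto
  from pq have e: "top_union A1 A2 = top_union B1 B2" by (simp add: p)
  from e have "top_rel A1 \<union> top_rel A2 = top_rel B1 \<union> top_rel B2"
    using top_rel_top_union[of A1 A2] top_rel_top_union[of B1 B2] dis * by simp
  moreover have "top_rel A1 \<subseteq> X \<times> X" "top_rel B1 \<subseteq> X \<times> X" "top_rel A2 \<subseteq> Y \<times> Y" "top_rel B2 \<subseteq> Y \<times> Y"
    using quasi_orderD[OF quasi_order_top_rel[of A1]] quasi_orderD[OF quasi_order_top_rel[of B1]] quasi_orderD[OF quasi_order_top_rel[of A2]] quasi_orderD[OF quasi_order_top_rel[of B2]] * by auto
  ultimately have "top_rel A1 = top_rel B1" "top_rel A2 = top_rel B2" using dis by blast+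
  then show "p = q" using * fin p by (auto intro!: top_eqI)
qed

lemma top_quot_union:
  assumes fin: "finite (topspace B1)" "finite (topspace B2)" and dis: "topspace B1 \<inter> topspace B2 = {}"
    and t: "topspace A1 = topspace B1" "topspace A2 = topspace B2"
  shows "top_quot (top_union B1 B2) (top_union A1 A2) = top_union (top_quot B1 A1) (top_quot B2 A2)"
proof (rule top_eqI)
  note q = quasi_orderD[OF quasi_order_top_rel[of A1]] quasi_orderD[OF quasi_order_top_rel[of A2]]
  show "top_rel (top_quot (top_union B1 B2) (top_union A1 A2)) = top_rel (top_union (top_quot B1 A1) (top_quot B2 A2))"
    using rel_quot_Un[OF quasi_orderD[OF quasi_order_top_rel[of B1]] q(1)[unfolded t] quasi_orderD[OF quasi_order_top_rel[of B2]] q(2)[unfolded t] dis] t dis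
    by (simp add: top_rel_top_quot top_rel_top_union)
qed (use fin in auto)

lemma degree_union:
  assumes fin: "finite (topspace T1)" "finite (topspace T2)" and dis: "topspace T1 \<inter> topspace T2 = {}"
  shows "top_degree (top_union T1 T2) = top_degree T1 + top_degree T2"
  using assms rel_degree_Un[OF assms quasi_order_top_rel quasi_order_top_rel] by (simp add: top_degree_rel_degree top_rel_top_union)

lemma top_union_assoc:
  "top_union (top_union T1 T2) T3 = top_union T1 (top_union T2 T3)"
  unfolding topology_eq openin_top_union topspace_top_union
  by (auto simp: Int_assoc inf_absorb2 Int_Un_distrib2)

lemma top_union_commute: "top_union T1 T2 = top_union T2 T1"
  unfolding topology_eq openin_top_union by blast

lemma top_union_empty: "top_union (discrete_topology {}) T = T"
  unfolding topology_eq openin_top_union by (auto dest: openin_subset simp: Int_absorb2)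

section \<open>Relabelling of topologies\<close>

lemma adm_pull:
  assumes f: "bij_betw f X (topspace T)" and fin: "finite X" and A: "admissible A T"
  shows "admissible (pullback_topology X f A) (pullback_topology X f T)"
proof -
  have s: "f ` X \<subseteq> topspace T" "f ` X \<subseteq> topspace A" and finT: "finite (topspace T)"
    using f fin adm_topspace[OF A] bij_betw_finite[OF f] by (auto simp: bij_betw_def)
  show ?thesis using rel_adm_rel_pull[OF f adm_rel_adm[OF finT A]] fin
    by (intro admI) (simp_all add: topspace_pull[OF s(1)] topspace_pull[OF s(2)] top_rel_pull[OF s(1)] top_rel_pull[OF s(2)])
qed

lemma rel_pull_rel_pull:
  assumes "f ` X \<subseteq> Y"
  shows "rel_pull X f (rel_pull Y g R) = rel_pull X (g \<circ> f) R"
  using assms by (auto simp: rel_pull_def)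

lemma pull_pull:
  assumes f: "f ` X \<subseteq> Y" and g: "g ` Y \<subseteq> topspace T" and fin: "finite X"
  shows "pullback_topology X f (pullback_topology Y g T) = pullback_topology X (g \<circ> f) T"
proof (rule top_eqI)
  have s: "f ` X \<subseteq> topspace (pullback_topology Y g T)" "(g \<circ> f) ` X \<subseteq> topspace T"
    using f g topspace_pull[OF g] by auto
  show "finite (topspace (pullback_topology X f (pullback_topology Y g T)))"
    "topspace (pullback_topology X f (pullback_topology Y g T)) = topspace (pullback_topology X (g \<circ> f) T)"
    using fin topspace_pull[OF s(1)] topspace_pull[OF s(2)] by auto
  show "top_rel (pullback_topology X f (pullback_topology Y g T)) = top_rel (pullback_topology X (g \<circ> f) T)"
    unfolding top_rel_pull[OF s(1)] top_rel_pull[OF s(2)] top_rel_pull[OF g] by (rule rel_pull_rel_pull[OF f])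
qed

lemma pull_cong:
  assumes "f ` X \<subseteq> topspace T" "\<And>x. x \<in> X \<Longrightarrow> f x = g x" "finite X"
  shows "pullback_topology X f T = pullback_topology X g T"
proof (rule top_eqI)
  have g: "g ` X \<subseteq> topspace T" using assms by auto
  show "finite (topspace (pullback_topology X f T))"
    "topspace (pullback_topology X f T) = topspace (pullback_topology X g T)"
    using assms topspace_pull[OF assms(1)] topspace_pull[OF g] by auto
  show "top_rel (pullback_topology X f T) = top_rel (pullback_topology X g T)"
    unfolding top_rel_pull[OF assms(1)] top_rel_pull[OF g] using assms by (auto simp: rel_pull_def)
qed

lemma pull_id: "topspace T = X \<Longrightarrow> pullback_topology X (\<lambda>x. x) T = T"
  unfolding topology_eq openin_pullback_topology by (auto dest: openin_subset simp: Int_absorb2)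

text \<open>Pulling back along \<open>inv_into X f\<close> undoes the pullback along
  \<open>f\<close> and preserves admissibility, so every admissible topology on \<open>X\<close> is
  itself a pullback.\<close>

lemma adm_pull_image:
  assumes f: "bij_betw f X (topspace T)" and fin: "finite X"
  shows "{A. admissible A (pullback_topology X f T)} = pullback_topology X f ` {A. admissible A T}"
proof (intro subset_antisym subsetI)
  fix A assume "A \<in> {A. admissible A (pullback_topology X f T)}"
  then have A: "admissible A (pullback_topology X f T)" by simp
  let ?Y = "topspace T"
  let ?g = "inv_into X f"
  have s: "f ` X \<subseteq> topspace T" and finT: "finite (topspace T)" using f fin bij_betw_finite[OF f] by (auto simp: bij_betw_def)
  have tA: "topspace A = X" using adm_topspace[OF A] topspace_pull[OF s] by simp
  have g: "bij_betw ?g ?Y X" by (rule bij_betw_inv_into[OF f])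
  have "pullback_topology ?Y ?g (pullback_topology X f T) = T"
  proof -
    have "pullback_topology ?Y ?g (pullback_topology X f T) = pullback_topology ?Y (f \<circ> ?g) T"
      using g s finT by (intro pull_pull) (auto simp: bij_betw_def)
    also have "\<dots> = pullback_topology ?Y (\<lambda>x. x) T"
      using f finT bij_betw_inv_into_right[OF f] by (intro pull_cong) auto
    finally show ?thesis by (simp add: pull_id)
  qed
  moreover have "admissible (pullback_topology ?Y ?g A) (pullback_topology ?Y ?g (pullback_topology X f T))"
    using g topspace_pull[OF s] finT A by (intro adm_pull) auto
  ultimately have "admissible (pullback_topology ?Y ?g A) T" by simp
  moreover have "pullback_topology X f (pullback_topology ?Y ?g A) = A"
  proof -
    have "pullback_topology X f (pullback_topology ?Y ?g A) = pullback_topology X (?g \<circ> f) A"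
      using g s tA fin by (intro pull_pull) (auto simp: bij_betw_def)
    also have "\<dots> = pullback_topology X (\<lambda>x. x) A"
      using fin tA bij_betw_inv_into_left[OF f] by (intro pull_cong) auto
    finally show ?thesis by (simp add: pull_id tA)
  qed
  ultimately show "A \<in> pullback_topology X f ` {A. admissible A T}" by (metis image_eqI mem_Collect_eq)
next
  fix A assume "A \<in> pullback_topology X f ` {A. admissible A T}"
  then show "A \<in> {A. admissible A (pullback_topology X f T)}" using adm_pull[OF f fin] by auto
qed

lemma pull_inj:
  assumes f: "bij_betw f X Y" and fin: "finite X"
  shows "inj_on (pullback_topology X f) {A. topspace A = Y}"
proof (rule inj_onI)
  fix A B assume *: "A \<in> {A. topspace A = Y}" "B \<in> {A. topspace A = Y}" "pullback_topology X f A = pullback_topology X f B"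
  have "pullback_topology Y (inv_into X f) (pullback_topology X f A) = A" if "topspace A = Y" for A :: "'b topology"
  proof -
    have finY: "finite Y" using f fin bij_betw_finite by blast
    have g: "bij_betw (inv_into X f) Y X" by (rule bij_betw_inv_into[OF f])
    have "pullback_topology Y (inv_into X f) (pullback_topology X f A) = pullback_topology Y (f \<circ> inv_into X f) A"
      using g f that finY by (intro pull_pull) (auto simp: bij_betw_def)
    also have "\<dots> = pullback_topology Y (\<lambda>x. x) A"
      using f finY that bij_betw_inv_into_right[OF f] by (intro pull_cong) auto
    finally show ?thesis by (simp add: pull_id that)
  qed
  then show "A = B" using * by (metis mem_Collect_eq)
qed

lemma pull_quot:
  assumes f: "bij_betw f X (topspace T)" and fin: "finite X" and A: "topspace A = topspace T"
  shows "pullback_topology X f (top_quot T A) = top_quot (pullback_topology X f T) (pullback_topology X f A)"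
proof (rule top_eqI)
  have s: "f ` X \<subseteq> topspace T" "f ` X \<subseteq> topspace A" "f ` X \<subseteq> topspace (top_quot T A)"
    using f A by (auto simp: bij_betw_def)
  note [simp] = topspace_pull[OF s(1)] topspace_pull[OF s(2)] topspace_pull[OF s(3)]
  show "finite (topspace (pullback_topology X f (top_quot T A)))"
    "topspace (pullback_topology X f (top_quot T A)) = topspace (top_quot (pullback_topology X f T) (pullback_topology X f A))"
    using fin by simp_all
  show "top_rel (pullback_topology X f (top_quot T A)) = top_rel (top_quot (pullback_topology X f T) (pullback_topology X f A))"
    using rel_pull_rel_quot[OF f quasi_orderD[OF quasi_order_top_rel] quasi_orderD[OF quasi_order_top_rel[of A], unfolded A]] A
    by (simp add: top_rel_pull[OF s(1)] top_rel_pull[OF s(2)] top_rel_pull[OF s(3)] top_rel_top_quot)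
qed

lemma degree_pull:
  assumes f: "bij_betw f X (topspace T)" and fin: "finite X"
  shows "top_degree (pullback_topology X f T) = top_degree T"
proof -
  have s: "f ` X \<subseteq> topspace T" and "finite (topspace T)" using f fin bij_betw_finite[OF f] by (auto simp: bij_betw_def)
  then show ?thesis using rel_degree_rel_pull[OF f quasi_order_top_rel] fin
    by (simp add: top_degree_rel_degree topspace_pull top_rel_pull)
qed

lemma pull_union:
  assumes fin: "finite X" "finite Y" and XY: "X \<inter> Y = {}" and f: "inj_on f (X \<union> Y)"
    and t: "topspace T1 = f ` X" "topspace T2 = f ` Y"
  shows "pullback_topology (X \<union> Y) f (top_union T1 T2) = top_union (pullback_topology X f T1) (pullback_topology Y f T2)"
proof (rule top_eqI)
  have s: "f ` X \<subseteq> topspace T1" "f ` Y \<subseteq> topspace T2" "f ` (X \<union> Y) \<subseteq> topspace (top_union T1 T2)"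
    using t by auto
  note [simp] = topspace_pull[OF s(1)] topspace_pull[OF s(2)] topspace_pull[OF s(3)]
  show "finite (topspace (pullback_topology (X \<union> Y) f (top_union T1 T2)))"
    "topspace (pullback_topology (X \<union> Y) f (top_union T1 T2)) = topspace (top_union (pullback_topology X f T1) (pullback_topology Y f T2))"
    using fin by simp_all
  have dis: "topspace T1 \<inter> topspace T2 = {}" using f XY by (auto simp: t inj_on_def)
  have d2: "topspace (pullback_topology X f T1) \<inter> topspace (pullback_topology Y f T2) = {}" using XY by simp
  have r: "top_rel T1 \<subseteq> f ` X \<times> f ` X" "top_rel T2 \<subseteq> f ` Y \<times> f ` Y" using quasi_orderD[OF quasi_order_top_rel] t by metis+
  \<comment> \<open>Injectivity on the whole of \<open>X \<union> Y\<close> lets the image of a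
    point decide to which of the two sets the point belongs.\<close>
  have m: "x \<in> X" if "f x \<in> f ` X" "x \<in> X \<union> Y" for x using that f by (auto simp: inj_on_def)
  have m': "x \<in> Y" if "f x \<in> f ` Y" "x \<in> X \<union> Y" for x using that f by (auto simp: inj_on_def)
  have "rel_pull (X \<union> Y) f (top_rel T1 \<union> top_rel T2) = rel_pull X f (top_rel T1) \<union> rel_pull Y f (top_rel T2)"
  proof (intro subset_antisym subrelI)
    fix x y assume "(x, y) \<in> rel_pull (X \<union> Y) f (top_rel T1 \<union> top_rel T2)"
    then have xy: "x \<in> X \<union> Y" "y \<in> X \<union> Y" "(f x, f y) \<in> top_rel T1 \<or> (f x, f y) \<in> top_rel T2" by (auto simp: rel_pull_def)
    then show "(x, y) \<in> rel_pull X f (top_rel T1) \<union> rel_pull Y f (top_rel T2)"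
      using r m[OF _ xy(1)] m[OF _ xy(2)] m'[OF _ xy(1)] m'[OF _ xy(2)] unfolding rel_pull_def by blast
  qed (auto simp: rel_pull_def)
  then show "top_rel (pullback_topology (X \<union> Y) f (top_union T1 T2)) = top_rel (top_union (pullback_topology X f T1) (pullback_topology Y f T2))"
    by (simp add: top_rel_pull[OF s(1)] top_rel_pull[OF s(2)] top_rel_pull[OF s(3)] top_rel_top_union[OF dis] top_rel_top_union[OF d2])
qed

section \<open>Linear algebra over explicit carriers\<close>

text \<open>Only the field is fixed. The vector spaces stay arguments of each lemma, since spaces of
  different types, such as iterated tensor products, occur together in one statement.\<close>

locale linalg = field K for K :: "('k, 'm) ring_scheme" (structure)
begin

abbreviation vs where "vs V \<equiv> Module.module K V"
abbreviation lm where "lm \<equiv> linear_maps K"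

section \<open>Finite sums and linear maps\<close>

lemma vs_ab: "vs V \<Longrightarrow> abelian_group V" by (simp add: Module.module_def)
lemma vs_am: "vs V \<Longrightarrow> abelian_monoid V" by (simp add: Module.module_def abelian_group_def)

lemma vs_cm: "vs V \<Longrightarrow> comm_monoid (add_monoid V)"
  by (simp add: abelian_monoid.a_comm_monoid vs_am)

lemma vs_add [intro, simp]: "vs V \<Longrightarrow> x \<in> carrier V \<Longrightarrow> y \<in> carrier V \<Longrightarrow> x \<oplus>\<^bsub>V\<^esub> y \<in> carrier V"
  by (simp add: abelian_monoid.a_closed vs_am)
lemma vs_zero [intro, simp]: "vs V \<Longrightarrow> \<zero>\<^bsub>V\<^esub> \<in> carrier V"
  by (simp add: abelian_monoid.zero_closed vs_am)
lemma vs_smult [intro, simp]: "vs V \<Longrightarrow> c \<in> carrier K \<Longrightarrow> x \<in> carrier V \<Longrightarrow> c \<odot>\<^bsub>V\<^esub> x \<in> carrier V"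
  by (simp add: Module.module.smult_closed)
lemma vs_minus [intro, simp]: "vs V \<Longrightarrow> x \<in> carrier V \<Longrightarrow> y \<in> carrier V \<Longrightarrow> x \<ominus>\<^bsub>V\<^esub> y \<in> carrier V"
  by (simp add: abelian_group.minus_closed vs_ab)
lemma vs_sum [intro]: "vs V \<Longrightarrow> (\<And>a. a \<in> A \<Longrightarrow> f a \<in> carrier V) \<Longrightarrow> finsum V f A \<in> carrier V"
  by (rule abelian_monoid.finsum_closed) (auto simp: vs_am)

text \<open>Writing a difference with addition and the scalar \<open>\<ominus> \<one>\<close> makes
  its preservation by linear maps a consequence of \<open>lm_add\<close> and
  \<open>lm_smult\<close>.\<close>

lemma vs_minus_conv: "vs V \<Longrightarrow> x \<in> carrier V \<Longrightarrow> y \<in> carrier V \<Longrightarrow> x \<ominus>\<^bsub>V\<^esub> y = x \<oplus>\<^bsub>V\<^esub> ((\<ominus> \<one>) \<odot>\<^bsub>V\<^esub> y)"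
  by (simp add: Module.module.smult_l_minus Module.module.smult_one a_minus_def)

lemma vs_minus_self [simp]: "vs V \<Longrightarrow> x \<in> carrier V \<Longrightarrow> x \<ominus>\<^bsub>V\<^esub> x = \<zero>\<^bsub>V\<^esub>"
  using abelian_group.r_neg[OF vs_ab] by (simp add: a_minus_def)

lemma vs_minus_zeroD: "vs V \<Longrightarrow> x \<in> carrier V \<Longrightarrow> y \<in> carrier V \<Longrightarrow> x \<ominus>\<^bsub>V\<^esub> y = \<zero>\<^bsub>V\<^esub> \<Longrightarrow> x = y"
proof -
  assume *: "vs V" "x \<in> carrier V" "y \<in> carrier V" "x \<ominus>\<^bsub>V\<^esub> y = \<zero>\<^bsub>V\<^esub>"
  interpret abelian_group V by (rule vs_ab) fact
  have "x = (x \<ominus>\<^bsub>V\<^esub> y) \<oplus>\<^bsub>V\<^esub> y" using *(2,3) by (simp add: a_minus_def a_assoc l_neg)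
  then show "x = y" using *(2-4) by simp
qed

lemma sum_cong: "vs V \<Longrightarrow> A = B \<Longrightarrow> (\<And>a. a \<in> B \<Longrightarrow> f a = g a) \<Longrightarrow> (\<And>a. a \<in> B \<Longrightarrow> g a \<in> carrier V)
  \<Longrightarrow> finsum V f A = finsum V g B"
  by (rule abelian_monoid.finsum_cong') (auto simp: vs_am)

lemma sum_insert: "vs V \<Longrightarrow> finite A \<Longrightarrow> a \<notin> A \<Longrightarrow> f a \<in> carrier V \<Longrightarrow> (\<And>x. x \<in> A \<Longrightarrow> f x \<in> carrier V)
  \<Longrightarrow> finsum V f (insert a A) = f a \<oplus>\<^bsub>V\<^esub> finsum V f A"
  by (rule abelian_monoid.finsum_insert) (auto simp: vs_am)

lemma sum_empty [simp]: "vs V \<Longrightarrow> finsum V f {} = \<zero>\<^bsub>V\<^esub>"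
  by (simp add: abelian_monoid.finsum_empty vs_am)

lemma sum_add: "vs V \<Longrightarrow> (\<And>a. a \<in> A \<Longrightarrow> f a \<in> carrier V) \<Longrightarrow> (\<And>a. a \<in> A \<Longrightarrow> g a \<in> carrier V)
  \<Longrightarrow> finsum V (\<lambda>a. f a \<oplus>\<^bsub>V\<^esub> g a) A = finsum V f A \<oplus>\<^bsub>V\<^esub> finsum V g A"
  by (rule abelian_monoid.finsum_addf) (auto simp: vs_am)

lemma sum_smult: "vs V \<Longrightarrow> finite A \<Longrightarrow> c \<in> carrier K \<Longrightarrow> (\<And>a. a \<in> A \<Longrightarrow> f a \<in> carrier V)
  \<Longrightarrow> finsum V (\<lambda>a. c \<odot>\<^bsub>V\<^esub> f a) A = c \<odot>\<^bsub>V\<^esub> finsum V f A"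
  by (subst Module.module.finsum_smult_ldistr) auto

text \<open>Many sums below run over exact supports; this moves several of them to one common finite
  index set.\<close>

lemma sum_mono_neutral: "vs V \<Longrightarrow> finite B \<Longrightarrow> A \<subseteq> B \<Longrightarrow> (\<And>i. i \<in> B - A \<Longrightarrow> f i = \<zero>\<^bsub>V\<^esub>)
   \<Longrightarrow> (\<And>a. a \<in> A \<Longrightarrow> f a \<in> carrier V) \<Longrightarrow> finsum V f A = finsum V f B"
  unfolding finsum_def
proof (rule comm_monoid.finprod_mono_neutral_cong_left[OF vs_cm])
  assume *: "vs V" "\<And>i. i \<in> B - A \<Longrightarrow> f i = \<zero>\<^bsub>V\<^esub>" "\<And>a. a \<in> A \<Longrightarrow> f a \<in> carrier V"
  show "f \<in> B \<rightarrow> carrier (add_monoid V)"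
  proof
    fix x assume "x \<in> B" then show "f x \<in> carrier (add_monoid V)"
      using * by (cases "x \<in> A") auto
  qed
qed auto

lemma sum_single: "vs V \<Longrightarrow> finite A \<Longrightarrow> i \<in> A \<Longrightarrow> (\<And>j. j \<in> A \<Longrightarrow> j \<noteq> i \<Longrightarrow> f j = \<zero>\<^bsub>V\<^esub>) \<Longrightarrow> f i \<in> carrier V
   \<Longrightarrow> finsum V f A = f i"
proof -
  assume *: "vs V" "finite A" "i \<in> A" "\<And>j. j \<in> A \<Longrightarrow> j \<noteq> i \<Longrightarrow> f j = \<zero>\<^bsub>V\<^esub>" "f i \<in> carrier V"
  have "finsum V f {i} = finsum V f A" using * by (intro sum_mono_neutral) auto
  moreover have "finsum V f {i} = f i"
    using sum_insert[of V "{}" i f] * by (simp add: abelian_monoid.r_zero vs_am)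
  ultimately show ?thesis by simp
qed

lemma sum_zero: "vs V \<Longrightarrow> (\<And>a. a \<in> A \<Longrightarrow> f a = \<zero>\<^bsub>V\<^esub>) \<Longrightarrow> finsum V f A = \<zero>\<^bsub>V\<^esub>"
proof -
  assume *: "vs V" "\<And>a. a \<in> A \<Longrightarrow> f a = \<zero>\<^bsub>V\<^esub>"
  have "finsum V f A = finsum V (\<lambda>a. \<zero>\<^bsub>V\<^esub>) A" using * by (intro sum_cong) auto
  then show ?thesis using * by (simp add: abelian_monoid.finsum_zero vs_am)
qed

lemma sum_reindex: "vs V \<Longrightarrow> inj_on h A \<Longrightarrow> (\<And>a. a \<in> A \<Longrightarrow> f (h a) \<in> carrier V)
  \<Longrightarrow> finsum V f (h ` A) = finsum V (\<lambda>x. f (h x)) A"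
  by (rule abelian_monoid.finsum_reindex) (auto simp: vs_am)

lemma sum_Sigma:
  assumes "vs V" "finite A" "\<And>a. a \<in> A \<Longrightarrow> finite (B a)"
    "\<And>a b. a \<in> A \<Longrightarrow> b \<in> B a \<Longrightarrow> f a b \<in> carrier V"
  shows "finsum V (\<lambda>a. finsum V (f a) (B a)) A = finsum V (\<lambda>(a, b). f a b) (Sigma A B)"
proof -
  have 1: "Sigma A B = (\<Union>a\<in>A. Pair a ` B a)" by auto
  have "finsum V (\<lambda>(a, b). f a b) (Sigma A B) =
    finsum V (\<lambda>a. finsum V (\<lambda>(a, b). f a b) (Pair a ` B a)) A" unfolding 1
    unfolding finsum_def using comm_monoid.finprod_UN_disjoint[OF vs_cm[OF assms(1)], of A "\<lambda>a. Pair a ` B a" "\<lambda>(a, b). f a b"] assms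
    by (auto simp: pairwise_def disjnt_def)
  also have "\<dots> = finsum V (\<lambda>a. finsum V (f a) (B a)) A"
  proof (rule sum_cong[OF assms(1) refl])
    fix a assume a: "a \<in> A"
    have "finsum V (\<lambda>(a, b). f a b) (Pair a ` B a) = finsum V (\<lambda>x. (\<lambda>(a, b). f a b) (Pair a x)) (B a)"
      by (rule sum_reindex) (use assms a in \<open>auto simp: inj_on_def\<close>)
    then show "finsum V (\<lambda>(a, b). f a b) (Pair a ` B a) = finsum V (f a) (B a)" by simp
    show "finsum V (f a) (B a) \<in> carrier V" using assms a by (intro vs_sum) auto
  qed
  finally show ?thesis ..
qed

lemma lmI: "(\<And>x. x \<in> carrier V \<Longrightarrow> f x \<in> carrier W) \<Longrightarrow>
  (\<And>x y. x \<in> carrier V \<Longrightarrow> y \<in> carrier V \<Longrightarrow> f (x \<oplus>\<^bsub>V\<^esub> y) = f x \<oplus>\<^bsub>W\<^esub> f y) \<Longrightarrow>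
  (\<And>c x. c \<in> carrier K \<Longrightarrow> x \<in> carrier V \<Longrightarrow> f (c \<odot>\<^bsub>V\<^esub> x) = c \<odot>\<^bsub>W\<^esub> f x) \<Longrightarrow> f \<in> lm V W"
  by (auto simp: linear_maps_def)

lemma lm_closed: "f \<in> lm V W \<Longrightarrow> x \<in> carrier V \<Longrightarrow> f x \<in> carrier W" by (auto simp: linear_maps_def)
lemma lm_add: "f \<in> lm V W \<Longrightarrow> x \<in> carrier V \<Longrightarrow> y \<in> carrier V \<Longrightarrow> f (x \<oplus>\<^bsub>V\<^esub> y) = f x \<oplus>\<^bsub>W\<^esub> f y"
  by (auto simp: linear_maps_def)
lemma lm_smult: "f \<in> lm V W \<Longrightarrow> c \<in> carrier K \<Longrightarrow> x \<in> carrier V \<Longrightarrow> f (c \<odot>\<^bsub>V\<^esub> x) = c \<odot>\<^bsub>W\<^esub> f x"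
  by (auto simp: linear_maps_def)
lemma lm_zero: "vs V \<Longrightarrow> vs W \<Longrightarrow> f \<in> lm V W \<Longrightarrow> f \<zero>\<^bsub>V\<^esub> = \<zero>\<^bsub>W\<^esub>"
  using lm_smult[of f V W \<zero> "\<zero>\<^bsub>V\<^esub>"] by (simp add: Module.module.smult_l_null lm_closed)
lemma lm_minus: "vs V \<Longrightarrow> vs W \<Longrightarrow> f \<in> lm V W \<Longrightarrow> x \<in> carrier V \<Longrightarrow> y \<in> carrier V \<Longrightarrow> f (x \<ominus>\<^bsub>V\<^esub> y) = f x \<ominus>\<^bsub>W\<^esub> f y"
  by (simp add: vs_minus_conv lm_add lm_smult lm_closed)
lemma lm_sum:
  assumes "vs V" "vs W" "f \<in> lm V W" "finite A" "\<And>a. a \<in> A \<Longrightarrow> g a \<in> carrier V"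
  shows "f (finsum V g A) = finsum W (\<lambda>a. f (g a)) A"
  using assms(4,5)
proof (induct A rule: finite_induct)
  case (insert a A)
  then show ?case using assms(1-3) by (simp add: sum_insert lm_add lm_closed vs_sum)
qed (use assms in \<open>simp add: lm_zero\<close>)
lemma lm_comp: "f \<in> lm V W \<Longrightarrow> g \<in> lm W U \<Longrightarrow> (\<lambda>x. g (f x)) \<in> lm V U"
  by (intro lmI) (simp_all add: lm_closed lm_add lm_smult)
lemma lm_id: "(\<lambda>x. x) \<in> lm V V" by (auto simp: linear_maps_def)
lemma lm_cong: "vs V \<Longrightarrow> (\<And>x. x \<in> carrier V \<Longrightarrow> f x = g x) \<Longrightarrow> f \<in> lm V W \<longleftrightarrow> g \<in> lm V W"
  by (auto simp: linear_maps_def Pi_def)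
lemma lm_scale: "vs W \<Longrightarrow> c \<in> carrier K \<Longrightarrow> f \<in> lm V W \<Longrightarrow> (\<lambda>x. c \<odot>\<^bsub>W\<^esub> f x) \<in> lm V W"
proof -
  assume *: "vs W" "c \<in> carrier K" "f \<in> lm V W"
  interpret M: Module.module K W by fact
  show ?thesis using * by (intro lmI) (auto simp: lm_closed lm_add lm_smult M.smult_r_distr M.smult_assoc1[symmetric] m_comm)
qed
lemma lm_const_zero: "vs W \<Longrightarrow> (\<lambda>x. \<zero>\<^bsub>W\<^esub>) \<in> lm V W"
  by (intro lmI) (auto simp: abelian_monoid.r_zero vs_am Module.module.smult_r_null)
lemma lm_plus: "vs W \<Longrightarrow> f \<in> lm V W \<Longrightarrow> g \<in> lm V W \<Longrightarrow> (\<lambda>x. f x \<oplus>\<^bsub>W\<^esub> g x) \<in> lm V W"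
proof -
  assume *: "vs W" "f \<in> lm V W" "g \<in> lm V W"
  interpret abelian_monoid W by (rule vs_am) fact
  show ?thesis using * by (intro lmI) (auto simp: lm_closed lm_add lm_smult Module.module.smult_r_distr a_ac)
qed
lemma lm_finsum:
  assumes "vs V" "vs W" "finite A" "\<And>a. a \<in> A \<Longrightarrow> f a \<in> lm V W"
  shows "(\<lambda>x. \<Oplus>\<^bsub>W\<^esub>a\<in>A. f a x) \<in> lm V W"
  using assms(3,4)
proof (induction A rule: finite_induct)
  case empty
  then show ?case using assms by (simp add: lm_const_zero)
next
  case (insert a A)
  have "(\<lambda>x. f a x \<oplus>\<^bsub>W\<^esub> (\<Oplus>\<^bsub>W\<^esub>a\<in>A. f a x)) \<in> lm V W"
    using insert assms by (intro lm_plus) auto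
  then show ?case
    using insert.prems insert.hyps lm_closed[of _ V W] assms
    by (subst lm_cong[where g = "\<lambda>x. f a x \<oplus>\<^bsub>W\<^esub> (\<Oplus>\<^bsub>W\<^esub>a\<in>A. f a x)"])
      (auto simp: sum_insert)
qed
lemma lm_scale_vec: "vs V \<Longrightarrow> x \<in> carrier V \<Longrightarrow> (\<lambda>c. c \<odot>\<^bsub>V\<^esub> x) \<in> lm (base_vs K) V"
  by (intro lmI) (auto simp: base_vs_def Module.module.smult_l_distr Module.module.smult_assoc1)

lemma vs_base [simp]: "vs (base_vs K)"
proof (rule moduleI)
  show "cring K" by (rule is_cring)
  show "abelian_group (base_vs K)"
  proof (rule abelian_groupI)
    fix x assume "x \<in> carrier (base_vs K)"
    then show "\<exists>y\<in>carrier (base_vs K). y \<oplus>\<^bsub>base_vs K\<^esub> x = \<zero>\<^bsub>base_vs K\<^esub>"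
      by (auto simp: base_vs_def intro!: bexI[of _ "\<ominus> x"] l_neg)
  qed (auto simp: base_vs_def a_ac)
qed (auto simp: base_vs_def l_distr r_distr m_ac)

lemma base_simps [simp]: "carrier (base_vs K) = carrier K" "\<zero>\<^bsub>base_vs K\<^esub> = \<zero>" "x \<oplus>\<^bsub>base_vs K\<^esub> y = x \<oplus> y"
  "x \<odot>\<^bsub>base_vs K\<^esub> y = x \<otimes> y"
  by (auto simp: base_vs_def)

text \<open>The records \<open>K\<close> and \<open>base_vs K\<close> share carrier, addition and
  zero, and \<open>finsum\<close> reads nothing else.\<close>

lemma finsum_base [simp]: "finsum (base_vs K) = finsum K"
  by (intro ext) (simp add: finsum_def finprod_def base_vs_def)

section \<open>Submodules and spans\<close>

lemma submodI: "vs V \<Longrightarrow> N \<subseteq> carrier V \<Longrightarrow> \<zero>\<^bsub>V\<^esub> \<in> N \<Longrightarrow> (\<And>x y. x \<in> N \<Longrightarrow> y \<in> N \<Longrightarrow> x \<oplus>\<^bsub>V\<^esub> y \<in> N)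
  \<Longrightarrow> (\<And>c x. c \<in> carrier K \<Longrightarrow> x \<in> N \<Longrightarrow> c \<odot>\<^bsub>V\<^esub> x \<in> N) \<Longrightarrow> submodule N K V"
proof (rule Module.module.submoduleI)
  fix a assume *: "vs V" "N \<subseteq> carrier V" "\<And>c x. c \<in> carrier K \<Longrightarrow> x \<in> N \<Longrightarrow> c \<odot>\<^bsub>V\<^esub> x \<in> N" "a \<in> N"
  then have "\<ominus>\<^bsub>V\<^esub> a = (\<ominus> \<one>) \<odot>\<^bsub>V\<^esub> a"
    by (auto simp: Module.module.smult_l_minus Module.module.smult_one)
  with * show "\<ominus>\<^bsub>V\<^esub> a \<in> N" by auto
qed auto

lemma submod_sub: "submodule N K V \<Longrightarrow> N \<subseteq> carrier V"
  using subgroup.subset[OF submodule.axioms(1)] by fastforce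
lemma submod_zero: "submodule N K V \<Longrightarrow> \<zero>\<^bsub>V\<^esub> \<in> N"
  using subgroup.one_closed[OF submodule.axioms(1)] by fastforce
lemma submod_add: "submodule N K V \<Longrightarrow> x \<in> N \<Longrightarrow> y \<in> N \<Longrightarrow> x \<oplus>\<^bsub>V\<^esub> y \<in> N"
  using subgroup.m_closed[OF submodule.axioms(1)] by fastforce
lemma submod_smult: "submodule N K V \<Longrightarrow> c \<in> carrier K \<Longrightarrow> x \<in> N \<Longrightarrow> c \<odot>\<^bsub>V\<^esub> x \<in> N"
  using submodule.smult_closed by metis
lemma submod_sum:
  assumes "vs V" "submodule N K V" "\<And>a. a \<in> A \<Longrightarrow> f a \<in> N"
  shows "finsum V f A \<in> N"
proof (cases "finite A")
  case True
  then show ?thesis using assms(3)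
  proof (induction A)
    case (insert a A)
    then have "\<And>x. x \<in> insert a A \<Longrightarrow> f x \<in> carrier V" using submod_sub[OF assms(2)] by auto
    with insert show ?case using assms by (simp add: sum_insert submod_add)
  qed (use assms in \<open>simp add: submod_zero\<close>)
next
  \<comment> \<open>Over an infinite index set \<open>finsum\<close> is zero by convention, and zero
    lies in the submodule.\<close>
  case False
  then show ?thesis using assms
    by (simp add: abelian_monoid.finsum_infinite vs_am submod_zero)
qed

lemma submod_carrier: "vs V \<Longrightarrow> submodule (carrier V) K V"
  by (rule Module.module.carrier_is_submodule)

lemma submod_vimage:
  assumes "vs V" "vs W" "f \<in> lm V W" "submodule N K W"
  shows "submodule {x \<in> carrier V. f x \<in> N} K V"
  using assms by (intro submodI) (auto simp: lm_add lm_smult lm_zero submod_zero submod_add submod_smult)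

lemma submod_equalizer:
  assumes "vs V" "vs W" "f \<in> lm V W" "g \<in> lm V W"
  shows "submodule {x \<in> carrier V. f x = g x} K V"
  using assms by (intro submodI) (auto simp: lm_add lm_smult lm_zero)

lemma submod_image:
  assumes "vs V" "vs W" "f \<in> lm V W" "submodule N K V"
  shows "submodule (f ` N) K W"
proof (rule submodI)
  have N: "N \<subseteq> carrier V" using assms submod_sub by blast
  show "f ` N \<subseteq> carrier W" using N assms by (auto simp: lm_closed)
  show "\<zero>\<^bsub>W\<^esub> \<in> f ` N" using assms by (metis imageI lm_zero submod_zero)
  show "x \<oplus>\<^bsub>W\<^esub> y \<in> f ` N" if xy: "x \<in> f ` N" "y \<in> f ` N" for x y
  proof -
    from xy obtain a b where "a \<in> N" "b \<in> N" "x = f a" "y = f b" by blast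
    then have "x \<oplus>\<^bsub>W\<^esub> y = f (a \<oplus>\<^bsub>V\<^esub> b)" "a \<oplus>\<^bsub>V\<^esub> b \<in> N"
      using lm_add[OF assms(3), of a b] N submod_add[OF assms(4)] by (auto simp: subsetD)
    then show ?thesis by blast
  qed
  show "c \<odot>\<^bsub>W\<^esub> x \<in> f ` N" if cx: "c \<in> carrier K" "x \<in> f ` N" for c x
  proof -
    from cx obtain a where "a \<in> N" "x = f a" by blast
    then have "c \<odot>\<^bsub>W\<^esub> x = f (c \<odot>\<^bsub>V\<^esub> a)" "c \<odot>\<^bsub>V\<^esub> a \<in> N"
      using lm_smult[OF assms(3), of c a] N cx submod_smult[OF assms(4)] by auto
    then show ?thesis by blast
  qed
qed (use assms in auto)

lemma span_least: "submodule N K V \<Longrightarrow> S \<subseteq> N \<Longrightarrow> lin_span K V S \<subseteq> N"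
  by (auto simp: lin_span_def)
lemma span_superset: "S \<subseteq> lin_span K V S" by (auto simp: lin_span_def)
lemma span_submod: assumes "vs V" "S \<subseteq> carrier V" shows "submodule (lin_span K V S) K V"
proof (rule submodI)
  show "lin_span K V S \<subseteq> carrier V" using assms by (intro span_least submod_carrier)
qed (use assms in \<open>auto simp: lin_span_def submod_zero submod_add submod_smult\<close>)
lemma span_carrier: "vs V \<Longrightarrow> S \<subseteq> carrier V \<Longrightarrow> lin_span K V S \<subseteq> carrier V"
  by (intro span_least submod_carrier)

text \<open>The equalizer of two linear maps is a submodule, so it contains the span of
  \<open>S\<close> as soon as it contains \<open>S\<close>.\<close>

lemma lm_eq_on_span:
  assumes "vs V" "vs W" "f \<in> lm V W" "g \<in> lm V W" "S \<subseteq> carrier V" "\<And>x. x \<in> S \<Longrightarrow> f x = g x"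
    "v \<in> lin_span K V S"
  shows "f v = g v"
  using span_least[OF submod_equalizer[OF assms(1-4)], of S] assms(5-) by blast

lemma lm_span_in:
  assumes "vs V" "vs W" "f \<in> lm V W" "submodule N K W" "S \<subseteq> carrier V" "\<And>x. x \<in> S \<Longrightarrow> f x \<in> N"
    "v \<in> lin_span K V S"
  shows "f v \<in> N"
  using span_least[OF submod_vimage[OF assms(1-4)], of S] assms(5-) by blast

section \<open>Bilinear maps\<close>

abbreviation blm where "blm \<equiv> bilinear_map K"

lemma blmI: "(\<And>x. x \<in> carrier V \<Longrightarrow> b x \<in> lm W U) \<Longrightarrow> (\<And>y. y \<in> carrier W \<Longrightarrow> (\<lambda>x. b x y) \<in> lm V U) \<Longrightarrow> blm V W U b"
  by (auto simp: bilinear_map_def)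
lemma blm_right: "blm V W U b \<Longrightarrow> x \<in> carrier V \<Longrightarrow> b x \<in> lm W U" by (auto simp: bilinear_map_def)
lemma blm_left: "blm V W U b \<Longrightarrow> y \<in> carrier W \<Longrightarrow> (\<lambda>x. b x y) \<in> lm V U" by (auto simp: bilinear_map_def)
lemma blm_closed: "blm V W U b \<Longrightarrow> x \<in> carrier V \<Longrightarrow> y \<in> carrier W \<Longrightarrow> b x y \<in> carrier U"
  by (rule lm_closed[OF blm_right])
lemma blm_comp: "blm V W U b \<Longrightarrow> f \<in> lm V' V \<Longrightarrow> g \<in> lm W' W \<Longrightarrow> h \<in> lm U U'
   \<Longrightarrow> blm V' W' U' (\<lambda>x y. h (b (f x) (g y)))"
proof -
  assume *: "blm V W U b" "f \<in> lm V' V" "g \<in> lm W' W" "h \<in> lm U U'"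
  show ?thesis
  proof (rule blmI)
    fix x assume "x \<in> carrier V'"
    then have "b (f x) \<in> lm W U" using * by (blast intro: blm_right lm_closed)
    from lm_comp[OF lm_comp[OF *(3) this] *(4)] show "(\<lambda>y. h (b (f x) (g y))) \<in> lm W' U'" .
  next
    fix y assume "y \<in> carrier W'"
    then have "(\<lambda>x. b x (g y)) \<in> lm V U" using * by (blast intro: blm_left lm_closed)
    from lm_comp[OF lm_comp[OF *(2) this] *(4)] show "(\<lambda>x. h (b (f x) (g y))) \<in> lm V' U'" .
  qed
qed

lemma blm_sum:
  assumes V: "vs V" "vs W" "vs U" and A: "finite A" and b: "\<And>a. a \<in> A \<Longrightarrow> blm V W U (f a)"
  shows "blm V W U (\<lambda>x y. \<Oplus>\<^bsub>U\<^esub>a\<in>A. f a x y)"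
proof (rule blmI)
  fix x assume "x \<in> carrier V"
  then show "(\<lambda>y. \<Oplus>\<^bsub>U\<^esub>a\<in>A. f a x y) \<in> lm W U" by (intro lm_finsum[OF V(2,3) A] blm_right[OF b])
next
  fix y assume "y \<in> carrier W"
  then show "(\<lambda>x. \<Oplus>\<^bsub>U\<^esub>a\<in>A. f a x y) \<in> lm V U" by (intro lm_finsum[OF V(1,3) A] blm_left[OF b])
qed

text \<open>One argument is extended at a time: first \<open>w\<close> over the span of
  \<open>S'\<close> with \<open>x\<close> in \<open>S\<close> fixed, then \<open>v\<close> over the
  span of \<open>S\<close>.\<close>

lemma blm_eq_on_span:
  assumes "vs V" "vs W" "vs U" "blm V W U b" "blm V W U b'" "S \<subseteq> carrier V" "S' \<subseteq> carrier W"
    "\<And>x y. x \<in> S \<Longrightarrow> y \<in> S' \<Longrightarrow> b x y = b' x y" "v \<in> lin_span K V S" "w \<in> lin_span K W S'"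
  shows "b v w = b' v w"
proof -
  have 1: "b x w = b' x w" if "x \<in> S" for x
    using assms that by (intro lm_eq_on_span[of W U "b x" "b' x" S' w]) (auto simp: blm_right)
  have "w \<in> carrier W" using assms span_carrier by blast
  then show ?thesis using assms 1
    by (intro lm_eq_on_span[of V U "\<lambda>x. b x w" "\<lambda>x. b' x w" S v]) (auto simp: blm_left)
qed

lemma blm_span_in:
  assumes "vs V" "vs W" "vs U" "blm V W U b" "submodule N K U" "S \<subseteq> carrier V" "S' \<subseteq> carrier W"
    "\<And>x y. x \<in> S \<Longrightarrow> y \<in> S' \<Longrightarrow> b x y \<in> N" "v \<in> lin_span K V S" "w \<in> lin_span K W S'"
  shows "b v w \<in> N"
proof -
  have 1: "b x w \<in> N" if "x \<in> S" for x
    using assms that by (intro lm_span_in[of W U "b x" N S' w]) (auto simp: blm_right)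
  have "w \<in> carrier W" using assms span_carrier by blast
  then show ?thesis using assms 1
    by (intro lm_span_in[of V U "\<lambda>x. b x w" N S v]) (auto simp: blm_left)
qed

section \<open>Free vector spaces\<close>

lemma free_carrier: "f \<in> carrier (free_vs K B) \<longleftrightarrow>
  (\<forall>b. f b \<in> carrier K) \<and> (\<forall>b. f b \<noteq> \<zero> \<longrightarrow> b \<in> B) \<and> finite {b. f b \<noteq> \<zero>}"
  by (auto simp: free_vs_def)

lemma free_simps [simp]: "\<zero>\<^bsub>free_vs K B\<^esub> = (\<lambda>_. \<zero>)" "f \<oplus>\<^bsub>free_vs K B\<^esub> g = (\<lambda>b. f b \<oplus> g b)"
  "c \<odot>\<^bsub>free_vs K B\<^esub> f = (\<lambda>b. c \<otimes> f b)"
  by (auto simp: free_vs_def)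

lemma vs_free [simp]: "vs (free_vs K B)"
proof (rule moduleI)
  show "cring K" by (rule is_cring)
  have fin: "finite {b. f b \<oplus> g b \<noteq> \<zero>}" if "finite {b. f b \<noteq> \<zero>}" "finite {b. g b \<noteq> \<zero>}" for f g :: "'z \<Rightarrow> 'k"
    by (rule finite_subset[OF _ finite_UnI[OF that]]) auto
  have fins: "finite {b. c \<otimes> f b \<noteq> \<zero>}" if "finite {b. f b \<noteq> \<zero>}" "c \<in> carrier K" for f :: "'z \<Rightarrow> 'k" and c
    by (rule finite_subset[OF _ that(1)]) (use that(2) in auto)
  show "abelian_group (free_vs K B)"
  proof (rule abelian_groupI)
    fix f assume f: "f \<in> carrier (free_vs K B)"
    have "finite {b. \<ominus> f b \<noteq> \<zero>}" using f
      by (intro finite_subset[of "{b. \<ominus> f b \<noteq> \<zero>}" "{b. f b \<noteq> \<zero>}"]) (auto simp: free_carrier)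
    then have "(\<lambda>b. \<ominus> f b) \<in> carrier (free_vs K B)" using f by (auto simp: free_carrier)
    then show "\<exists>y\<in>carrier (free_vs K B). y \<oplus>\<^bsub>free_vs K B\<^esub> f = \<zero>\<^bsub>free_vs K B\<^esub>"
      using f by (intro bexI[of _ "\<lambda>b. \<ominus> f b"]) (auto simp: l_neg free_carrier)
  next
    fix f g assume "f \<in> carrier (free_vs K B)" "g \<in> carrier (free_vs K B)"
    then show "f \<oplus>\<^bsub>free_vs K B\<^esub> g \<in> carrier (free_vs K B)"
      by (auto simp: free_carrier fin) (metis l_zero)
  qed (auto simp: free_carrier a_ac)
  show "c \<odot>\<^bsub>free_vs K B\<^esub> f \<in> carrier (free_vs K B)" if "c \<in> carrier K" "f \<in> carrier (free_vs K B)" for c f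
    using that by (auto simp: free_carrier fins) (metis r_null)
qed (auto simp: free_carrier l_distr r_distr m_ac)

lemma basis_vec_in [simp, intro]: "b \<in> B \<Longrightarrow> basis_vec K b \<in> carrier (free_vs K B)"
  by (auto simp: free_carrier basis_vec_def)

lemma eval_lm: "(\<lambda>f. f b) \<in> lm (free_vs K B) (base_vs K)"
  by (intro lmI) (auto simp: free_carrier)

text \<open>\<open>lin_ext\<close> sums over the support, which differs for \<open>f\<close>,
  \<open>g\<close> and their sum; linearity is proved after passing to a common index set
  \<open>A\<close>.\<close>

lemma lin_ext_sum:
  assumes "vs U" "f \<in> carrier (free_vs K B)" "\<And>b. b \<in> B \<Longrightarrow> \<phi> b \<in> carrier U"
    "finite A" "A \<subseteq> B" "\<And>b. f b \<noteq> \<zero> \<Longrightarrow> b \<in> A"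
  shows "lin_ext K U \<phi> f = (\<Oplus>\<^bsub>U\<^esub>b\<in>A. f b \<odot>\<^bsub>U\<^esub> \<phi> b)"
  unfolding lin_ext_def
  using assms by (intro sum_mono_neutral) (auto simp: free_carrier Module.module.smult_l_null subset_iff)

lemma lin_ext_lm:
  assumes U: "vs U" and phi: "\<And>b. b \<in> B \<Longrightarrow> \<phi> b \<in> carrier U"
  shows "lin_ext K U \<phi> \<in> lm (free_vs K B) U"
proof (rule lmI)
  interpret U: Module.module K U by fact
  fix f assume f: "f \<in> carrier (free_vs K B)"
  then show "lin_ext K U \<phi> f \<in> carrier U"
    unfolding lin_ext_def using U phi by (intro vs_sum) (auto simp: free_carrier)
  { fix g assume g: "g \<in> carrier (free_vs K B)"
    let ?A = "{b. f b \<noteq> \<zero>} \<union> {b. g b \<noteq> \<zero>}"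
    have A: "finite ?A" "?A \<subseteq> B" using f g by (auto simp: free_carrier)
    have fg: "f \<oplus>\<^bsub>free_vs K B\<^esub> g \<in> carrier (free_vs K B)" using f g by (intro vs_add) auto
    have car: "f b \<in> carrier K" "g b \<in> carrier K" for b using f g by (auto simp: free_carrier)
    have *: "lin_ext K U \<phi> h = (\<Oplus>\<^bsub>U\<^esub>b\<in>?A. h b \<odot>\<^bsub>U\<^esub> \<phi> b)"
      if "h \<in> {f, g, f \<oplus>\<^bsub>free_vs K B\<^esub> g}" (is "_ \<in> ?H") for h
    proof (rule lin_ext_sum[OF U])
      show "h \<in> carrier (free_vs K B)" using that f g fg by blast
      show "b \<in> ?A" if "h b \<noteq> \<zero>" for b
      proof (rule ccontr)
        assume "b \<notin> ?A" then have "f b = \<zero>" "g b = \<zero>" by auto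
        with that \<open>h \<in> ?H\<close> show False by auto
      qed
    qed (use phi A in auto)
    have "(\<Oplus>\<^bsub>U\<^esub>b\<in>?A. (f \<oplus>\<^bsub>free_vs K B\<^esub> g) b \<odot>\<^bsub>U\<^esub> \<phi> b) =
      (\<Oplus>\<^bsub>U\<^esub>b\<in>?A. (f b \<odot>\<^bsub>U\<^esub> \<phi> b) \<oplus>\<^bsub>U\<^esub> (g b \<odot>\<^bsub>U\<^esub> \<phi> b))"
      using A phi car by (intro sum_cong[OF U]) (auto simp: U.smult_l_distr subset_iff)
    also have "\<dots> = lin_ext K U \<phi> f \<oplus>\<^bsub>U\<^esub> lin_ext K U \<phi> g"
      using A phi car *[of f] *[of g] by (subst sum_add[OF U]) (auto simp: subset_iff)
    finally show "lin_ext K U \<phi> (f \<oplus>\<^bsub>free_vs K B\<^esub> g) = lin_ext K U \<phi> f \<oplus>\<^bsub>U\<^esub> lin_ext K U \<phi> g"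
      using *[of "f \<oplus>\<^bsub>free_vs K B\<^esub> g"] by simp }
  { fix c assume c: "c \<in> carrier K"
    let ?A = "{b. f b \<noteq> \<zero>}"
    have A: "finite ?A" "?A \<subseteq> B" using f by (auto simp: free_carrier)
    have car: "f b \<in> carrier K" for b using f by (auto simp: free_carrier)
    have "c \<odot>\<^bsub>free_vs K B\<^esub> f \<in> carrier (free_vs K B)" using f c by (intro vs_smult) auto
    then have "lin_ext K U \<phi> (c \<odot>\<^bsub>free_vs K B\<^esub> f) = (\<Oplus>\<^bsub>U\<^esub>b\<in>?A. (c \<odot>\<^bsub>free_vs K B\<^esub> f) b \<odot>\<^bsub>U\<^esub> \<phi> b)"
      using A phi c by (intro lin_ext_sum[OF U]) auto
    also have "\<dots> = (\<Oplus>\<^bsub>U\<^esub>b\<in>?A. c \<odot>\<^bsub>U\<^esub> (f b \<odot>\<^bsub>U\<^esub> \<phi> b))"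
      using A phi car c by (intro sum_cong[OF U]) (auto simp: U.smult_assoc1 subset_iff)
    also have "\<dots> = c \<odot>\<^bsub>U\<^esub> lin_ext K U \<phi> f"
      unfolding lin_ext_def using A phi car c by (intro sum_smult[OF U]) (auto simp: subset_iff)
    finally show "lin_ext K U \<phi> (c \<odot>\<^bsub>free_vs K B\<^esub> f) = c \<odot>\<^bsub>U\<^esub> lin_ext K U \<phi> f" . }
qed

lemma lin_ext_basis:
  assumes "vs U" "\<phi> b \<in> carrier U"
  shows "lin_ext K U \<phi> (basis_vec K b) = \<phi> b"
proof -
  have "{c. basis_vec K b c \<noteq> \<zero>} = {b}" by (auto simp: basis_vec_def)
  then show ?thesis
    using assms sum_single[of U "{b}" b "\<lambda>c. basis_vec K b c \<odot>\<^bsub>U\<^esub> \<phi> c"]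
    by (simp add: lin_ext_def basis_vec_def Module.module.smult_one)
qed

text \<open>Evaluation at a basis element is linear, so the identity is checked coordinate by
  coordinate, where one term of the sum survives.\<close>

lemma free_decomp:
  assumes f: "f \<in> carrier (free_vs K B)"
  shows "f = (\<Oplus>\<^bsub>free_vs K B\<^esub>b\<in>{b. f b \<noteq> \<zero>}. f b \<odot>\<^bsub>free_vs K B\<^esub> basis_vec K b)" (is "f = ?s")
proof
  fix c
  let ?A = "{b. f b \<noteq> \<zero>}"
  have A: "finite ?A" "?A \<subseteq> B" and car: "\<And>b. f b \<in> carrier K" using f by (auto simp: free_carrier)
  have "?s c = (\<Oplus>\<^bsub>base_vs K\<^esub>b\<in>?A. (f b \<odot>\<^bsub>free_vs K B\<^esub> basis_vec K b) c)"
    using A car by (intro lm_sum[OF vs_free vs_base eval_lm[of c]] vs_smult basis_vec_in) auto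
  also have "\<dots> = (\<Oplus>\<^bsub>base_vs K\<^esub>b\<in>?A. if b = c then f c else \<zero>)"
    using car by (intro sum_cong) (auto simp: basis_vec_def)
  also have "\<dots> = f c"
  proof (cases "c \<in> ?A")
    case True
    then show ?thesis using A car sum_single[of "base_vs K" ?A c "\<lambda>b. if b = c then f c else \<zero>"] by auto
  next
    case False
    then have "(\<Oplus>\<^bsub>base_vs K\<^esub>b\<in>?A. if b = c then f c else \<zero>) = \<zero>\<^bsub>base_vs K\<^esub>"
      by (intro sum_zero) auto
    with False show ?thesis by simp
  qed
  finally show "f c = ?s c" ..
qed

lemma basis_sub: "basis_vec K ` B \<subseteq> carrier (free_vs K B)" by auto

lemma free_in_span:
  assumes f: "f \<in> carrier (free_vs K B)" and S: "\<And>b. f b \<noteq> \<zero> \<Longrightarrow> b \<in> S" "S \<subseteq> B"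
  shows "f \<in> lin_span K (free_vs K B) (basis_vec K ` S)"
proof (subst free_decomp[OF f], rule submod_sum[OF vs_free])
  show sm: "submodule (lin_span K (free_vs K B) (basis_vec K ` S)) K (free_vs K B)"
    using S by (intro span_submod) auto
  show "f b \<odot>\<^bsub>free_vs K B\<^esub> basis_vec K b \<in> lin_span K (free_vs K B) (basis_vec K ` S)"
    if "b \<in> {b. f b \<noteq> \<zero>}" for b
    using that S f by (intro submod_smult[OF sm] set_mp[OF span_superset]) (auto simp: free_carrier)
qed

lemma free_span: "f \<in> carrier (free_vs K B) \<Longrightarrow> f \<in> lin_span K (free_vs K B) (basis_vec K ` B)"
  by (rule free_in_span) (auto simp: free_carrier)

lemma free_ext:
  assumes "vs W" "f \<in> lm (free_vs K B) W" "g \<in> lm (free_vs K B) W"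
    "\<And>b. b \<in> B \<Longrightarrow> f (basis_vec K b) = g (basis_vec K b)" "v \<in> carrier (free_vs K B)"
  shows "f v = g v"
  by (rule lm_eq_on_span[OF vs_free assms(1-3) basis_sub _ free_span]) (use assms(4,5) in auto)

lemma free_ext2:
  assumes "vs W" "blm (free_vs K B) (free_vs K C) W f" "blm (free_vs K B) (free_vs K C) W g"
    "\<And>b c. b \<in> B \<Longrightarrow> c \<in> C \<Longrightarrow> f (basis_vec K b) (basis_vec K c) = g (basis_vec K b) (basis_vec K c)"
    "v \<in> carrier (free_vs K B)" "w \<in> carrier (free_vs K C)"
  shows "f v w = g v w"
  by (rule blm_eq_on_span[OF vs_free vs_free assms(1-3) basis_sub basis_sub _ free_span free_span])
    (use assms(4-) in auto)

text \<open>Linearity in the outer argument is that of \<open>lin_ext\<close>. In the inner argument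
  the outer extension is a finite combination, over the support of \<open>f\<close>, of maps linear
  in \<open>g\<close>.\<close>

lemma lin_ext2_blm:
  assumes U: "vs U" and phi: "\<And>b c. b \<in> B \<Longrightarrow> c \<in> C \<Longrightarrow> \<phi> b c \<in> carrier U"
  shows "blm (free_vs K B) (free_vs K C) U (\<lambda>f g. lin_ext K U (\<lambda>b. lin_ext K U (\<phi> b) g) f)"
proof (rule blmI)
  fix g assume "g \<in> carrier (free_vs K C)"
  then show "(\<lambda>f. lin_ext K U (\<lambda>b. lin_ext K U (\<phi> b) g) f) \<in> lm (free_vs K B) U"
    by (intro lin_ext_lm U lm_closed[OF lin_ext_lm[OF U phi]])
next
  fix f assume f: "f \<in> carrier (free_vs K B)"
  then have "f b \<in> carrier K" "f b \<noteq> \<zero> \<Longrightarrow> b \<in> B" "finite {b. f b \<noteq> \<zero>}" for b by (auto simp: free_carrier)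
  then show "(\<lambda>g. lin_ext K U (\<lambda>b. lin_ext K U (\<phi> b) g) f) \<in> lm (free_vs K C) U"
    unfolding lin_ext_def[of K U _ f]
    by (intro lm_finsum vs_free U lm_scale lin_ext_lm phi) auto
qed

section \<open>Quotient spaces\<close>

lemma submod_absub: "vs V \<Longrightarrow> submodule N K V \<Longrightarrow> abelian_subgroup N V"
  by (intro abelian_subgroupI3 vs_ab additive_subgroupI submodule.axioms(1))

lemma coset_eq_iff:
  assumes "vs V" "submodule N K V" "v \<in> carrier V" "w \<in> carrier V"
  shows "N +>\<^bsub>V\<^esub> v = N +>\<^bsub>V\<^esub> w \<longleftrightarrow> v \<ominus>\<^bsub>V\<^esub> w \<in> N"
proof -
  interpret abelian_subgroup N V using assms by (intro submod_absub)
  show ?thesis using assms(3,4) a_rcos_module[of w v]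
    by (metis a_minus_def a_repr_independence' a_rcos_self)
qed

lemma coset_eqI:
  assumes "vs V" "submodule N K V" "v \<in> carrier V" "w \<in> carrier V" "v \<ominus>\<^bsub>V\<^esub> w \<in> N"
  shows "N +>\<^bsub>V\<^esub> v = N +>\<^bsub>V\<^esub> w"
  using assms by (simp add: coset_eq_iff)

lemma coset_memD:
  assumes "vs V" "submodule N K V" "v \<in> carrier V" "w \<in> N +>\<^bsub>V\<^esub> v"
  shows "w \<in> carrier V" "w \<ominus>\<^bsub>V\<^esub> v \<in> N"
proof -
  interpret abelian_subgroup N V using assms by (intro submod_absub)
  show "w \<in> carrier V" "w \<ominus>\<^bsub>V\<^esub> v \<in> N"
    using assms(3,4) a_elemrcos_carrier a_rcos_module_imp by (auto simp: a_minus_def)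
qed

lemma coset_self: "vs V \<Longrightarrow> submodule N K V \<Longrightarrow> v \<in> carrier V \<Longrightarrow> v \<in> N +>\<^bsub>V\<^esub> v"
  using abelian_subgroup.a_rcos_self[OF submod_absub] .

lemma quot_carrier: "carrier (quot_vs V N) = (\<lambda>v. N +>\<^bsub>V\<^esub> v) ` carrier V"
  by (auto simp: quot_vs_def A_RCOSETS_def' a_r_coset_def')

lemma quot_zero: "vs V \<Longrightarrow> submodule N K V \<Longrightarrow> \<zero>\<^bsub>quot_vs V N\<^esub> = N +>\<^bsub>V\<^esub> \<zero>\<^bsub>V\<^esub>"
proof -
  assume *: "vs V" "submodule N K V"
  then interpret abelian_subgroup N V by (rule submod_absub)
  show ?thesis using a_rcos_const[OF submod_zero[OF *(2)]] by (simp add: quot_vs_def)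
qed

lemma quot_add: "vs V \<Longrightarrow> submodule N K V \<Longrightarrow> v \<in> carrier V \<Longrightarrow> w \<in> carrier V \<Longrightarrow>
  (N +>\<^bsub>V\<^esub> v) \<oplus>\<^bsub>quot_vs V N\<^esub> (N +>\<^bsub>V\<^esub> w) = N +>\<^bsub>V\<^esub> (v \<oplus>\<^bsub>V\<^esub> w)"
  using abelian_subgroup.a_rcos_sum[OF submod_absub] by (simp add: quot_vs_def)

text \<open>In \<open>quot_vs\<close> the scalar multiple of a coset is a union over all its
  representatives. All the cosets in this union coincide because \<open>N\<close> is stable under
  scalars.\<close>

lemma quot_smult:
  assumes "vs V" "submodule N K V" "v \<in> carrier V" "c \<in> carrier K"
  shows "c \<odot>\<^bsub>quot_vs V N\<^esub> (N +>\<^bsub>V\<^esub> v) = N +>\<^bsub>V\<^esub> (c \<odot>\<^bsub>V\<^esub> v)"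
proof -
  have 1: "N +>\<^bsub>V\<^esub> (c \<odot>\<^bsub>V\<^esub> a) = N +>\<^bsub>V\<^esub> (c \<odot>\<^bsub>V\<^esub> v)" if "a \<in> N +>\<^bsub>V\<^esub> v" for a
  proof -
    have a: "a \<in> carrier V" "a \<ominus>\<^bsub>V\<^esub> v \<in> N" using coset_memD[OF assms(1-3) that] by auto
    have "(\<lambda>x. c \<odot>\<^bsub>V\<^esub> x) \<in> lm V V" using assms by (intro lm_scale lm_id)
    from lm_minus[OF assms(1,1) this a(1) assms(3)]
    have "c \<odot>\<^bsub>V\<^esub> a \<ominus>\<^bsub>V\<^esub> c \<odot>\<^bsub>V\<^esub> v = c \<odot>\<^bsub>V\<^esub> (a \<ominus>\<^bsub>V\<^esub> v)" by simp
    moreover have "c \<odot>\<^bsub>V\<^esub> (a \<ominus>\<^bsub>V\<^esub> v) \<in> N" by (rule submod_smult[OF assms(2,4) a(2)])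
    ultimately show ?thesis using assms a by (intro coset_eqI) simp_all
  qed
  have "c \<odot>\<^bsub>quot_vs V N\<^esub> (N +>\<^bsub>V\<^esub> v) = (\<Union>a\<in>N +>\<^bsub>V\<^esub> v. N +>\<^bsub>V\<^esub> (c \<odot>\<^bsub>V\<^esub> v))"
    by (simp add: quot_vs_def 1)
  then show ?thesis using coset_self[OF assms(1-3)] by blast
qed

lemma vs_quot:
  assumes V: "vs V" and N: "submodule N K V"
  shows "vs (quot_vs V N)"
proof -
  interpret V: Module.module K V by fact
  note [simp] = quot_add[OF V N] quot_smult[OF V N] quot_zero[OF V N] quot_carrier
  show ?thesis
  proof (rule moduleI)
    show "cring K" by (rule is_cring)
    show "abelian_group (quot_vs V N)"
    proof (rule abelian_groupI)
      fix x assume "x \<in> carrier (quot_vs V N)"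
      then obtain v where v: "v \<in> carrier V" "x = N +>\<^bsub>V\<^esub> v" by auto
      then have "(N +>\<^bsub>V\<^esub> (\<ominus>\<^bsub>V\<^esub> v)) \<oplus>\<^bsub>quot_vs V N\<^esub> x = \<zero>\<^bsub>quot_vs V N\<^esub>" by (simp add: V.l_neg)
      then show "\<exists>y\<in>carrier (quot_vs V N). y \<oplus>\<^bsub>quot_vs V N\<^esub> x = \<zero>\<^bsub>quot_vs V N\<^esub>"
        using v by (intro bexI[of _ "N +>\<^bsub>V\<^esub> (\<ominus>\<^bsub>V\<^esub> v)"]) auto
    qed (auto simp: V.a_ac)
  qed (auto simp: V.smult_l_distr V.smult_r_distr V.smult_assoc1)
qed

lemma proj_lm: "vs V \<Longrightarrow> submodule N K V \<Longrightarrow> (\<lambda>v. N +>\<^bsub>V\<^esub> v) \<in> lm V (quot_vs V N)"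
  by (intro lmI) (auto simp: quot_add quot_smult quot_carrier)

text \<open>A map that vanishes on \<open>N\<close> is constant on each coset, so the image is a
  singleton and \<open>the_elem\<close> returns the common value. Maps out of tensor products and
  coinvariants are evaluated in this way.\<close>

lemma coset_lift:
  assumes "vs V" "vs U" "submodule N K V" "f \<in> lm V U" "\<And>x. x \<in> N \<Longrightarrow> f x = \<zero>\<^bsub>U\<^esub>" "v \<in> carrier V"
  shows "the_elem (f ` (N +>\<^bsub>V\<^esub> v)) = f v"
proof -
  have "f w = f v" if "w \<in> N +>\<^bsub>V\<^esub> v" for w
  proof -
    have w: "w \<in> carrier V" "w \<ominus>\<^bsub>V\<^esub> v \<in> N" using coset_memD[OF assms(1,3,6) that] .
    then have "f w \<ominus>\<^bsub>U\<^esub> f v = \<zero>\<^bsub>U\<^esub>" using lm_minus[OF assms(1,2,4) w(1) assms(6)] assms(5) by simp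
    then show ?thesis by (rule vs_minus_zeroD[OF assms(2) lm_closed[OF assms(4) w(1)] lm_closed[OF assms(4,6)]])
  qed
  then have "f ` (N +>\<^bsub>V\<^esub> v) = {f v}" using coset_self[OF assms(1,3,6)] by blast
  then show ?thesis by simp
qed

lemma coset_lift_lm:
  assumes "vs V" "vs U" "submodule N K V" "f \<in> lm V U" "\<And>x. x \<in> N \<Longrightarrow> f x = \<zero>\<^bsub>U\<^esub>"
  shows "(\<lambda>A. the_elem (f ` A)) \<in> lm (quot_vs V N) U"
proof -
  note l = coset_lift[OF assms]
  have c: "\<And>x. x \<in> carrier V \<Longrightarrow> f x \<in> carrier U" by (rule lm_closed[OF assms(4)])
  show ?thesis
    by (intro lmI) (auto simp: quot_carrier l c quot_add[OF assms(1,3)] quot_smult[OF assms(1,3)]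
        lm_add[OF assms(4)] lm_smult[OF assms(4)] vs_add[OF assms(1)] vs_smult[OF assms(1)])
qed

lemma lm_vanish_span:
  assumes "vs V" "vs U" "f \<in> lm V U" "S \<subseteq> carrier V" "\<And>x. x \<in> S \<Longrightarrow> f x = \<zero>\<^bsub>U\<^esub>" "x \<in> lin_span K V S"
  shows "f x = \<zero>\<^bsub>U\<^esub>"
  using lm_eq_on_span[OF assms(1,2,3) lm_const_zero[OF assms(2)] assms(4)] assms(5,6) by simp

section \<open>Tensor products\<close>

lemma bilin_rels_sub: assumes "vs V" "vs W" shows "bilin_rels K V W \<subseteq> carrier (free_vs K (carrier V \<times> carrier W))"
  unfolding bilin_rels_def Let_def using assms
  by (intro Un_least subsetI; clarsimp simp del: free_simps; intro vs_minus vs_add vs_smult vs_free basis_vec_in; simp)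

lemma bilin_submod: "vs V \<Longrightarrow> vs W \<Longrightarrow> submodule (bilin_sub K V W) K (free_vs K (carrier V \<times> carrier W))"
  unfolding bilin_sub_def by (intro span_submod bilin_rels_sub) auto

lemma vs_tensor [simp, intro]: "vs V \<Longrightarrow> vs W \<Longrightarrow> vs (tensor K V W)"
  unfolding tensor_def by (intro vs_quot bilin_submod) auto

lemma tens_relI:
  assumes V: "vs V" "vs W" and f: "f \<ominus>\<^bsub>free_vs K (carrier V \<times> carrier W)\<^esub> g \<in> bilin_rels K V W"
    and "f \<in> carrier (free_vs K (carrier V \<times> carrier W))" "g \<in> carrier (free_vs K (carrier V \<times> carrier W))"
  shows "bilin_sub K V W +>\<^bsub>free_vs K (carrier V \<times> carrier W)\<^esub> f = bilin_sub K V W +>\<^bsub>free_vs K (carrier V \<times> carrier W)\<^esub> g"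
  using assms by (intro coset_eqI bilin_submod) (auto simp: bilin_sub_def span_superset[THEN set_mp])

text \<open>Each of the four laws of bilinearity is one of the four families of relations that were
  divided out.\<close>

lemma tens_blm:
  assumes V: "vs V" "vs W"
  shows "blm V W (tensor K V W) (tens K V W)"
proof -
  let ?F = "free_vs K (carrier V \<times> carrier W)"
  let ?p = "\<lambda>f. bilin_sub K V W +>\<^bsub>?F\<^esub> f"
  have p: "?p \<in> lm ?F (tensor K V W)" unfolding tensor_def using V by (intro proj_lm bilin_submod) auto
  have b: "basis_vec K (v, w) \<in> carrier ?F" if "v \<in> carrier V" "w \<in> carrier W" for v w using that by auto
  have t: "tens K V W v w = ?p (basis_vec K (v, w))" for v w by (simp add: tens_def)
  note pa = lm_add[OF p, symmetric] and ps = lm_smult[OF p, symmetric]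
  show ?thesis
  proof (rule blmI; rule lmI; (unfold t)?)
    fix v w assume "v \<in> carrier V" "w \<in> carrier W"
    then show "?p (basis_vec K (v, w)) \<in> carrier (tensor K V W)" by (intro lm_closed[OF p] b)
  next
    fix v w assume "v \<in> carrier V" "w \<in> carrier W"
    then show "?p (basis_vec K (v, w)) \<in> carrier (tensor K V W)" by (intro lm_closed[OF p] b)
  next
    fix v w w' assume *: "v \<in> carrier V" "w \<in> carrier W" "w' \<in> carrier W"
    show "?p (basis_vec K (v, w \<oplus>\<^bsub>W\<^esub> w')) = ?p (basis_vec K (v, w)) \<oplus>\<^bsub>tensor K V W\<^esub> ?p (basis_vec K (v, w'))"
      using * V by (subst pa[OF b b]; (intro tens_relI V b vs_add vs_free)?)
       (auto simp: bilin_rels_def Let_def simp del: free_simps)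
  next
    fix v w w' assume *: "v \<in> carrier W" "w \<in> carrier V" "w' \<in> carrier V"
    show "?p (basis_vec K (w \<oplus>\<^bsub>V\<^esub> w', v)) = ?p (basis_vec K (w, v)) \<oplus>\<^bsub>tensor K V W\<^esub> ?p (basis_vec K (w', v))"
      using * V by (subst pa[OF b b]; (intro tens_relI V b vs_add vs_free)?)
       (auto simp: bilin_rels_def Let_def simp del: free_simps)
  next
    fix v w c assume *: "v \<in> carrier V" "w \<in> carrier W" "c \<in> carrier K"
    show "?p (basis_vec K (v, c \<odot>\<^bsub>W\<^esub> w)) = c \<odot>\<^bsub>tensor K V W\<^esub> ?p (basis_vec K (v, w))"
      using * V by (subst ps[OF _ b]; (intro tens_relI V b vs_smult vs_free)?)
       (auto simp: bilin_rels_def Let_def simp del: free_simps)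
  next
    fix v w c assume *: "v \<in> carrier W" "w \<in> carrier V" "c \<in> carrier K"
    show "?p (basis_vec K (c \<odot>\<^bsub>V\<^esub> w, v)) = c \<odot>\<^bsub>tensor K V W\<^esub> ?p (basis_vec K (w, v))"
      using * V by (subst ps[OF _ b]; (intro tens_relI V b vs_smult vs_free)?)
       (auto simp: bilin_rels_def Let_def simp del: free_simps)
  qed
qed

lemma tens_closed [simp, intro]: "vs V \<Longrightarrow> vs W \<Longrightarrow> v \<in> carrier V \<Longrightarrow> w \<in> carrier W \<Longrightarrow> tens K V W v w \<in> carrier (tensor K V W)"
  by (rule blm_closed[OF tens_blm])

text \<open>The universal property on the level of representatives: the linear extension of a
  bilinear \<open>b\<close> kills every defining relation, hence their span, and so
  \<open>coset_lift\<close> applies to it.\<close>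

lemma lift_aux:
  assumes V: "vs V" "vs W" "vs U" and b: "blm V W U b"
  defines "L \<equiv> lin_ext K U (\<lambda>(v, w). b v w)"
  shows "L \<in> lm (free_vs K (carrier V \<times> carrier W)) U"
    "\<And>x. x \<in> bilin_sub K V W \<Longrightarrow> L x = \<zero>\<^bsub>U\<^esub>"
    "\<And>v w. v \<in> carrier V \<Longrightarrow> w \<in> carrier W \<Longrightarrow> L (basis_vec K (v, w)) = b v w"
proof -
  let ?F = "free_vs K (carrier V \<times> carrier W)"
  show L: "L \<in> lm ?F U" unfolding L_def using V blm_closed[OF b] by (intro lin_ext_lm) auto
  show Lb: "L (basis_vec K (v, w)) = b v w" if "v \<in> carrier V" "w \<in> carrier W" for v w
    unfolding L_def using V that blm_closed[OF b] by (subst lin_ext_basis) auto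
  have bv: "basis_vec K (v, w) \<in> carrier ?F" if "v \<in> carrier V" "w \<in> carrier W" for v w using that by auto
  note bl = blm_right[OF b] blm_left[OF b]
  show "L x = \<zero>\<^bsub>U\<^esub>" if "x \<in> bilin_sub K V W" for x
  proof (rule lm_vanish_span[OF vs_free V(3) L bilin_rels_sub[OF V(1,2)] _ that[unfolded bilin_sub_def]])
    fix x assume "x \<in> bilin_rels K V W"
    then show "L x = \<zero>\<^bsub>U\<^esub>"
      unfolding bilin_rels_def Let_def
      using V blm_closed[OF b]
      by (elim UnE CollectE exE conjE)
       (simp_all add: lm_minus[OF vs_free V(3) L] lm_add[OF L] lm_smult[OF L] Lb bv vs_free[THEN vs_add] vs_free[THEN vs_smult]
          lm_add[OF bl(1)] lm_smult[OF bl(1)] lm_add[OF bl(2)] lm_smult[OF bl(2)] del: free_simps)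
  qed
qed

lemma tensor_lift_lm: "vs V \<Longrightarrow> vs W \<Longrightarrow> vs U \<Longrightarrow> blm V W U b \<Longrightarrow> tensor_lift K U b \<in> lm (tensor K V W) U"
  unfolding tensor_lift_def[abs_def] tensor_def
  by (intro coset_lift_lm bilin_submod lift_aux vs_free)

lemma tensor_lift_tens: "vs V \<Longrightarrow> vs W \<Longrightarrow> vs U \<Longrightarrow> blm V W U b \<Longrightarrow> v \<in> carrier V \<Longrightarrow> w \<in> carrier W \<Longrightarrow>
   tensor_lift K U b (tens K V W v w) = b v w"
  unfolding tensor_lift_def tens_def
  by (subst coset_lift[OF vs_free _ bilin_submod lift_aux(1,2)]) (auto simp: lift_aux(3))

text \<open>The coset of a free basis vector is a pure tensor, and bilinearity expands its two
  factors over \<open>S\<close> and \<open>S'\<close>.\<close>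

lemma tensor_span:
  assumes V: "vs V" "vs W" and t: "t \<in> carrier (tensor K V W)"
    and S: "S \<subseteq> carrier V" "S' \<subseteq> carrier W" "carrier V \<subseteq> lin_span K V S" "carrier W \<subseteq> lin_span K W S'"
  shows "t \<in> lin_span K (tensor K V W) {tens K V W v w |v w. v \<in> S \<and> w \<in> S'}"
proof -
  let ?F = "free_vs K (carrier V \<times> carrier W)"
  let ?N = "lin_span K (tensor K V W) {tens K V W v w |v w. v \<in> S \<and> w \<in> S'}"
  let ?p = "\<lambda>f. bilin_sub K V W +>\<^bsub>?F\<^esub> f"
  have p: "?p \<in> lm ?F (tensor K V W)" unfolding tensor_def using V by (intro proj_lm bilin_submod) auto
  have N: "submodule ?N K (tensor K V W)" using V S by (intro span_submod) (auto simp: subset_iff)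
  obtain f where f: "f \<in> carrier ?F" "t = ?p f" using t unfolding tensor_def quot_carrier by auto
  have "?p f \<in> ?N"
  proof (rule lm_span_in[OF vs_free vs_tensor[OF V] p N basis_sub _ free_span[OF f(1)]])
    fix x assume "x \<in> basis_vec K ` (carrier V \<times> carrier W)"
    then obtain v w where vw: "x = basis_vec K (v, w)" "v \<in> carrier V" "w \<in> carrier W" by auto
    have "tens K V W v w \<in> ?N"
    proof (rule blm_span_in[OF V vs_tensor[OF V] tens_blm[OF V] N S(1,2)])
      show "tens K V W x y \<in> ?N" if "x \<in> S" "y \<in> S'" for x y
        using that by (intro span_superset[THEN set_mp]) blast
    qed (use vw S in blast)+
    then show "?p x \<in> ?N" by (simp add: vw tens_def)
  qed
  then show ?thesis using f by simp
qed

lemma tensor_ext: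
  assumes "vs V" "vs W" "vs U" "f \<in> lm (tensor K V W) U" "g \<in> lm (tensor K V W) U"
    "\<And>v w. v \<in> carrier V \<Longrightarrow> w \<in> carrier W \<Longrightarrow> f (tens K V W v w) = g (tens K V W v w)"
    "t \<in> carrier (tensor K V W)"
  shows "f t = g t"
proof (rule lm_eq_on_span[OF vs_tensor[OF assms(1,2)] assms(3-5) _ _
      tensor_span[OF assms(1,2,7) subset_refl subset_refl span_superset span_superset]])
  show "{tens K V W v w |v w. v \<in> carrier V \<and> w \<in> carrier W} \<subseteq> carrier (tensor K V W)"
    using tens_closed[OF assms(1,2)] by blast
qed (use assms(6) in blast)

lemma tensor_ext2:
  assumes "vs V" "vs W" "vs V'" "vs W'" "vs U" "blm (tensor K V W) (tensor K V' W') U f" "blm (tensor K V W) (tensor K V' W') U g"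
    "\<And>v w v' w'. v \<in> carrier V \<Longrightarrow> w \<in> carrier W \<Longrightarrow> v' \<in> carrier V' \<Longrightarrow> w' \<in> carrier W' \<Longrightarrow>
       f (tens K V W v w) (tens K V' W' v' w') = g (tens K V W v w) (tens K V' W' v' w')"
    "t \<in> carrier (tensor K V W)" "t' \<in> carrier (tensor K V' W')"
  shows "f t t' = g t t'"
proof (rule blm_eq_on_span[OF vs_tensor[OF assms(1,2)] vs_tensor[OF assms(3,4)] assms(5-7) _ _ _
      tensor_span[OF assms(1,2,9) subset_refl subset_refl span_superset span_superset]
      tensor_span[OF assms(3,4,10) subset_refl subset_refl span_superset span_superset]])
  show "{tens K V W v w |v w. v \<in> carrier V \<and> w \<in> carrier W} \<subseteq> carrier (tensor K V W)"
    using tens_closed[OF assms(1,2)] by blast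
  show "{tens K V' W' v w |v w. v \<in> carrier V' \<and> w \<in> carrier W'} \<subseteq> carrier (tensor K V' W')"
    using tens_closed[OF assms(3,4)] by blast
qed (use assms(8) in blast)

lemma tensor_map_blm:
  "vs V' \<Longrightarrow> vs W' \<Longrightarrow> f \<in> lm V V' \<Longrightarrow> g \<in> lm W W' \<Longrightarrow>
    blm V W (tensor K V' W') (\<lambda>v w. tens K V' W' (f v) (g w))"
  by (rule blm_comp[OF tens_blm _ _ lm_id])

lemma tensor_map_lm: "vs V \<Longrightarrow> vs W \<Longrightarrow> vs V' \<Longrightarrow> vs W' \<Longrightarrow> f \<in> lm V V' \<Longrightarrow> g \<in> lm W W' \<Longrightarrow>
  tensor_map K V' W' f g \<in> lm (tensor K V W) (tensor K V' W')"
  unfolding tensor_map_def by (intro tensor_lift_lm tensor_map_blm vs_tensor)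

lemma tensor_map_tens: "vs V \<Longrightarrow> vs W \<Longrightarrow> vs V' \<Longrightarrow> vs W' \<Longrightarrow> f \<in> lm V V' \<Longrightarrow> g \<in> lm W W' \<Longrightarrow>
  v \<in> carrier V \<Longrightarrow> w \<in> carrier W \<Longrightarrow>
  tensor_map K V' W' f g (tens K V W v w) = tens K V' W' (f v) (g w)"
  unfolding tensor_map_def by (intro tensor_lift_tens tensor_map_blm vs_tensor)

lemma tensor_map_comp:
  assumes "vs V" "vs W" "vs V'" "vs W'" "vs V2" "vs W2" "f \<in> lm V V'" "g \<in> lm W W'" "f' \<in> lm V' V2" "g' \<in> lm W' W2"
    "t \<in> carrier (tensor K V W)"
  shows "tensor_map K V2 W2 f' g' (tensor_map K V' W' f g t) = tensor_map K V2 W2 (\<lambda>x. f' (f x)) (\<lambda>x. g' (g x)) t"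
proof (rule tensor_ext[OF assms(1,2) vs_tensor[OF assms(5,6)] _ _ _ assms(11)])
  note fc = lm_closed[OF assms(7)] lm_closed[OF assms(8)]
  note t1 = tensor_map_tens[OF assms(1-4,7,8)] and t2 = tensor_map_tens[OF assms(3-6,9,10)]
    and t3 = tensor_map_tens[OF assms(1,2,5,6) lm_comp[OF assms(7,9)] lm_comp[OF assms(8,10)]]
  show "(\<lambda>t. tensor_map K V2 W2 f' g' (tensor_map K V' W' f g t)) \<in> lm (tensor K V W) (tensor K V2 W2)"
    by (rule lm_comp[OF tensor_map_lm[OF assms(1-4,7,8)] tensor_map_lm[OF assms(3-6,9,10)]])
  show "tensor_map K V2 W2 (\<lambda>x. f' (f x)) (\<lambda>x. g' (g x)) \<in> lm (tensor K V W) (tensor K V2 W2)"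
    by (rule tensor_map_lm[OF assms(1,2,5,6) lm_comp[OF assms(7,9)] lm_comp[OF assms(8,10)]])
  fix v w assume "v \<in> carrier V" "w \<in> carrier W"
  then show "tensor_map K V2 W2 f' g' (tensor_map K V' W' f g (tens K V W v w)) =
    tensor_map K V2 W2 (\<lambda>x. f' (f x)) (\<lambda>x. g' (g x)) (tens K V W v w)"
    by (simp add: t1 t2 t3 fc)
qed

lemma tensor_map_cong:
  assumes "vs V" "vs W" "vs V'" "vs W'" "f \<in> lm V V'" "g \<in> lm W W'" "f' \<in> lm V V'" "g' \<in> lm W W'"
    "\<And>x. x \<in> carrier V \<Longrightarrow> f x = f' x" "\<And>x. x \<in> carrier W \<Longrightarrow> g x = g' x"
    "t \<in> carrier (tensor K V W)"
  shows "tensor_map K V' W' f g t = tensor_map K V' W' f' g' t"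
  by (rule tensor_ext[OF assms(1,2) vs_tensor[OF assms(3,4)] tensor_map_lm[OF assms(1-6)]
        tensor_map_lm[OF assms(1-4,7,8)] _ assms(11)])
   (simp add: tensor_map_tens[OF assms(1-6)] tensor_map_tens[OF assms(1-4,7,8)] assms(9,10))

lemma assoc_aux:
  assumes V: "vs V" "vs W" "vs U" and u: "u \<in> carrier U"
  defines "T \<equiv> tensor K V (tensor K W U)"
  shows "blm V W T (\<lambda>v w. tens K V (tensor K W U) v (tens K W U w u))"
  unfolding T_def using V u
  by (intro blm_comp[OF tens_blm lm_id _ lm_id] blm_left[OF tens_blm]) auto

text \<open>For fixed \<open>u\<close> the map is a lift and hence linear in \<open>t\<close>.
  Linearity in \<open>u\<close> is not formal: two lifts attached to different \<open>u\<close> are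
  compared on pure tensors by \<open>tensor_ext\<close>.\<close>

lemma assoc_blm:
  assumes V: "vs V" "vs W" "vs U"
  defines "T \<equiv> tensor K V (tensor K W U)"
  shows "blm (tensor K V W) U T (\<lambda>t u. tensor_lift K T (\<lambda>v w. tens K V (tensor K W U) v (tens K W U w u)) t)"
proof -
  have T: "vs T" using V by (simp add: T_def)
  note L = tensor_lift_lm[OF V(1,2) T assoc_aux[OF V, folded T_def]]
  note Lt = tensor_lift_tens[OF V(1,2) T assoc_aux[OF V, folded T_def]]
  note b1 = tens_blm[OF V(2,3)] and b2 = tens_blm[OF V(1) vs_tensor[OF V(2,3)], folded T_def]
  note r1 = blm_right[OF b1] and r2 = blm_right[OF b2]
  show ?thesis
  proof (rule blmI)
    fix u assume "u \<in> carrier U"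
    then show "tensor_lift K T (\<lambda>v w. tens K V (tensor K W U) v (tens K W U w u)) \<in> lm (tensor K V W) T"
      by (rule L)
  next
    fix t assume t: "t \<in> carrier (tensor K V W)"
    show "(\<lambda>u. tensor_lift K T (\<lambda>v w. tens K V (tensor K W U) v (tens K W U w u)) t) \<in> lm U T"
    proof (rule lmI)
      fix u assume u: "u \<in> carrier U"
      show "tensor_lift K T (\<lambda>v w. tens K V (tensor K W U) v (tens K W U w u)) t \<in> carrier T"
        by (rule lm_closed[OF L[OF u] t])
      { fix u' assume u': "u' \<in> carrier U"
        have uu: "u \<oplus>\<^bsub>U\<^esub> u' \<in> carrier U" using u u' V by auto
        show "tensor_lift K T (\<lambda>v w. tens K V (tensor K W U) v (tens K W U w (u \<oplus>\<^bsub>U\<^esub> u'))) t =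
         tensor_lift K T (\<lambda>v w. tens K V (tensor K W U) v (tens K W U w u)) t \<oplus>\<^bsub>T\<^esub>
         tensor_lift K T (\<lambda>v w. tens K V (tensor K W U) v (tens K W U w u')) t"
          by (rule tensor_ext[OF V(1,2) T L[OF uu] lm_plus[OF T L[OF u] L[OF u']] _ t])
             (simp add: Lt u u' uu lm_add[OF r1] lm_add[OF r2] V) }
      { fix c assume c: "c \<in> carrier K"
        have uu: "c \<odot>\<^bsub>U\<^esub> u \<in> carrier U" using u c V by auto
        show "tensor_lift K T (\<lambda>v w. tens K V (tensor K W U) v (tens K W U w (c \<odot>\<^bsub>U\<^esub> u))) t =
         c \<odot>\<^bsub>T\<^esub> tensor_lift K T (\<lambda>v w. tens K V (tensor K W U) v (tens K W U w u)) t"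
          by (rule tensor_ext[OF V(1,2) T L[OF uu] lm_scale[OF T c L[OF u]] _ t])
             (simp add: Lt u c uu lm_smult[OF r1] lm_smult[OF r2] V) }
    qed
  qed
qed

lemma assoc_lm: "vs V \<Longrightarrow> vs W \<Longrightarrow> vs U \<Longrightarrow>
  tensor_assoc K V W U \<in> lm (tensor K (tensor K V W) U) (tensor K V (tensor K W U))"
  unfolding tensor_assoc_def[abs_def] Let_def
  by (intro tensor_lift_lm assoc_blm vs_tensor)

lemma assoc_tens: "vs V \<Longrightarrow> vs W \<Longrightarrow> vs U \<Longrightarrow> v \<in> carrier V \<Longrightarrow> w \<in> carrier W \<Longrightarrow> u \<in> carrier U \<Longrightarrow>
  tensor_assoc K V W U (tens K (tensor K V W) U (tens K V W v w) u) = tens K V (tensor K W U) v (tens K W U w u)"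
  unfolding tensor_assoc_def Let_def
  by (subst tensor_lift_tens[OF _ _ _ assoc_blm], simp_all)
    (rule tensor_lift_tens[OF _ _ _ assoc_aux], simp_all)

lemma tensor_mult_aux:
  assumes "vs V" "vs W" "vs U" "blm V W U m"
    and a: "a1 \<in> carrier V" "a2 \<in> carrier V"
  shows "blm W W (tensor K U U) (\<lambda>b1 b2. tens K U U (m a1 b1) (m a2 b2))"
  using assms by (intro blm_comp[OF tens_blm _ _ lm_id] blm_right[OF assms(4)])

text \<open>\<open>tensor_mult\<close> is a lift nested inside a lift, so bilinearity must be known
  for the inner one before the outer one can be evaluated.\<close>

lemma tensor_mult_blm:
  assumes V: "vs V" "vs W" "vs U" and m: "blm V W U m"
  shows "blm (tensor K V V) (tensor K W W) (tensor K U U) (tensor_mult K U m)"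
    "\<And>a1 a2 b1 b2. a1 \<in> carrier V \<Longrightarrow> a2 \<in> carrier V \<Longrightarrow> b1 \<in> carrier W \<Longrightarrow> b2 \<in> carrier W \<Longrightarrow>
      tensor_mult K U m (tens K V V a1 a2) (tens K W W b1 b2) = tens K U U (m a1 b1) (m a2 b2)"
proof -
  let ?T = "tensor K U U"
  have T: "vs ?T" using V by simp
  let ?L = "\<lambda>a1 a2. tensor_lift K ?T (\<lambda>b1 b2. tens K U U (m a1 b1) (m a2 b2))"
  note L = tensor_lift_lm[OF V(2,2) T tensor_mult_aux[OF V m]]
  note Lt = tensor_lift_tens[OF V(2,2) T tensor_mult_aux[OF V m]]
  note bt = tens_blm[OF V(3,3)]
  note r = blm_right[OF bt] and l = blm_left[OF bt] and ml = blm_left[OF m] and mc = blm_closed[OF m]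
  \<comment> \<open>With \<open>t\<close> fixed, both sides of each law are linear in
    \<open>t\<close>; this allows the comparison on pure tensors, where the law comes from
    \<open>m\<close> and from the tensor product.\<close>
  have inner: "blm V V ?T (\<lambda>a1 a2. ?L a1 a2 t)" if t: "t \<in> carrier (tensor K W W)" for t
  proof (rule blmI; rule lmI)
    fix a1 a2 assume a: "a1 \<in> carrier V" "a2 \<in> carrier V"
    then show "?L a1 a2 t \<in> carrier ?T" using lm_closed[OF L t] by auto
  next
    fix a1 a2 assume a: "a1 \<in> carrier V" "a2 \<in> carrier V"
    then show "?L a1 a2 t \<in> carrier ?T" using lm_closed[OF L t] by auto
  next
    fix a1 a2 a2' assume a: "a1 \<in> carrier V" "a2 \<in> carrier V" "a2' \<in> carrier V"
    show "?L a1 (a2 \<oplus>\<^bsub>V\<^esub> a2') t = ?L a1 a2 t \<oplus>\<^bsub>?T\<^esub> ?L a1 a2' t"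
      by (rule tensor_ext[OF V(2,2) T L lm_plus[OF T L L] _ t]) (use a V in \<open>auto simp: Lt lm_add[OF ml] lm_add[OF r] mc\<close>)
  next
    fix a1 a2 c assume a: "a1 \<in> carrier V" "a2 \<in> carrier V" "c \<in> carrier K"
    show "?L a1 (c \<odot>\<^bsub>V\<^esub> a2) t = c \<odot>\<^bsub>?T\<^esub> ?L a1 a2 t"
      by (rule tensor_ext[OF V(2,2) T L lm_scale[OF T a(3) L] _ t]) (use a V in \<open>auto simp: Lt lm_smult[OF ml] lm_smult[OF r] mc\<close>)
  next
    fix a1 a2 a1' assume a: "a2 \<in> carrier V" "a1 \<in> carrier V" "a1' \<in> carrier V"
    show "?L (a1 \<oplus>\<^bsub>V\<^esub> a1') a2 t = ?L a1 a2 t \<oplus>\<^bsub>?T\<^esub> ?L a1' a2 t"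
      by (rule tensor_ext[OF V(2,2) T L lm_plus[OF T L L] _ t]) (use a V in \<open>auto simp: Lt lm_add[OF ml] lm_add[OF l] mc\<close>)
  next
    fix a1 a2 c assume a: "a2 \<in> carrier V" "a1 \<in> carrier V" "c \<in> carrier K"
    show "?L (c \<odot>\<^bsub>V\<^esub> a1) a2 t = c \<odot>\<^bsub>?T\<^esub> ?L a1 a2 t"
      by (rule tensor_ext[OF V(2,2) T L lm_scale[OF T a(3) L] _ t]) (use a V in \<open>auto simp: Lt lm_smult[OF ml] lm_smult[OF l] mc\<close>)
  qed
  have out: "tensor_mult K U m s t = tensor_lift K ?T (\<lambda>a1 a2. ?L a1 a2 t) s" for s t
    by (simp add: tensor_mult_def)
  note O = tensor_lift_lm[OF V(1,1) T inner] and Ot = tensor_lift_tens[OF V(1,1) T inner]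
  show "blm (tensor K V V) (tensor K W W) ?T (tensor_mult K U m)"
  proof (rule blmI)
    fix t assume "t \<in> carrier (tensor K W W)"
    then show "(\<lambda>s. tensor_mult K U m s t) \<in> lm (tensor K V V) ?T" unfolding out by (rule O)
  next
    fix s assume s: "s \<in> carrier (tensor K V V)"
    show "tensor_mult K U m s \<in> lm (tensor K W W) ?T"
    proof (rule lmI; (unfold out)?)
      fix t assume t: "t \<in> carrier (tensor K W W)"
      then show "tensor_lift K ?T (\<lambda>a1 a2. ?L a1 a2 t) s \<in> carrier ?T" using lm_closed[OF O s] by auto
    next
      fix t t' assume t: "t \<in> carrier (tensor K W W)" "t' \<in> carrier (tensor K W W)"
      then have tt: "t \<oplus>\<^bsub>tensor K W W\<^esub> t' \<in> carrier (tensor K W W)" using V by auto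
      show "tensor_lift K ?T (\<lambda>a1 a2. ?L a1 a2 (t \<oplus>\<^bsub>tensor K W W\<^esub> t')) s =
        tensor_lift K ?T (\<lambda>a1 a2. ?L a1 a2 t) s \<oplus>\<^bsub>?T\<^esub> tensor_lift K ?T (\<lambda>a1 a2. ?L a1 a2 t') s"
        by (rule tensor_ext[OF V(1,1) T O[OF tt] lm_plus[OF T O[OF t(1)] O[OF t(2)]] _ s])
          (use t V in \<open>auto simp: Ot[OF tt] Ot[OF t(1)] Ot[OF t(2)] lm_add[OF L]\<close>)
    next
      fix t c assume t: "t \<in> carrier (tensor K W W)" "c \<in> carrier K"
      then have tt: "c \<odot>\<^bsub>tensor K W W\<^esub> t \<in> carrier (tensor K W W)" using V by auto
      show "tensor_lift K ?T (\<lambda>a1 a2. ?L a1 a2 (c \<odot>\<^bsub>tensor K W W\<^esub> t)) s =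
        c \<odot>\<^bsub>?T\<^esub> tensor_lift K ?T (\<lambda>a1 a2. ?L a1 a2 t) s"
        by (rule tensor_ext[OF V(1,1) T O[OF tt] lm_scale[OF T t(2) O[OF t(1)]] _ s])
          (use t V in \<open>auto simp: Ot[OF tt] Ot[OF t(1)] lm_smult[OF L]\<close>)
    qed
  qed
  show "tensor_mult K U m (tens K V V a1 a2) (tens K W W b1 b2) = tens K U U (m a1 b1) (m a2 b2)"
    if "a1 \<in> carrier V" "a2 \<in> carrier V" "b1 \<in> carrier W" "b2 \<in> carrier W" for a1 a2 b1 b2
    unfolding out using that V by (simp add: Ot Lt)
qed

section \<open>Gradings\<close>

text \<open>\<open>direct_sum_decomposition\<close> sums over exact supports, and cancellation may
  shrink the support of a sum. All three sums are therefore compared over the union of the two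
  supports.\<close>

lemma supp_add:
  assumes V: "vs V" and h: "\<And>n::nat. h n \<in> carrier V" "\<And>n. h' n \<in> carrier V"
    and f: "finite {n. h n \<noteq> \<zero>\<^bsub>V\<^esub>}" "finite {n. h' n \<noteq> \<zero>\<^bsub>V\<^esub>}"
  shows "finite {n. h n \<oplus>\<^bsub>V\<^esub> h' n \<noteq> \<zero>\<^bsub>V\<^esub>}"
    "(\<Oplus>\<^bsub>V\<^esub>n\<in>{n. h n \<oplus>\<^bsub>V\<^esub> h' n \<noteq> \<zero>\<^bsub>V\<^esub>}. h n \<oplus>\<^bsub>V\<^esub> h' n) =
     (\<Oplus>\<^bsub>V\<^esub>n\<in>{n. h n \<noteq> \<zero>\<^bsub>V\<^esub>}. h n) \<oplus>\<^bsub>V\<^esub> (\<Oplus>\<^bsub>V\<^esub>n\<in>{n. h' n \<noteq> \<zero>\<^bsub>V\<^esub>}. h' n)"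
proof -
  interpret V: abelian_monoid V by (rule vs_am[OF V])
  let ?A = "{n. h n \<noteq> \<zero>\<^bsub>V\<^esub>} \<union> {n. h' n \<noteq> \<zero>\<^bsub>V\<^esub>}"
  have A: "finite ?A" using f by simp
  have s: "{n. h n \<oplus>\<^bsub>V\<^esub> h' n \<noteq> \<zero>\<^bsub>V\<^esub>} \<subseteq> ?A" by auto
  show "finite {n. h n \<oplus>\<^bsub>V\<^esub> h' n \<noteq> \<zero>\<^bsub>V\<^esub>}" using s A by (rule finite_subset)
  have hh: "h n \<oplus>\<^bsub>V\<^esub> h' n \<in> carrier V" for n using h by simp
  have e: "(\<Oplus>\<^bsub>V\<^esub>n\<in>{n. k n \<noteq> \<zero>\<^bsub>V\<^esub>}. k n) = (\<Oplus>\<^bsub>V\<^esub>n\<in>?A. k n)" if "{n. k n \<noteq> \<zero>\<^bsub>V\<^esub>} \<subseteq> ?A" "\<And>n. k n \<in> carrier V" for k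
    by (rule sum_mono_neutral[OF V A that(1)]) (use that in auto)
  show "(\<Oplus>\<^bsub>V\<^esub>n\<in>{n. h n \<oplus>\<^bsub>V\<^esub> h' n \<noteq> \<zero>\<^bsub>V\<^esub>}. h n \<oplus>\<^bsub>V\<^esub> h' n) =
     (\<Oplus>\<^bsub>V\<^esub>n\<in>{n. h n \<noteq> \<zero>\<^bsub>V\<^esub>}. h n) \<oplus>\<^bsub>V\<^esub> (\<Oplus>\<^bsub>V\<^esub>n\<in>{n. h' n \<noteq> \<zero>\<^bsub>V\<^esub>}. h' n)"
    unfolding e[OF s hh] e[OF Un_upper1 h(1)] e[OF Un_upper2 h(2)] by (rule sum_add[OF V h])
qed

lemma supp_smult:
  assumes V: "vs V" and c: "c \<in> carrier K" and h: "\<And>n::nat. h n \<in> carrier V" and f: "finite {n. h n \<noteq> \<zero>\<^bsub>V\<^esub>}"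
  shows "finite {n. c \<odot>\<^bsub>V\<^esub> h n \<noteq> \<zero>\<^bsub>V\<^esub>}"
    "(\<Oplus>\<^bsub>V\<^esub>n\<in>{n. c \<odot>\<^bsub>V\<^esub> h n \<noteq> \<zero>\<^bsub>V\<^esub>}. c \<odot>\<^bsub>V\<^esub> h n) = c \<odot>\<^bsub>V\<^esub> (\<Oplus>\<^bsub>V\<^esub>n\<in>{n. h n \<noteq> \<zero>\<^bsub>V\<^esub>}. h n)"
proof -
  have s: "{n. c \<odot>\<^bsub>V\<^esub> h n \<noteq> \<zero>\<^bsub>V\<^esub>} \<subseteq> {n. h n \<noteq> \<zero>\<^bsub>V\<^esub>}"
    using Module.module.smult_r_null[OF V c] by auto
  show "finite {n. c \<odot>\<^bsub>V\<^esub> h n \<noteq> \<zero>\<^bsub>V\<^esub>}" using s f by (rule finite_subset)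
  have "(\<Oplus>\<^bsub>V\<^esub>n\<in>{n. c \<odot>\<^bsub>V\<^esub> h n \<noteq> \<zero>\<^bsub>V\<^esub>}. c \<odot>\<^bsub>V\<^esub> h n) = (\<Oplus>\<^bsub>V\<^esub>n\<in>{n. h n \<noteq> \<zero>\<^bsub>V\<^esub>}. c \<odot>\<^bsub>V\<^esub> h n)"
    using V c h by (intro sum_mono_neutral[OF V f s]) auto
  also have "\<dots> = c \<odot>\<^bsub>V\<^esub> (\<Oplus>\<^bsub>V\<^esub>n\<in>{n. h n \<noteq> \<zero>\<^bsub>V\<^esub>}. h n)"
    by (rule sum_smult[OF V f c h])
  finally show "(\<Oplus>\<^bsub>V\<^esub>n\<in>{n. c \<odot>\<^bsub>V\<^esub> h n \<noteq> \<zero>\<^bsub>V\<^esub>}. c \<odot>\<^bsub>V\<^esub> h n) = c \<odot>\<^bsub>V\<^esub> (\<Oplus>\<^bsub>V\<^esub>n\<in>{n. h n \<noteq> \<zero>\<^bsub>V\<^esub>}. h n)" .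
qed

text \<open>The homogeneous component of degree \<open>d\<close>. The description is meaningful
  because \<open>direct_sum_decomposition\<close> asserts unique existence of the whole family of
  components.\<close>

definition proj_to :: "('k, 'v) module \<Rightarrow> (nat \<Rightarrow> 'v set) \<Rightarrow> nat \<Rightarrow> 'v \<Rightarrow> 'v" where
  "proj_to V G d v = (THE h. (\<forall>n. h n \<in> G n) \<and> finite {n. h n \<noteq> \<zero>\<^bsub>V\<^esub>} \<and> v = (\<Oplus>\<^bsub>V\<^esub>n\<in>{n. h n \<noteq> \<zero>\<^bsub>V\<^esub>}. h n)) d"

context
  fixes V :: "('k, 'v) module" and G
  assumes V: "vs V" and dsd: "direct_sum_decomposition K V G"
begin

lemma dsd_sub: "submodule (G n) K V" using dsd by (simp add: direct_sum_decomposition_def)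

lemma dsd_car: "v \<in> G n \<Longrightarrow> v \<in> carrier V" using submod_sub[OF dsd_sub] by blast

lemma proj_to_unique:
  assumes "\<And>n. h n \<in> G n" "finite {n. h n \<noteq> \<zero>\<^bsub>V\<^esub>}"
  shows "proj_to V G d (\<Oplus>\<^bsub>V\<^esub>n\<in>{n. h n \<noteq> \<zero>\<^bsub>V\<^esub>}. h n) = h d"
proof -
  let ?v = "\<Oplus>\<^bsub>V\<^esub>n\<in>{n. h n \<noteq> \<zero>\<^bsub>V\<^esub>}. h n"
  have "?v \<in> carrier V" by (rule vs_sum[OF V dsd_car[OF assms(1)]])
  then have "\<exists>!h. (\<forall>n. h n \<in> G n) \<and> finite {n. h n \<noteq> \<zero>\<^bsub>V\<^esub>} \<and> ?v = (\<Oplus>\<^bsub>V\<^esub>n\<in>{n. h n \<noteq> \<zero>\<^bsub>V\<^esub>}. h n)"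
    using dsd unfolding direct_sum_decomposition_def by blast
  from the1_equality[OF this, of h] show ?thesis unfolding proj_to_def using assms by simp
qed

lemma proj_to_decomp:
  assumes "v \<in> carrier V"
  shows "proj_to V G n v \<in> G n" "finite {n. proj_to V G n v \<noteq> \<zero>\<^bsub>V\<^esub>}"
    "v = (\<Oplus>\<^bsub>V\<^esub>n\<in>{n. proj_to V G n v \<noteq> \<zero>\<^bsub>V\<^esub>}. proj_to V G n v)"
proof -
  have ex: "\<exists>!h. (\<forall>n. h n \<in> G n) \<and> finite {n. h n \<noteq> \<zero>\<^bsub>V\<^esub>} \<and> v = (\<Oplus>\<^bsub>V\<^esub>n\<in>{n. h n \<noteq> \<zero>\<^bsub>V\<^esub>}. h n)"
    using dsd assms unfolding direct_sum_decomposition_def by blast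
  from theI'[OF this]
  show "proj_to V G n v \<in> G n" "finite {n. proj_to V G n v \<noteq> \<zero>\<^bsub>V\<^esub>}"
    "v = (\<Oplus>\<^bsub>V\<^esub>n\<in>{n. proj_to V G n v \<noteq> \<zero>\<^bsub>V\<^esub>}. proj_to V G n v)"
    unfolding proj_to_def by blast+
qed

text \<open>The componentwise sum of two decompositions decomposes the sum of the vectors, so by
  uniqueness it is the decomposition; likewise for scalar multiples.\<close>

lemma proj_to_lm: "proj_to V G d \<in> lm V V"
proof (rule lmI)
  fix v assume v: "v \<in> carrier V"
  note p = proj_to_decomp[OF v]
  have pc: "proj_to V G n v \<in> carrier V" for n by (rule dsd_car[OF p(1)])
  show "proj_to V G d v \<in> carrier V" by (rule pc)
  { fix w assume w: "w \<in> carrier V"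
    note q = proj_to_decomp[OF w]
    have qc: "proj_to V G n w \<in> carrier V" for n by (rule dsd_car[OF q(1)])
    note s = supp_add[OF V pc qc p(2) q(2)]
    have "proj_to V G d (\<Oplus>\<^bsub>V\<^esub>n\<in>{n. proj_to V G n v \<oplus>\<^bsub>V\<^esub> proj_to V G n w \<noteq> \<zero>\<^bsub>V\<^esub>}. proj_to V G n v \<oplus>\<^bsub>V\<^esub> proj_to V G n w)
      = proj_to V G d v \<oplus>\<^bsub>V\<^esub> proj_to V G d w"
      by (rule proj_to_unique[OF submod_add[OF dsd_sub p(1) q(1)] s(1)])
    then show "proj_to V G d (v \<oplus>\<^bsub>V\<^esub> w) = proj_to V G d v \<oplus>\<^bsub>V\<^esub> proj_to V G d w"
      unfolding s(2) using p(3) q(3) by simp }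
  { fix c assume c: "c \<in> carrier K"
    note s = supp_smult[OF V c pc p(2)]
    have "proj_to V G d (\<Oplus>\<^bsub>V\<^esub>n\<in>{n. c \<odot>\<^bsub>V\<^esub> proj_to V G n v \<noteq> \<zero>\<^bsub>V\<^esub>}. c \<odot>\<^bsub>V\<^esub> proj_to V G n v) = c \<odot>\<^bsub>V\<^esub> proj_to V G d v"
      by (rule proj_to_unique[OF submod_smult[OF dsd_sub c p(1)] s(1)])
    then show "proj_to V G d (c \<odot>\<^bsub>V\<^esub> v) = c \<odot>\<^bsub>V\<^esub> proj_to V G d v"
      unfolding s(2) using p(3) by simp }
qed

lemma proj_to_homog:
  assumes v: "v \<in> G e"
  shows "proj_to V G d v = (if d = e then v else \<zero>\<^bsub>V\<^esub>)"
proof -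
  define h where "h n = (if n = e then v else \<zero>\<^bsub>V\<^esub>)" for n
  have sub: "{n. h n \<noteq> \<zero>\<^bsub>V\<^esub>} \<subseteq> {e}" by (auto simp: h_def)
  then have fin: "finite {n. h n \<noteq> \<zero>\<^bsub>V\<^esub>}" by (rule finite_subset) simp
  have "(\<Oplus>\<^bsub>V\<^esub>n\<in>{n. h n \<noteq> \<zero>\<^bsub>V\<^esub>}. h n) = (\<Oplus>\<^bsub>V\<^esub>n\<in>{e}. h n)"
    using dsd_car[OF v] V by (intro sum_mono_neutral[OF V _ sub]) (auto simp: h_def)
  also have "\<dots> = h e" by (rule sum_single[OF V]) (use dsd_car[OF v] in \<open>auto simp: h_def\<close>)
  also have "\<dots> = v" by (simp add: h_def)
  finally have "v = (\<Oplus>\<^bsub>V\<^esub>n\<in>{n. h n \<noteq> \<zero>\<^bsub>V\<^esub>}. h n)" ..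
  moreover have "proj_to V G d (\<Oplus>\<^bsub>V\<^esub>n\<in>{n. h n \<noteq> \<zero>\<^bsub>V\<^esub>}. h n) = h d"
    by (rule proj_to_unique[OF _ fin]) (use v submod_zero[OF dsd_sub] in \<open>auto simp: h_def\<close>)
  ultimately show ?thesis by (simp add: h_def)
qed

end

text \<open>The converse route, for a space whose homogeneous parts are known only as images: linear
  projections that separate spanning submodules force the sum to be direct. It is applied to the
  Fock space.\<close>

lemma dsd_from_proj:
  assumes V: "vs V" and G: "\<And>d. submodule (G d) K V" and P: "\<And>d. P d \<in> lm V V"
    and PG: "\<And>d e v. v \<in> G e \<Longrightarrow> P d v = (if d = e then v else \<zero>\<^bsub>V\<^esub>)"
    and sp: "carrier V \<subseteq> lin_span K V (\<Union>d. G d)"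
  shows "direct_sum_decomposition K V G"
proof -
  have Gc: "(\<Union>d. G d) \<subseteq> carrier V" using submod_sub[OF G] by blast
  have PinG: "P d v \<in> G d" if "v \<in> carrier V" for d v
    by (rule lm_span_in[OF V V P G Gc _ set_mp[OF sp that]]) (auto simp: PG submod_zero[OF G])
  have Pc: "P d v \<in> carrier V" if "v \<in> carrier V" for d v using lm_closed[OF P that] .
  \<comment> \<open>The vectors that are the finite sum of their nonzero projections. They form a
    submodule containing every \<open>G d\<close>, hence the whole space.\<close>
  define Q where "Q = {v \<in> carrier V. finite {n. P n v \<noteq> \<zero>\<^bsub>V\<^esub>} \<and> v = (\<Oplus>\<^bsub>V\<^esub>n\<in>{n. P n v \<noteq> \<zero>\<^bsub>V\<^esub>}. P n v)}"
  have "submodule Q K V"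
  proof (rule submodI[OF V])
    show "\<zero>\<^bsub>V\<^esub> \<in> Q" using V lm_zero[OF V V P] by (simp add: Q_def)
    fix v w assume v: "v \<in> Q" and w: "w \<in> Q"
    then have c: "v \<in> carrier V" "w \<in> carrier V" and f: "finite {n. P n v \<noteq> \<zero>\<^bsub>V\<^esub>}" "finite {n. P n w \<noteq> \<zero>\<^bsub>V\<^esub>}"
      and e: "v = (\<Oplus>\<^bsub>V\<^esub>n\<in>{n. P n v \<noteq> \<zero>\<^bsub>V\<^esub>}. P n v)" "w = (\<Oplus>\<^bsub>V\<^esub>n\<in>{n. P n w \<noteq> \<zero>\<^bsub>V\<^esub>}. P n w)"
      unfolding Q_def by blast+
    have "v \<oplus>\<^bsub>V\<^esub> w = (\<Oplus>\<^bsub>V\<^esub>n\<in>{n. P n v \<oplus>\<^bsub>V\<^esub> P n w \<noteq> \<zero>\<^bsub>V\<^esub>}. P n v \<oplus>\<^bsub>V\<^esub> P n w)"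
      unfolding supp_add(2)[OF V Pc[OF c(1)] Pc[OF c(2)] f] using e by simp
    then show "v \<oplus>\<^bsub>V\<^esub> w \<in> Q"
      unfolding Q_def mem_Collect_eq lm_add[OF P c]
      by (intro conjI vs_add V c supp_add(1)[OF V Pc[OF c(1)] Pc[OF c(2)] f])
  next
    fix c v assume k: "c \<in> carrier K" and "v \<in> Q"
    then have c: "v \<in> carrier V" and f: "finite {n. P n v \<noteq> \<zero>\<^bsub>V\<^esub>}"
      and e: "v = (\<Oplus>\<^bsub>V\<^esub>n\<in>{n. P n v \<noteq> \<zero>\<^bsub>V\<^esub>}. P n v)"
      unfolding Q_def by blast+
    have "c \<odot>\<^bsub>V\<^esub> v = (\<Oplus>\<^bsub>V\<^esub>n\<in>{n. c \<odot>\<^bsub>V\<^esub> P n v \<noteq> \<zero>\<^bsub>V\<^esub>}. c \<odot>\<^bsub>V\<^esub> P n v)"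
      unfolding supp_smult(2)[OF V k Pc[OF c] f] using e by simp
    then show "c \<odot>\<^bsub>V\<^esub> v \<in> Q"
      unfolding Q_def mem_Collect_eq lm_smult[OF P k c]
      by (intro conjI vs_smult V c k supp_smult(1)[OF V k Pc[OF c] f])
  qed (auto simp: Q_def)
  moreover have "(\<Union>d. G d) \<subseteq> Q"
  proof
    fix v assume "v \<in> (\<Union>d. G d)"
    then obtain e where v: "v \<in> G e" by blast
    have vc: "v \<in> carrier V" using Gc v by blast
    have sub: "{n. P n v \<noteq> \<zero>\<^bsub>V\<^esub>} \<subseteq> {e}" using PG[OF v] by auto
    have "(\<Oplus>\<^bsub>V\<^esub>n\<in>{n. P n v \<noteq> \<zero>\<^bsub>V\<^esub>}. P n v) = (\<Oplus>\<^bsub>V\<^esub>n\<in>{e}. P n v)"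
      using vc Pc by (intro sum_mono_neutral[OF V _ sub]) auto
    also have "\<dots> = v" using sum_single[OF V, of "{e}" e "\<lambda>n. P n v"] vc PG[OF v] by simp
    finally show "v \<in> Q" using finite_subset[OF sub] vc by (simp add: Q_def)
  qed
  ultimately have "carrier V \<subseteq> Q" using span_least[of Q V] sp by blast
  then have dec: "finite {n. P n v \<noteq> \<zero>\<^bsub>V\<^esub>}" "v = (\<Oplus>\<^bsub>V\<^esub>n\<in>{n. P n v \<noteq> \<zero>\<^bsub>V\<^esub>}. P n v)" if "v \<in> carrier V" for v
    using that unfolding Q_def by blast+
  have "\<exists>!h. (\<forall>n. h n \<in> G n) \<and> finite {n. h n \<noteq> \<zero>\<^bsub>V\<^esub>} \<and> v = (\<Oplus>\<^bsub>V\<^esub>n\<in>{n. h n \<noteq> \<zero>\<^bsub>V\<^esub>}. h n)"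
    if v: "v \<in> carrier V" for v
  proof (rule ex1I[of _ "\<lambda>n. P n v"])
    show "(\<forall>n. P n v \<in> G n) \<and> finite {n. P n v \<noteq> \<zero>\<^bsub>V\<^esub>} \<and> v = (\<Oplus>\<^bsub>V\<^esub>n\<in>{n. P n v \<noteq> \<zero>\<^bsub>V\<^esub>}. P n v)"
      using PinG[OF v] dec[OF v] by blast
    fix h assume h: "(\<forall>n. h n \<in> G n) \<and> finite {n. h n \<noteq> \<zero>\<^bsub>V\<^esub>} \<and> v = (\<Oplus>\<^bsub>V\<^esub>n\<in>{n. h n \<noteq> \<zero>\<^bsub>V\<^esub>}. h n)"
    have hG: "h n \<in> G n" for n using h by blast
    have hc: "h n \<in> carrier V" for n using hG Gc by blast
    show "h = (\<lambda>n. P n v)"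
    proof
      fix d
      have "P d v = P d (\<Oplus>\<^bsub>V\<^esub>n\<in>{n. h n \<noteq> \<zero>\<^bsub>V\<^esub>}. h n)" using h by metis
      also have "\<dots> = (\<Oplus>\<^bsub>V\<^esub>n\<in>{n. h n \<noteq> \<zero>\<^bsub>V\<^esub>}. P d (h n))"
        using h hc by (intro lm_sum[OF V V P]) auto
      also have "\<dots> = (\<Oplus>\<^bsub>V\<^esub>n\<in>{n. h n \<noteq> \<zero>\<^bsub>V\<^esub>}. if d = n then h d else \<zero>\<^bsub>V\<^esub>)"
        using hc V by (intro sum_cong[OF V]) (auto simp: PG[OF hG])
      also have "\<dots> = h d"
      proof (cases "h d = \<zero>\<^bsub>V\<^esub>")
        case True
        then show ?thesis by (intro trans[OF sum_zero[OF V]]) auto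
      next
        case False
        then show ?thesis using h hc
          by (subst sum_single[OF V, of _ d]) auto
      qed
      finally show "h d = P d v" ..
    qed
  qed
  then show ?thesis using G unfolding direct_sum_decomposition_def by blast
qed

text \<open>Applying \<open>f\<close> to the decomposition of \<open>v\<close> gives a decomposition
  of \<open>f v\<close>, which is unique. With \<open>f\<close> a relabelling this lets the
  projections descend to coinvariants.\<close>

lemma proj_to_commute:
  assumes V: "vs V" and dsd: "direct_sum_decomposition K V G" and f: "f \<in> lm V V" and fG: "\<And>d v. v \<in> G d \<Longrightarrow> f v \<in> G d"
    and v: "v \<in> carrier V"
  shows "proj_to V G d (f v) = f (proj_to V G d v)"
proof -
  note p = proj_to_decomp[OF V dsd v]
  let ?h = "\<lambda>n. f (proj_to V G n v)"
  have pc: "proj_to V G n v \<in> carrier V" for n by (rule dsd_car[OF V dsd p(1)])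
  have sub: "{n. ?h n \<noteq> \<zero>\<^bsub>V\<^esub>} \<subseteq> {n. proj_to V G n v \<noteq> \<zero>\<^bsub>V\<^esub>}" using lm_zero[OF V V f] by auto
  have "f v = f (\<Oplus>\<^bsub>V\<^esub>n\<in>{n. proj_to V G n v \<noteq> \<zero>\<^bsub>V\<^esub>}. proj_to V G n v)" using p(3) by simp
  also have "\<dots> = (\<Oplus>\<^bsub>V\<^esub>n\<in>{n. proj_to V G n v \<noteq> \<zero>\<^bsub>V\<^esub>}. ?h n)" by (rule lm_sum[OF V V f p(2) pc])
  also have "\<dots> = (\<Oplus>\<^bsub>V\<^esub>n\<in>{n. ?h n \<noteq> \<zero>\<^bsub>V\<^esub>}. ?h n)"
    by (rule sum_mono_neutral[OF V p(2) sub, symmetric]) (auto simp: lm_closed[OF f pc])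
  finally show ?thesis
    using proj_to_unique[OF V dsd fG[OF p(1)] finite_subset[OF sub p(2)], of d] by simp
qed

section \<open>Naturality of lifts and associativity, and maps on pairs of cosets\<close>

text \<open>Both sides are linear in \<open>t\<close> and agree on pure tensors by the hypothesis
  \<open>nat\<close>. It carries the counit laws from the species to its Fock space.\<close>

lemma tensor_lift_natural:
  assumes V: "vs V" "vs W" and b: "blm V V V b" "blm W W W b'" and f: "f \<in> lm V W"
    and nat: "\<And>v w. v \<in> carrier V \<Longrightarrow> w \<in> carrier V \<Longrightarrow> b' (f v) (f w) = f (b v w)"
    and t: "t \<in> carrier (tensor K V V)"
  shows "tensor_lift K W b' (tensor_map K W W f f t) = f (tensor_lift K V b t)"
proof -
  note ff = tensor_map_lm[OF V(1,1) V(2,2) f f] and fft = tensor_map_tens[OF V(1,1) V(2,2) f f]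
  note l = tensor_lift_lm[OF V(1,1,1) b(1)] and lt = tensor_lift_tens[OF V(1,1,1) b(1)]
  note l' = tensor_lift_lm[OF V(2,2,2) b(2)] and lt' = tensor_lift_tens[OF V(2,2,2) b(2)]
  show ?thesis
    by (rule tensor_ext[OF V(1,1,2) lm_comp[OF ff l'] lm_comp[OF l f] _ t])
      (simp only: fft lt lt' lm_closed[OF f] nat)
qed

text \<open>Checked on pure tensors in two rounds, since the first factor is itself a tensor
  product. It carries coassociativity from the species to its Fock space.\<close>

lemma assoc_natural:
  assumes V: "vs V" "vs W" and f: "f \<in> lm V W" and t: "t \<in> carrier (tensor K (tensor K V V) V)"
  shows "tensor_assoc K W W W (tensor_map K (tensor K W W) W (tensor_map K W W f f) f t) =
    tensor_map K W (tensor K W W) f (tensor_map K W W f f) (tensor_assoc K V V V t)"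
proof -
  let ?T = "tensor K V V" and ?S = "tensor K W W"
  have v: "vs ?T" "vs ?S" "vs (tensor K ?T V)" "vs (tensor K ?S W)" "vs (tensor K V ?T)" "vs (tensor K W ?S)"
    using V by (simp_all add: vs_tensor)
  note ff = tensor_map_lm[OF V(1,1) V(2,2) f f] and fft = tensor_map_tens[OF V(1,1) V(2,2) f f]
  note m1 = tensor_map_lm[OF v(1) V(1) v(2) V(2) ff f] and m1t = tensor_map_tens[OF v(1) V(1) v(2) V(2) ff f]
  note m2 = tensor_map_lm[OF V(1) v(1) V(2) v(2) f ff] and m2t = tensor_map_tens[OF V(1) v(1) V(2) v(2) f ff]
  note aV = assoc_lm[OF V(1,1,1)] and aW = assoc_lm[OF V(2,2,2)]
  note aVt = assoc_tens[OF V(1,1,1)] and aWt = assoc_tens[OF V(2,2,2)]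
  note L = lm_comp[OF m1 aW] and R = lm_comp[OF aV m2]
  show ?thesis
  proof (rule tensor_ext[OF v(1) V(1) v(6) L R _ t])
    fix s u assume s: "s \<in> carrier ?T" and u: "u \<in> carrier V"
    note b = blm_left[OF tens_blm[OF v(1) V(1)] u]
    show "tensor_assoc K W W W (tensor_map K ?S W (tensor_map K W W f f) f (tens K ?T V s u)) =
      tensor_map K W ?S f (tensor_map K W W f f) (tensor_assoc K V V V (tens K ?T V s u))"
    proof (rule tensor_ext[OF V(1,1) v(6) lm_comp[OF b L] lm_comp[OF b R] _ s])
      fix x y assume x: "x \<in> carrier V" and y: "y \<in> carrier V"
      note fx = lm_closed[OF f x] lm_closed[OF f y] lm_closed[OF f u]
      note t1 = tens_closed[OF V(1,1) x y] and t2 = tens_closed[OF V(1,1) y u]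
      show "tensor_assoc K W W W (tensor_map K ?S W (tensor_map K W W f f) f (tens K ?T V (tens K V V x y) u)) =
        tensor_map K W ?S f (tensor_map K W W f f) (tensor_assoc K V V V (tens K ?T V (tens K V V x y) u))"
        unfolding m1t[OF t1 u] fft[OF x y] aWt[OF fx] aVt[OF x y u] m2t[OF x t2] fft[OF y u] by (rule refl)
    qed
  qed
qed

text \<open>The two-variable analogue of \<open>coset_lift\<close>: replacing one representative at
  a time does not change the value. It gives meaning to the \<open>the_elem\<close> in
  \<open>coinv_prod\<close>.\<close>

lemma blm_coset:
  assumes V: "vs V" "vs W" "vs U" and N: "submodule N K V" "submodule M K W" and b: "blm V W U b"
    and z: "\<And>x w. x \<in> N \<Longrightarrow> w \<in> carrier W \<Longrightarrow> b x w = \<zero>\<^bsub>U\<^esub>" "\<And>v y. v \<in> carrier V \<Longrightarrow> y \<in> M \<Longrightarrow> b v y = \<zero>\<^bsub>U\<^esub>"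
    and v: "v \<in> carrier V" "w \<in> carrier W"
  shows "{b x y |x y. x \<in> N +>\<^bsub>V\<^esub> v \<and> y \<in> M +>\<^bsub>W\<^esub> w} = {b v w}"
proof -
  have e: "b x y = b v w" if x: "x \<in> N +>\<^bsub>V\<^esub> v" and y: "y \<in> M +>\<^bsub>W\<^esub> w" for x y
  proof -
    note xm = coset_memD[OF V(1) N(1) v(1) x] and ym = coset_memD[OF V(2) N(2) v(2) y]
    have "b x y = b v y"
    proof (rule vs_minus_zeroD[OF V(3) blm_closed[OF b xm(1) ym(1)] blm_closed[OF b v(1) ym(1)]])
      show "b x y \<ominus>\<^bsub>U\<^esub> b v y = \<zero>\<^bsub>U\<^esub>"
        using lm_minus[OF V(1,3) blm_left[OF b ym(1)] xm(1) v(1)] z(1)[OF xm(2) ym(1)] by simp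
    qed
    also have "b v y = b v w"
    proof (rule vs_minus_zeroD[OF V(3) blm_closed[OF b v(1) ym(1)] blm_closed[OF b v]])
      show "b v y \<ominus>\<^bsub>U\<^esub> b v w = \<zero>\<^bsub>U\<^esub>"
        using lm_minus[OF V(2,3) blm_right[OF b v(1)] ym(1) v(2)] z(2)[OF v(1) ym(2)] by simp
    qed
    finally show ?thesis .
  qed
  note self = coset_self[OF V(1) N(1) v(1)] coset_self[OF V(2) N(2) v(2)]
  show ?thesis
  proof (intro equalityI subsetI)
    fix u assume "u \<in> {b x y |x y. x \<in> N +>\<^bsub>V\<^esub> v \<and> y \<in> M +>\<^bsub>W\<^esub> w}"
    then show "u \<in> {b v w}" by (elim CollectE exE conjE) (simp add: e)
  next
    fix u assume "u \<in> {b v w}"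
    then have u: "u = b v w" by simp
    show "u \<in> {b x y |x y. x \<in> N +>\<^bsub>V\<^esub> v \<and> y \<in> M +>\<^bsub>W\<^esub> w}"
      unfolding u by (rule CollectI, rule exI[of _ v], rule exI[of _ w]) (simp only: self simp_thms)
  qed
qed

text \<open>A degree function on the basis splits a vector into its restrictions to the basis
  elements of each degree.\<close>

lemma free_graded:
  fixes B :: "'b set" and d :: "'b \<Rightarrow> nat"
  shows "direct_sum_decomposition K (free_vs K B) (\<lambda>n. lin_span K (free_vs K B) (basis_vec K ` {b \<in> B. d b = n}))"
proof -
  let ?F = "free_vs K B"
  define G where "G n = lin_span K ?F (basis_vec K ` {b \<in> B. d b = n})" for n
  have sub: "submodule (G n) K ?F" for n unfolding G_def by (intro span_submod) auto
  have Gsupp: "f b = \<zero>" if "f \<in> G n" "d b \<noteq> n" for f b n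
  proof -
    have "(\<lambda>f. f b) f = \<zero>\<^bsub>base_vs K\<^esub>"
    proof (rule lm_vanish_span[OF vs_free vs_base eval_lm _ _ that(1)[unfolded G_def]])
      show "x b = \<zero>\<^bsub>base_vs K\<^esub>" if "x \<in> basis_vec K ` {b \<in> B. d b = n}" for x
        using that \<open>d b \<noteq> n\<close> by (auto simp: basis_vec_def)
    qed auto
    then show ?thesis by simp
  qed
  have Gcar: "f \<in> carrier ?F" if "f \<in> G n" for f n using submod_sub[OF sub] that by blast
  \<comment> \<open>At a basis element \<open>b\<close> only the component of degree
    \<open>d b\<close> can be nonzero. This both verifies the decomposition and yields its
    uniqueness.\<close>
  have key: "(\<Oplus>\<^bsub>?F\<^esub>n\<in>{n. h n \<noteq> \<zero>\<^bsub>?F\<^esub>}. h n) b = h (d b) b"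
    if h: "\<And>n. h n \<in> G n" "finite {n. h n \<noteq> \<zero>\<^bsub>?F\<^esub>}" for h b
  proof -
    have hc: "h n b \<in> carrier K" for n using Gcar[OF h(1)[of n]] by (auto simp: free_carrier)
    have "(\<Oplus>\<^bsub>?F\<^esub>n\<in>{n. h n \<noteq> \<zero>\<^bsub>?F\<^esub>}. h n) b = (\<Oplus>\<^bsub>base_vs K\<^esub>n\<in>{n. h n \<noteq> \<zero>\<^bsub>?F\<^esub>}. h n b)"
      using h Gcar by (intro lm_sum[OF vs_free vs_base eval_lm[of b]]) blast+
    also have "\<dots> = h (d b) b"
    proof (cases "h (d b) = \<zero>\<^bsub>?F\<^esub>")
      case True
      then have "(\<Oplus>\<^bsub>base_vs K\<^esub>n\<in>{n. h n \<noteq> \<zero>\<^bsub>?F\<^esub>}. h n b) = \<zero>\<^bsub>base_vs K\<^esub>"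
        using Gsupp[OF h(1), of b] by (intro sum_zero) (auto, metis)
      with True show ?thesis by simp
    next
      case False
      show ?thesis
      proof (rule sum_single[OF vs_base h(2)])
        show "d b \<in> {n. h n \<noteq> \<zero>\<^bsub>?F\<^esub>}" using False by simp
      qed (use Gsupp[OF h(1), of b] hc in auto)
    qed
    finally show ?thesis .
  qed
  have ex: "\<exists>!h. (\<forall>n. h n \<in> G n) \<and> finite {n. h n \<noteq> \<zero>\<^bsub>?F\<^esub>} \<and> v = (\<Oplus>\<^bsub>?F\<^esub>n\<in>{n. h n \<noteq> \<zero>\<^bsub>?F\<^esub>}. h n)"
    if v: "v \<in> carrier ?F" for v
  proof -
    define h where "h n = (\<lambda>b. if d b = n then v b else \<zero>)" for n
    have hc: "h n \<in> carrier ?F" for n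
    proof -
      have "finite {b. h n b \<noteq> \<zero>}"
        by (rule finite_subset[of _ "{b. v b \<noteq> \<zero>}"]) (use v in \<open>auto simp: free_carrier h_def\<close>)
      then show ?thesis using v unfolding free_carrier by (simp add: h_def)
    qed
    have hG: "h n \<in> G n" for n
      unfolding G_def by (rule free_in_span[OF hc]) (use v in \<open>auto simp: h_def free_carrier split: if_splits\<close>)
    have "{n. h n \<noteq> \<zero>\<^bsub>?F\<^esub>} \<subseteq> d ` {b. v b \<noteq> \<zero>}" by (auto simp: h_def fun_eq_iff split: if_splits)
    then have hf: "finite {n. h n \<noteq> \<zero>\<^bsub>?F\<^esub>}"
      by (rule finite_subset) (use v in \<open>auto simp: free_carrier\<close>)
    have hv: "v = (\<Oplus>\<^bsub>?F\<^esub>n\<in>{n. h n \<noteq> \<zero>\<^bsub>?F\<^esub>}. h n)"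
      by (rule ext) (simp only: key[OF hG hf], simp add: h_def)
    show ?thesis
    proof (rule ex1I[of _ h])
      show "(\<forall>n. h n \<in> G n) \<and> finite {n. h n \<noteq> \<zero>\<^bsub>?F\<^esub>} \<and> v = (\<Oplus>\<^bsub>?F\<^esub>n\<in>{n. h n \<noteq> \<zero>\<^bsub>?F\<^esub>}. h n)"
        using hG hf hv by blast
      fix h' assume h': "(\<forall>n. h' n \<in> G n) \<and> finite {n. h' n \<noteq> \<zero>\<^bsub>?F\<^esub>} \<and> v = (\<Oplus>\<^bsub>?F\<^esub>n\<in>{n. h' n \<noteq> \<zero>\<^bsub>?F\<^esub>}. h' n)"
      show "h' = h"
      proof (intro ext)
        fix n b
        have "v b = h' (d b) b" using key[of h' b] h' by metis
        then show "h' n b = h n b" using Gsupp[of "h' n" n b] h' by (auto simp: h_def)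
      qed
    qed
  qed
  show ?thesis using sub ex unfolding direct_sum_decomposition_def G_def by blast
qed

section \<open>The species of pairs of topologies\<close>

abbreviation D where "D X \<equiv> free_vs K (adm_pairs X)"
abbreviation ev where "ev T T' \<equiv> basis_vec K (T, T')"
abbreviation \<Gamma> where "\<Gamma> X \<equiv> coprod_sp (Dtilde K) X"
abbreviation TD where "TD X \<equiv> tensor K (D X) (D X)"

section \<open>The structure maps on basis pairs\<close>

lemma Dspace [simp]: "sp_space (Dtilde K) X = D X"
  by (simp add: Dtilde_def Let_def)

lemma in_adm_pairs: "(T, T') \<in> adm_pairs X \<longleftrightarrow> topspace T = X \<and> admissible T' T"
  by (simp add: adm_pairs_def)

lemma ev_in: "topspace T = X \<Longrightarrow> admissible T' T \<Longrightarrow> ev T T' \<in> carrier (D X)"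
  by (intro basis_vec_in) (simp add: in_adm_pairs)

lemma D_ext:
  assumes "vs W" "f \<in> lm (D X) W" "g \<in> lm (D X) W"
    "\<And>T T'. topspace T = X \<Longrightarrow> admissible T' T \<Longrightarrow> f (ev T T') = g (ev T T')" "v \<in> carrier (D X)"
  shows "f v = g v"
  by (rule free_ext[OF assms(1-3) _ assms(5)]) (use assms(4) in \<open>auto simp: adm_pairs_def\<close>)

lemma D_ext2:
  assumes "vs W" "blm (D X) (D Y) W f" "blm (D X) (D Y) W g"
    "\<And>T T' S S'. topspace T = X \<Longrightarrow> admissible T' T \<Longrightarrow> topspace S = Y \<Longrightarrow> admissible S' S \<Longrightarrow>
      f (ev T T') (ev S S') = g (ev T T') (ev S S')" "v \<in> carrier (D X)" "w \<in> carrier (D Y)"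
  shows "f v w = g v w"
  by (rule free_ext2[OF assms(1-3) _ assms(5,6)]) (use assms(4) in \<open>auto simp: adm_pairs_def\<close>)

lemma relab_lm:
  assumes "finite X" "bij_betw f X Y"
  shows "relab_sp (Dtilde K) X f \<in> lm (D Y) (D X)"
proof -
  have "(case b of (T, T') \<Rightarrow> ev (pullback_topology X f T) (pullback_topology X f T')) \<in> carrier (D X)"
    if "b \<in> adm_pairs Y" for b
    using that assms adm_pull[of f X "fst b" "snd b"] topspace_pull[of f X "fst b"]
    by (auto simp: adm_pairs_def bij_betw_def intro!: ev_in)
  then show ?thesis
    by (simp add: Dtilde_def Let_def) (rule lin_ext_lm[OF vs_free], auto)
qed

lemma relab_ev:
  assumes "finite X" "bij_betw f X (topspace T)" "admissible T' T"
  shows "relab_sp (Dtilde K) X f (ev T T') = ev (pullback_topology X f T) (pullback_topology X f T')"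
proof -
  have "ev (pullback_topology X f T) (pullback_topology X f T') \<in> carrier (D X)"
    using assms adm_pull[of f X T T'] topspace_pull[of f X T] by (intro ev_in) (auto simp: bij_betw_def)
  then show ?thesis by (simp add: Dtilde_def Let_def lin_ext_basis)
qed

lemma relab_ev_in:
  assumes "finite X" "bij_betw f X (topspace T)" "admissible T' T"
  shows "topspace (pullback_topology X f T) = X" "admissible (pullback_topology X f T') (pullback_topology X f T)"
  using assms adm_pull[of f X T T'] topspace_pull[of f X T] by (auto simp: bij_betw_def)

lemma prod_aux:
  assumes "finite X" "finite Y" "X \<inter> Y = {}" "topspace T = X" "admissible T' T" "topspace S = Y" "admissible S' S"
  shows "topspace (top_union T S) = X \<union> Y" "admissible (top_union T' S') (top_union T S)"
  using assms adm_union[of T S T' S'] by auto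

lemma prod_blm:
  assumes "finite X" "finite Y" "X \<inter> Y = {}"
  shows "blm (D X) (D Y) (D (X \<union> Y)) (prod_sp (Dtilde K) X Y)"
proof -
  have "blm (D X) (D Y) (D (X \<union> Y)) (\<lambda>f g. lin_ext K (D (X \<union> Y)) (\<lambda>b. lin_ext K (D (X \<union> Y))
     ((\<lambda>(T1, T1') (T2, T2'). ev (top_union T1 T2) (top_union T1' T2')) b) g) f)"
    by (rule lin_ext2_blm[OF vs_free]) (use prod_aux[OF assms] in \<open>auto simp: in_adm_pairs\<close>)
  then show ?thesis by (simp add: Dtilde_def Let_def case_prod_unfold)
qed

lemma prod_ev:
  assumes "finite X" "finite Y" "X \<inter> Y = {}" "topspace T = X" "admissible T' T" "topspace S = Y" "admissible S' S"
  shows "prod_sp (Dtilde K) X Y (ev T T') (ev S S') = ev (top_union T S) (top_union T' S')"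
  using prod_aux[OF assms] by (simp add: Dtilde_def Let_def lin_ext_basis ev_in)

lemma quot_pair_in:
  assumes "finite (topspace T)" "admissible T' T" "admissible A T'"
  shows "topspace (top_quot T A) = topspace T" "admissible (top_quot T' A) (top_quot T A)" "admissible A T"
  using assms adm_quot adm_trans by auto

lemma coprod_aux:
  assumes "finite X" "topspace T = X" "admissible T' T" "admissible A T'"
  shows "tens K (D X) (D X) (ev T A) (ev (top_quot T A) (top_quot T' A)) \<in> carrier (TD X)"
  using assms quot_pair_in[of T T' A] by (intro tens_closed ev_in) auto

lemma coprod_lm:
  assumes "finite X"
  shows "\<Gamma> X \<in> lm (D X) (TD X)"
proof -
  have "(case b of (T, T') \<Rightarrow> \<Oplus>\<^bsub>TD X\<^esub>T''\<in>{T''. admissible T'' T'}.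
         tens K (D X) (D X) (ev T T'') (ev (top_quot T T'') (top_quot T' T''))) \<in> carrier (TD X)" if "b \<in> adm_pairs X" for b
    using that coprod_aux[OF assms] by (auto simp: adm_pairs_def intro!: vs_sum)
  then show ?thesis by (simp add: Dtilde_def Let_def) (rule lin_ext_lm, auto)
qed

lemma coprod_ev:
  assumes "finite X" "topspace T = X" "admissible T' T"
  shows "\<Gamma> X (ev T T') = (\<Oplus>\<^bsub>TD X\<^esub>A\<in>{A. admissible A T'}.
         tens K (D X) (D X) (ev T A) (ev (top_quot T A) (top_quot T' A)))"
proof -
  have "(\<Oplus>\<^bsub>TD X\<^esub>A\<in>{A. admissible A T'}.
         tens K (D X) (D X) (ev T A) (ev (top_quot T A) (top_quot T' A))) \<in> carrier (TD X)"
    using coprod_aux[OF assms] by (intro vs_sum) auto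
  then show ?thesis by (simp add: Dtilde_def Let_def lin_ext_basis)
qed

lemma counit_lm: "counit_sp (Dtilde K) X \<in> lm (D X) (base_vs K)"
  by (simp add: Dtilde_def Let_def) (rule lin_ext_lm, auto)

lemma counit_ev: "counit_sp (Dtilde K) X (ev T T') = (if top_degree T' = 0 then \<one> else \<zero>)"
  by (simp add: Dtilde_def Let_def lin_ext_basis)

section \<open>The axioms of a species and of a commutative monoid\<close>

lemma Dspecies: "linear_species K (Dtilde K)"
  unfolding linear_species_def Dspace
proof (intro conjI allI impI ballI; (elim conjE)?)
  fix X :: "'a set" and f :: "'a \<Rightarrow> 'a" and Y
  assume "finite X" "bij_betw f X Y"
  then show "relab_sp (Dtilde K) X f \<in> lm (D Y) (D X)" by (rule relab_lm)
next
  fix X Y :: "'a set" and f g :: "'a \<Rightarrow> 'a" and v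
  assume X: "finite X" "bij_betw f X Y" "\<forall>x\<in>X. f x = g x" and v: "v \<in> carrier (D Y)"
  then have g: "bij_betw g X Y" using bij_betw_cong by metis
  show "relab_sp (Dtilde K) X f v = relab_sp (Dtilde K) X g v"
  proof (rule D_ext[OF vs_free relab_lm[OF X(1,2)] relab_lm[OF X(1) g] _ v])
    fix T T' :: "'a topology" assume T: "topspace T = Y" "admissible T' T"
    have "pullback_topology X f S = pullback_topology X g S" if "topspace S = Y" for S
      using X that by (intro pull_cong) (auto simp: bij_betw_def)
    then show "relab_sp (Dtilde K) X f (ev T T') = relab_sp (Dtilde K) X g (ev T T')"
      using T X g adm_topspace[OF T(2)] by (simp add: relab_ev)
  qed
next
  fix X :: "'a set" and v
  assume X: "finite X" and v: "v \<in> carrier (D X)"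
  show "relab_sp (Dtilde K) X (\<lambda>x. x) v = v"
  proof (rule D_ext[OF vs_free relab_lm lm_id _ v])
    fix T T' :: "'a topology" assume T: "topspace T = X" "admissible T' T"
    then show "relab_sp (Dtilde K) X (\<lambda>x. x) (ev T T') = ev T T'"
      using X adm_topspace[OF T(2)] by (subst relab_ev) (auto simp: bij_betw_def pull_id)
  qed (use X in \<open>auto simp: bij_betw_def\<close>)
next
  fix X Y Z :: "'a set" and f g :: "'a \<Rightarrow> 'a" and v
  assume X: "finite X" "bij_betw f X Y" "bij_betw g Y Z" and v: "v \<in> carrier (D Z)"
  have Y: "finite Y" using X bij_betw_finite by blast
  have gf: "bij_betw (g \<circ> f) X Z" using X bij_betw_trans by blast
  show "relab_sp (Dtilde K) X (g \<circ> f) v = relab_sp (Dtilde K) X f (relab_sp (Dtilde K) Y g v)"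
  proof (rule D_ext[OF vs_free relab_lm[OF X(1) gf] lm_comp[OF relab_lm[OF Y X(3)] relab_lm[OF X(1,2)]] _ v])
    fix T T' :: "'a topology" assume T: "topspace T = Z" "admissible T' T"
    have p: "pullback_topology X f (pullback_topology Y g S) = pullback_topology X (g \<circ> f) S" if "topspace S = Z" for S
      using X that by (intro pull_pull) (auto simp: bij_betw_def)
    show "relab_sp (Dtilde K) X (g \<circ> f) (ev T T') = relab_sp (Dtilde K) X f (relab_sp (Dtilde K) Y g (ev T T'))"
      using T X Y gf adm_topspace[OF T(2)] relab_ev_in[of Y g T T']
      by (simp add: relab_ev p)
  qed
qed simp

lemma Dmonoid: "species_monoid K (Dtilde K)"
  unfolding species_monoid_def Dspace
proof (intro conjI allI impI ballI Dspecies; (elim conjE)?)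
  fix X Y :: "'a set" assume "finite X" "finite Y" "X \<inter> Y = {}"
  then show "blm (D X) (D Y) (D (X \<union> Y)) (prod_sp (Dtilde K) X Y)" by (rule prod_blm)
next
  fix X Y Z :: "'a set" and f :: "'a \<Rightarrow> 'a" and a b
  assume X: "finite X" "finite Y" "X \<inter> Y = {}" "bij_betw f (X \<union> Y) Z" and a: "a \<in> carrier (D (f ` X))" "b \<in> carrier (D (f ` Y))"
  have inj: "inj_on f (X \<union> Y)" and Z: "f ` X \<union> f ` Y = Z" using X by (auto simp: bij_betw_def)
  have fX: "bij_betw f X (f ` X)" "bij_betw f Y (f ` Y)" using inj by (auto simp: bij_betw_def inj_on_Un)
  have fin: "finite (f ` X)" "finite (f ` Y)" "finite (X \<union> Y)" using X by auto
  have dis: "f ` X \<inter> f ` Y = {}" using inj X(3) by (auto simp: inj_on_def)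
  show "relab_sp (Dtilde K) (X \<union> Y) f (prod_sp (Dtilde K) (f ` X) (f ` Y) a b) =
           prod_sp (Dtilde K) X Y (relab_sp (Dtilde K) X f a) (relab_sp (Dtilde K) Y f b)"
  proof (rule D_ext2[OF vs_free _ _ _ a])
    show "blm (D (f ` X)) (D (f ` Y)) (D (X \<union> Y)) (\<lambda>a b. relab_sp (Dtilde K) (X \<union> Y) f (prod_sp (Dtilde K) (f ` X) (f ` Y) a b))"
      by (rule blm_comp[OF prod_blm[OF fin(1,2) dis] lm_id lm_id relab_lm[OF fin(3)]]) (use X(4) Z in simp)
    show "blm (D (f ` X)) (D (f ` Y)) (D (X \<union> Y)) (\<lambda>a b. prod_sp (Dtilde K) X Y (relab_sp (Dtilde K) X f a) (relab_sp (Dtilde K) Y f b))"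
      by (rule blm_comp[OF prod_blm[OF X(1-3)] relab_lm[OF X(1) fX(1)] relab_lm[OF X(2) fX(2)] lm_id])
    fix T T' S S' :: "'a topology" assume T: "topspace T = f ` X" "admissible T' T" "topspace S = f ` Y" "admissible S' S"
    have f1: "bij_betw f X (topspace T)" "bij_betw f Y (topspace S)" using fX T by auto
    have f2: "bij_betw f (X \<union> Y) (topspace (top_union T S))" using T Z X(4) by simp
    have pu: "pullback_topology (X \<union> Y) f (top_union A B) = top_union (pullback_topology X f A) (pullback_topology Y f B)"
      if "topspace A = f ` X" "topspace B = f ` Y" for A B
      by (rule pull_union[OF X(1-3) inj that])
    show "relab_sp (Dtilde K) (X \<union> Y) f (prod_sp (Dtilde K) (f ` X) (f ` Y) (ev T T') (ev S S')) =
           prod_sp (Dtilde K) X Y (relab_sp (Dtilde K) X f (ev T T')) (relab_sp (Dtilde K) Y f (ev S S'))"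
      unfolding prod_ev[OF fin(1,2) dis T] relab_ev[OF X(1) f1(1) T(2)] relab_ev[OF X(2) f1(2) T(4)]
        relab_ev[OF fin(3) f2 prod_aux(2)[OF fin(1,2) dis T]]
        prod_ev[OF X(1-3) relab_ev_in[OF X(1) f1(1) T(2)] relab_ev_in[OF X(2) f1(2) T(4)]]
      using T adm_topspace[OF T(2)] adm_topspace[OF T(4)] by (simp add: pu)
  qed
next
  fix X Y Z :: "'a set" and a b c
  assume X: "finite X" "finite Y" "finite Z" "X \<inter> Y = {}" "X \<inter> Z = {}" "Y \<inter> Z = {}"
    and a: "a \<in> carrier (D X)" "b \<in> carrier (D Y)" "c \<in> carrier (D Z)"
  \<comment> \<open>The two bracketings take values over syntactically different unions; the last
    equation identifies these spaces so that both sides can be compared as maps into one of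
    them.\<close>
  have f: "finite (X \<union> Y)" "finite (Y \<union> Z)" "(X \<union> Y) \<inter> Z = {}" "X \<inter> (Y \<union> Z) = {}" "X \<union> Y \<union> Z = X \<union> (Y \<union> Z)"
    using X by auto
  let ?p = "prod_sp (Dtilde K)"
  note p1 = prod_blm[OF X(1,2,4)] and p2 = prod_blm[OF X(2,3,6)] and p3 = prod_blm[OF f(1) X(3) f(3)]
    and p4 = prod_blm[OF X(1) f(2,4), folded f(5)]
  show "?p (X \<union> Y) Z (?p X Y a b) c = ?p X (Y \<union> Z) a (?p Y Z b c)"
  proof (rule D_ext2[OF vs_free _ _ _ a(1,2)])
    show "blm (D X) (D Y) (D (X \<union> Y \<union> Z)) (\<lambda>a b. ?p (X \<union> Y) Z (?p X Y a b) c)"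
      by (rule blm_comp[OF p1 lm_id lm_id blm_left[OF p3 a(3)]])
    show "blm (D X) (D Y) (D (X \<union> Y \<union> Z)) (\<lambda>a b. ?p X (Y \<union> Z) a (?p Y Z b c))"
      by (rule blm_comp[OF p4 lm_id blm_left[OF p2 a(3)] lm_id])
    fix T T' S S' :: "'a topology" assume T: "topspace T = X" "admissible T' T" "topspace S = Y" "admissible S' S"
    show "?p (X \<union> Y) Z (?p X Y (ev T T') (ev S S')) c = ?p X (Y \<union> Z) (ev T T') (?p Y Z (ev S S') c)"
    proof (rule D_ext[OF vs_free _ _ _ a(3)])
      show "?p (X \<union> Y) Z (?p X Y (ev T T') (ev S S')) \<in> lm (D Z) (D (X \<union> Y \<union> Z))"
        by (intro blm_right[OF p3] blm_closed[OF p1] ev_in T)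
      show "(\<lambda>c. ?p X (Y \<union> Z) (ev T T') (?p Y Z (ev S S') c)) \<in> lm (D Z) (D (X \<union> Y \<union> Z))"
        by (intro lm_comp[OF blm_right[OF p2] blm_right[OF p4]] ev_in T)
      fix U U' :: "'a topology" assume U: "topspace U = Z" "admissible U' U"
      note a1 = prod_aux[OF X(1,2,4) T] and a2 = prod_aux[OF X(2,3,6) T(3,4) U]
      show "?p (X \<union> Y) Z (?p X Y (ev T T') (ev S S')) (ev U U') = ?p X (Y \<union> Z) (ev T T') (?p Y Z (ev S S') (ev U U'))"
        unfolding prod_ev[OF X(1,2,4) T] prod_ev[OF X(2,3,6) T(3,4) U] prod_ev[OF f(1) X(3) f(3) a1 U]
          prod_ev[OF X(1) f(2,4) T(1,2) a2] top_union_assoc by (rule refl)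
    qed
  qed
next
  have "admissible (discrete_topology {}) (discrete_topology {} :: 'a topology)" by (rule adm_refl) simp
  then show u: "unit_sp (Dtilde K) \<in> carrier (D {} :: ('k, 'a topology \<times> 'a topology \<Rightarrow> 'k) module)"
    by (simp add: Dtilde_def Let_def ev_in)
  fix X :: "'a set" and a assume X: "finite X" and a: "a \<in> carrier (D X)"
  have ue: "unit_sp (Dtilde K) = ev (discrete_topology {}) (discrete_topology {})"
    by (simp add: Dtilde_def Let_def)
  have ad: "admissible (discrete_topology {}) (discrete_topology {} :: 'a topology)" by (rule adm_refl) simp
  have p1: "blm (D {}) (D X) (D X) (prod_sp (Dtilde K) {} X)" using prod_blm[of "{}" X] X by simp
  have p2: "blm (D X) (D {}) (D X) (prod_sp (Dtilde K) X {})" using prod_blm[of X "{}"] X by simp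
  show "prod_sp (Dtilde K) {} X (unit_sp (Dtilde K)) a = a"
  proof (rule D_ext[OF vs_free blm_right[OF p1 u] lm_id _ a])
    fix T T' assume T: "topspace T = X" "admissible T' T"
    show "prod_sp (Dtilde K) {} X (unit_sp (Dtilde K)) (ev T T') = ev T T'"
      unfolding ue using X T ad by (subst prod_ev) (auto simp: top_union_empty)
  qed
  show "prod_sp (Dtilde K) X {} a (unit_sp (Dtilde K)) = a"
  proof (rule D_ext[OF vs_free blm_left[OF p2 u] lm_id _ a])
    fix T T' assume T: "topspace T = X" "admissible T' T"
    show "prod_sp (Dtilde K) X {} (ev T T') (unit_sp (Dtilde K)) = ev T T'"
      unfolding ue using X T ad
      by (subst prod_ev) (auto simp: top_union_empty top_union_commute[of _ "discrete_topology {}"])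
  qed
qed

text \<open>Disjoint unions are actual unions of subsets, so both products lie in the same space and
  commutativity is a plain equality with no symmetry map in between.\<close>

lemma Dcommutative: "commutative_species (Dtilde K :: ('k, 'a, 'a topology \<times> 'a topology \<Rightarrow> 'k) species_data)"
  unfolding commutative_species_def Dspace
proof (intro allI impI ballI; (elim conjE)?)
  fix X Y :: "'a set" and a b assume X: "finite X" "finite Y" "X \<inter> Y = {}" and a: "a \<in> carrier (D X)" "b \<in> carrier (D Y)"
  have X': "Y \<inter> X = {}" "Y \<union> X = X \<union> Y" using X by auto
  have p: "blm (D X) (D Y) (D (X \<union> Y)) (\<lambda>a b. prod_sp (Dtilde K) Y X b a)"
    using prod_blm[OF X(2,1) X'(1)] unfolding bilinear_map_def X'(2) by auto
  show "prod_sp (Dtilde K) X Y a b = prod_sp (Dtilde K) Y X b a"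
    by (rule D_ext2[OF vs_free prod_blm[OF X] p _ a])
      (simp add: prod_ev[OF X] prod_ev[OF X(2,1) X'(1)] top_union_commute)
qed

section \<open>Coassociativity and counit laws for pairs\<close>

lemma tens_basis_sum2:
  assumes "vs V" "vs W" "finite A" "\<And>a. a \<in> A \<Longrightarrow> f a \<in> carrier W" "v \<in> carrier V"
  shows "tens K V W v (finsum W f A) = (\<Oplus>\<^bsub>tensor K V W\<^esub>a\<in>A. tens K V W v (f a))"
  using lm_sum[OF assms(2) vs_tensor[OF assms(1,2)] blm_right[OF tens_blm[OF assms(1,2)] assms(5)] assms(3,4)] .

text \<open>On a basis pair, the left side is a double sum over chains \<open>A\<close>,
  \<open>B\<close>, \<open>T'\<close>, the right side one over \<open>A\<close> and a topology
  \<open>U\<close> admissible for \<open>T'/A\<close>. The bijection between the index sets concerns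
  \<open>T'\<close> alone; the first topology \<open>T\<close> is carried along as a
  parameter.\<close>

lemma D_coassoc:
  assumes X: "finite X" and c: "c \<in> carrier (D X)"
  shows "tensor_assoc K (D X) (D X) (D X) (tensor_map K (TD X) (D X) (\<Gamma> X) (\<lambda>x. x) (\<Gamma> X c)) =
    tensor_map K (D X) (TD X) (\<lambda>x. x) (\<Gamma> X) (\<Gamma> X c)"
proof -
  let ?V = "D X" and ?T = "TD X"
  let ?L = "tensor K ?T ?V" and ?R = "tensor K ?V ?T"
  note G = coprod_lm[OF X]
  have mL: "tensor_map K ?T ?V (\<Gamma> X) (\<lambda>x. x) \<in> lm ?T ?L" by (intro tensor_map_lm G lm_id) auto
  have mR: "tensor_map K ?V ?T (\<lambda>x. x) (\<Gamma> X) \<in> lm ?T ?R" by (intro tensor_map_lm G lm_id) auto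
  have as: "tensor_assoc K ?V ?V ?V \<in> lm ?L ?R" by (intro assoc_lm) auto
  have v[simp]: "vs ?V" "vs ?T" "vs ?L" "vs ?R" by auto
  show ?thesis
  proof (rule D_ext[OF v(4) lm_comp[OF lm_comp[OF G mL] as] lm_comp[OF G mR] _ c])
    fix T T' assume T: "topspace T = X" "admissible T' T"
    have T'X: "topspace T' = X" using adm_topspace[OF T(2)] T by simp
    have fin: "finite (topspace T)" "finite (topspace T')" using T X T'X by auto
    note fa = finite_adm
    have ad: "topspace A = X" "admissible A T" if "admissible A T'" for A
      using that adm_topspace[OF that] T'X adm_trans[OF fin(1) that T(2)] by auto
    have cl: "ev T A \<in> carrier ?V" "ev (top_quot T A) (top_quot T' A) \<in> carrier ?V" if "admissible A T'" for A
      using ad[OF that] T adm_quot[OF fin(1) that T(2)] by (simp_all add: ev_in)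
    have fad: "finite {A. admissible A S}" if "topspace S = X" for S using X that by (intro finite_adm) simp
    note tm1 = tensor_map_tens[OF v(1,1,2,1) G lm_id] and tm2 = tensor_map_tens[OF v(1,1,1,2) lm_id G]
    \<comment> \<open>On the left \<open>U\<close> is \<open>B/A\<close>. It is kept as a separate
      argument so that membership in the carrier can be proved for any \<open>U\<close> admissible
      for \<open>T'/A\<close>.\<close>
    define f where "f A B U = tens K ?V ?T (ev T A) (tens K ?V ?V (ev (top_quot T A) U) (ev (top_quot T B) (top_quot T' B)))" for A B U
    have fc: "f A B U \<in> carrier ?R" if "admissible A T'" "admissible B T'" "admissible U (top_quot T' A)" for A B U
    proof -
      have "admissible U (top_quot T A)"
        using adm_trans[OF _ that(3) adm_quot[OF fin(1) that(1) T(2)]] fin by simp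
      then have "ev (top_quot T A) U \<in> carrier ?V" using T by (simp add: ev_in)
      then show ?thesis unfolding f_def
        by (intro tens_closed[OF v(1,2)] tens_closed[OF v(1,1)] cl that)
    qed
    let ?S = "SIGMA B:{B. admissible B T'}. {A. admissible A B}"
    let ?S' = "SIGMA A:{A. admissible A T'}. {U. admissible U (top_quot T' A)}"
    have tB: "topspace B = X" if "admissible B T'" for B using ad[OF that] by simp
    have "tensor_assoc K ?V ?V ?V (tensor_map K ?T ?V (\<Gamma> X) (\<lambda>x. x) (\<Gamma> X (ev T T'))) =
      (\<Oplus>\<^bsub>?R\<^esub>B\<in>{B. admissible B T'}. tensor_assoc K ?V ?V ?V (tensor_map K ?T ?V (\<Gamma> X) (\<lambda>x. x)
         (tens K ?V ?V (ev T B) (ev (top_quot T B) (top_quot T' B)))))"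
      unfolding coprod_ev[OF X T]
      by (rule lm_sum[OF v(2,4) lm_comp[OF mL as] fad[OF T'X]]) (simp add: cl)
    also have "\<dots> = (\<Oplus>\<^bsub>?R\<^esub>B\<in>{B. admissible B T'}. \<Oplus>\<^bsub>?R\<^esub>A\<in>{A. admissible A B}. f A B (top_quot B A))"
    proof (rule sum_cong[OF v(4) refl])
      fix B assume "B \<in> {B. admissible B T'}"
      then have B: "admissible B T'" by simp
      have AT: "admissible A T'" if "admissible A B" for A using that B adm_trans[OF fin(2)] by blast
      have cl2: "ev T A \<in> carrier ?V" "ev (top_quot T A) (top_quot B A) \<in> carrier ?V" if "admissible A B" for A
        using cl(1)[OF AT[OF that]] T adm_quot[OF fin(1) that ad(2)[OF B]] by (simp_all add: ev_in)
      have "tensor_assoc K ?V ?V ?V (tensor_map K ?T ?V (\<Gamma> X) (\<lambda>x. x)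
         (tens K ?V ?V (ev T B) (ev (top_quot T B) (top_quot T' B)))) =
        tensor_assoc K ?V ?V ?V (tens K ?T ?V (\<Oplus>\<^bsub>?T\<^esub>A\<in>{A. admissible A B}.
         tens K ?V ?V (ev T A) (ev (top_quot T A) (top_quot B A))) (ev (top_quot T B) (top_quot T' B)))"
        by (subst tm1[OF cl[OF B]]) (simp add: coprod_ev[OF X T(1) ad(2)[OF B]])
      also have "\<dots> = (\<Oplus>\<^bsub>?R\<^esub>A\<in>{A. admissible A B}. tensor_assoc K ?V ?V ?V (tens K ?T ?V
         (tens K ?V ?V (ev T A) (ev (top_quot T A) (top_quot B A))) (ev (top_quot T B) (top_quot T' B))))"
        by (rule lm_sum[OF v(2,4) lm_comp[OF blm_left[OF tens_blm[OF v(2,1)] cl(2)[OF B]] as] fad[OF tB[OF B]]]) (simp add: cl2)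
      also have "\<dots> = (\<Oplus>\<^bsub>?R\<^esub>A\<in>{A. admissible A B}. f A B (top_quot B A))"
      proof (rule sum_cong[OF v(4) refl])
        fix A assume "A \<in> {A. admissible A B}"
        then have A: "admissible A B" by simp
        show "tensor_assoc K ?V ?V ?V (tens K ?T ?V (tens K ?V ?V (ev T A) (ev (top_quot T A) (top_quot B A))) (ev (top_quot T B) (top_quot T' B)))
          = f A B (top_quot B A)" unfolding f_def by (rule assoc_tens[OF v(1,1,1) cl2[OF A] cl(2)[OF B]])
        show "f A B (top_quot B A) \<in> carrier ?R" by (intro fc AT[OF A] B adm_quot[OF fin(2)] A)
      qed
      finally show "tensor_assoc K ?V ?V ?V (tensor_map K ?T ?V (\<Gamma> X) (\<lambda>x. x)
         (tens K ?V ?V (ev T B) (ev (top_quot T B) (top_quot T' B)))) = (\<Oplus>\<^bsub>?R\<^esub>A\<in>{A. admissible A B}. f A B (top_quot B A))" .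
      show "(\<Oplus>\<^bsub>?R\<^esub>A\<in>{A. admissible A B}. f A B (top_quot B A)) \<in> carrier ?R"
        by (intro vs_sum v fc) (use AT B adm_quot[OF fin(2)] in auto)
    qed
    also have "\<dots> = finsum ?R (\<lambda>(B, A). f A B (top_quot B A)) ?S"
      using fad tB T'X adm_trans[OF fin(2)] adm_quot[OF fin(2)] by (intro sum_Sigma v fc) auto
    finally have 1: "tensor_assoc K ?V ?V ?V (tensor_map K ?T ?V (\<Gamma> X) (\<lambda>x. x) (\<Gamma> X (ev T T'))) =
      finsum ?R (\<lambda>(B, A). f A B (top_quot B A)) ?S" .
    \<comment> \<open>The right summand, with iterated quotients in its last factor; under the
      substitution \<open>U = B/A\<close> these collapse to quotients by \<open>B\<close>.\<close>
    define g where "g A U = tens K ?V ?T (ev T A) (tens K ?V ?V (ev (top_quot T A) U)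
        (ev (top_quot (top_quot T A) U) (top_quot (top_quot T' A) U)))" for A U
    have gc: "g A U \<in> carrier ?R" if "admissible A T'" "admissible U (top_quot T' A)" for A U
    proof -
      have q: "admissible (top_quot T' A) (top_quot T A)" by (rule adm_quot[OF fin(1) that(1) T(2)])
      have "tens K ?V ?V (ev (top_quot T A) U) (ev (top_quot (top_quot T A) U) (top_quot (top_quot T' A) U)) \<in> carrier ?T"
        using coprod_aux[OF X _ q that(2)] T by simp
      then show ?thesis unfolding g_def by (rule tens_closed[OF v(1,2) cl(1)[OF that(1)]])
    qed
    have "tensor_map K ?V ?T (\<lambda>x. x) (\<Gamma> X) (\<Gamma> X (ev T T')) =
      (\<Oplus>\<^bsub>?R\<^esub>A\<in>{A. admissible A T'}. tensor_map K ?V ?T (\<lambda>x. x) (\<Gamma> X)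
         (tens K ?V ?V (ev T A) (ev (top_quot T A) (top_quot T' A))))"
      unfolding coprod_ev[OF X T]
      by (rule lm_sum[OF v(2,4) mR fad[OF T'X]]) (simp add: cl)
    also have "\<dots> = (\<Oplus>\<^bsub>?R\<^esub>A\<in>{A. admissible A T'}. \<Oplus>\<^bsub>?R\<^esub>U\<in>{U. admissible U (top_quot T' A)}. g A U)"
    proof (rule sum_cong[OF v(4) refl])
      fix A assume "A \<in> {A. admissible A T'}"
      then have A: "admissible A T'" by simp
      have q: "topspace (top_quot T A) = X" "admissible (top_quot T' A) (top_quot T A)"
        using T adm_quot[OF fin(1) A T(2)] by auto
      show "tensor_map K ?V ?T (\<lambda>x. x) (\<Gamma> X) (tens K ?V ?V (ev T A) (ev (top_quot T A) (top_quot T' A))) =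
        (\<Oplus>\<^bsub>?R\<^esub>U\<in>{U. admissible U (top_quot T' A)}. g A U)"
        unfolding g_def
        by (subst tm2[OF cl[OF A]], subst coprod_ev[OF X q], rule tens_basis_sum2[OF v(1,2)])
          (use cl[OF A] coprod_aux[OF X q] fad[of "top_quot T' A"] T'X in simp_all)
      show "(\<Oplus>\<^bsub>?R\<^esub>U\<in>{U. admissible U (top_quot T' A)}. g A U) \<in> carrier ?R"
        by (rule vs_sum[OF v(4)]) (simp add: gc[OF A])
    qed
    also have "\<dots> = finsum ?R (\<lambda>(A, U). g A U) ?S'"
      using fad T'X gc by (intro sum_Sigma v) auto
    also have "\<dots> = finsum ?R (\<lambda>p. (\<lambda>(A, U). g A U) ((\<lambda>(B, A). (A, top_quot B A)) p)) ?S"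
    proof -
      have inj: "inj_on (\<lambda>(B, A). (A, top_quot B A)) ?S" and img: "(\<lambda>(B, A). (A, top_quot B A)) ` ?S = ?S'"
        using adm_quot_bij[OF fin(2)] by (simp_all add: bij_betw_def)
      show ?thesis
      proof (subst img[symmetric], rule sum_reindex[OF v(4) inj])
        fix p assume "p \<in> ?S"
        then have "(\<lambda>(B, A). (A, top_quot B A)) p \<in> ?S'" using img by blast
        then show "(\<lambda>(A, U). g A U) ((\<lambda>(B, A). (A, top_quot B A)) p) \<in> carrier ?R"
          using gc by (auto simp: case_prod_unfold)
      qed
    qed
    also have "\<dots> = finsum ?R (\<lambda>(B, A). f A B (top_quot B A)) ?S"
    proof (rule sum_cong[OF v(4) refl]; clarify)
      fix B A assume B: "admissible B T'" and A: "admissible A B"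
      \<comment> \<open>The collapse of an iterated quotient is used for each member of the last
        pair, once for \<open>T\<close> and once for \<open>T'\<close>.\<close>
      show "g A (top_quot B A) = f A B (top_quot B A)"
        unfolding g_def f_def using quot_quot[OF fin(1) A ad(2)[OF B]] quot_quot[OF fin(2) A B] by simp
      show "f A B (top_quot B A) \<in> carrier ?R" by (rule fc[OF adm_trans[OF fin(2) A B] B adm_quot[OF fin(2) A B]])
    qed
    finally show "tensor_assoc K ?V ?V ?V (tensor_map K ?T ?V (\<Gamma> X) (\<lambda>x. x) (\<Gamma> X (ev T T'))) =
      tensor_map K ?V ?T (\<lambda>x. x) (\<Gamma> X) (\<Gamma> X (ev T T'))" using 1 by simp
  qed
qed

lemma counit_action_blm:
  assumes "vs V" "e \<in> lm V (base_vs K)"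
  shows "blm V V V (\<lambda>x y. e x \<odot>\<^bsub>V\<^esub> y)" "blm V V V (\<lambda>x y. e y \<odot>\<^bsub>V\<^esub> x)"
proof -
  have ec: "e x \<in> carrier K" if "x \<in> carrier V" for x using lm_closed[OF assms(2) that] by simp
  have 1: "(\<lambda>y. e x \<odot>\<^bsub>V\<^esub> y) \<in> lm V V" if "x \<in> carrier V" for x
    by (rule lm_scale[OF assms(1) ec[OF that] lm_id])
  have 2: "(\<lambda>x. e x \<odot>\<^bsub>V\<^esub> y) \<in> lm V V" if "y \<in> carrier V" for y
    by (rule lm_comp[OF assms(2) lm_scale_vec[OF assms(1) that]])
  show "blm V V V (\<lambda>x y. e x \<odot>\<^bsub>V\<^esub> y)" "blm V V V (\<lambda>x y. e y \<odot>\<^bsub>V\<^esub> x)"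
    using 1 2 by (auto intro: blmI)
qed

lemma smult_one: "vs V \<Longrightarrow> v \<in> carrier V \<Longrightarrow> \<one> \<odot>\<^bsub>V\<^esub> v = v" by (rule Module.module.smult_one)
lemma smult_zero: "vs V \<Longrightarrow> v \<in> carrier V \<Longrightarrow> \<zero> \<odot>\<^bsub>V\<^esub> v = \<zero>\<^bsub>V\<^esub>" by (rule Module.module.smult_l_null)

text \<open>Applied to the left factor, the counit keeps only the \<open>A\<close> of degree zero,
  which is the partition of \<open>T'\<close> into classes. Applied to the right factor, it keeps
  only the \<open>A\<close> for which \<open>T'/A\<close> has degree zero, which is
  \<open>T'\<close>.\<close>

lemma D_counit:
  assumes X: "finite X" and c: "c \<in> carrier (D X)"
  shows "tensor_lift K (D X) (\<lambda>x y. counit_sp (Dtilde K) X x \<odot>\<^bsub>D X\<^esub> y) (\<Gamma> X c) = c"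
    "tensor_lift K (D X) (\<lambda>x y. counit_sp (Dtilde K) X y \<odot>\<^bsub>D X\<^esub> x) (\<Gamma> X c) = c"
proof -
  let ?V = "D X" and ?T = "TD X" and ?e = "counit_sp (Dtilde K) X"
  have v: "vs ?V" "vs ?T" by auto
  note G = coprod_lm[OF X]
  note b = counit_action_blm[OF v(1) counit_lm[of X]]
  note l1 = tensor_lift_lm[OF v(1,1,1) b(1)] and l2 = tensor_lift_lm[OF v(1,1,1) b(2)]
  note t1 = tensor_lift_tens[OF v(1,1,1) b(1)] and t2 = tensor_lift_tens[OF v(1,1,1) b(2)]
  { fix T T' assume T: "topspace T = X" "admissible T' T"
    have T'X: "topspace T' = X" using adm_topspace[OF T(2)] T by simp
    have fin: "finite (topspace T)" "finite (topspace T')" using T X T'X by auto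
    have cl: "ev T A \<in> carrier ?V" "ev (top_quot T A) (top_quot T' A) \<in> carrier ?V" if "admissible A T'" for A
      using T adm_quot[OF fin(1) that T(2)] adm_trans[OF fin(1) that T(2)] by (auto intro!: ev_in)
    have fad: "finite {A. admissible A T'}" by (rule finite_adm[OF fin(2)])
    have s: "L (\<Gamma> X (ev T T')) = (\<Oplus>\<^bsub>?V\<^esub>A\<in>{A. admissible A T'}. L (tens K ?V ?V (ev T A) (ev (top_quot T A) (top_quot T' A))))"
      if "L \<in> lm ?T ?V" for L
      unfolding coprod_ev[OF X T]
      by (rule lm_sum[OF v(2,1) that fad]) (intro tens_closed v; auto simp: cl)
    have "tensor_lift K ?V (\<lambda>x y. ?e x \<odot>\<^bsub>?V\<^esub> y) (\<Gamma> X (ev T T')) =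
      (\<Oplus>\<^bsub>?V\<^esub>A\<in>{A. admissible A T'}. (if top_degree A = 0 then \<one> else \<zero>) \<odot>\<^bsub>?V\<^esub> ev (top_quot T A) (top_quot T' A))"
      unfolding s[OF l1] by (rule sum_cong[OF v(1) refl])
       (auto simp: t1 cl counit_ev simp del: free_simps intro!: vs_smult)
    also have "\<dots> = (if top_degree (discrete_adm T') = 0 then \<one> else \<zero>) \<odot>\<^bsub>?V\<^esub> ev (top_quot T (discrete_adm T')) (top_quot T' (discrete_adm T'))"
      using cl adm_disc[OF fin(2)] degree_zero_disc[OF fin(2)]
      by (intro sum_single v fad) (auto simp: smult_zero simp del: free_simps intro!: vs_smult)
    \<comment> \<open>\<open>T\<close> and \<open>T'\<close> have the same classes, so dividing
      either of them by the partition of \<open>T'\<close> leaves it unchanged.\<close>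
    also have "\<dots> = ev T T'"
      using quot_disc[OF fin(1) T(2)] quot_disc[OF fin(2) adm_refl[OF fin(2)]] degree_disc[OF fin(2)] ev_in[OF T]
      by (simp add: smult_one del: free_simps)
    finally have 1: "tensor_lift K ?V (\<lambda>x y. ?e x \<odot>\<^bsub>?V\<^esub> y) (\<Gamma> X (ev T T')) = ev T T'" .
    have "tensor_lift K ?V (\<lambda>x y. ?e y \<odot>\<^bsub>?V\<^esub> x) (\<Gamma> X (ev T T')) =
      (\<Oplus>\<^bsub>?V\<^esub>A\<in>{A. admissible A T'}. (if top_degree (top_quot T' A) = 0 then \<one> else \<zero>) \<odot>\<^bsub>?V\<^esub> ev T A)"
      unfolding s[OF l2] by (rule sum_cong[OF v(1) refl])
       (auto simp: t2 cl counit_ev simp del: free_simps intro!: vs_smult)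
    also have "\<dots> = (if top_degree (top_quot T' T') = 0 then \<one> else \<zero>) \<odot>\<^bsub>?V\<^esub> ev T T'"
      using cl adm_refl[OF fin(2)] degree_quot_zero[OF fin(2)]
      by (intro sum_single v fad) (auto simp: smult_zero simp del: free_simps intro!: vs_smult)
    also have "\<dots> = ev T T'"
      using degree_quot_self[OF fin(2)] ev_in[OF T] by (simp add: smult_one del: free_simps)
    finally have "tensor_lift K ?V (\<lambda>x y. ?e y \<odot>\<^bsub>?V\<^esub> x) (\<Gamma> X (ev T T')) = ev T T'" .
    note 1 this }
  note gen = this
  show "tensor_lift K ?V (\<lambda>x y. ?e x \<odot>\<^bsub>?V\<^esub> y) (\<Gamma> X c) = c"
    by (rule D_ext[OF v(1) lm_comp[OF G l1] lm_id _ c]) (rule gen(1))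
  show "tensor_lift K ?V (\<lambda>x y. ?e y \<odot>\<^bsub>?V\<^esub> x) (\<Gamma> X c) = c"
    by (rule D_ext[OF v(1) lm_comp[OF G l2] lm_id _ c]) (rule gen(2))
qed

lemma D_coalgebra: "finite X \<Longrightarrow> coalgebra K (D X) (\<Gamma> X) (counit_sp (Dtilde K) X)"
  unfolding coalgebra_def by (intro conjI ballI vs_free coprod_lm counit_lm D_coassoc D_counit)

section \<open>Compatibility of coproduct and counit with relabelling, product and unit\<close>

text \<open>Pullback maps the topologies admissible for \<open>T'\<close> bijectively to those
  admissible for its pullback, and it commutes with quotients; the sum is reindexed along
  it.\<close>

lemma D_relab_coprod:
  assumes X: "finite X" "bij_betw f X Y" and c: "c \<in> carrier (D Y)"
  shows "\<Gamma> X (relab_sp (Dtilde K) X f c) =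
    tensor_map K (D X) (D X) (relab_sp (Dtilde K) X f) (relab_sp (Dtilde K) X f) (\<Gamma> Y c)"
    "counit_sp (Dtilde K) X (relab_sp (Dtilde K) X f c) = counit_sp (Dtilde K) Y c"
proof -
  let ?r = "relab_sp (Dtilde K) X f"
  let ?p = "pullback_topology X f"
  have Y: "finite Y" using X bij_betw_finite by blast
  note R = relab_lm[OF X]
  have v: "vs (D X)" "vs (D Y)" "vs (TD X)" "vs (TD Y)" by auto
  note m = tensor_map_lm[OF v(2,2,1,1) R R] and mt = tensor_map_tens[OF v(2,2,1,1) R R]
  show "\<Gamma> X (?r c) = tensor_map K (D X) (D X) ?r ?r (\<Gamma> Y c)"
  proof (rule D_ext[OF v(3) lm_comp[OF R coprod_lm[OF X(1)]] lm_comp[OF coprod_lm[OF Y] m] _ c])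
    fix T T' assume T: "topspace T = Y" "admissible T' T"
    have T'Y: "topspace T' = Y" using adm_topspace[OF T(2)] T by simp
    have fin: "finite (topspace T)" "finite (topspace T')" using T Y T'Y by auto
    have f: "bij_betw f X (topspace T)" "bij_betw f X (topspace T')" using X T T'Y by auto
    have ad: "topspace A = Y" "admissible A T" if "admissible A T'" for A
      using that adm_topspace[OF that] T'Y adm_trans[OF fin(1) that T(2)] by auto
    have q: "admissible (top_quot T' A) (top_quot T A)" if "admissible A T'" for A by (rule adm_quot[OF fin(1) that T(2)])
    have cl: "ev T A \<in> carrier (D Y)" "ev (top_quot T A) (top_quot T' A) \<in> carrier (D Y)" if "admissible A T'" for A
      using ad[OF that] T q[OF that] by (simp_all add: ev_in)
    note pin = relab_ev_in[OF X(1) f(1) T(2)]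
    let ?h = "\<lambda>A. tens K (D X) (D X) (ev (?p T) A) (ev (top_quot (?p T) A) (top_quot (?p T') A))"
    have hc: "?h (?p A) \<in> carrier (TD X)" if "admissible A T'" for A
      using coprod_aux[OF X(1) pin, of "?p A"] adm_pull[OF f(2) X(1) that] by simp
    have "\<Gamma> X (?r (ev T T')) = (\<Oplus>\<^bsub>TD X\<^esub>A\<in>?p ` {A. admissible A T'}. ?h A)"
      unfolding relab_ev[OF X(1) f(1) T(2)] coprod_ev[OF X(1) pin] adm_pull_image[OF f(2) X(1)] by (rule refl)
    also have "\<dots> = (\<Oplus>\<^bsub>TD X\<^esub>A\<in>{A. admissible A T'}. ?h (?p A))"
      by (rule sum_reindex[OF v(3) inj_on_subset[OF pull_inj[OF X(2,1)]]]) (use ad hc in auto)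
    also have "\<dots> = (\<Oplus>\<^bsub>TD X\<^esub>A\<in>{A. admissible A T'}. tensor_map K (D X) (D X) ?r ?r (tens K (D Y) (D Y) (ev T A) (ev (top_quot T A) (top_quot T' A))))"
    proof (rule sum_cong[OF v(3) refl])
      fix A assume "A \<in> {A. admissible A T'}"
      then have A: "admissible A T'" by simp
      have fq: "bij_betw f X (topspace (top_quot T A))" using f by simp
      show "?h (?p A) = tensor_map K (D X) (D X) ?r ?r (tens K (D Y) (D Y) (ev T A) (ev (top_quot T A) (top_quot T' A)))"
        unfolding mt[OF cl[OF A]] relab_ev[OF X(1) f(1) ad(2)[OF A]] relab_ev[OF X(1) fq q[OF A]]
        using pull_quot[OF f(1) X(1), of A] pull_quot[OF f(2) X(1), of A] ad[OF A] T T'Y by simp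
      show "tensor_map K (D X) (D X) ?r ?r (tens K (D Y) (D Y) (ev T A) (ev (top_quot T A) (top_quot T' A))) \<in> carrier (TD X)"
        using cl[OF A] by (intro lm_closed[OF m]) auto
    qed
    also have "\<dots> = tensor_map K (D X) (D X) ?r ?r (\<Gamma> Y (ev T T'))"
      unfolding coprod_ev[OF Y T]
      by (rule lm_sum[OF v(4,3) m finite_adm[OF fin(2)], symmetric]) (intro tens_closed v; auto simp: cl)
    finally show "\<Gamma> X (?r (ev T T')) = tensor_map K (D X) (D X) ?r ?r (\<Gamma> Y (ev T T'))" .
  qed
  show "counit_sp (Dtilde K) X (?r c) = counit_sp (Dtilde K) Y c"
  proof (rule D_ext[OF vs_base lm_comp[OF R counit_lm] counit_lm _ c])
    fix T T' assume T: "topspace T = Y" "admissible T' T"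
    then have "bij_betw f X (topspace T)" "bij_betw f X (topspace T')" using X adm_topspace[OF T(2)] by auto
    then show "counit_sp (Dtilde K) X (?r (ev T T')) = counit_sp (Dtilde K) Y (ev T T')"
      using T X by (simp add: relab_ev counit_ev degree_pull)
  qed
qed

lemma K_mult_blm: "blm (base_vs K) (base_vs K) (base_vs K) (\<lambda>x y. x \<otimes> y)"
  by (intro blmI lmI) (auto simp: l_distr r_distr m_ac)

text \<open>A topology admissible for a disjoint union is a disjoint union of admissible ones in
  exactly one way, and quotients respect the splitting. The sum over the union thus becomes a double
  sum, which bilinearity of the componentwise product factors.\<close>

lemma D_prod_coprod:
  assumes X: "finite X" "finite Y" "X \<inter> Y = {}" and a: "a \<in> carrier (D X)" "b \<in> carrier (D Y)"
  shows "\<Gamma> (X \<union> Y) (prod_sp (Dtilde K) X Y a b) =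
     tensor_mult K (D (X \<union> Y)) (prod_sp (Dtilde K) X Y) (\<Gamma> X a) (\<Gamma> Y b)"
    "counit_sp (Dtilde K) (X \<union> Y) (prod_sp (Dtilde K) X Y a b) = counit_sp (Dtilde K) X a \<otimes> counit_sp (Dtilde K) Y b"
proof -
  let ?p = "prod_sp (Dtilde K) X Y" and ?Z = "X \<union> Y"
  have Z: "finite ?Z" using X by simp
  have v: "vs (D X)" "vs (D Y)" "vs (D ?Z)" "vs (TD X)" "vs (TD Y)" "vs (TD ?Z)" by auto
  note P = prod_blm[OF X]
  note M = tensor_mult_blm[OF v(1,2,3) P]
  show "\<Gamma> ?Z (?p a b) = tensor_mult K (D ?Z) ?p (\<Gamma> X a) (\<Gamma> Y b)"
  proof (rule D_ext2[OF v(6) blm_comp[OF P lm_id lm_id coprod_lm[OF Z]]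
        blm_comp[OF M(1) coprod_lm[OF X(1)] coprod_lm[OF X(2)] lm_id] _ a])
    fix T T' S S' assume T: "topspace T = X" "admissible T' T" "topspace S = Y" "admissible S' S"
    have T'X: "topspace T' = X" "topspace S' = Y" using adm_topspace T by metis+
    have fin: "finite (topspace T)" "finite (topspace T')" "finite (topspace S)" "finite (topspace S')" using T X T'X by auto
    have ad: "topspace A = X" "admissible A T" if "admissible A T'" for A
      using that adm_topspace[OF that] T'X adm_trans[OF fin(1) that T(2)] by auto
    have bd: "topspace A = Y" "admissible A S" if "admissible A S'" for A
      using that adm_topspace[OF that] T'X adm_trans[OF fin(3) that T(4)] by auto
    note qa = adm_quot[OF fin(1) _ T(2)] and qb = adm_quot[OF fin(3) _ T(4)]
    have cl: "ev T A \<in> carrier (D X)" "ev (top_quot T A) (top_quot T' A) \<in> carrier (D X)" if "admissible A T'" for A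
      using ad[OF that] T qa[OF that] by (simp_all add: ev_in)
    have cm: "ev S A \<in> carrier (D Y)" "ev (top_quot S A) (top_quot S' A) \<in> carrier (D Y)" if "admissible A S'" for A
      using bd[OF that] T qb[OF that] by (simp_all add: ev_in)
    note pin = prod_aux[OF X T]
    let ?U = "top_union T S" and ?U' = "top_union T' S'"
    let ?h = "\<lambda>A. tens K (D ?Z) (D ?Z) (ev ?U A) (ev (top_quot ?U A) (top_quot ?U' A))"
    let ?x = "\<lambda>A. tens K (D X) (D X) (ev T A) (ev (top_quot T A) (top_quot T' A))"
    let ?y = "\<lambda>A. tens K (D Y) (D Y) (ev S A) (ev (top_quot S A) (top_quot S' A))"
    have xc: "?x A \<in> carrier (TD X)" if "admissible A T'" for A using coprod_aux[OF X(1) T(1,2) that] .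
    have yc: "?y A \<in> carrier (TD Y)" if "admissible A S'" for A using coprod_aux[OF X(2) T(3,4) that] .
    have dis: "topspace T \<inter> topspace S = {}" "topspace T' \<inter> topspace S' = {}" using X T T'X by auto
    have hc: "?h (top_union A B) \<in> carrier (TD ?Z)" if "admissible A T'" "admissible B S'" for A B
      using coprod_aux[OF Z pin] adm_union[OF fin(2,4) dis(2) that] by simp
    have hxy: "?h (top_union A B) = tensor_mult K (D ?Z) ?p (?x A) (?y B)" if A: "admissible A T'" and B: "admissible B S'" for A B
    proof -
      have "top_quot ?U (top_union A B) = top_union (top_quot T A) (top_quot S B)"
        "top_quot ?U' (top_union A B) = top_union (top_quot T' A) (top_quot S' B)"
        using ad[OF A] bd[OF B] T T'X fin dis by (auto intro!: top_quot_union)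
      then show ?thesis
        unfolding M(2)[OF cl[OF A] cm[OF B]] using T ad[OF A] bd[OF B] qa[OF A] qb[OF B]
        by (simp add: prod_ev[OF X])
    qed
    have "\<Gamma> ?Z (?p (ev T T') (ev S S')) = (\<Oplus>\<^bsub>TD ?Z\<^esub>A\<in>(\<lambda>(A, B). top_union A B) ` ({A. admissible A T'} \<times> {A. admissible A S'}). ?h A)"
      unfolding prod_ev[OF X T] coprod_ev[OF Z pin] adm_union_image[OF fin(2,4) dis(2)] by (rule refl)
    also have "\<dots> = (\<Oplus>\<^bsub>TD ?Z\<^esub>q\<in>{A. admissible A T'} \<times> {A. admissible A S'}. ?h ((\<lambda>(A, B). top_union A B) q))"
      by (rule sum_reindex[OF v(6) inj_on_subset[OF top_union_inj[OF X]]]) (use ad bd hc in auto)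
    also have "\<dots> = finsum (TD ?Z) (\<lambda>(A, B). tensor_mult K (D ?Z) ?p (?x A) (?y B)) ({A. admissible A T'} \<times> {A. admissible A S'})"
    proof (rule sum_cong[OF v(6) refl])
      fix q assume "q \<in> {A. admissible A T'} \<times> {A. admissible A S'}"
      then obtain A B where q: "q = (A, B)" "admissible A T'" "admissible B S'" by blast
      show "?h ((\<lambda>(A, B). top_union A B) q) = (\<lambda>(A, B). tensor_mult K (D ?Z) ?p (?x A) (?y B)) q"
        unfolding q(1) prod.case by (rule hxy[OF q(2,3)])
      show "(\<lambda>(A, B). tensor_mult K (D ?Z) ?p (?x A) (?y B)) q \<in> carrier (TD ?Z)"
        unfolding q(1) prod.case by (rule blm_closed[OF M(1) xc[OF q(2)] yc[OF q(3)]])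
    qed
    also have "\<dots> = (\<Oplus>\<^bsub>TD ?Z\<^esub>A\<in>{A. admissible A T'}. \<Oplus>\<^bsub>TD ?Z\<^esub>B\<in>{A. admissible A S'}. tensor_mult K (D ?Z) ?p (?x A) (?y B))"
      using xc yc by (intro sum_Sigma[symmetric] v finite_adm fin blm_closed[OF M(1)]) auto
    also have "\<dots> = (\<Oplus>\<^bsub>TD ?Z\<^esub>A\<in>{A. admissible A T'}. tensor_mult K (D ?Z) ?p (?x A) (\<Gamma> Y (ev S S')))"
    proof (rule sum_cong[OF v(6) refl])
      fix A assume "A \<in> {A. admissible A T'}"
      then have A: "admissible A T'" by simp
      show "(\<Oplus>\<^bsub>TD ?Z\<^esub>B\<in>{A. admissible A S'}. tensor_mult K (D ?Z) ?p (?x A) (?y B)) = tensor_mult K (D ?Z) ?p (?x A) (\<Gamma> Y (ev S S'))"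
        unfolding coprod_ev[OF X(2) T(3,4)]
        by (rule lm_sum[OF v(5,6) blm_right[OF M(1) xc[OF A]] finite_adm[OF fin(4)], symmetric]) (use yc in auto)
      show "tensor_mult K (D ?Z) ?p (?x A) (\<Gamma> Y (ev S S')) \<in> carrier (TD ?Z)"
        using T by (intro blm_closed[OF M(1)] xc A lm_closed[OF coprod_lm[OF X(2)]] ev_in)
    qed
    also have "\<dots> = tensor_mult K (D ?Z) ?p (\<Gamma> X (ev T T')) (\<Gamma> Y (ev S S'))"
      unfolding coprod_ev[OF X(1) T(1,2)]
      by (rule lm_sum[OF v(4,6) blm_left[OF M(1) lm_closed[OF coprod_lm[OF X(2)] ev_in[OF T(3,4)]]] finite_adm[OF fin(2)], symmetric])
        (use xc in auto)
    finally show "\<Gamma> ?Z (?p (ev T T') (ev S S')) = tensor_mult K (D ?Z) ?p (\<Gamma> X (ev T T')) (\<Gamma> Y (ev S S'))" .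
  qed
  show "counit_sp (Dtilde K) ?Z (?p a b) = counit_sp (Dtilde K) X a \<otimes> counit_sp (Dtilde K) Y b"
  proof (rule D_ext2[OF vs_base blm_comp[OF P lm_id lm_id counit_lm] blm_comp[OF K_mult_blm counit_lm counit_lm lm_id] _ a])
    fix T T' S S' assume T: "topspace T = X" "admissible T' T" "topspace S = Y" "admissible S' S"
    then have T'X: "topspace T' = X" "topspace S' = Y" using adm_topspace by metis+
    \<comment> \<open>The degrees are natural numbers and add up, so the total vanishes exactly when
      both do.\<close>
    show "counit_sp (Dtilde K) ?Z (?p (ev T T') (ev S S')) = counit_sp (Dtilde K) X (ev T T') \<otimes> counit_sp (Dtilde K) Y (ev S S')"
      unfolding prod_ev[OF X T] counit_ev using degree_union[of T' S'] T'X X by simp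
  qed
qed

lemma D_unit: "unit_sp (Dtilde K) = ev (discrete_topology {}) (discrete_topology {})"
  by (simp add: Dtilde_def Let_def)

lemma adm_empty: "admissible (discrete_topology {}) (discrete_topology {})" by (rule adm_refl) simp

lemma degree_empty: "top_degree (discrete_topology {} :: 'a topology) = 0"
  by (simp add: top_degree_def)

lemma top_empty: "topspace T = {} \<Longrightarrow> T = discrete_topology {}"
  by (intro top_eqI) (use quasi_orderD[OF quasi_order_top_rel[of T]] quasi_orderD[OF quasi_order_top_rel[of "discrete_topology {}"]] in auto)

lemma Dbimonoid: "species_bimonoid K (Dtilde K :: ('k, 'a, 'a topology \<times> 'a topology \<Rightarrow> 'k) species_data)"
  unfolding species_bimonoid_def Dspace
proof (intro conjI allI impI ballI Dmonoid D_coalgebra; (elim conjE)?)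
  let ?o = "discrete_topology {} :: 'a topology"
  \<comment> \<open>The empty set carries a single topology, so the sum defining the coproduct of
    the unit has one term.\<close>
  have s: "{A. admissible A ?o} = {?o}" using adm_topspace[of _ ?o] top_empty adm_empty by auto
  have q: "top_quot ?o ?o = ?o" by (rule top_empty) simp
  have e: "ev ?o ?o \<in> carrier (D {})" by (intro ev_in adm_empty) simp
  show "\<Gamma> {} (unit_sp (Dtilde K)) = tens K (D {}) (D {}) (unit_sp (Dtilde K)) (unit_sp (Dtilde K) :: 'a topology \<times> 'a topology \<Rightarrow> 'k)"
  proof -
    have t: "tens K (D {}) (D {}) (ev ?o ?o) (ev ?o ?o) \<in> carrier (TD {})" using e by (intro tens_closed) auto
    have "\<Gamma> {} (ev ?o ?o) = (\<Oplus>\<^bsub>TD {}\<^esub>A\<in>{?o}. tens K (D {}) (D {}) (ev ?o A) (ev (top_quot ?o A) (top_quot ?o A)))"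
      unfolding s[symmetric] by (rule coprod_ev) (simp_all add: adm_empty[simplified])
    also have "\<dots> = tens K (D {}) (D {}) (ev ?o ?o) (ev (top_quot ?o ?o) (top_quot ?o ?o))"
      by (rule sum_single) (use t q in simp_all)
    finally show ?thesis unfolding D_unit q .
  qed
  show "counit_sp (Dtilde K) {} (unit_sp (Dtilde K) :: 'a topology \<times> 'a topology \<Rightarrow> 'k) = \<one>"
    unfolding D_unit counit_ev by (simp add: degree_empty)
qed (assumption | (rule D_relab_coprod D_prod_coprod; assumption))+

section \<open>The grading on pairs\<close>

lemma deg_sp_span: "deg_sp (Dtilde K) X n = lin_span K (D X) (basis_vec K ` {b \<in> adm_pairs X. top_degree (snd b) = n})"
proof -
  have "{ev T T' |T T'. (T, T') \<in> adm_pairs X \<and> top_degree T' = n} = basis_vec K ` {b \<in> adm_pairs X. top_degree (snd b) = n}"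
    by force
  then show ?thesis by (simp add: Dtilde_def Let_def)
qed

lemma deg_gen_sub: "basis_vec K ` {b \<in> adm_pairs X. top_degree (snd b) = n} \<subseteq> carrier (D X)"
  by (auto intro!: basis_vec_in)

lemma ev_deg: "topspace T = X \<Longrightarrow> admissible T' T \<Longrightarrow> top_degree T' = n \<Longrightarrow> ev T T' \<in> deg_sp (Dtilde K) X n"
  unfolding deg_sp_span by (intro set_mp[OF span_superset] imageI) (simp add: in_adm_pairs)

lemma deg_gen_cases:
  assumes "x \<in> basis_vec K ` {b \<in> adm_pairs X. top_degree (snd b) = n}"
  obtains T T' where "x = ev T T'" "topspace T = X" "admissible T' T" "top_degree T' = n"
  using assms by (auto simp: in_adm_pairs)

text \<open>The degrees of \<open>A\<close> and of \<open>T'/A\<close> add up to that of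
  \<open>T'\<close> by \<open>degree_quot\<close>, so each term of the coproduct has the right total
  degree.\<close>

lemma D_graded_coalgebra:
  assumes X: "finite X"
  shows "graded_coalgebra K (D X) (\<Gamma> X) (counit_sp (Dtilde K) X) (deg_sp (Dtilde K) X)"
  unfolding graded_coalgebra_def
proof (intro conjI allI impI D_coalgebra X)
  let ?G = "deg_sp (Dtilde K) X"
  show "direct_sum_decomposition K (D X) ?G"
    unfolding deg_sp_span by (rule free_graded)
  fix n
  let ?S = "{tens K (D X) (D X) a b |a b i j. i + j = n \<and> a \<in> ?G i \<and> b \<in> ?G j}"
  have Gs: "?G i \<subseteq> carrier (D X)" for i unfolding deg_sp_span by (rule span_carrier[OF vs_free deg_gen_sub])
  have "?S \<subseteq> carrier (TD X)"
  proof
    fix x assume "x \<in> ?S"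
    then obtain a b i j where "x = tens K (D X) (D X) a b" "a \<in> ?G i" "b \<in> ?G j" by blast
    then show "x \<in> carrier (TD X)" using Gs by (simp add: tens_closed subset_iff)
  qed
  then have sm: "submodule (tensor_degree K (D X) ?G n) K (TD X)"
    unfolding tensor_degree_def by (intro span_submod) auto
  have "\<Gamma> X v \<in> tensor_degree K (D X) ?G n" if v: "v \<in> ?G n" for v
  proof (rule lm_span_in[OF vs_free _ coprod_lm[OF X] sm deg_gen_sub _ v[unfolded deg_sp_span]])
    show "vs (TD X)" by simp
    fix x assume "x \<in> basis_vec K ` {b \<in> adm_pairs X. top_degree (snd b) = n}"
    then obtain T T' where T: "x = ev T T'" "topspace T = X" "admissible T' T" "top_degree T' = n"
      by (rule deg_gen_cases)
    have T'X: "topspace T' = X" using adm_topspace[OF T(3)] T by simp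
    have fin: "finite (topspace T)" "finite (topspace T')" using T X T'X by auto
    show "\<Gamma> X x \<in> tensor_degree K (D X) ?G n"
      unfolding T(1) coprod_ev[OF X T(2,3)]
    proof (rule submod_sum[OF vs_tensor[OF vs_free vs_free] sm])
      fix A assume "A \<in> {A. admissible A T'}"
      then have A: "admissible A T'" by simp
      have "ev T A \<in> ?G (top_degree A)"
        by (rule ev_deg[OF T(2) adm_trans[OF fin(1) A T(3)] refl])
      moreover have "ev (top_quot T A) (top_quot T' A) \<in> ?G (top_degree (top_quot T' A))"
        by (rule ev_deg[OF _ adm_quot[OF fin(1) A T(3)] refl]) (simp add: T)
      moreover have "top_degree A + top_degree (top_quot T' A) = n"
        using degree_quot[OF fin(2) A] T(4) by simp
      ultimately have "tens K (D X) (D X) (ev T A) (ev (top_quot T A) (top_quot T' A)) \<in> ?S" by blast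
      then show "tens K (D X) (D X) (ev T A) (ev (top_quot T A) (top_quot T' A)) \<in> tensor_degree K (D X) ?G n"
        unfolding tensor_degree_def by (rule set_mp[OF span_superset])
    qed
  qed
  then show "\<Gamma> X ` ?G n \<subseteq> tensor_degree K (D X) ?G n" by blast
  assume n: "n \<noteq> 0"
  have "counit_sp (Dtilde K) X v = \<zero>\<^bsub>base_vs K\<^esub>" if v: "v \<in> ?G n" for v
  proof (rule lm_vanish_span[OF vs_free vs_base counit_lm deg_gen_sub _ v[unfolded deg_sp_span]])
    fix x assume "x \<in> basis_vec K ` {b \<in> adm_pairs X. top_degree (snd b) = n}"
    then obtain T T' where T: "x = ev T T'" "topspace T = X" "admissible T' T" "top_degree T' = n"
      by (rule deg_gen_cases)
    then show "counit_sp (Dtilde K) X x = \<zero>\<^bsub>base_vs K\<^esub>" using n by (simp add: counit_ev)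
  qed
  then show "counit_sp (Dtilde K) X ` ?G n \<subseteq> {\<zero>}" by auto
qed

lemma deg_submod: "submodule (deg_sp (Dtilde K) X n) K (D X)"
  unfolding deg_sp_span by (rule span_submod[OF vs_free deg_gen_sub])

theorem Dtilde_graded_bimonoid:
  "graded_species_bimonoid K (Dtilde K :: ('k, 'a, 'a topology \<times> 'a topology \<Rightarrow> 'k) species_data)"
  unfolding graded_species_bimonoid_def Dspace
proof (intro conjI allI impI ballI Dbimonoid D_graded_coalgebra; (elim conjE)?)
  fix X Y :: "'a set" and f n assume X: "finite X" "bij_betw f X Y"
  have Y: "finite Y" using X bij_betw_finite by blast
  have "relab_sp (Dtilde K) X f v \<in> deg_sp (Dtilde K) X n" if v: "v \<in> deg_sp (Dtilde K) Y n" for v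
  proof (rule lm_span_in[OF vs_free vs_free relab_lm[OF X] deg_submod deg_gen_sub _ v[unfolded deg_sp_span]])
    fix x assume "x \<in> basis_vec K ` {b \<in> adm_pairs Y. top_degree (snd b) = n}"
    then obtain T T' where T: "x = ev T T'" "topspace T = Y" "admissible T' T" "top_degree T' = n"
      by (rule deg_gen_cases)
    have f: "bij_betw f X (topspace T)" "bij_betw f X (topspace T')" using X T adm_topspace[OF T(3)] by auto
    show "relab_sp (Dtilde K) X f x \<in> deg_sp (Dtilde K) X n"
      unfolding T(1) relab_ev[OF X(1) f(1) T(3)]
      using relab_ev_in[OF X(1) f(1) T(3)] degree_pull[OF f(2) X(1)] T(4) by (intro ev_deg) auto
  qed
  then show "relab_sp (Dtilde K) X f ` deg_sp (Dtilde K) Y n \<subseteq> deg_sp (Dtilde K) X n" by blast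
next
  fix X Y :: "'a set" and i j a b
  assume X: "finite X" "finite Y" "X \<inter> Y = {}" and a: "a \<in> deg_sp (Dtilde K) X i" "b \<in> deg_sp (Dtilde K) Y j"
  show "prod_sp (Dtilde K) X Y a b \<in> deg_sp (Dtilde K) (X \<union> Y) (i + j)"
  proof (rule blm_span_in[OF vs_free vs_free vs_free prod_blm[OF X] deg_submod deg_gen_sub deg_gen_sub _ a[unfolded deg_sp_span]])
    fix x y assume x: "x \<in> basis_vec K ` {b \<in> adm_pairs X. top_degree (snd b) = i}"
      and y: "y \<in> basis_vec K ` {b \<in> adm_pairs Y. top_degree (snd b) = j}"
    from x obtain T T' where T: "x = ev T T'" "topspace T = X" "admissible T' T" "top_degree T' = i"
      by (rule deg_gen_cases)
    from y obtain S S' where S: "y = ev S S'" "topspace S = Y" "admissible S' S" "top_degree S' = j"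
      by (rule deg_gen_cases)
    have "top_degree (top_union T' S') = i + j"
      using degree_union[of T' S'] adm_topspace[OF T(3)] adm_topspace[OF S(3)] T S X by simp
    then show "prod_sp (Dtilde K) X Y x y \<in> deg_sp (Dtilde K) (X \<union> Y) (i + j)"
      unfolding T(1) S(1) prod_ev[OF X T(2,3) S(2,3)] using prod_aux[OF X T(2,3) S(2,3)] by (intro ev_deg)
  qed
next
  show "unit_sp (Dtilde K) \<in> (deg_sp (Dtilde K) {} 0 :: ('a topology \<times> 'a topology \<Rightarrow> 'k) set)"
    unfolding D_unit by (intro ev_deg adm_empty degree_empty) simp
qed

end

section \<open>The Fock space of a graded bimonoid\<close>

text \<open>Topologies no longer occur from here on; only the axioms of a graded bimonoid enter. The
  ground type is \<open>nat\<close> because coinvariants are taken over the sets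
  \<open>{1..n}\<close>.\<close>

locale graded_bimonoid = linalg K for K :: "('k, 'm) ring_scheme" (structure) +
  fixes E :: "('k, nat, 'v) species_data"
  assumes bimonoid: "graded_species_bimonoid K E"
begin

abbreviation V where "V n \<equiv> sp_space E {1..n}"
abbreviation cl where "cl \<equiv> coinv_class K E"
abbreviation C where "C \<equiv> coinv K E"
abbreviation H where "H \<equiv> fock K E"
abbreviation fc where "fc \<equiv> fock_class K E"
abbreviation G where "G n \<equiv> deg_sp E {1..n}"
abbreviation cop where "cop n \<equiv> coprod_sp E {1..n}"

text \<open>Otherwise the simplifier turns \<open>{1..n}\<close> into \<open>{Suc 0..n}\<close>, and \<open>V n\<close> is no longer recognised.\<close>

declare One_nat_def [simp del]

section \<open>The axioms of the bimonoid as separate rules\<close>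

lemmas graded_facts = bimonoid[unfolded graded_species_bimonoid_def]
lemmas bim = graded_facts[THEN conjunct1]
lemmas bimonoid_facts = bim[unfolded species_bimonoid_def]
lemmas monoid_facts = bimonoid_facts[THEN conjunct1, unfolded species_monoid_def]
lemmas species_facts = monoid_facts[THEN conjunct1, unfolded linear_species_def]

lemma vsE: "finite X \<Longrightarrow> vs (sp_space E X)"
  by (rule species_facts[THEN conjunct1, rule_format])
lemma relE_lm: "finite X \<Longrightarrow> bij_betw f X Y \<Longrightarrow> relab_sp E X f \<in> lm (sp_space E Y) (sp_space E X)"
  by (rule species_facts[THEN conjunct2, THEN conjunct1, rule_format, OF conjI])
lemma relE_cong: "finite X \<Longrightarrow> bij_betw f X Y \<Longrightarrow> (\<And>x. x \<in> X \<Longrightarrow> f x = g x) \<Longrightarrow> v \<in> carrier (sp_space E Y) \<Longrightarrow>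
   relab_sp E X f v = relab_sp E X g v"
  by (rule species_facts[THEN conjunct2, THEN conjunct2, THEN conjunct1, rule_format, OF conjI[OF _ conjI]]) auto
lemma relE_id: "finite X \<Longrightarrow> v \<in> carrier (sp_space E X) \<Longrightarrow> relab_sp E X (\<lambda>x. x) v = v"
  by (rule species_facts[THEN conjunct2, THEN conjunct2, THEN conjunct2, THEN conjunct1, rule_format])
lemma relE_comp: "finite X \<Longrightarrow> bij_betw f X Y \<Longrightarrow> bij_betw g Y Z \<Longrightarrow> v \<in> carrier (sp_space E Z) \<Longrightarrow>
   relab_sp E X f (relab_sp E Y g v) = relab_sp E X (g \<circ> f) v"
  by (rule species_facts[THEN conjunct2, THEN conjunct2, THEN conjunct2, THEN conjunct2, rule_format,
        OF conjI[OF _ conjI], symmetric])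
lemma prodE_blm: "finite X \<Longrightarrow> finite Y \<Longrightarrow> X \<inter> Y = {} \<Longrightarrow>
  blm (sp_space E X) (sp_space E Y) (sp_space E (X \<union> Y)) (prod_sp E X Y)"
  by (rule monoid_facts[THEN conjunct2, THEN conjunct1, rule_format, OF conjI[OF _ conjI]])
lemma prodE_natural: "finite X \<Longrightarrow> finite Y \<Longrightarrow> X \<inter> Y = {} \<Longrightarrow> bij_betw f (X \<union> Y) Z \<Longrightarrow>
  a \<in> carrier (sp_space E (f ` X)) \<Longrightarrow> b \<in> carrier (sp_space E (f ` Y)) \<Longrightarrow>
  relab_sp E (X \<union> Y) f (prod_sp E (f ` X) (f ` Y) a b) = prod_sp E X Y (relab_sp E X f a) (relab_sp E Y f b)"
  by (rule monoid_facts[THEN conjunct2, THEN conjunct2, THEN conjunct1, rule_format, OF conjI[OF _ conjI[OF _ conjI]]])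
lemma prodE_assoc: "finite X \<Longrightarrow> finite Y \<Longrightarrow> finite Z \<Longrightarrow> X \<inter> Y = {} \<Longrightarrow> X \<inter> Z = {} \<Longrightarrow> Y \<inter> Z = {} \<Longrightarrow>
  a \<in> carrier (sp_space E X) \<Longrightarrow> b \<in> carrier (sp_space E Y) \<Longrightarrow> c \<in> carrier (sp_space E Z) \<Longrightarrow>
  prod_sp E (X \<union> Y) Z (prod_sp E X Y a b) c = prod_sp E X (Y \<union> Z) a (prod_sp E Y Z b c)"
  by (rule monoid_facts[THEN conjunct2, THEN conjunct2, THEN conjunct2, THEN conjunct1, rule_format,
        OF conjI[OF _ conjI[OF _ conjI[OF _ conjI[OF _ conjI]]]]])
lemma unitE: "unit_sp E \<in> carrier (sp_space E {})"
  by (rule monoid_facts[THEN conjunct2, THEN conjunct2, THEN conjunct2, THEN conjunct2, THEN conjunct1])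
lemma unitE_prod:
  assumes "finite X" "a \<in> carrier (sp_space E X)"
  shows "prod_sp E {} X (unit_sp E) a = a" "prod_sp E X {} a (unit_sp E) = a"
  using monoid_facts[THEN conjunct2, THEN conjunct2, THEN conjunct2, THEN conjunct2, THEN conjunct2, rule_format, OF assms]
  by (rule conjunct1, rule conjunct2)
lemma coalgE: "finite X \<Longrightarrow> coalgebra K (sp_space E X) (coprod_sp E X) (counit_sp E X)"
  by (rule bimonoid_facts[THEN conjunct2, THEN conjunct1, rule_format])
lemmas coalgE_facts = coalgE[unfolded coalgebra_def]
lemma copE_lm: "finite X \<Longrightarrow> coprod_sp E X \<in> lm (sp_space E X) (tensor K (sp_space E X) (sp_space E X))"
  by (rule coalgE_facts[THEN conjunct2, THEN conjunct1])
lemma epsE_lm: "finite X \<Longrightarrow> counit_sp E X \<in> lm (sp_space E X) (base_vs K)"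
  by (rule coalgE_facts[THEN conjunct2, THEN conjunct2, THEN conjunct1])
lemmas relabE_facts = bimonoid_facts[THEN conjunct2, THEN conjunct2, THEN conjunct1, rule_format, OF conjI]
lemma copE_relab: "finite X \<Longrightarrow> bij_betw f X Y \<Longrightarrow> v \<in> carrier (sp_space E Y) \<Longrightarrow>
    coprod_sp E X (relab_sp E X f v) = tensor_map K (sp_space E X) (sp_space E X) (relab_sp E X f) (relab_sp E X f) (coprod_sp E Y v)"
  by (rule relabE_facts[THEN conjunct1])
lemma epsE_relab: "finite X \<Longrightarrow> bij_betw f X Y \<Longrightarrow> v \<in> carrier (sp_space E Y) \<Longrightarrow>
    counit_sp E X (relab_sp E X f v) = counit_sp E Y v"
  by (rule relabE_facts[THEN conjunct2])
lemmas prodE_facts = bimonoid_facts[THEN conjunct2, THEN conjunct2, THEN conjunct2, THEN conjunct1, rule_format, OF conjI[OF _ conjI]]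
lemma copE_prod: "finite X \<Longrightarrow> finite Y \<Longrightarrow> X \<inter> Y = {} \<Longrightarrow> a \<in> carrier (sp_space E X) \<Longrightarrow> b \<in> carrier (sp_space E Y) \<Longrightarrow>
    coprod_sp E (X \<union> Y) (prod_sp E X Y a b) =
      tensor_mult K (sp_space E (X \<union> Y)) (prod_sp E X Y) (coprod_sp E X a) (coprod_sp E Y b)"
  by (rule prodE_facts[THEN conjunct1])
lemma epsE_prod: "finite X \<Longrightarrow> finite Y \<Longrightarrow> X \<inter> Y = {} \<Longrightarrow> a \<in> carrier (sp_space E X) \<Longrightarrow> b \<in> carrier (sp_space E Y) \<Longrightarrow>
    counit_sp E (X \<union> Y) (prod_sp E X Y a b) = counit_sp E X a \<otimes> counit_sp E Y b"
  by (rule prodE_facts[THEN conjunct2])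
lemma copE_unit: "coprod_sp E {} (unit_sp E) = tens K (sp_space E {}) (sp_space E {}) (unit_sp E) (unit_sp E)"
  by (rule bimonoid_facts[THEN conjunct2, THEN conjunct2, THEN conjunct2, THEN conjunct2, THEN conjunct1])
lemma epsE_unit: "counit_sp E {} (unit_sp E) = \<one>"
  by (rule bimonoid_facts[THEN conjunct2, THEN conjunct2, THEN conjunct2, THEN conjunct2, THEN conjunct2])
lemma gradE: "finite X \<Longrightarrow> graded_coalgebra K (sp_space E X) (coprod_sp E X) (counit_sp E X) (deg_sp E X)"
  by (rule graded_facts[THEN conjunct2, THEN conjunct1, rule_format])
lemma degE_relab: "finite X \<Longrightarrow> bij_betw f X Y \<Longrightarrow> v \<in> deg_sp E Y d \<Longrightarrow> relab_sp E X f v \<in> deg_sp E X d"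
  by (rule set_mp[OF graded_facts[THEN conjunct2, THEN conjunct2, THEN conjunct1, rule_format, OF conjI]]) auto
lemma degE_prod: "finite X \<Longrightarrow> finite Y \<Longrightarrow> X \<inter> Y = {} \<Longrightarrow> a \<in> deg_sp E X i \<Longrightarrow> b \<in> deg_sp E Y j \<Longrightarrow>
    prod_sp E X Y a b \<in> deg_sp E (X \<union> Y) (i + j)"
  by (rule graded_facts[THEN conjunct2, THEN conjunct2, THEN conjunct2, THEN conjunct1, rule_format, OF conjI[OF _ conjI]])
lemma degE_unit: "unit_sp E \<in> deg_sp E {} 0"
  by (rule graded_facts[THEN conjunct2, THEN conjunct2, THEN conjunct2, THEN conjunct2])

section \<open>Coinvariants\<close>

lemma vsV [simp, intro]: "vs (V n)" by (simp add: vsE)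

lemma coinv_gen_sub: "{v \<ominus>\<^bsub>V n\<^esub> relab_sp E {1..n} \<sigma> v | v \<sigma>. v \<in> carrier (V n) \<and> bij_betw \<sigma> {1..n} {1..n}} \<subseteq> carrier (V n)"
proof
  fix x assume "x \<in> {v \<ominus>\<^bsub>V n\<^esub> relab_sp E {1..n} \<sigma> v | v \<sigma>. v \<in> carrier (V n) \<and> bij_betw \<sigma> {1..n} {1..n}}"
  then obtain v \<sigma> where "x = v \<ominus>\<^bsub>V n\<^esub> relab_sp E {1..n} \<sigma> v" "v \<in> carrier (V n)" "bij_betw \<sigma> {1..n} {1..n}" by blast
  then show "x \<in> carrier (V n)" using lm_closed[OF relE_lm, of "{1..n}" \<sigma> "{1..n}" v] by simp
qed

lemma coinv_submod: "submodule (coinv_sub K E n) K (V n)"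
  unfolding coinv_sub_def by (rule span_submod[OF vsV coinv_gen_sub])

lemma vsC [simp, intro]: "vs (C n)"
  unfolding coinv_def by (rule vs_quot[OF vsV coinv_submod])

lemma cl_lm: "cl n \<in> lm (V n) (C n)"
  unfolding coinv_class_def[abs_def] coinv_def by (rule proj_lm[OF vsV coinv_submod])

lemma carrier_C: "carrier (C n) = cl n ` carrier (V n)"
  unfolding coinv_class_def[abs_def] coinv_def by (rule quot_carrier)

lemma cl_closed: "v \<in> carrier (V n) \<Longrightarrow> cl n v \<in> carrier (C n)" by (rule lm_closed[OF cl_lm])

lemma cl_zero: "cl n \<zero>\<^bsub>V n\<^esub> = \<zero>\<^bsub>C n\<^esub>" by (rule lm_zero[OF vsV vsC cl_lm])

text \<open>An invariant linear map takes equal values on a vector and its relabelling, so it kills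
  the generators of \<open>coinv_sub\<close>.\<close>

lemma coinv_vanish:
  assumes U: "vs U" and f: "f \<in> lm (V n) U"
    and inv: "\<And>\<sigma> v. bij_betw \<sigma> {1..n} {1..n} \<Longrightarrow> v \<in> carrier (V n) \<Longrightarrow> f (relab_sp E {1..n} \<sigma> v) = f v"
    and x: "x \<in> coinv_sub K E n"
  shows "f x = \<zero>\<^bsub>U\<^esub>"
proof (rule lm_vanish_span[OF vsV U f coinv_gen_sub _ x[unfolded coinv_sub_def]])
  fix x assume "x \<in> {v \<ominus>\<^bsub>V n\<^esub> relab_sp E {1..n} \<sigma> v | v \<sigma>. v \<in> carrier (V n) \<and> bij_betw \<sigma> {1..n} {1..n}}"
  then obtain v \<sigma> where x: "x = v \<ominus>\<^bsub>V n\<^esub> relab_sp E {1..n} \<sigma> v" "v \<in> carrier (V n)" "bij_betw \<sigma> {1..n} {1..n}" by blast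
  have r: "relab_sp E {1..n} \<sigma> v \<in> carrier (V n)" using x by (intro lm_closed[OF relE_lm]) auto
  have "f v \<in> carrier U" by (rule lm_closed[OF f x(2)])
  then show "f x = \<zero>\<^bsub>U\<^esub>"
    unfolding x(1) lm_minus[OF vsV U f x(2) r] inv[OF x(3,2)] by (rule vs_minus_self[OF U])
qed

lemma cl_relab:
  assumes s: "bij_betw \<sigma> {1..n} {1..n}" and v: "v \<in> carrier (V n)"
  shows "cl n (relab_sp E {1..n} \<sigma> v) = cl n v"
proof -
  have r: "relab_sp E {1..n} \<sigma> v \<in> carrier (V n)" using assms by (intro lm_closed[OF relE_lm]) auto
  have "v \<ominus>\<^bsub>V n\<^esub> relab_sp E {1..n} \<sigma> v \<in> coinv_sub K E n"
    unfolding coinv_sub_def using assms by (intro set_mp[OF span_superset]) blast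
  then show ?thesis unfolding coinv_class_def by (rule coset_eqI[OF vsV coinv_submod v r, symmetric])
qed

text \<open>The universal property of coinvariants, in the form in which \<open>fock_coprod\<close>
  and \<open>fock_counit\<close> use it: an invariant map may be evaluated on any
  representative.\<close>

lemma coinv_lift:
  assumes U: "vs U" and f: "f \<in> lm (V n) U"
    and inv: "\<And>\<sigma> v. bij_betw \<sigma> {1..n} {1..n} \<Longrightarrow> v \<in> carrier (V n) \<Longrightarrow> f (relab_sp E {1..n} \<sigma> v) = f v"
  shows "(\<lambda>A. the_elem (f ` A)) \<in> lm (C n) U"
    "\<And>v. v \<in> carrier (V n) \<Longrightarrow> the_elem (f ` cl n v) = f v"
  unfolding coinv_def coinv_class_def
  by (rule coset_lift_lm[OF vsV U coinv_submod f coinv_vanish[OF assms]], assumption+)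
    (rule coset_lift[OF vsV U coinv_submod f coinv_vanish[OF assms]])

section \<open>The product on coinvariants\<close>

text \<open>Relabelling is contravariant, so the map \<open>i - m\<close> from
  \<open>{m+1..m+n}\<close> to \<open>{1..n}\<close> transports vectors in the opposite direction,
  onto the shifted interval.\<close>

definition sh where "sh m n b = relab_sp E {m+1..m+n} (\<lambda>i. i - m) b"
definition pr where "pr m n a b = prod_sp E {1..m} {m+1..m+n} a (sh m n b)"

lemma shift_bij: "bij_betw (\<lambda>i. i - m) {m+1..m+n} {1..n::nat}"
  by (rule bij_betw_byWitness[where f' = "\<lambda>i. i + m"]) auto

lemma sh_lm: "sh m n \<in> lm (V n) (sp_space E {m+1..m+n})"
  unfolding sh_def[abs_def] by (rule relE_lm[OF _ shift_bij]) simp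

lemma ivl_Un: "{1..m} \<union> {m+1..m+n} = {1..m+n::nat}" by auto

lemma ivl_dis: "{1..m} \<inter> {m+1..m+n::nat} = {}" by auto

lemma pr_prod_blm: "blm (V m) (sp_space E {m+1..m+n}) (V (m+n)) (prod_sp E {1..m} {m+1..m+n})"
  using prodE_blm[of "{1..m}" "{m+1..m+n}"] unfolding ivl_Un using ivl_dis by simp

lemma pr_blm: "blm (V m) (V n) (V (m+n)) (pr m n)"
  unfolding pr_def[abs_def] by (rule blm_comp[OF pr_prod_blm lm_id sh_lm lm_id])

text \<open>The permutation of \<open>{1..m}\<close> is extended by the identity to
  \<open>{1..m+n}\<close>. By naturality the product then changes only by a relabelling, which its
  class does not see.\<close>

lemma pr_relab_left:
  assumes s: "bij_betw \<sigma> {1..m} {1..m}" and a: "a \<in> carrier (V m)" and b: "b \<in> carrier (V n)"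
  shows "cl (m+n) (pr m n (relab_sp E {1..m} \<sigma> a) b) = cl (m+n) (pr m n a b)"
proof -
  let ?X = "{1..m}" and ?Y = "{m+1..m+n}"
  define f where "f i = (if i \<le> m then \<sigma> i else i)" for i
  have fX: "bij_betw f ?X ?X" using s by (rule bij_betw_cong[THEN iffD1, rotated]) (auto simp: f_def)
  have fY: "bij_betw f ?Y ?Y" by (rule bij_betw_cong[THEN iffD1, OF _ bij_betw_id]) (auto simp: f_def)
  have f: "bij_betw f (?X \<union> ?Y) (?X \<union> ?Y)" by (rule bij_betw_combine[OF fX fY ivl_dis])
  have im: "f ` ?X = ?X" "f ` ?Y = ?Y" using fX fY by (auto simp: bij_betw_def)
  have sb: "sh m n b \<in> carrier (sp_space E ?Y)" by (rule lm_closed[OF sh_lm b])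
  have "relab_sp E (?X \<union> ?Y) f (prod_sp E (f ` ?X) (f ` ?Y) a (sh m n b)) =
      prod_sp E ?X ?Y (relab_sp E ?X f a) (relab_sp E ?Y f (sh m n b))"
    using a sb by (intro prodE_natural[OF _ _ ivl_dis f]) (simp_all add: im)
  moreover have "relab_sp E ?X f a = relab_sp E ?X \<sigma> a"
    by (rule relE_cong[OF _ fX _ a]) (auto simp: f_def)
  moreover have "relab_sp E ?Y f (sh m n b) = sh m n b"
    using relE_cong[OF _ fY _ sb, of "\<lambda>x. x"] relE_id[OF _ sb] by (auto simp: f_def)
  ultimately have "pr m n (relab_sp E ?X \<sigma> a) b = relab_sp E {1..m+n} f (pr m n a b)"
    unfolding pr_def im ivl_Un by simp
  then show ?thesis using cl_relab[OF f[unfolded ivl_Un] blm_closed[OF pr_blm a b]] by simp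
qed

text \<open>As on the left, except that the permutation must first be conjugated by the shift in
  order to act on \<open>{m+1..m+n}\<close>.\<close>

lemma pr_relab_right:
  assumes s: "bij_betw \<tau> {1..n} {1..n}" and a: "a \<in> carrier (V m)" and b: "b \<in> carrier (V n)"
  shows "cl (m+n) (pr m n a (relab_sp E {1..n} \<tau> b)) = cl (m+n) (pr m n a b)"
proof -
  let ?X = "{1..m}" and ?Y = "{m+1..m+n}"
  \<comment> \<open>Natural subtraction is harmless here, since only indices above \<open>m\<close>
    are used.\<close>
  define t where "t i = \<tau> (i - m) + m" for i
  have tY: "bij_betw t ?Y ?Y"
  proof -
    have "bij_betw (\<lambda>i. i + m) {1..n} ?Y" by (rule bij_betw_byWitness[where f' = "\<lambda>i. i - m"]) auto
    from bij_betw_trans[OF bij_betw_trans[OF shift_bij s] this] show ?thesis by (simp add: t_def[abs_def] comp_def)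
  qed
  define f where "f i = (if i \<le> m then i else t i)" for i
  have fX: "bij_betw f ?X ?X" by (rule bij_betw_cong[THEN iffD1, OF _ bij_betw_id]) (auto simp: f_def)
  have fY: "bij_betw f ?Y ?Y" using tY by (rule bij_betw_cong[THEN iffD1, rotated]) (auto simp: f_def)
  have f: "bij_betw f (?X \<union> ?Y) (?X \<union> ?Y)" by (rule bij_betw_combine[OF fX fY ivl_dis])
  have im: "f ` ?X = ?X" "f ` ?Y = ?Y" using fX fY by (auto simp: bij_betw_def)
  have sb: "sh m n b \<in> carrier (sp_space E ?Y)" by (rule lm_closed[OF sh_lm b])
  have rb: "relab_sp E {1..n} \<tau> b \<in> carrier (V n)" using s b by (intro lm_closed[OF relE_lm]) auto
  have "relab_sp E (?X \<union> ?Y) f (prod_sp E (f ` ?X) (f ` ?Y) a (sh m n b)) =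
      prod_sp E ?X ?Y (relab_sp E ?X f a) (relab_sp E ?Y f (sh m n b))"
    using a sb by (intro prodE_natural[OF _ _ ivl_dis f]) (simp_all add: im)
  moreover have "relab_sp E ?X f a = a"
    using relE_cong[OF _ fX _ a, of "\<lambda>x. x"] relE_id[OF _ a] by (auto simp: f_def)
  moreover have "relab_sp E ?Y f (sh m n b) = sh m n (relab_sp E {1..n} \<tau> b)"
  proof -
    have "relab_sp E ?Y f (sh m n b) = relab_sp E ?Y ((\<lambda>i. i - m) \<circ> f) b"
      unfolding sh_def by (rule relE_comp[OF _ fY shift_bij b]) simp
    also have "\<dots> = relab_sp E ?Y (\<tau> \<circ> (\<lambda>i. i - m)) b"
      by (rule relE_cong[OF _ bij_betw_trans[OF fY shift_bij] _ b]) (auto simp: f_def t_def)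
    also have "\<dots> = sh m n (relab_sp E {1..n} \<tau> b)"
      unfolding sh_def by (rule relE_comp[OF _ shift_bij s b, symmetric]) simp
    finally show ?thesis .
  qed
  ultimately have "pr m n a (relab_sp E {1..n} \<tau> b) = relab_sp E {1..m+n} f (pr m n a b)"
    unfolding pr_def im ivl_Un by simp
  then show ?thesis using cl_relab[OF f[unfolded ivl_Un] blm_closed[OF pr_blm a b]] by simp
qed

text \<open>The class of the product is bilinear and, by the two preceding invariances, kills the
  relations in either argument; hence it does not depend on the representatives.\<close>

lemma coinv_prod_cl:
  assumes a: "a \<in> carrier (V m)" and b: "b \<in> carrier (V n)"
  shows "coinv_prod K E m n (cl m a) (cl n b) = cl (m+n) (pr m n a b)"
proof -
  note B = blm_comp[OF pr_blm lm_id lm_id cl_lm]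
  have "{cl (m+n) (pr m n x y) |x y. x \<in> cl m a \<and> y \<in> cl n b} = {cl (m+n) (pr m n a b)}"
    unfolding coinv_class_def[of _ _ m] coinv_class_def[of _ _ n]
  proof (rule blm_coset[OF vsV vsV vsC coinv_submod coinv_submod B _ _ a b])
    fix x w assume x: "x \<in> coinv_sub K E m" and w: "w \<in> carrier (V n)"
    show "cl (m+n) (pr m n x w) = \<zero>\<^bsub>C (m+n)\<^esub>"
      by (rule coinv_vanish[OF vsC blm_left[OF B w] _ x]) (rule pr_relab_left[OF _ _ w])
  next
    fix v y assume v: "v \<in> carrier (V m)" and y: "y \<in> coinv_sub K E n"
    show "cl (m+n) (pr m n v y) = \<zero>\<^bsub>C (m+n)\<^esub>"
      by (rule coinv_vanish[OF vsC blm_right[OF B v] _ y]) (rule pr_relab_right[OF _ v])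
  qed
  then show ?thesis unfolding coinv_prod_def by (simp add: pr_def sh_def)
qed

lemma coinv_prod_blm: "blm (C m) (C n) (C (m+n)) (coinv_prod K E m n)"
proof -
  note B = blm_comp[OF pr_blm lm_id lm_id cl_lm]
  note add = lm_add[OF cl_lm, symmetric] and sm = lm_smult[OF cl_lm, symmetric]
  note ml = blm_left[OF B] and mr = blm_right[OF B]
  show ?thesis
  proof (rule blmI)
    fix x assume "x \<in> carrier (C m)"
    then obtain a where a: "a \<in> carrier (V m)" "x = cl m a" unfolding carrier_C by blast
    show "coinv_prod K E m n x \<in> lm (C n) (C (m+n))" unfolding a(2)
      by (intro lmI; unfold carrier_C[of n]; elim imageE; hypsubst)
       (simp_all add: add sm coinv_prod_cl[OF a(1)] vs_add[OF vsV] vs_smult[OF vsV] lm_closed[OF mr[OF a(1)]] lm_add[OF mr[OF a(1)]] lm_smult[OF mr[OF a(1)]])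
  next
    fix y assume "y \<in> carrier (C n)"
    then obtain b where b: "b \<in> carrier (V n)" "y = cl n b" unfolding carrier_C by blast
    show "(\<lambda>x. coinv_prod K E m n x y) \<in> lm (C m) (C (m+n))" unfolding b(2)
      by (intro lmI; unfold carrier_C[of m]; elim imageE; hypsubst)
       (simp_all add: add sm coinv_prod_cl[OF _ b(1)] vs_add[OF vsV] vs_smult[OF vsV] lm_closed[OF ml[OF b(1)]] lm_add[OF ml[OF b(1)]] lm_smult[OF ml[OF b(1)]])
  qed
qed

section \<open>The Fock space as a vector space\<close>

lemma H_carrier: "h \<in> carrier H \<longleftrightarrow> (\<forall>n. h n \<in> carrier (C n)) \<and> finite {n. h n \<noteq> \<zero>\<^bsub>C n\<^esub>}"
  by (simp add: fock_def)

lemma H_simps: "\<zero>\<^bsub>H\<^esub> = (\<lambda>n. \<zero>\<^bsub>C n\<^esub>)" "h \<oplus>\<^bsub>H\<^esub> h' = (\<lambda>n. h n \<oplus>\<^bsub>C n\<^esub> h' n)" "c \<odot>\<^bsub>H\<^esub> h = (\<lambda>n. c \<odot>\<^bsub>C n\<^esub> h n)"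
  by (simp_all add: fock_def)

lemma C_am: "abelian_monoid (C n)" by (rule vs_am[OF vsC])

lemma vsH [simp, intro]: "vs H"
proof (rule moduleI)
  show "cring K" by (rule is_cring)
  have add: "h \<oplus>\<^bsub>H\<^esub> h' \<in> carrier H" if h: "h \<in> carrier H" "h' \<in> carrier H" for h h'
  proof -
    have "finite {n. h n \<oplus>\<^bsub>C n\<^esub> h' n \<noteq> \<zero>\<^bsub>C n\<^esub>}"
      by (rule finite_subset[of _ "{n. h n \<noteq> \<zero>\<^bsub>C n\<^esub>} \<union> {n. h' n \<noteq> \<zero>\<^bsub>C n\<^esub>}"])
        (use h in \<open>auto simp: H_carrier abelian_monoid.l_zero[OF C_am]\<close>)
    then show ?thesis using h by (simp add: H_carrier H_simps)
  qed
  have sm: "c \<odot>\<^bsub>H\<^esub> h \<in> carrier H" if c: "c \<in> carrier K" and h: "h \<in> carrier H" for c h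
  proof -
    have "finite {n. c \<odot>\<^bsub>C n\<^esub> h n \<noteq> \<zero>\<^bsub>C n\<^esub>}"
      by (rule finite_subset[of _ "{n. h n \<noteq> \<zero>\<^bsub>C n\<^esub>}"])
        (use h c in \<open>auto simp: H_carrier Module.module.smult_r_null[OF vsC]\<close>)
    then show ?thesis using h c by (simp add: H_carrier H_simps)
  qed
  have hc[simp]: "h n \<in> carrier (C n)" if "h \<in> carrier H" for h n using that by (simp add: H_carrier)
  show "abelian_group H"
  proof (rule abelian_groupI)
    fix h assume h: "h \<in> carrier H"
    have "(\<ominus> \<one>) \<odot>\<^bsub>H\<^esub> h \<oplus>\<^bsub>H\<^esub> h = \<zero>\<^bsub>H\<^esub>"
    proof
      fix n
      interpret M: Module.module K "C n" by (rule vsC)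
      show "((\<ominus> \<one>) \<odot>\<^bsub>H\<^esub> h \<oplus>\<^bsub>H\<^esub> h) n = \<zero>\<^bsub>H\<^esub> n"
        using hc[OF h, of n] by (simp add: H_simps M.smult_l_minus M.l_neg)
    qed
    then show "\<exists>y\<in>carrier H. y \<oplus>\<^bsub>H\<^esub> h = \<zero>\<^bsub>H\<^esub>" using sm[OF _ h, of "\<ominus> \<one>"] by auto
  next
    show "\<zero>\<^bsub>H\<^esub> \<in> carrier H" by (simp add: H_carrier H_simps)
  next
    fix x y z assume *: "x \<in> carrier H" "y \<in> carrier H"
    show "x \<oplus>\<^bsub>H\<^esub> y \<in> carrier H" by (rule add[OF *])
    show "x \<oplus>\<^bsub>H\<^esub> y = y \<oplus>\<^bsub>H\<^esub> x"
      using * by (auto simp: H_simps hc intro!: abelian_monoid.a_comm[OF C_am])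
    show "\<zero>\<^bsub>H\<^esub> \<oplus>\<^bsub>H\<^esub> x = x"
      using * by (simp add: H_simps hc abelian_monoid.l_zero[OF C_am])
    assume "z \<in> carrier H"
    then show "x \<oplus>\<^bsub>H\<^esub> y \<oplus>\<^bsub>H\<^esub> z = x \<oplus>\<^bsub>H\<^esub> (y \<oplus>\<^bsub>H\<^esub> z)"
      using * by (simp add: H_simps hc abelian_monoid.a_assoc[OF C_am])
  qed
  show "c \<odot>\<^bsub>H\<^esub> h \<in> carrier H" if "c \<in> carrier K" "h \<in> carrier H" for c h using sm[OF that] .
qed (auto simp: H_simps H_carrier Module.module.smult_l_distr[OF vsC] Module.module.smult_r_distr[OF vsC]
    Module.module.smult_assoc1[OF vsC] Module.module.smult_one[OF vsC])

lemma H_eval: "(\<lambda>h. h n) \<in> lm H (C n)"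
  by (intro lmI) (auto simp: H_carrier H_simps)

definition inc :: "nat \<Rightarrow> 'v set \<Rightarrow> nat \<Rightarrow> 'v set" where
  "inc n c = (\<lambda>m. if m = n then c else \<zero>\<^bsub>C m\<^esub>)"

lemma inc_lm: "inc n \<in> lm (C n) H"
proof (rule lmI)
  fix x assume x: "x \<in> carrier (C n)"
  have "finite {m. inc n x m \<noteq> \<zero>\<^bsub>C m\<^esub>}"
    by (rule finite_subset[of _ "{n}"]) (auto simp: inc_def)
  then show "inc n x \<in> carrier H" using x by (auto simp: H_carrier inc_def)
qed (auto simp: inc_def H_simps fun_eq_iff abelian_monoid.r_zero[OF C_am] Module.module.smult_r_null[OF vsC])

lemma fc_inc: "fc n v = inc n (cl n v)"
  by (simp add: fock_class_def inc_def)

lemma fc_lm: "fc n \<in> lm (V n) H"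
  unfolding fc_inc[abs_def] by (rule lm_comp[OF cl_lm inc_lm])

lemma fc_closed: "v \<in> carrier (V n) \<Longrightarrow> fc n v \<in> carrier H" by (rule lm_closed[OF fc_lm])

lemma H_decomp:
  assumes h: "h \<in> carrier H"
  shows "h = (\<Oplus>\<^bsub>H\<^esub>n\<in>{n. h n \<noteq> \<zero>\<^bsub>C n\<^esub>}. inc n (h n))" (is "h = ?s")
proof
  fix m
  let ?A = "{n. h n \<noteq> \<zero>\<^bsub>C n\<^esub>}"
  have hc: "h n \<in> carrier (C n)" for n using h by (simp add: H_carrier)
  have A: "finite ?A" using h by (simp add: H_carrier)
  have "?s m = (\<Oplus>\<^bsub>C m\<^esub>n\<in>?A. inc n (h n) m)"
    by (rule lm_sum[OF vsH vsC H_eval A lm_closed[OF inc_lm hc]])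
  also have "\<dots> = h m"
  proof (cases "m \<in> ?A")
    case True
    have "(\<Oplus>\<^bsub>C m\<^esub>n\<in>?A. inc n (h n) m) = inc m (h m) m"
      by (rule sum_single[OF vsC A True]) (auto simp: inc_def hc)
    then show ?thesis by (simp add: inc_def)
  next
    case False
    have "(\<Oplus>\<^bsub>C m\<^esub>n\<in>?A. inc n (h n) m) = \<zero>\<^bsub>C m\<^esub>"
      by (rule sum_zero[OF vsC]) (use False in \<open>auto simp: inc_def\<close>)
    then show ?thesis using False by simp
  qed
  finally show "h m = ?s m" ..
qed

text \<open>The family \<open>S\<close> stands for the whole spaces \<open>V n\<close> in
  \<open>H_span\<close> and for their parts of a given degree in \<open>Hdeg_span\<close>.\<close>

lemma H_in_span:
  assumes h: "h \<in> carrier H" and S: "\<And>n. \<exists>v\<in>S n. h n = cl n v" and Sc: "\<And>n. S n \<subseteq> carrier (V n)"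
  shows "h \<in> lin_span K H {fc n v |n v. v \<in> S n}"
proof (subst H_decomp[OF h], rule submod_sum[OF vsH])
  show "submodule (lin_span K H {fc n v |n v. v \<in> S n}) K H"
    by (rule span_submod[OF vsH]) (use Sc fc_closed in blast)
  fix n
  obtain v where "v \<in> S n" "h n = cl n v" using S by blast
  then show "inc n (h n) \<in> lin_span K H {fc n v |n v. v \<in> S n}"
    by (intro set_mp[OF span_superset]) (auto simp: fc_inc)
qed

lemma H_span: "h \<in> carrier H \<Longrightarrow> h \<in> lin_span K H {fc n v |n v. v \<in> carrier (V n)}"
  by (rule H_in_span) (auto simp: H_carrier carrier_C)

lemma H_gen_sub: "{fc n v |n v. v \<in> carrier (V n)} \<subseteq> carrier H" using fc_closed by blast

lemma H_ext:
  assumes "vs W" "f \<in> lm H W" "g \<in> lm H W" "\<And>n v. v \<in> carrier (V n) \<Longrightarrow> f (fc n v) = g (fc n v)" "h \<in> carrier H"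
  shows "f h = g h"
  by (rule lm_eq_on_span[OF vsH assms(1-3) H_gen_sub _ H_span[OF assms(5)]]) (use assms(4) in blast)

lemma H_ext2:
  assumes "vs W" "blm H H W f" "blm H H W g"
    "\<And>m n v w. v \<in> carrier (V m) \<Longrightarrow> w \<in> carrier (V n) \<Longrightarrow> f (fc m v) (fc n w) = g (fc m v) (fc n w)"
    "h \<in> carrier H" "h' \<in> carrier H"
  shows "f h h' = g h h'"
  by (rule blm_eq_on_span[OF vsH vsH assms(1-3) H_gen_sub H_gen_sub _ H_span[OF assms(5)] H_span[OF assms(6)]])
    (use assms(4) in blast)

text \<open>The universal property of the direct sum. \<open>F\<close> sums over the exact support
  because \<open>fock_coprod\<close> and \<open>fock_counit\<close> are written in that
  form.\<close>

lemma H_lift: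
  assumes W: "vs W" and g: "\<And>n. g n \<in> lm (C n) W"
  defines "F \<equiv> \<lambda>h. \<Oplus>\<^bsub>W\<^esub>n\<in>{n. h n \<noteq> \<zero>\<^bsub>C n\<^esub>}. g n (h n)"
  shows "F \<in> lm H W" "\<And>n v. v \<in> carrier (V n) \<Longrightarrow> F (fc n v) = g n (cl n v)"
proof -
  note gz = lm_zero[OF vsC W g] and gc = lm_closed[OF g]
  have hc: "h n \<in> carrier (C n)" if "h \<in> carrier H" for h n using that by (simp add: H_carrier)
  have hf: "finite {n. h n \<noteq> \<zero>\<^bsub>C n\<^esub>}" if "h \<in> carrier H" for h using that by (simp add: H_carrier)
  \<comment> \<open>Terms outside the support vanish, so the sum may run over any finite set
    containing it; for additivity this is the union of two supports.\<close>
  have FA: "F h = (\<Oplus>\<^bsub>W\<^esub>n\<in>A. g n (h n))" if "h \<in> carrier H" "finite A" "{n. h n \<noteq> \<zero>\<^bsub>C n\<^esub>} \<subseteq> A" for h A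
    unfolding F_def by (rule sum_mono_neutral[OF W that(2,3)]) (use gz gc[OF hc[OF that(1)]] in auto)
  show "F \<in> lm H W"
  proof (rule lmI)
    fix h assume h: "h \<in> carrier H"
    show "F h \<in> carrier W" unfolding F_def by (rule vs_sum[OF W gc[OF hc[OF h]]])
    { fix h' assume h': "h' \<in> carrier H"
      let ?A = "{n. h n \<noteq> \<zero>\<^bsub>C n\<^esub>} \<union> {n. h' n \<noteq> \<zero>\<^bsub>C n\<^esub>}"
      have A: "finite ?A" using hf[OF h] hf[OF h'] by simp
      have "F (h \<oplus>\<^bsub>H\<^esub> h') = (\<Oplus>\<^bsub>W\<^esub>n\<in>?A. g n ((h \<oplus>\<^bsub>H\<^esub> h') n))"
        by (rule FA[OF vs_add[OF vsH h h'] A]) (auto simp: H_simps abelian_monoid.l_zero[OF C_am])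
      also have "\<dots> = (\<Oplus>\<^bsub>W\<^esub>n\<in>?A. g n (h n) \<oplus>\<^bsub>W\<^esub> g n (h' n))"
        by (rule sum_cong[OF W refl]) (simp_all add: H_simps lm_add[OF g] hc[OF h] hc[OF h'] gc vs_add[OF W])
      also have "\<dots> = F h \<oplus>\<^bsub>W\<^esub> F h'"
        unfolding FA[OF h A Un_upper1] FA[OF h' A Un_upper2]
        by (rule sum_add[OF W gc[OF hc[OF h]] gc[OF hc[OF h']]])
      finally show "F (h \<oplus>\<^bsub>H\<^esub> h') = F h \<oplus>\<^bsub>W\<^esub> F h'" . }
    { fix c assume c: "c \<in> carrier K"
      let ?A = "{n. h n \<noteq> \<zero>\<^bsub>C n\<^esub>}"
      have "F (c \<odot>\<^bsub>H\<^esub> h) = (\<Oplus>\<^bsub>W\<^esub>n\<in>?A. g n ((c \<odot>\<^bsub>H\<^esub> h) n))"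
      proof (rule FA[OF vs_smult[OF vsH c h] hf[OF h]], rule Collect_mono, rule impI, rule contrapos_nn, assumption)
        fix n assume "h n = \<zero>\<^bsub>C n\<^esub>"
        then show "(c \<odot>\<^bsub>H\<^esub> h) n = \<zero>\<^bsub>C n\<^esub>" by (simp add: H_simps Module.module.smult_r_null[OF vsC c])
      qed
      also have "\<dots> = (\<Oplus>\<^bsub>W\<^esub>n\<in>?A. c \<odot>\<^bsub>W\<^esub> g n (h n))"
        by (rule sum_cong[OF W refl]) (simp_all add: H_simps lm_smult[OF g] hc[OF h] gc c vs_smult[OF W])
      also have "\<dots> = c \<odot>\<^bsub>W\<^esub> F h"
        unfolding F_def by (rule sum_smult[OF W hf[OF h] c gc[OF hc[OF h]]])
      finally show "F (c \<odot>\<^bsub>H\<^esub> h) = c \<odot>\<^bsub>W\<^esub> F h" . }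
  qed
  fix n v assume v: "v \<in> carrier (V n)"
  have e: "fc n v n = cl n v" by (simp add: fc_inc inc_def)
  have "F (fc n v) = (\<Oplus>\<^bsub>W\<^esub>m\<in>{n}. g m (fc n v m))"
  proof (rule FA[OF fc_closed[OF v]])
    show "{m. fc n v m \<noteq> \<zero>\<^bsub>C m\<^esub>} \<subseteq> {n}"
    proof
      fix m assume "m \<in> {m. fc n v m \<noteq> \<zero>\<^bsub>C m\<^esub>}"
      then have "fc n v m \<noteq> \<zero>\<^bsub>C m\<^esub>" by blast
      then show "m \<in> {n}" unfolding fc_inc inc_def by (cases "m = n") simp_all
    qed
  qed simp
  also have "\<dots> = g n (fc n v n)"
    by (rule sum_single[OF W]) (simp_all add: e gc cl_closed[OF v])
  finally show "F (fc n v) = g n (cl n v)" by (simp add: e)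
qed

text \<open>Linearity can be tested on coordinates, but finiteness of the support cannot; the latter
  is the separate premise on carriers.\<close>

lemma H_lmI: "(\<And>x. x \<in> carrier W \<Longrightarrow> f x \<in> carrier H) \<Longrightarrow> (\<And>n. (\<lambda>x. f x n) \<in> lm W (C n)) \<Longrightarrow> f \<in> lm W H"
proof (rule lmI)
  assume f: "\<And>n. (\<lambda>x. f x n) \<in> lm W (C n)"
  show "f (x \<oplus>\<^bsub>W\<^esub> y) = f x \<oplus>\<^bsub>H\<^esub> f y" if "x \<in> carrier W" "y \<in> carrier W" for x y
    using lm_add[OF f that] by (simp add: H_simps fun_eq_iff)
  show "f (c \<odot>\<^bsub>W\<^esub> x) = c \<odot>\<^bsub>H\<^esub> f x" if "c \<in> carrier K" "x \<in> carrier W" for c x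
    using lm_smult[OF f that] by (simp add: H_simps fun_eq_iff)
qed

section \<open>The algebra structure of the Fock space\<close>

lemma H_mult: "h \<otimes>\<^bsub>H\<^esub> h' = (\<lambda>N. \<Oplus>\<^bsub>C N\<^esub>m\<in>{..N}. coinv_prod K E m (N - m) (h m) (h' (N - m)))"
  by (simp add: fock_def)

lemma H_one: "\<one>\<^bsub>H\<^esub> = fc 0 (unit_sp E)"
  by (auto simp: fock_def fock_class_def)

lemma mult_coord: "blm H H (C N) (\<lambda>h h'. (h \<otimes>\<^bsub>H\<^esub> h') N)"
  unfolding H_mult
proof (rule blm_sum[OF vsH vsH vsC])
  fix m assume "m \<in> {..N}"
  \<comment> \<open>The coinvariant product lands in the coordinate \<open>m + (N - m)\<close>; for
    \<open>m \<le> N\<close> this is \<open>N\<close>, with no truncation.\<close>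
  then have e: "m + (N - m) = N" by simp
  show "blm H H (C N) (\<lambda>h h'. coinv_prod K E m (N - m) (h m) (h' (N - m)))"
    using blm_comp[OF coinv_prod_blm[of m "N - m", unfolded e] H_eval H_eval lm_id] .
qed simp

text \<open>A nonzero coordinate of the product needs nonzero coordinates in both factors, so its
  index lies in the finite sumset of the two supports.\<close>

lemma mult_closed:
  assumes h: "h \<in> carrier H" "h' \<in> carrier H"
  shows "h \<otimes>\<^bsub>H\<^esub> h' \<in> carrier H"
proof -
  let ?A = "{n. h n \<noteq> \<zero>\<^bsub>C n\<^esub>}" and ?B = "{n. h' n \<noteq> \<zero>\<^bsub>C n\<^esub>}"
  have f: "finite ?A" "finite ?B" using h by (simp_all add: H_carrier)
  have hc: "h n \<in> carrier (C n)" "h' n \<in> carrier (C n)" for n using h by (simp_all add: H_carrier)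
  have z: "coinv_prod K E m n (h m) (h' n) = \<zero>\<^bsub>C (m + n)\<^esub>" if "h m = \<zero>\<^bsub>C m\<^esub> \<or> h' n = \<zero>\<^bsub>C n\<^esub>" for m n
    using that lm_zero[OF vsC vsC blm_left[OF coinv_prod_blm hc(2)]] lm_zero[OF vsC vsC blm_right[OF coinv_prod_blm hc(1)]] by auto
  have "(h \<otimes>\<^bsub>H\<^esub> h') N = \<zero>\<^bsub>C N\<^esub>" if N: "N \<notin> (\<lambda>(m, n). m + n) ` (?A \<times> ?B)" for N
    unfolding H_mult
  proof (rule sum_zero[OF vsC])
    fix m assume "m \<in> {..N}"
    then have e: "m + (N - m) = N" by simp
    have "h m = \<zero>\<^bsub>C m\<^esub> \<or> h' (N - m) = \<zero>\<^bsub>C (N - m)\<^esub>"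
    proof (rule ccontr)
      assume "\<not> ?thesis"
      then have "(m, N - m) \<in> ?A \<times> ?B" by simp
      then have "m + (N - m) \<in> (\<lambda>(m, n). m + n) ` (?A \<times> ?B)" by (rule rev_image_eqI) simp
      then show False using N e by simp
    qed
    from z[OF this] show "coinv_prod K E m (N - m) (h m) (h' (N - m)) = \<zero>\<^bsub>C N\<^esub>" by (simp add: e)
  qed
  then have "{N. (h \<otimes>\<^bsub>H\<^esub> h') N \<noteq> \<zero>\<^bsub>C N\<^esub>} \<subseteq> (\<lambda>(m, n). m + n) ` (?A \<times> ?B)" by blast
  then have "finite {N. (h \<otimes>\<^bsub>H\<^esub> h') N \<noteq> \<zero>\<^bsub>C N\<^esub>}" by (rule finite_subset) (use f in simp)
  then show ?thesis unfolding H_carrier using blm_closed[OF mult_coord h] by simp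
qed

lemma mult_blm: "blm H H H (mult H)"
  by (intro blmI H_lmI mult_closed blm_right[OF mult_coord] blm_left[OF mult_coord])

lemma pr_closed: "a \<in> carrier (V m) \<Longrightarrow> b \<in> carrier (V n) \<Longrightarrow> pr m n a b \<in> carrier (V (m + n))"
  by (rule blm_closed[OF pr_blm])

text \<open>In the convolution of two elements concentrated in coordinates \<open>m\<close> and
  \<open>n\<close>, the single pair \<open>(m, n)\<close> contributes, and it does so in coordinate
  \<open>m + n\<close>. This reduces the algebra axioms to statements about
  \<open>pr\<close>.\<close>

lemma mult_fc:
  assumes a: "a \<in> carrier (V m)" and b: "b \<in> carrier (V n)"
  shows "fc m a \<otimes>\<^bsub>H\<^esub> fc n b = fc (m + n) (pr m n a b)"
proof
  fix N
  note hc = fc_closed[OF a] fc_closed[OF b]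
  have fcn: "fc k v j = (if j = k then cl k v else \<zero>\<^bsub>C j\<^esub>)" for k v j by (simp add: fock_class_def)
  have cc: "fc m a k \<in> carrier (C k)" "fc n b k \<in> carrier (C k)" for k using hc by (simp_all add: H_carrier)
  have z: "coinv_prod K E k j (fc m a k) (fc n b j) = \<zero>\<^bsub>C (k + j)\<^esub>" if "k \<noteq> m \<or> j \<noteq> n" for k j
  proof (cases "k = m")
    case True
    then have "fc n b j = \<zero>\<^bsub>C j\<^esub>" using that by (simp add: fcn)
    then show ?thesis using lm_zero[OF vsC vsC blm_right[OF coinv_prod_blm cc(1)[of k]], of j] by simp
  next
    case False
    then have "fc m a k = \<zero>\<^bsub>C k\<^esub>" by (simp add: fcn)
    then show ?thesis using lm_zero[OF vsC vsC blm_left[OF coinv_prod_blm cc(2)[of j]], of k] by simp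
  qed
  show "(fc m a \<otimes>\<^bsub>H\<^esub> fc n b) N = fc (m + n) (pr m n a b) N"
  proof (cases "N = m + n")
    case True
    have "(fc m a \<otimes>\<^bsub>H\<^esub> fc n b) N = coinv_prod K E m (N - m) (fc m a m) (fc n b (N - m))"
      unfolding H_mult
    proof (rule sum_single[OF vsC])
      fix k assume k: "k \<in> {..N}" "k \<noteq> m"
      then have "k + (N - k) = N" by simp
      then show "coinv_prod K E k (N - k) (fc m a k) (fc n b (N - k)) = \<zero>\<^bsub>C N\<^esub>" using z[of k "N - k"] k by simp
    next
      show "coinv_prod K E m (N - m) (fc m a m) (fc n b (N - m)) \<in> carrier (C N)"
        using blm_closed[OF coinv_prod_blm[of m n] cc] True by simp
    qed (use True in auto)
    then show ?thesis using True coinv_prod_cl[OF a b] by (simp add: fcn)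
  next
    case False
    have "(fc m a \<otimes>\<^bsub>H\<^esub> fc n b) N = \<zero>\<^bsub>C N\<^esub>"
      unfolding H_mult
    proof (rule sum_zero[OF vsC])
      fix k assume k: "k \<in> {..N}"
      then have e: "k + (N - k) = N" by simp
      then have "k \<noteq> m \<or> N - k \<noteq> n" using False by auto
      then show "coinv_prod K E k (N - k) (fc m a k) (fc n b (N - k)) = \<zero>\<^bsub>C N\<^esub>" using z[of k "N - k"] e by simp
    qed
    then show ?thesis using False by (simp add: fcn)
  qed
qed

text \<open>Shifting by \<open>n\<close> and then by \<open>m\<close> is shifting by
  \<open>m + n\<close>. Naturality of the product along \<open>i - m\<close> moves the outer shift
  inside the product of the last two factors, after which associativity of the species
  applies.\<close>

lemma pr_assoc:
  assumes a: "a \<in> carrier (V m)" and b: "b \<in> carrier (V n)" and c: "c \<in> carrier (V p)"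
  shows "pr (m + n) p (pr m n a b) c = pr m (n + p) a (pr n p b c)"
proof -
  let ?X = "{1..m}" and ?Y = "{m+1..m+n}" and ?Z = "{m+n+1..m+n+p}"
  let ?f = "\<lambda>i. i - m"
  have YZ: "?Y \<union> ?Z = {m+1..m+(n+p)}" and dis: "?X \<inter> ?Y = {}" "?X \<inter> ?Z = {}" "?Y \<inter> ?Z = {}" by auto
  have fY: "bij_betw ?f ?Y {1..n}" by (rule shift_bij)
  have fZ: "bij_betw ?f ?Z {n+1..n+p}" by (rule bij_betw_byWitness[where f' = "\<lambda>i. i + m"]) auto
  have f: "bij_betw ?f (?Y \<union> ?Z) {1..n+p}" unfolding YZ by (rule shift_bij)
  have im: "?f ` ?Y = {1..n}" "?f ` ?Z = {n+1..n+p}" using fY fZ by (auto simp: bij_betw_def)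
  have sb: "sh m n b \<in> carrier (sp_space E ?Y)" by (rule lm_closed[OF sh_lm b])
  have sc: "sh (m+n) p c \<in> carrier (sp_space E ?Z)" by (rule lm_closed[OF sh_lm c])
  have sc': "sh n p c \<in> carrier (sp_space E {n+1..n+p})" by (rule lm_closed[OF sh_lm c])
  have "relab_sp E (?Y \<union> ?Z) ?f (prod_sp E (?f ` ?Y) (?f ` ?Z) b (sh n p c)) =
      prod_sp E ?Y ?Z (relab_sp E ?Y ?f b) (relab_sp E ?Z ?f (sh n p c))"
    by (rule prodE_natural[OF _ _ dis(3) f]) (use b sc' in \<open>simp_all add: im\<close>)
  moreover have "relab_sp E ?Z ?f (sh n p c) = sh (m+n) p c"
  proof -
    have "relab_sp E ?Z ?f (sh n p c) = relab_sp E ?Z ((\<lambda>i. i - n) \<circ> ?f) c"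
      unfolding sh_def by (rule relE_comp[OF _ fZ shift_bij c]) simp
    also have "\<dots> = sh (m+n) p c"
      unfolding sh_def by (rule relE_cong[OF _ bij_betw_trans[OF fZ shift_bij] _ c]) auto
    finally show ?thesis .
  qed
  ultimately have e: "sh m (n+p) (pr n p b c) = prod_sp E ?Y ?Z (sh m n b) (sh (m+n) p c)"
    unfolding im YZ by (simp add: sh_def pr_def)
  have "prod_sp E (?X \<union> ?Y) ?Z (prod_sp E ?X ?Y a (sh m n b)) (sh (m+n) p c) =
     prod_sp E ?X (?Y \<union> ?Z) a (prod_sp E ?Y ?Z (sh m n b) (sh (m+n) p c))"
    by (rule prodE_assoc[OF _ _ _ dis a sb sc]) simp_all
  then show ?thesis unfolding pr_def[of "m+n"] pr_def[of m "n+p"] e ivl_Un YZ by (simp add: pr_def)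
qed

lemma unit_V: "unit_sp E \<in> carrier (V 0)" using unitE by simp

lemma pr_unit:
  assumes a: "a \<in> carrier (V n)"
  shows "pr 0 n (unit_sp E) a = a" "pr n 0 a (unit_sp E) = a"
proof -
  have "sh 0 n a = a" using relE_id[OF _ a] by (simp add: sh_def)
  then show "pr 0 n (unit_sp E) a = a" using unitE_prod(1)[OF _ a] by (simp add: pr_def)
  \<comment> \<open>The shift is a relabelling of the empty set, on which every map agrees with the
    identity.\<close>
  have "sh n 0 (unit_sp E) = unit_sp E"
    using relE_cong[of "{}" "\<lambda>i. i - n" "{}" "\<lambda>i. i" "unit_sp E"] relE_id[OF _ unitE] unitE by (simp add: sh_def bij_betw_def)
  then show "pr n 0 a (unit_sp E) = a" using unitE_prod(2)[OF _ a] by (simp add: pr_def)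
qed

lemma H_assoc:
  assumes h: "x \<in> carrier H" "y \<in> carrier H" "z \<in> carrier H"
  shows "x \<otimes>\<^bsub>H\<^esub> y \<otimes>\<^bsub>H\<^esub> z = x \<otimes>\<^bsub>H\<^esub> (y \<otimes>\<^bsub>H\<^esub> z)"
proof -
  note M = mult_blm
  show ?thesis
  proof (rule H_ext2[OF vsH blm_comp[OF M lm_id lm_id blm_left[OF M h(3)]] blm_comp[OF M lm_id blm_left[OF M h(3)] lm_id] _ h(1,2)])
    fix m n v w assume v: "v \<in> carrier (V m)" and w: "w \<in> carrier (V n)"
    note vw = fc_closed[OF v] fc_closed[OF w]
    show "fc m v \<otimes>\<^bsub>H\<^esub> fc n w \<otimes>\<^bsub>H\<^esub> z = fc m v \<otimes>\<^bsub>H\<^esub> (fc n w \<otimes>\<^bsub>H\<^esub> z)"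
    proof (rule H_ext[OF vsH blm_right[OF M blm_closed[OF M vw]] lm_comp[OF blm_right[OF M vw(2)] blm_right[OF M vw(1)]] _ h(3)])
      fix p u assume u: "u \<in> carrier (V p)"
      show "fc m v \<otimes>\<^bsub>H\<^esub> fc n w \<otimes>\<^bsub>H\<^esub> fc p u = fc m v \<otimes>\<^bsub>H\<^esub> (fc n w \<otimes>\<^bsub>H\<^esub> fc p u)"
        unfolding mult_fc[OF v w] mult_fc[OF w u] mult_fc[OF pr_closed[OF v w] u] mult_fc[OF v pr_closed[OF w u]]
          pr_assoc[OF v w u] by (simp add: add.assoc)
    qed
  qed
qed

lemma H_unit:
  assumes h: "h \<in> carrier H"
  shows "\<one>\<^bsub>H\<^esub> \<otimes>\<^bsub>H\<^esub> h = h" "h \<otimes>\<^bsub>H\<^esub> \<one>\<^bsub>H\<^esub> = h"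
proof -
  note o = fc_closed[OF unit_V]
  show "\<one>\<^bsub>H\<^esub> \<otimes>\<^bsub>H\<^esub> h = h" unfolding H_one
    by (rule H_ext[OF vsH blm_right[OF mult_blm o] lm_id _ h]) (simp add: mult_fc[OF unit_V] pr_unit)
  show "h \<otimes>\<^bsub>H\<^esub> \<one>\<^bsub>H\<^esub> = h" unfolding H_one
    by (rule H_ext[OF vsH blm_left[OF mult_blm o] lm_id _ h]) (simp add: mult_fc[OF _ unit_V] pr_unit)
qed

lemma H_ring: "ring H"
proof (rule ringI)
  show "abelian_group H" by (rule vs_ab[OF vsH])
  show "Group.monoid H"
  proof (rule Group.monoidI)
    show "\<one>\<^bsub>H\<^esub> \<in> carrier H" unfolding H_one by (rule fc_closed[OF unit_V])
  qed (auto intro: mult_closed H_assoc H_unit)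
  fix x y z assume h: "x \<in> carrier H" "y \<in> carrier H" "z \<in> carrier H"
  show "(x \<oplus>\<^bsub>H\<^esub> y) \<otimes>\<^bsub>H\<^esub> z = x \<otimes>\<^bsub>H\<^esub> z \<oplus>\<^bsub>H\<^esub> y \<otimes>\<^bsub>H\<^esub> z" by (rule lm_add[OF blm_left[OF mult_blm h(3)] h(1,2)])
  show "z \<otimes>\<^bsub>H\<^esub> (x \<oplus>\<^bsub>H\<^esub> y) = z \<otimes>\<^bsub>H\<^esub> x \<oplus>\<^bsub>H\<^esub> z \<otimes>\<^bsub>H\<^esub> y" by (rule lm_add[OF blm_right[OF mult_blm h(3)] h(1,2)])
qed

section \<open>The coalgebra structure of the Fock space\<close>

abbreviation TH where "TH \<equiv> tensor K H H"
abbreviation TV where "TV n \<equiv> tensor K (V n) (V n)"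

text \<open>The coproduct of a representative, read in the tensor square of the Fock space. The
  passage to classes in both factors is what makes it independent of the representative.\<close>

definition phi :: "nat \<Rightarrow> 'v \<Rightarrow> ((nat \<Rightarrow> 'v set) \<times> (nat \<Rightarrow> 'v set) \<Rightarrow> 'k) set" where
  "phi n v = tensor_map K H H (fc n) (fc n) (cop n v)"

lemma vsTH [simp]: "vs TH" and vsTV [simp]: "vs (TV n)" by (simp_all add: vs_tensor)

lemma cop_lm: "cop n \<in> lm (V n) (TV n)" by (rule copE_lm) simp
lemma eps_lm: "counit_sp E {1..n} \<in> lm (V n) (base_vs K)" by (rule epsE_lm) simp

lemma ff_lm: "tensor_map K H H (fc n) (fc n) \<in> lm (TV n) TH"
  by (rule tensor_map_lm[OF vsV vsV vsH vsH fc_lm fc_lm])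

lemma ff_tens: "a \<in> carrier (V n) \<Longrightarrow> b \<in> carrier (V n) \<Longrightarrow>
  tensor_map K H H (fc n) (fc n) (tens K (V n) (V n) a b) = tens K H H (fc n a) (fc n b)"
  by (rule tensor_map_tens[OF vsV vsV vsH vsH fc_lm fc_lm])

lemma phi_lm: "phi n \<in> lm (V n) TH"
  unfolding phi_def[abs_def] by (rule lm_comp[OF cop_lm ff_lm])

text \<open>Naturality of the coproduct turns a permutation of \<open>v\<close> into the same
  permutation of both tensor factors, and passing to classes removes it.\<close>

lemma phi_inv:
  assumes s: "bij_betw \<sigma> {1..n} {1..n}" and v: "v \<in> carrier (V n)"
  shows "phi n (relab_sp E {1..n} \<sigma> v) = phi n v"
proof -
  have r: "relab_sp E {1..n} \<sigma> \<in> lm (V n) (V n)" using s by (intro relE_lm) auto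
  have cv: "cop n v \<in> carrier (TV n)" by (rule lm_closed[OF cop_lm v])
  have fr: "fc n (relab_sp E {1..n} \<sigma> x) = fc n x" if "x \<in> carrier (V n)" for x
    unfolding fc_inc cl_relab[OF s that] ..
  have "phi n (relab_sp E {1..n} \<sigma> v) =
    tensor_map K H H (fc n) (fc n) (tensor_map K (V n) (V n) (relab_sp E {1..n} \<sigma>) (relab_sp E {1..n} \<sigma>) (cop n v))"
    unfolding phi_def by (subst copE_relab[OF _ s v]) simp_all
  also have "\<dots> = tensor_map K H H (\<lambda>x. fc n (relab_sp E {1..n} \<sigma> x)) (\<lambda>x. fc n (relab_sp E {1..n} \<sigma> x)) (cop n v)"
    by (rule tensor_map_comp[OF vsV vsV vsV vsV vsH vsH r r fc_lm fc_lm cv])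
  also have "\<dots> = phi n v" unfolding phi_def
    by (rule tensor_map_cong[OF vsV vsV vsH vsH lm_comp[OF r fc_lm] lm_comp[OF r fc_lm] fc_lm fc_lm fr fr cv])
  finally show ?thesis .
qed

abbreviation Delta where "Delta \<equiv> fock_coprod K E"
abbreviation eps where "eps \<equiv> fock_counit K E"

lemma Delta_lift: "Delta = (\<lambda>h. \<Oplus>\<^bsub>TH\<^esub>n\<in>{n. h n \<noteq> \<zero>\<^bsub>C n\<^esub>}. the_elem (phi n ` h n))"
  by (simp add: fock_coprod_def[abs_def] phi_def[abs_def])

lemma Delta_lm: "Delta \<in> lm H TH"
  unfolding Delta_lift by (rule H_lift(1)[OF vsTH coinv_lift(1)[OF vsTH phi_lm phi_inv]])

lemma Delta_fc: "v \<in> carrier (V n) \<Longrightarrow> Delta (fc n v) = phi n v"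
  unfolding Delta_lift
  by (subst H_lift(2)[OF vsTH coinv_lift(1)[OF vsTH phi_lm phi_inv]]) (simp_all add: coinv_lift(2)[OF vsTH phi_lm phi_inv])

lemma eps_inv: "bij_betw \<sigma> {1..n} {1..n} \<Longrightarrow> v \<in> carrier (V n) \<Longrightarrow>
  counit_sp E {1..n} (relab_sp E {1..n} \<sigma> v) = counit_sp E {1..n} v"
  by (rule epsE_relab) simp

lemma eps_lift: "eps = (\<lambda>h. \<Oplus>\<^bsub>base_vs K\<^esub>n\<in>{n. h n \<noteq> \<zero>\<^bsub>C n\<^esub>}. the_elem (counit_sp E {1..n} ` h n))"
  by (simp add: fock_counit_def[abs_def])

lemma feps_lm: "eps \<in> lm H (base_vs K)"
  unfolding eps_lift by (rule H_lift(1)[OF vs_base coinv_lift(1)[OF vs_base eps_lm eps_inv]])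

lemma eps_fc: "v \<in> carrier (V n) \<Longrightarrow> eps (fc n v) = counit_sp E {1..n} v"
  unfolding eps_lift
  by (subst H_lift(2)[OF vs_base coinv_lift(1)[OF vs_base eps_lm eps_inv]]) (simp_all add: coinv_lift(2)[OF vs_base eps_lm eps_inv])

text \<open>The map \<open>fc n\<close> is compatible with the coproducts, so both sides are images
  under its threefold tensor power of the two sides for \<open>V n\<close>;
  \<open>assoc_natural\<close> moves the associativity isomorphism across.\<close>

lemma H_coassoc:
  assumes h: "h \<in> carrier H"
  shows "tensor_assoc K H H H (tensor_map K TH H Delta (\<lambda>x. x) (Delta h)) = tensor_map K H TH (\<lambda>x. x) Delta (Delta h)"
proof -
  have v: "vs (tensor K H TH)" "vs (tensor K TH H)" "vs (tensor K (TV n) (V n))" "vs (tensor K (V n) (TV n))" for n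
    by (simp_all add: vs_tensor)
  note DL = tensor_map_lm[OF vsH vsH vsTH vsH Delta_lm lm_id] and DR = tensor_map_lm[OF vsH vsH vsH vsTH lm_id Delta_lm]
  show ?thesis
  proof (rule H_ext[OF v(1) lm_comp[OF Delta_lm lm_comp[OF DL assoc_lm[OF vsH vsH vsH]]] lm_comp[OF Delta_lm DR] _ h])
    fix n x assume x: "x \<in> carrier (V n)"
    note cx = lm_closed[OF cop_lm x]
    note ce = coalgE_facts[of "{1..n}", THEN conjunct2, THEN conjunct2, THEN conjunct2, THEN conjunct1, rule_format, OF finite_atLeastAtMost x]
    note lc = lm_comp[OF fc_lm Delta_lm] and pc = lm_comp[OF cop_lm ff_lm, of n]
    note cL = tensor_map_lm[OF vsV vsV vsTV vsV cop_lm lm_id, of n] and cR = tensor_map_lm[OF vsV vsV vsV vsTV lm_id cop_lm, of n]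
    have e: "Delta (fc n y) = tensor_map K H H (fc n) (fc n) (cop n y)" if "y \<in> carrier (V n)" for y
      using Delta_fc[OF that] by (simp add: phi_def)
    have "tensor_map K TH H Delta (\<lambda>x. x) (Delta (fc n x)) = tensor_map K TH H (\<lambda>y. Delta (fc n y)) (fc n) (cop n x)"
      unfolding e[OF x] by (rule tensor_map_comp[OF vsV vsV vsH vsH vsTH vsH fc_lm fc_lm Delta_lm lm_id cx])
    also have "\<dots> = tensor_map K TH H (\<lambda>y. tensor_map K H H (fc n) (fc n) (cop n y)) (fc n) (cop n x)"
      by (rule tensor_map_cong[OF vsV vsV vsTH vsH lc fc_lm pc fc_lm e refl cx])
    also have "\<dots> = tensor_map K TH H (tensor_map K H H (fc n) (fc n)) (fc n) (tensor_map K (TV n) (V n) (cop n) (\<lambda>x. x) (cop n x))"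
      by (rule tensor_map_comp[OF vsV vsV vsTV vsV vsTH vsH cop_lm lm_id ff_lm fc_lm cx, symmetric])
    finally have L: "tensor_map K TH H Delta (\<lambda>x. x) (Delta (fc n x)) =
      tensor_map K TH H (tensor_map K H H (fc n) (fc n)) (fc n) (tensor_map K (TV n) (V n) (cop n) (\<lambda>x. x) (cop n x))" .
    have "tensor_map K H TH (\<lambda>x. x) Delta (Delta (fc n x)) = tensor_map K H TH (fc n) (\<lambda>y. Delta (fc n y)) (cop n x)"
      unfolding e[OF x] by (rule tensor_map_comp[OF vsV vsV vsH vsH vsH vsTH fc_lm fc_lm lm_id Delta_lm cx])
    also have "\<dots> = tensor_map K H TH (fc n) (\<lambda>y. tensor_map K H H (fc n) (fc n) (cop n y)) (cop n x)"
      by (rule tensor_map_cong[OF vsV vsV vsH vsTH fc_lm lc fc_lm pc refl e cx])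
    also have "\<dots> = tensor_map K H TH (fc n) (tensor_map K H H (fc n) (fc n)) (tensor_map K (V n) (TV n) (\<lambda>x. x) (cop n) (cop n x))"
      by (rule tensor_map_comp[OF vsV vsV vsV vsTV vsH vsTH lm_id cop_lm fc_lm ff_lm cx, symmetric])
    finally have R: "tensor_map K H TH (\<lambda>x. x) Delta (Delta (fc n x)) =
      tensor_map K H TH (fc n) (tensor_map K H H (fc n) (fc n)) (tensor_map K (V n) (TV n) (\<lambda>x. x) (cop n) (cop n x))" .
    show "tensor_assoc K H H H (tensor_map K TH H Delta (\<lambda>x. x) (Delta (fc n x))) = tensor_map K H TH (\<lambda>x. x) Delta (Delta (fc n x))"
      unfolding L R assoc_natural[OF vsV vsH fc_lm lm_closed[OF cL cx]] ce by (rule refl)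
  qed
qed

text \<open>\<open>fc n\<close> carries the action of the counit on \<open>V n\<close> to the action
  on the Fock space, so \<open>tensor_lift_natural\<close> transports both laws.\<close>

lemma H_counit:
  assumes h: "h \<in> carrier H"
  shows "tensor_lift K H (\<lambda>x y. eps x \<odot>\<^bsub>H\<^esub> y) (Delta h) = h" "tensor_lift K H (\<lambda>x y. eps y \<odot>\<^bsub>H\<^esub> x) (Delta h) = h"
proof -
  note b = counit_action_blm[OF vsH feps_lm] and bV = counit_action_blm[OF vsV eps_lm]
  note l1 = tensor_lift_lm[OF vsH vsH vsH b(1)] and l2 = tensor_lift_lm[OF vsH vsH vsH b(2)]
  have ec: "counit_sp E {1..n} x \<in> carrier K" if "x \<in> carrier (V n)" for n x using lm_closed[OF eps_lm that] by simp
  note cop_counit = coalgE_facts[THEN conjunct2, THEN conjunct2, THEN conjunct2, THEN conjunct2, OF finite_atLeastAtMost]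
  have "tensor_lift K H (\<lambda>x y. eps x \<odot>\<^bsub>H\<^esub> y) (Delta (fc n x)) = fc n x"
    "tensor_lift K H (\<lambda>x y. eps y \<odot>\<^bsub>H\<^esub> x) (Delta (fc n x)) = fc n x" if x: "x \<in> carrier (V n)" for n x
    unfolding Delta_fc[OF x] phi_def
    using tensor_lift_natural[OF vsV vsH bV(1) b(1) fc_lm _ lm_closed[OF cop_lm x]]
      tensor_lift_natural[OF vsV vsH bV(2) b(2) fc_lm _ lm_closed[OF cop_lm x]]
      cop_counit[THEN conjunct1, rule_format, OF x] cop_counit[THEN conjunct2, rule_format, OF x]
    by (simp_all add: eps_fc lm_smult[OF fc_lm ec])
  note gen = this
  show "tensor_lift K H (\<lambda>x y. eps x \<odot>\<^bsub>H\<^esub> y) (Delta h) = h"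
    by (rule H_ext[OF vsH lm_comp[OF Delta_lm l1] lm_id _ h]) (rule gen(1))
  show "tensor_lift K H (\<lambda>x y. eps y \<odot>\<^bsub>H\<^esub> x) (Delta h) = h"
    by (rule H_ext[OF vsH lm_comp[OF Delta_lm l2] lm_id _ h]) (rule gen(2))
qed

lemma H_coalgebra: "coalgebra K H Delta eps"
  unfolding coalgebra_def by (intro conjI ballI vsH Delta_lm feps_lm H_coassoc H_counit)

section \<open>Compatibility of product and coproduct\<close>

lemma H_Delta_mult:
  assumes h: "a \<in> carrier H" "b \<in> carrier H"
  shows "Delta (a \<otimes>\<^bsub>H\<^esub> b) = tensor_mult K H (mult H) (Delta a) (Delta b)"
proof -
  note M = tensor_mult_blm[OF vsH vsH vsH mult_blm]
  show ?thesis
  proof (rule H_ext2[OF vsTH blm_comp[OF mult_blm lm_id lm_id Delta_lm] blm_comp[OF M(1) Delta_lm Delta_lm lm_id] _ h])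
    fix m n v w assume v: "v \<in> carrier (V m)" and w: "w \<in> carrier (V n)"
    let ?S = "sp_space E {m+1..m+n}" and ?p = "prod_sp E {1..m} {m+1..m+n}"
    have vS: "vs ?S" by (rule vsE) simp
    have sw: "sh m n w \<in> carrier ?S" by (rule lm_closed[OF sh_lm w])
    note P = tensor_mult_blm[OF vsV vS vsV pr_prod_blm]
    \<comment> \<open>The shift is a relabelling, so the coproduct commutes with it; this brings the
      second factor back to \<open>{1..n}\<close>.\<close>
    have sc: "coprod_sp E {m+1..m+n} (sh m n w) = tensor_map K ?S ?S (sh m n) (sh m n) (cop n w)"
      unfolding sh_def[abs_def] by (rule copE_relab[OF _ shift_bij w]) simp
    have cp: "cop (m+n) (pr m n v w) = tensor_mult K (V (m+n)) ?p (cop m v) (coprod_sp E {m+1..m+n} (sh m n w))"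
      using copE_prod[OF _ _ ivl_dis v sw] unfolding ivl_Un pr_def by simp
    note ss = tensor_map_lm[OF vsV vsV vS vS sh_lm sh_lm] and sst = tensor_map_tens[OF vsV vsV vS vS sh_lm sh_lm]
    \<comment> \<open>Passing to classes is multiplicative on tensor squares. The claim is stated
      for arbitrary \<open>s\<close> and \<open>t\<close>, so that it can be checked on pure tensors
      before the coproducts are inserted.\<close>
    have "tensor_map K H H (fc (m+n)) (fc (m+n)) (tensor_mult K (V (m+n)) ?p s (tensor_map K ?S ?S (sh m n) (sh m n) t)) =
      tensor_mult K H (mult H) (tensor_map K H H (fc m) (fc m) s) (tensor_map K H H (fc n) (fc n) t)"
      if s: "s \<in> carrier (TV m)" and t: "t \<in> carrier (TV n)" for s t
    proof (rule tensor_ext2[OF vsV vsV vsV vsV vsTH blm_comp[OF P(1) lm_id ss ff_lm] blm_comp[OF M(1) ff_lm ff_lm lm_id] _ s t])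
      fix a1 a2 b1 b2 assume a: "a1 \<in> carrier (V m)" "a2 \<in> carrier (V m)" and b: "b1 \<in> carrier (V n)" "b2 \<in> carrier (V n)"
      note sb = lm_closed[OF sh_lm b(1)] lm_closed[OF sh_lm b(2)]
      note f = fc_closed[OF a(1)] fc_closed[OF a(2)] fc_closed[OF b(1)] fc_closed[OF b(2)]
      show "tensor_map K H H (fc (m+n)) (fc (m+n)) (tensor_mult K (V (m+n)) ?p (tens K (V m) (V m) a1 a2)
          (tensor_map K ?S ?S (sh m n) (sh m n) (tens K (V n) (V n) b1 b2))) =
        tensor_mult K H (mult H) (tensor_map K H H (fc m) (fc m) (tens K (V m) (V m) a1 a2)) (tensor_map K H H (fc n) (fc n) (tens K (V n) (V n) b1 b2))"
        unfolding sst[OF b] P(2)[OF a sb] ff_tens[OF a] ff_tens[OF b] M(2)[OF f] mult_fc[OF a(1) b(1)] mult_fc[OF a(2) b(2)]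
          pr_def[symmetric]
        by (rule ff_tens[OF pr_closed[OF a(1) b(1)] pr_closed[OF a(2) b(2)]])
    qed
    from this[OF lm_closed[OF cop_lm v] lm_closed[OF cop_lm w]]
    show "Delta (fc m v \<otimes>\<^bsub>H\<^esub> fc n w) = tensor_mult K H (mult H) (Delta (fc m v)) (Delta (fc n w))"
      unfolding mult_fc[OF v w] Delta_fc[OF pr_closed[OF v w]] Delta_fc[OF v] Delta_fc[OF w] phi_def cp sc .
  qed
qed

lemma H_eps_mult:
  assumes h: "a \<in> carrier H" "b \<in> carrier H"
  shows "eps (a \<otimes>\<^bsub>H\<^esub> b) = eps a \<otimes> eps b"
proof (rule H_ext2[OF vs_base blm_comp[OF mult_blm lm_id lm_id feps_lm] blm_comp[OF K_mult_blm feps_lm feps_lm lm_id] _ h])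
  fix m n v w assume v: "v \<in> carrier (V m)" and w: "w \<in> carrier (V n)"
  have sw: "sh m n w \<in> carrier (sp_space E {m+1..m+n})" by (rule lm_closed[OF sh_lm w])
  have "counit_sp E {m+1..m+n} (sh m n w) = counit_sp E {1..n} w"
    unfolding sh_def by (rule epsE_relab[OF _ shift_bij w]) simp
  then show "eps (fc m v \<otimes>\<^bsub>H\<^esub> fc n w) = eps (fc m v) \<otimes> eps (fc n w)"
    unfolding mult_fc[OF v w] eps_fc[OF pr_closed[OF v w]] eps_fc[OF v] eps_fc[OF w]
    using epsE_prod[OF _ _ ivl_dis v sw] unfolding ivl_Un pr_def by simp
qed

section \<open>The grading of the Fock space\<close>

lemma dsdV: "direct_sum_decomposition K (V n) (G n)"
  using gradE[of "{1..n}"] unfolding graded_coalgebra_def by simp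

lemma G_sub: "submodule (G n d) K (V n)" by (rule dsd_sub[OF vsV dsdV])

lemma G_car: "G n d \<subseteq> carrier (V n)" by (rule submod_sub[OF G_sub])

abbreviation Hdeg where "Hdeg \<equiv> fock_deg K E"

lemma Hdeg_mem: "h \<in> Hdeg d \<longleftrightarrow> h \<in> carrier H \<and> (\<forall>n. h n \<in> cl n ` G n d)"
  unfolding fock_deg_def image_iff by blast

lemma clG_sub: "submodule (cl n ` G n d) K (C n)"
  by (rule submod_image[OF vsV vsC cl_lm G_sub])

lemma Hdeg_sub: "submodule (Hdeg d) K H"
proof (rule submodI[OF vsH])
  show "Hdeg d \<subseteq> carrier H" by (auto simp: Hdeg_mem)
  show "\<zero>\<^bsub>H\<^esub> \<in> Hdeg d" using submod_zero[OF clG_sub] vs_zero[OF vsH] by (simp add: Hdeg_mem H_simps)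
  show "x \<oplus>\<^bsub>H\<^esub> y \<in> Hdeg d" if "x \<in> Hdeg d" "y \<in> Hdeg d" for x y
    using that submod_add[OF clG_sub] vs_add[OF vsH, of x y] by (simp add: Hdeg_mem H_simps)
  show "c \<odot>\<^bsub>H\<^esub> x \<in> Hdeg d" if "c \<in> carrier K" "x \<in> Hdeg d" for c x
    using that submod_smult[OF clG_sub] vs_smult[OF vsH, of c x] by (simp add: Hdeg_mem H_simps)
qed

lemma fc_deg: assumes v: "v \<in> G n d" shows "fc n v \<in> Hdeg d"
proof -
  have "v \<in> carrier (V n)" using v G_car by blast
  then have "fc n v \<in> carrier H" by (rule fc_closed)
  moreover have "fc n v m \<in> cl m ` G m d" for m
    using v submod_zero[OF clG_sub, of m d] by (simp add: fock_class_def)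
  ultimately show ?thesis by (simp add: Hdeg_mem)
qed

lemma Hdeg_gen_sub: "{fc n v |n v. v \<in> G n d} \<subseteq> carrier H"
  using fc_closed G_car by blast

lemma Hdeg_span: "h \<in> Hdeg d \<Longrightarrow> h \<in> lin_span K H {fc n v |n v. v \<in> G n d}"
  by (rule H_in_span[OF _ _ G_car]) (auto simp: Hdeg_mem image_iff)

definition hproj :: "nat \<Rightarrow> nat \<Rightarrow> 'v \<Rightarrow> 'v set" where
  "hproj d n v = cl n (proj_to (V n) (G n) d v)"

lemma hproj_lm: "hproj d n \<in> lm (V n) (C n)"
  unfolding hproj_def[abs_def] by (rule lm_comp[OF proj_to_lm[OF vsV dsdV] cl_lm])

text \<open>Relabelling preserves degrees and so commutes with the projection; the class then
  absorbs the permutation. This makes the projection well defined on coinvariants.\<close>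

lemma hproj_inv:
  assumes s: "bij_betw \<sigma> {1..n} {1..n}" and v: "v \<in> carrier (V n)"
  shows "hproj d n (relab_sp E {1..n} \<sigma> v) = hproj d n v"
proof -
  have r: "relab_sp E {1..n} \<sigma> \<in> lm (V n) (V n)" using s by (intro relE_lm) auto
  have "proj_to (V n) (G n) d (relab_sp E {1..n} \<sigma> v) = relab_sp E {1..n} \<sigma> (proj_to (V n) (G n) d v)"
    by (rule proj_to_commute[OF vsV dsdV r _ v]) (rule degE_relab[OF _ s], simp_all)
  then show ?thesis unfolding hproj_def using cl_relab[OF s lm_closed[OF proj_to_lm[OF vsV dsdV] v]] by simp
qed

text \<open>The degree projections of the Fock space, induced coordinatewise. They serve to
  recognise the direct sum through \<open>dsd_from_proj\<close>.\<close>

definition Hproj :: "nat \<Rightarrow> (nat \<Rightarrow> 'v set) \<Rightarrow> nat \<Rightarrow> 'v set" where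
  "Hproj d h = (\<lambda>n. the_elem (hproj d n ` h n))"

lemma Hproj_coord: "(\<lambda>A. the_elem (hproj d n ` A)) \<in> lm (C n) (C n)"
  by (rule coinv_lift(1)[OF vsC hproj_lm hproj_inv])

lemma Hproj_lm: "Hproj d \<in> lm H H"
proof (rule H_lmI)
  show l: "(\<lambda>h. Hproj d h n) \<in> lm H (C n)" for n
    unfolding Hproj_def by (rule lm_comp[OF H_eval Hproj_coord])
  have c: "Hproj d h n \<in> carrier (C n)" if "h \<in> carrier H" for h n by (rule lm_closed[OF l that])
  fix h assume h: "h \<in> carrier H"
  have "Hproj d h n = \<zero>\<^bsub>C n\<^esub>" if "h n = \<zero>\<^bsub>C n\<^esub>" for n
    unfolding Hproj_def that by (rule lm_zero[OF vsC vsC Hproj_coord])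
  then have "{n. Hproj d h n \<noteq> \<zero>\<^bsub>C n\<^esub>} \<subseteq> {n. h n \<noteq> \<zero>\<^bsub>C n\<^esub>}" by blast
  then have "finite {n. Hproj d h n \<noteq> \<zero>\<^bsub>C n\<^esub>}" by (rule finite_subset) (use h in \<open>simp add: H_carrier\<close>)
  then show "Hproj d h \<in> carrier H" using c[OF h] by (simp add: H_carrier)
qed

lemma Hproj_homog:
  assumes h: "h \<in> Hdeg e"
  shows "Hproj d h = (if d = e then h else \<zero>\<^bsub>H\<^esub>)"
proof
  fix n
  obtain v where v: "v \<in> G n e" "h n = cl n v" using h unfolding Hdeg_mem by blast
  have vc: "v \<in> carrier (V n)" using v G_car by blast
  have "Hproj d h n = cl n (if d = e then v else \<zero>\<^bsub>V n\<^esub>)"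
  proof -
    have "the_elem (hproj d n ` cl n v) = hproj d n v"
      by (rule coinv_lift(2)[OF vsC hproj_lm hproj_inv vc])
    then show ?thesis by (simp only: Hproj_def v(2) hproj_def proj_to_homog[OF vsV dsdV v(1)])
  qed
  then show "Hproj d h n = (if d = e then h else \<zero>\<^bsub>H\<^esub>) n" by (simp add: v(2) cl_zero H_simps)
qed

lemma H_dsd: "direct_sum_decomposition K H Hdeg"
proof (rule dsd_from_proj[OF vsH Hdeg_sub Hproj_lm Hproj_homog])
  have sm: "submodule (lin_span K H (\<Union>d. Hdeg d)) K H"
    using submod_sub[OF Hdeg_sub] by (intro span_submod[OF vsH]) blast
  show "carrier H \<subseteq> lin_span K H (\<Union>d. Hdeg d)"
  proof
    fix h assume "h \<in> carrier H"
    from H_span[OF this] show "h \<in> lin_span K H (\<Union>d. Hdeg d)"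
    proof (rule set_mp[OF span_least[OF sm], rotated], intro subsetI)
      fix x assume "x \<in> {fc n v |n v. v \<in> carrier (V n)}"
      then obtain n v where x: "x = fc n v" and v: "v \<in> carrier (V n)" by blast
      \<comment> \<open>A generator \<open>fc n v\<close> is the sum of the images of the
        homogeneous components of \<open>v\<close>, so homogeneous elements span the Fock
        space.\<close>
      note p = proj_to_decomp[OF vsV dsdV v]
      have "fc n (\<Oplus>\<^bsub>V n\<^esub>d\<in>{d. proj_to (V n) (G n) d v \<noteq> \<zero>\<^bsub>V n\<^esub>}. proj_to (V n) (G n) d v) =
        (\<Oplus>\<^bsub>H\<^esub>d\<in>{d. proj_to (V n) (G n) d v \<noteq> \<zero>\<^bsub>V n\<^esub>}. fc n (proj_to (V n) (G n) d v))"
        using G_car p(1) by (intro lm_sum[OF vsV vsH fc_lm p(2)]) blast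
      also have "\<dots> \<in> lin_span K H (\<Union>d. Hdeg d)"
      proof (rule submod_sum[OF vsH sm])
        fix d show "fc n (proj_to (V n) (G n) d v) \<in> lin_span K H (\<Union>d. Hdeg d)"
          using fc_deg[OF p(1), of d] by (intro set_mp[OF span_superset]) blast
      qed
      finally show "x \<in> lin_span K H (\<Union>d. Hdeg d)" using p(3) x by simp
    qed
  qed
qed

lemma tensor_degree_gen_sub:
  assumes "vs W" "\<And>i. F i \<subseteq> carrier W"
  shows "{tens K W W a b |a b i j. i + j = d \<and> a \<in> F i \<and> b \<in> F j} \<subseteq> carrier (tensor K W W)"
proof
  fix x assume "x \<in> {tens K W W a b |a b i j. i + j = d \<and> a \<in> F i \<and> b \<in> F j}"
  then obtain a b i j where "x = tens K W W a b" "a \<in> F i" "b \<in> F j" by blast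
  then show "x \<in> carrier (tensor K W W)" using assms by (simp add: tens_closed subset_iff)
qed

text \<open>\<open>fc n\<close> preserves degrees, so its tensor square preserves total degree, and
  the coproduct of a homogeneous representative is homogeneous already in the species.\<close>

lemma H_Delta_deg: assumes h: "h \<in> Hdeg d" shows "Delta h \<in> tensor_degree K H Hdeg d"
proof -
  note gs = tensor_degree_gen_sub[OF vsH submod_sub[OF Hdeg_sub]]
  have sm: "submodule (tensor_degree K H Hdeg d) K TH"
    unfolding tensor_degree_def by (rule span_submod[OF vsTH gs])
  show ?thesis
  proof (rule lm_span_in[OF vsH vsTH Delta_lm sm Hdeg_gen_sub _ Hdeg_span[OF h]])
    fix x assume "x \<in> {fc n v |n v. v \<in> G n d}"
    then obtain n v where x: "x = fc n v" and v: "v \<in> G n d" by blast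
    have vc: "v \<in> carrier (V n)" using v G_car by blast
    have "cop n v \<in> tensor_degree K (V n) (G n) d"
      using gradE[of "{1..n}"] v unfolding graded_coalgebra_def by blast
    then have cv: "cop n v \<in> lin_span K (TV n) {tens K (V n) (V n) a b |a b i j. i + j = d \<and> a \<in> G n i \<and> b \<in> G n j}"
      unfolding tensor_degree_def .
    have "tensor_map K H H (fc n) (fc n) (cop n v) \<in> tensor_degree K H Hdeg d"
    proof (rule lm_span_in[OF vsTV vsTH ff_lm sm tensor_degree_gen_sub[OF vsV G_car] _ cv])
      fix y assume "y \<in> {tens K (V n) (V n) a b |a b i j. i + j = d \<and> a \<in> G n i \<and> b \<in> G n j}"
      then obtain a b i j where y: "y = tens K (V n) (V n) a b" "i + j = d" "a \<in> G n i" "b \<in> G n j" by blast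
      have ab: "a \<in> carrier (V n)" "b \<in> carrier (V n)" using y G_car by blast+
      show "tensor_map K H H (fc n) (fc n) y \<in> tensor_degree K H Hdeg d"
        unfolding y(1) ff_tens[OF ab] tensor_degree_def
        using y(2) fc_deg[OF y(3)] fc_deg[OF y(4)] by (intro set_mp[OF span_superset]) blast
    qed
    then show "Delta x \<in> tensor_degree K H Hdeg d" unfolding x Delta_fc[OF vc] phi_def .
  qed
qed

lemma H_eps_deg: assumes h: "h \<in> Hdeg d" and d: "d \<noteq> 0" shows "eps h = \<zero>"
proof -
  have "eps h = \<zero>\<^bsub>base_vs K\<^esub>"
  proof (rule lm_vanish_span[OF vsH vs_base feps_lm Hdeg_gen_sub _ Hdeg_span[OF h]])
    fix x assume "x \<in> {fc n v |n v. v \<in> G n d}"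
    then obtain n v where x: "x = fc n v" and v: "v \<in> G n d" by blast
    have vc: "v \<in> carrier (V n)" using v G_car by blast
    have "counit_sp E {1..n} v = \<zero>"
      using gradE[of "{1..n}"] v d unfolding graded_coalgebra_def by blast
    then show "eps x = \<zero>\<^bsub>base_vs K\<^esub>" by (simp add: x eps_fc[OF vc])
  qed
  then show ?thesis by simp
qed

lemma H_mult_deg:
  assumes a: "a \<in> Hdeg i" and b: "b \<in> Hdeg j"
  shows "a \<otimes>\<^bsub>H\<^esub> b \<in> Hdeg (i + j)"
proof (rule blm_span_in[OF vsH vsH vsH mult_blm Hdeg_sub Hdeg_gen_sub Hdeg_gen_sub _ Hdeg_span[OF a] Hdeg_span[OF b]])
  fix x y assume "x \<in> {fc n v |n v. v \<in> G n i}" "y \<in> {fc n v |n v. v \<in> G n j}"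
  then obtain m v n w where x: "x = fc m v" "v \<in> G m i" and y: "y = fc n w" "w \<in> G n j" by blast
  have c: "v \<in> carrier (V m)" "w \<in> carrier (V n)" using x y G_car by blast+
  have "sh m n w \<in> deg_sp E {m+1..m+n} j"
    unfolding sh_def by (rule degE_relab[OF _ shift_bij y(2)]) simp
  then have "pr m n v w \<in> G (m + n) (i + j)"
    using degE_prod[OF _ _ ivl_dis x(2)] unfolding ivl_Un pr_def by simp
  then show "x \<otimes>\<^bsub>H\<^esub> y \<in> Hdeg (i + j)" unfolding x(1) y(1) mult_fc[OF c] by (rule fc_deg)
qed

theorem fock_graded_bialgebra: "graded_bialgebra K H Delta eps Hdeg"
  unfolding graded_bialgebra_def graded_coalgebra_def
proof (intro conjI allI ballI impI H_ring mult_blm H_coalgebra H_dsd H_Delta_mult H_eps_mult H_mult_deg)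
  show "Delta ` Hdeg n \<subseteq> tensor_degree K H Hdeg n" for n using H_Delta_deg by blast
  show "eps ` Hdeg n \<subseteq> {\<zero>}" if "n \<noteq> 0" for n using H_eps_deg[OF _ that] by blast
  have u: "unit_sp E \<in> G 0 0" using degE_unit by simp
  show "\<one>\<^bsub>H\<^esub> \<in> Hdeg 0" unfolding H_one by (rule fc_deg[OF u])
  have "cop 0 (unit_sp E) = tens K (V 0) (V 0) (unit_sp E) (unit_sp E)" using copE_unit by simp
  then show "Delta \<one>\<^bsub>H\<^esub> = tens K H H \<one>\<^bsub>H\<^esub> \<one>\<^bsub>H\<^esub>"
    unfolding H_one Delta_fc[OF unit_V] phi_def by (simp only: ff_tens[OF unit_V unit_V])
  show "eps \<one>\<^bsub>H\<^esub> = \<one>"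
    unfolding H_one eps_fc[OF unit_V] using epsE_unit by simp
qed

end

theorem theorem2p2:
  fixes K :: "('k, 'm) ring_scheme"
  assumes "field K"
  shows "graded_species_bimonoid K (Dtilde K :: ('k, 'a, 'a topology \<times> 'a topology \<Rightarrow> 'k) species_data)
      \<and> commutative_species (Dtilde K :: ('k, 'a, 'a topology \<times> 'a topology \<Rightarrow> 'k) species_data)
      \<and> graded_bialgebra K (fock K (Dtilde K)) (fock_coprod K (Dtilde K)) (fock_counit K (Dtilde K))
          (fock_deg K (Dtilde K))"
proof -
  interpret linalg K by (rule linalg.intro) (rule assms)
  \<comment> \<open>The Fock space needs the species over \<open>nat\<close>, whereas the other two
    claims keep an arbitrary ground type; the bimonoid theorem is used at both types.\<close>
  interpret F: graded_bimonoid K "Dtilde K :: ('k, nat, nat topology \<times> nat topology \<Rightarrow> 'k) species_data"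
    by unfold_locales (rule Dtilde_graded_bimonoid)
  show ?thesis
    by (intro conjI Dtilde_graded_bimonoid Dcommutative F.fock_graded_bialgebra)
qed

end
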